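(* Let $\mu>0$, $\lambda+2\mu>0$, $\kappa>0$. Let $s>0$ be a real number and $(p,r)\in[1,+\infty]^2$. Let $(q,u)$ be the solution of $$\begin{cases}\partial_tq+\operatorname{div}u=0,\\ \partial_tu-\mu\Delta u-(\lambda+\mu)\nabla\operatorname{div}u-\kappa\nabla\Delta q=0,\\ (q(0,\cdot),u(0,\cdot))=(q_0,u_0)\end{cases}$$ on $\mathbb{R}^N$, and write $(\nabla q,u)(t)=e^{B(t)}(\nabla q_0,u_0)$. Then there exists a constant $C>0$ such that $$\Big\|\ \big\|t^s e^{B(t)}(\nabla q_0,u_0)\big\|_{L^p}\ \Big\|_{L^r(\mathbb{R}^+,\frac{dt}{t})}\le C\,\|(\nabla q_0,u_0)\|_{B^{-2s}_{p,r}}\qquad\text{for all }(\nabla q_0,u_0)\in B^{-2s}_{p,r}.$$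
   Context: Here $q$ is scalar and $u$ is $\mathbb{R}^N$-valued; $B(t)$ denotes the semigroup associated with the linear system, so $e^{B(t)}(\nabla q_0,u_0)$ simply denotes the value at time $t$ of $(\nabla q,u)$. Littlewood–Paley: fix $\varphi,\chi\in C^\infty(\mathbb{R}^N)$ supported in $\{3/4\le|\xi|\le8/3\}$ and $B(0,4/3)$ respectively, with $\sum_{l\in\mathbb Z}\varphi(2^{-l}\xi)=1$ for $\xi\ne0$ and $\chi(\xi)+\sum_{l\ge0}\varphi(2^{-l}\xi)=1$ for all $\xi$. Set $\Delta_l u=\varphi(2^{-l}D)u$ and $S_lu=\chi(2^{-l}D)u$. $\mathcal S'_h$ is the space of tempered distributions $u$ with $S_ju\to0$ in $\mathcal S'$ as $j\to-\infty$. The homogeneous Besov norm is $\|u\|_{B^\sigma_{p,r}}=\big(\sum_{l\in\mathbb Z}(2^{l\sigma}\|\Delta_lu\|_{L^p})^r\big)^{1/r}$ (supremum if $r=\infty$), and $B^\sigma_{p,r}=\{u\in\mathcal S'_h:\|u\|_{B^\sigma_{p,r}}<\infty\}$, also for vector-valued $u$. *)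

theory Defs
  imports "HOL-Analysis.Analysis" "HOL-Probability.Essential_Supremum"
begin

subsection \<open>Schwartz functions\<close>

definition partial :: "'n::finite \<Rightarrow> (real^'n \<Rightarrow> complex) \<Rightarrow> real^'n \<Rightarrow> complex" where
  "partial i f x = frechet_derivative f (at x) (axis i 1)"

primrec partials :: "'n::finite list \<Rightarrow> (real^'n \<Rightarrow> complex) \<Rightarrow> real^'n \<Rightarrow> complex" where
  "partials [] f = f"
| "partials (i # \<alpha>) f = partial i (partials \<alpha> f)"

text \<open>Multi-indices are lists of coordinates. All iterated partial derivatives exist and are
  Frechet differentiable everywhere exactly when the function is of class C-infinity.\<close>

definition smooth :: "(real^'n::finite \<Rightarrow> complex) \<Rightarrow> bool" where
  "smooth f \<longleftrightarrow> (\<forall>\<alpha>. partials \<alpha> f differentiable_on UNIV)"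

definition schwartz :: "(real^'n::finite \<Rightarrow> complex) set" where
  "schwartz = {f. smooth f \<and>
     (\<forall>\<alpha> (k::nat). bounded (range (\<lambda>x. (1 + norm x) ^ k * norm (partials \<alpha> f x))))}"

definition schwartz_seminorm :: "nat \<Rightarrow> (real^'n::finite \<Rightarrow> complex) \<Rightarrow> real" where
  "schwartz_seminorm k f =
     (SUP (\<alpha>, x) \<in> {\<alpha>. length \<alpha> \<le> k} \<times> UNIV. (1 + norm x) ^ k * norm (partials \<alpha> f x))"

subsection \<open>Tempered distributions\<close>

text \<open>A distribution is a functional on all functions of which only the values on Schwartz functions
  are meaningful; equality of distributions is equality on \<^const>\<open>schwartz\<close>.\<close>

type_synonym 'n distr = "(real^'n \<Rightarrow> complex) \<Rightarrow> complex"

text \<open>Continuity of a linear functional on the Schwartz space amounts to a bound by one of the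
  increasing family of seminorms \<^const>\<open>schwartz_seminorm\<close>.\<close>

definition tempered :: "'n::finite distr \<Rightarrow> bool" where
  "tempered T \<longleftrightarrow>
     (\<forall>f\<in>schwartz. \<forall>g\<in>schwartz. T (\<lambda>x. f x + g x) = T f + T g) \<and>
     (\<forall>f\<in>schwartz. \<forall>c. T (\<lambda>x. c * f x) = c * T f) \<and>
     (\<exists>C k. \<forall>f\<in>schwartz. norm (T f) \<le> C * schwartz_seminorm k f)"

definition real_valued :: "'n::finite distr \<Rightarrow> bool" where
  "real_valued T \<longleftrightarrow> (\<forall>f\<in>schwartz. T (\<lambda>x. cnj (f x)) = cnj (T f))"

definition distr_partial :: "'n::finite \<Rightarrow> 'n distr \<Rightarrow> 'n distr" where
  "distr_partial i T = (\<lambda>\<psi>. - T (partial i \<psi>))"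

definition distr_div :: "('n::finite \<Rightarrow> 'n distr) \<Rightarrow> 'n distr" where
  "distr_div u = (\<lambda>\<psi>. \<Sum>i\<in>UNIV. distr_partial i (u i) \<psi>)"

definition distr_laplacian :: "'n::finite distr \<Rightarrow> 'n distr" where
  "distr_laplacian T = (\<lambda>\<psi>. \<Sum>i\<in>UNIV. distr_partial i (distr_partial i T) \<psi>)"

definition fourier :: "(real^'n::finite \<Rightarrow> complex) \<Rightarrow> real^'n \<Rightarrow> complex" where
  "fourier f \<xi> = (\<integral>x. cis (- (x \<bullet> \<xi>)) * f x \<partial>lborel)"

definition inv_fourier :: "(real^'n::finite \<Rightarrow> complex) \<Rightarrow> real^'n \<Rightarrow> complex" where
  "inv_fourier g x =
     complex_of_real (1 / (2 * pi) ^ CARD('n)) * (\<integral>\<xi>. cis (x \<bullet> \<xi>) * g \<xi> \<partial>lborel)"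

definition distr_fourier :: "'n::finite distr \<Rightarrow> 'n distr" where
  "distr_fourier T = (\<lambda>\<psi>. T (fourier \<psi>))"

definition distr_inv_fourier :: "'n::finite distr \<Rightarrow> 'n distr" where
  "distr_inv_fourier T = (\<lambda>\<psi>. T (inv_fourier \<psi>))"

definition distr_mult :: "(real^'n::finite \<Rightarrow> complex) \<Rightarrow> 'n distr \<Rightarrow> 'n distr" where
  "distr_mult m T = (\<lambda>\<psi>. T (\<lambda>\<xi>. m \<xi> * \<psi> \<xi>))"

text \<open>The operator \<open>m(D)\<close>.\<close>

definition fourier_multiplier :: "(real^'n::finite \<Rightarrow> complex) \<Rightarrow> 'n distr \<Rightarrow> 'n distr" where
  "fourier_multiplier m T = distr_inv_fourier (distr_mult m (distr_fourier T))"

subsection \<open>Lebesgue norms with exponent in \<open>[1, \<infinity>]\<close>\<close>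

definition enn_powr :: "ennreal \<Rightarrow> real \<Rightarrow> ennreal" where
  "enn_powr x a = (if x = \<infinity> then \<infinity> else ennreal (enn2real x powr a))"

definition Lnorm :: "'a measure \<Rightarrow> ennreal \<Rightarrow> ('a \<Rightarrow> ennreal) \<Rightarrow> ennreal" where
  "Lnorm M p f =
     (if p = \<infinity> then esssup M f
      else enn_powr (\<integral>\<^sup>+ x. enn_powr (f x) (enn2real p) \<partial>M) (1 / enn2real p))"

definition represents ::
    "(real^'n::finite \<Rightarrow> complex^'m::finite) \<Rightarrow> ('m \<Rightarrow> 'n distr) \<Rightarrow> bool" where
  "represents f T \<longleftrightarrow> f \<in> borel_measurable lborel \<and>
     (\<forall>\<psi>\<in>schwartz. \<forall>i. integrable lborel (\<lambda>x. f x $ i * \<psi> x) \<and>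
        T i \<psi> = (\<integral>x. f x $ i * \<psi> x \<partial>lborel))"

text \<open>The representing function is unique almost everywhere, so the infimum is its \<open>L\<^sup>p\<close> norm,
  and it is \<open>\<infinity>\<close> if the distribution is not a function.\<close>

definition distr_Lp :: "ennreal \<Rightarrow> ('m::finite \<Rightarrow> 'n::finite distr) \<Rightarrow> ennreal" where
  "distr_Lp p T = (INF f \<in> {f. represents f T}. Lnorm lborel p (\<lambda>x. ennreal (norm (f x))))"

definition dt_over_t :: "real measure" where
  "dt_over_t = density (restrict_space lborel {0<..}) (\<lambda>t. ennreal (1 / t))"

subsection \<open>Littlewood--Paley decomposition and homogeneous Besov spaces\<close>

definition dilated :: "(real^'n::finite \<Rightarrow> complex) \<Rightarrow> int \<Rightarrow> real^'n \<Rightarrow> complex" where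
  "dilated m l \<xi> = m ((2 powi (- l)) *\<^sub>R \<xi>)"

text \<open>For the smooth function \<open>chi\<close> the support condition below is the same as \<open>chi\<close> vanishing outside
  the open ball.\<close>

definition littlewood_paley ::
    "(real^'n::finite \<Rightarrow> complex) \<Rightarrow> (real^'n \<Rightarrow> complex) \<Rightarrow> bool" where
  "littlewood_paley phi chi \<longleftrightarrow> smooth phi \<and> smooth chi \<and>
     closure {\<xi>. phi \<xi> \<noteq> 0} \<subseteq> {\<xi>. 3/4 \<le> norm \<xi> \<and> norm \<xi> \<le> 8/3} \<and>
     closure {\<xi>. chi \<xi> \<noteq> 0} \<subseteq> cball 0 (4/3) \<and>
     (\<forall>\<xi>. \<xi> \<noteq> 0 \<longrightarrow> ((\<lambda>l::int. dilated phi l \<xi>) has_sum 1) UNIV) \<and>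
     (\<forall>\<xi>. ((\<lambda>l. dilated phi l \<xi>) has_sum (1 - chi \<xi>)) {0..})"

definition dyadic_block :: "(real^'n::finite \<Rightarrow> complex) \<Rightarrow> int \<Rightarrow> 'n distr \<Rightarrow> 'n distr" where
  "dyadic_block phi l = fourier_multiplier (dilated phi l)"

definition low_freq :: "(real^'n::finite \<Rightarrow> complex) \<Rightarrow> int \<Rightarrow> 'n distr \<Rightarrow> 'n distr" where
  "low_freq chi l = fourier_multiplier (dilated chi l)"

text \<open>The space \<open>S'\<^sub>h\<close>.\<close>

definition tempered_h :: "(real^'n::finite \<Rightarrow> complex) \<Rightarrow> 'n distr set" where
  "tempered_h chi = {T. tempered T \<and> (\<forall>\<psi>\<in>schwartz. ((\<lambda>j. low_freq chi j T \<psi>) \<longlongrightarrow> 0) at_bot)}"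

definition besov_norm ::
    "(real^'n::finite \<Rightarrow> complex) \<Rightarrow> real \<Rightarrow> ennreal \<Rightarrow> ennreal \<Rightarrow> ('m::finite \<Rightarrow> 'n distr) \<Rightarrow> ennreal"
  where
  "besov_norm phi \<sigma> p r T =
     Lnorm (count_space UNIV) r
       (\<lambda>l::int. ennreal (2 powr (real_of_int l * \<sigma>)) * distr_Lp p (\<lambda>i. dyadic_block phi l (T i)))"

definition besov ::
    "(real^'n::finite \<Rightarrow> complex) \<Rightarrow> (real^'n \<Rightarrow> complex) \<Rightarrow> real \<Rightarrow> ennreal \<Rightarrow> ennreal \<Rightarrow>
     ('m::finite \<Rightarrow> 'n distr) set"
  where
  "besov phi chi \<sigma> p r = {T. (\<forall>i. T i \<in> tempered_h chi) \<and> besov_norm phi \<sigma> p r T < \<infinity>}"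

subsection \<open>The linear system\<close>

text \<open>Solutions are curves of class \<open>C\<^sup>1\<close> on \<open>[0, \<infinity>)\<close> with values in the tempered distributions
  equipped with pointwise convergence. Continuity of the time derivative is automatic, since the
  equations express it through the (continuous) curves themselves.\<close>

definition linear_solution ::
    "real \<Rightarrow> real \<Rightarrow> real \<Rightarrow> 'n::finite distr \<Rightarrow> ('n \<Rightarrow> 'n distr) \<Rightarrow>
     (real \<Rightarrow> 'n distr) \<Rightarrow> (real \<Rightarrow> 'n \<Rightarrow> 'n distr) \<Rightarrow> bool"
  where
  "linear_solution \<mu> lam \<kappa> q\<^sub>0 u\<^sub>0 q u \<longleftrightarrow>
     (\<forall>t\<ge>0. tempered (q t) \<and> real_valued (q t) \<and>
        (\<forall>i. tempered (u t i) \<and> real_valued (u t i))) \<and>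
     (\<forall>\<psi>\<in>schwartz. \<forall>t\<ge>0.
        ((\<lambda>\<tau>. q \<tau> \<psi>) has_vector_derivative - distr_div (u t) \<psi>) (at t within {0..})) \<and>
     (\<forall>\<psi>\<in>schwartz. \<forall>t\<ge>0. \<forall>i.
        ((\<lambda>\<tau>. u \<tau> i \<psi>) has_vector_derivative
          \<mu> *\<^sub>R distr_laplacian (u t i) \<psi>
          + (lam + \<mu>) *\<^sub>R distr_partial i (distr_div (u t)) \<psi>
          + \<kappa> *\<^sub>R distr_partial i (distr_laplacian (q t)) \<psi>) (at t within {0..})) \<and>
     (\<forall>\<psi>\<in>schwartz. q 0 \<psi> = q\<^sub>0 \<psi> \<and> (\<forall>i. u 0 i \<psi> = u\<^sub>0 i \<psi>))"

text \<open>The vector \<open>(\<nabla>q, u)\<close> with \<open>2N\<close> components.\<close>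

definition grad_pair :: "'n::finite distr \<Rightarrow> ('n \<Rightarrow> 'n distr) \<Rightarrow> 'n + 'n \<Rightarrow> 'n distr" where
  "grad_pair q u = case_sum (\<lambda>i. distr_partial i q) u"

definition distr_scale :: "real \<Rightarrow> ('m \<Rightarrow> 'n::finite distr) \<Rightarrow> 'm \<Rightarrow> 'n distr" where
  "distr_scale c T = (\<lambda>i \<psi>. c *\<^sub>R T i \<psi>)"

end

theory Submission
  imports Defs "HOL-Probability.Probability" "HOL-Complex_Analysis.Complex_Analysis"
begin

text \<open>
In Fourier variables the vector \<open>W = (\<nabla>q, u)\<close> solves \<open>W' = B(\<xi>) W\<close> with a matrix \<open>B\<close> that is homogeneous
of degree two in \<open>\<xi>\<close>. With the orthogonal projection \<open>P(\<xi>)\<close> onto the line of \<open>\<xi>\<close>, the exponential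
\<open>e\<^bsup>t B(\<xi>)\<^esup>\<close> is the heat factor \<open>e\<^bsup>-\<mu> t |\<xi>|\<^sup>2\<^esup>\<close> on the range of \<open>1 - P(\<xi>)\<close>, and on the range of \<open>P(\<xi>)\<close> it is the
exponential of \<open>t |\<xi>|\<^sup>2 A\<close> for a constant matrix \<open>A\<close> of size two (\<open>matexp_sys_symbol\<close>). Since \<open>\<kappa> > 0\<close> and
\<open>\<lambda> + 2\<mu> > 0\<close>, both eigenvalues of \<open>A\<close> have negative real part, and a Lyapunov functional gives
exponential decay (\<open>damped_decay\<close>). The system is parabolic in all components.

Consequently a dyadic block of \<open>W(t)\<close> at frequency \<open>2\<^sup>l\<close> arises from the same block of the initial value by
convolution with a matrix of kernels of \<open>L\<^sup>1\<close> norm at most \<open>C min(1, (t 4\<^sup>l)\<^bsup>-K\<^esup>)\<close>, for any \<open>K\<close>: the localised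
symbol is \<open>(t 4\<^sup>l)\<^bsup>-K\<^esup>\<close> times a sum of products of a dilate by \<open>2\<^bsup>-l\<^esup>\<close> and a dilate by \<open>t\<^bsup>1/2\<^esup>\<close> of fixed Schwartz
functions, and the \<open>L\<^sup>1\<close> norm of a kernel does not see dilations (\<open>block_symbol_kernel_norm\<close>). Young's inequality
and summation over \<open>l\<close> give, with \<open>b\<^sub>l\<close> the term of index \<open>l\<close> in the Besov norm and \<open>m\<close> a function with
\<open>m(\<tau>) \<le> C min(\<tau>\<^sup>s, 1/\<tau>)\<close>,
\<open>\<parallel>t\<^sup>s W(t)\<parallel> \<le> \<Sum>\<^sub>l m(t 4\<^sup>l) b\<^sub>l\<close> in \<open>L\<^sup>p\<close>. The kernel \<open>m(t 4\<^sup>l)\<close> has bounded sums over \<open>l\<close> and bounded integrals with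
respect to \<open>dt/t\<close>, so Schur's test (\<open>Schur_test\<close>) turns this into the claim for every exponent \<open>r\<close>.

Three points need an argument of their own because solutions are curves of distributions.

A solution is differentiable only after pairing with a fixed test function, so \<open>e\<^bsup>(t - \<tau>)B\<^esup>\<close> cannot be inserted
directly to solve the equation. For test functions of compact support in frequency, pairing the solution with the
resolvent \<open>(z - B)\<^sup>-\<^sup>1 g\<close> gives scalar linear equations, and a contour integral over \<open>z\<close> recovers the
exponential (\<open>laplace_flow\<close>, \<open>polynomial_flow\<close>).

The solution is the sum of its dyadic blocks: the high frequencies disappear in the limit because
\<open>W(t)\<close> is tempered, the low ones because the initial value lies in the space \<open>S'\<^sub>h\<close>, and the representation formula
transports this to positive times (\<open>flow_decomposition\<close>).

For \<open>r = \<infinity>\<close> the norm in time is an essential supremum, which is \<open>\<infinity>\<close> for a function that is not measurable. The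
\<open>L\<^sup>p\<close> norm of a distribution is an infimum over representing functions, and its measurability in time is
obtained from continuity (\<open>solution_norm_measurable\<close>).
\<close>

section \<open>Partial derivatives and smooth functions\<close>

lemma partial_eqI: "(f has_derivative f') (at x) \<Longrightarrow> partial i f x = f' (axis i 1)"
  by (simp add: partial_def frechet_derivative_at[symmetric])

lemma partial_const: "partial i (\<lambda>x. c) = (\<lambda>x. 0)"
  by (rule ext, rule partial_eqI[THEN trans], rule has_derivative_const, simp)

lemma partial_add:
  assumes "f differentiable (at x)" "g differentiable (at x)"
  shows "partial i (\<lambda>x. f x + g x) x = partial i f x + partial i g x"
  using assms
  by (intro partial_eqI[THEN trans, OF has_derivative_add])
     (auto simp: frechet_derivative_works partial_def)

lemma partial_mult:
  assumes "f differentiable (at x)" "g differentiable (at x)"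
  shows "partial i (\<lambda>x. f x * g x) x = partial i f x * g x + f x * partial i g x"
  using assms
  by (intro partial_eqI[THEN trans, OF has_derivative_mult])
     (auto simp: frechet_derivative_works partial_def)

lemma has_derivative_coord:
  "((\<lambda>x::real^'n::finite. complex_of_real (x $ i)) has_derivative (\<lambda>h. complex_of_real (h $ i))) F"
  by (intro derivative_intros bounded_linear_imp_has_derivative bounded_linear_vec_nth)

lemma partial_coord:
  "partial j (\<lambda>x::real^'n::finite. complex_of_real (x $ i)) x = (if i = j then 1 else 0)"
  by (subst partial_eqI[OF has_derivative_coord]) (simp add: axis_def)

lemma partials_append: "partials (\<alpha> @ \<beta>) f = partials \<alpha> (partials \<beta> f)"
  by (induction \<alpha>) auto

lemma smooth_differentiable: "smooth f \<Longrightarrow> f differentiable (at x)"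
  unfolding smooth_def differentiable_on_def by (metis UNIV_I partials.simps(1))

lemma smooth_partials: "smooth f \<Longrightarrow> smooth (partials \<beta> f)"
  unfolding smooth_def by (simp flip: partials_append)

lemma smooth_partial: "smooth f \<Longrightarrow> smooth (partial i f)"
  using smooth_partials[of f "[i]"] by simp

text \<open>A class of functions that is closed under partial derivatives contains all iterated derivatives of
its members, so that differentiability of the members is all that smoothness asks. Closure properties follow
without any formula for higher derivatives.\<close>

lemma smooth_coinduct:
  fixes f :: "real^'n::finite \<Rightarrow> complex"
  assumes "f \<in> A" and d: "\<And>f. f \<in> A \<Longrightarrow> f differentiable_on UNIV"
    and p: "\<And>f i. f \<in> A \<Longrightarrow> partial i f \<in> A"
  shows "smooth f"
proof -
  have "partials \<alpha> f \<in> A" for \<alpha> using assms(1) p by (induction \<alpha>) auto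
  then show ?thesis using d by (auto simp: smooth_def)
qed

lemma differentiable_onI: "(\<And>x. f differentiable (at x)) \<Longrightarrow> f differentiable_on UNIV"
  by (simp add: differentiable_on_def)

lemma smooth_const [simp]: "smooth (\<lambda>x. c)"
  by (rule smooth_coinduct[where A = "range (\<lambda>c x. c)"]) (auto simp: partial_const)

lemma smooth_add:
  assumes "smooth f" "smooth g" shows "smooth (\<lambda>x. f x + g x)"
proof (rule smooth_coinduct[where A = "{\<lambda>x. f x + g x |f g. smooth f \<and> smooth g}"])
  show "(\<lambda>x. f x + g x) \<in> {\<lambda>x. f x + g x |f g. smooth f \<and> smooth g}" using assms by blast
  fix h :: "real^'a \<Rightarrow> complex" and i assume "h \<in> {\<lambda>x. f x + g x |f g. smooth f \<and> smooth g}"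
  then obtain f g where h: "h = (\<lambda>x. f x + g x)" "smooth f" "smooth g" by auto
  then show "h differentiable_on UNIV"
    by (auto intro!: differentiable_onI differentiable_add simp: smooth_differentiable)
  have "partial i h = (\<lambda>x. partial i f x + partial i g x)"
    using h by (auto simp: partial_add smooth_differentiable)
  then show "partial i h \<in> {\<lambda>x. f x + g x |f g. smooth f \<and> smooth g}"
    using smooth_partial h by blast
qed

lemma partials_add:
  assumes "smooth f" "smooth g"
  shows "partials \<alpha> (\<lambda>x. f x + g x) = (\<lambda>x. partials \<alpha> f x + partials \<alpha> g x)"
proof (induction \<alpha>)
  case (Cons i \<alpha>)
  show ?case unfolding partials.simps Cons
    by (rule ext) (simp add: partial_add smooth_differentiable smooth_partials assms)
qed simp

lemma smooth_sum: "(\<And>i. i \<in> I \<Longrightarrow> smooth (f i)) \<Longrightarrow> smooth (\<lambda>x. \<Sum>i\<in>I. f i x)"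
  by (induction I rule: infinite_finite_induct) (auto simp: smooth_add)

text \<open>The Leibniz rule leads from products to sums of products, so this is the class to which
coinduction applies.\<close>

inductive_set product_sums :: "(real^'n::finite \<Rightarrow> complex) set" where
  prod: "smooth f \<Longrightarrow> smooth g \<Longrightarrow> (\<lambda>x. f x * g x) \<in> product_sums"
| add: "f \<in> product_sums \<Longrightarrow> g \<in> product_sums \<Longrightarrow> (\<lambda>x. f x + g x) \<in> product_sums"

lemma product_sums_smooth:
  assumes "h \<in> product_sums" shows "smooth h"
proof (rule smooth_coinduct[OF assms])
  fix h :: "real^'n \<Rightarrow> complex" and i assume "h \<in> product_sums"
  then have *: "h differentiable_on UNIV \<and> (\<forall>i. partial i h \<in> product_sums)"
  proof induction
    case (prod f g)
    have "partial i (\<lambda>x. f x * g x) = (\<lambda>x. partial i f x * g x + f x * partial i g x)" for i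
      using prod by (simp add: fun_eq_iff partial_mult smooth_differentiable)
    then show ?case using prod
      by (auto intro!: differentiable_onI derivative_intros product_sums.intros
          simp: smooth_differentiable smooth_partial)
  next
    case (add f g)
    have "partial i (\<lambda>x. f x + g x) = (\<lambda>x. partial i f x + partial i g x)" for i
      using add by (simp add: fun_eq_iff partial_add differentiable_on_def)
    then show ?case using add
      by (auto intro!: product_sums.intros differentiable_on_add)
  qed
  show "h differentiable_on UNIV" "partial i h \<in> product_sums" using * by auto
qed

lemma smooth_mult: "smooth f \<Longrightarrow> smooth g \<Longrightarrow> smooth (\<lambda>x. f x * g x)"
  by (rule product_sums_smooth) (rule product_sums.prod)

lemma smooth_coord [simp]: "smooth (\<lambda>x::real^'n::finite. complex_of_real (x $ i))"
proof (rule smooth_coinduct[where A = "insert (\<lambda>x. complex_of_real (x $ i)) (range (\<lambda>c x. c))"])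
  have *: "(\<lambda>x::real^'n. complex_of_real (x $ i)) differentiable_on UNIV"
    using has_derivative_coord by (intro differentiable_onI differentiableI) blast
  have **: "partial j (\<lambda>x::real^'n. complex_of_real (x $ i)) = (\<lambda>x. if i = j then 1 else 0)" for j
    by (simp add: fun_eq_iff partial_coord)
  fix f :: "real^'n \<Rightarrow> complex" and j assume "f \<in> insert (\<lambda>x. complex_of_real (x $ i)) (range (\<lambda>c x. c))"
  then show "f differentiable_on UNIV" "partial j f \<in> insert (\<lambda>x. complex_of_real (x $ i)) (range (\<lambda>c x. c))"
    using * by (auto simp: partial_const **)
qed auto

lemma partials_cmult:
  assumes "smooth f"
  shows "partials \<alpha> (\<lambda>x. c * f x) = (\<lambda>x. c * partials \<alpha> f x)"
proof (induction \<alpha>)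
  case (Cons i \<alpha>)
  show ?case unfolding partials.simps Cons
    by (rule ext) (simp add: partial_mult smooth_differentiable smooth_partials assms partial_const)
qed simp

lemma partials_sum:
  assumes "\<And>i. i \<in> I \<Longrightarrow> smooth (f i)"
  shows "partials \<alpha> (\<lambda>x. \<Sum>i\<in>I. f i x) = (\<lambda>x. \<Sum>i\<in>I. partials \<alpha> (f i) x)"
proof -
  have 0: "partials \<alpha> (\<lambda>x. 0) = (\<lambda>x. 0)" using partials_cmult[of "\<lambda>x. 0" \<alpha> 0] by simp
  show ?thesis using assms
    by (induction I rule: infinite_finite_induct) (auto simp: partials_add smooth_sum 0)
qed

text \<open>Each derivative falls on one of the two factors, which makes \<open>2\<close> to the power \<open>|\<alpha>|\<close> terms; a bound
of this kind suffices throughout and avoids the combinatorial Leibniz formula.\<close>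

lemma partials_mult_bound:
  assumes "smooth f" "smooth g" "A \<ge> 0"
    and "\<And>\<beta>. length \<beta> \<le> length \<alpha> \<Longrightarrow> norm (partials \<beta> f x) \<le> A"
    and "\<And>\<beta>. length \<beta> \<le> length \<alpha> \<Longrightarrow> norm (partials \<beta> g x) \<le> B"
  shows "norm (partials \<alpha> (\<lambda>x. f x * g x) x) \<le> 2 ^ length \<alpha> * (A * B)"
  using assms
proof (induction \<alpha> arbitrary: f g rule: rev_induct)
  case Nil
  then show ?case using Nil(4)[of "[]"] Nil(5)[of "[]"] by (auto simp: norm_mult intro!: mult_mono)
next
  case (snoc i \<alpha>)
  have eq: "partial i (\<lambda>x. f x * g x) = (\<lambda>x. partial i f x * g x + f x * partial i g x)"
    using snoc by (simp add: fun_eq_iff partial_mult smooth_differentiable)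
  have f': "norm (partials \<beta> (partial i f) x) \<le> A" if "length \<beta> \<le> length \<alpha>" for \<beta>
    using snoc.prems(4)[of "\<beta> @ [i]"] that by (simp add: partials_append)
  have g': "norm (partials \<beta> (partial i g) x) \<le> B" if "length \<beta> \<le> length \<alpha>" for \<beta>
    using snoc.prems(5)[of "\<beta> @ [i]"] that by (simp add: partials_append)
  have 1: "norm (partials \<alpha> (\<lambda>x. partial i f x * g x) x) \<le> 2 ^ length \<alpha> * (A * B)"
    by (rule snoc.IH) (use snoc.prems f' in \<open>auto intro: smooth_partial\<close>)
  have 2: "norm (partials \<alpha> (\<lambda>x. f x * partial i g x) x) \<le> 2 ^ length \<alpha> * (A * B)"
    by (rule snoc.IH) (use snoc.prems g' in \<open>auto intro: smooth_partial\<close>)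
  show ?case
    unfolding partials_append partials.simps eq
    by (subst partials_add) (use snoc.prems norm_triangle_le[OF add_mono[OF 1 2]] in
        \<open>auto intro!: smooth_mult smooth_partial simp: algebra_simps\<close>)
qed

text \<open>At most one of the derivatives can fall on the coordinate, and this in \<open>|\<alpha>|\<close> ways. The weight \<open>\<delta>\<close> of
a derivative is \<open>1\<close> for estimates of seminorms; a weight that grows with the number of derivatives makes the
second term bounded, see \<open>poly_fun_derivs_le\<close>.\<close>

lemma partials_coord_mult_bound:
  fixes f :: "real^'n::finite \<Rightarrow> complex"
  assumes "smooth f" "\<delta> > 0" "\<And>\<beta>. length \<beta> \<le> length \<alpha> \<Longrightarrow> norm (partials \<beta> f x) \<le> A * \<delta> ^ length \<beta>"
  shows "norm (partials \<alpha> (\<lambda>x. complex_of_real (x $ j) * f x) x) \<le> (norm x + length \<alpha> / \<delta>) * A * \<delta> ^ length \<alpha>"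
  using assms(1,3)
proof (induction \<alpha> arbitrary: f A rule: rev_induct)
  case Nil
  then show ?case using Nil(2)[of "[]"]
    by (auto simp: norm_mult component_le_norm_cart intro!: mult_mono)
next
  case (snoc i \<alpha>)
  have A: "A \<ge> 0" using snoc.prems(2)[of "[]"] by (auto intro: order_trans[OF norm_ge_zero])
  have eq: "partial i (\<lambda>x. complex_of_real (x $ j) * f x) =
     (\<lambda>x. (if j = i then 1 else 0) * f x + complex_of_real (x $ j) * partial i f x)"
    using snoc by (simp add: fun_eq_iff partial_mult smooth_differentiable partial_coord)
  have f': "norm (partials \<beta> (partial i f) x) \<le> (A * \<delta>) * \<delta> ^ length \<beta>" if "length \<beta> \<le> length \<alpha>" for \<beta>
    using snoc.prems(2)[of "\<beta> @ [i]"] that by (simp add: partials_append mult_ac)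
  have 1: "norm (partials \<alpha> (\<lambda>x. complex_of_real (x $ j) * partial i f x) x) \<le> (norm x + length \<alpha> / \<delta>) * (A * \<delta>) * \<delta> ^ length \<alpha>"
    by (rule snoc.IH) (use snoc.prems f' in \<open>auto intro: smooth_partial\<close>)
  have 2: "norm (partials \<alpha> (\<lambda>x. (if j = i then 1 else 0) * f x) x) \<le> A * \<delta> ^ length \<alpha>"
    using snoc.prems(2)[of \<alpha>] A \<open>\<delta> > 0\<close> by (subst partials_cmult[OF snoc.prems(1)]) (auto simp: norm_mult)
  have "norm (partials \<alpha> (\<lambda>x. (if j = i then 1 else 0) * f x) x + partials \<alpha> (\<lambda>x. complex_of_real (x $ j) * partial i f x) x)
     \<le> A * \<delta> ^ length \<alpha> + (norm x + length \<alpha> / \<delta>) * (A * \<delta>) * \<delta> ^ length \<alpha>"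
    by (rule norm_triangle_le[OF add_mono[OF 2 1]])
  also have "\<dots> = (norm x + length (\<alpha> @ [i]) / \<delta>) * A * \<delta> ^ length (\<alpha> @ [i])" using \<open>\<delta> > 0\<close> by (simp add: field_simps)
  finally show ?case
    unfolding partials_append partials.simps eq
    by (subst partials_add) (use snoc.prems in \<open>auto intro!: smooth_mult smooth_partial\<close>)
qed

lemma partial_dilate:
  assumes "f differentiable (at (a *\<^sub>R x))"
  shows "partial i (\<lambda>x. f (a *\<^sub>R x)) x = complex_of_real a * partial i f (a *\<^sub>R x)"
proof -
  let ?D = "frechet_derivative f (at (a *\<^sub>R x))"
  have D: "(f has_derivative ?D) (at (a *\<^sub>R x))" using assms by (simp add: frechet_derivative_works)
  have "((\<lambda>x. f (a *\<^sub>R x)) has_derivative (\<lambda>h. ?D (a *\<^sub>R h))) (at x)"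
    using has_derivative_compose[of "\<lambda>x. a *\<^sub>R x" "\<lambda>h. a *\<^sub>R h" x UNIV f ?D] D
      has_derivative_scaleR_right[OF has_derivative_ident, of a "at x"]
    by auto
  then show ?thesis
    by (subst partial_eqI) (auto simp: partial_def linear_cmul[OF has_derivative_linear[OF D]] scaleR_conv_of_real[where 'a=complex])
qed

lemma differentiable_dilate:
  assumes "f differentiable (at (a *\<^sub>R x))"
  shows "(\<lambda>x::real^'n. f (a *\<^sub>R x)) differentiable (at x)"
  by (rule differentiable_compose[where f=f and g="\<lambda>x. a *\<^sub>R x", OF assms])
     (rule bounded_linear_imp_differentiable[OF bounded_linear_scaleR_right])

lemma smooth_dilate:
  assumes "smooth f" shows "smooth (\<lambda>x. f (a *\<^sub>R x))"
proof (rule smooth_coinduct[where A = "{\<lambda>x. c * f (a *\<^sub>R x) |f c. smooth f}"])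
  show "(\<lambda>x. f (a *\<^sub>R x)) \<in> {\<lambda>x. c * f (a *\<^sub>R x) |f c. smooth f}"
    using assms by (intro CollectI exI[of _ f] exI[of _ 1]) auto
  fix h :: "real^'a \<Rightarrow> complex" and i assume "h \<in> {\<lambda>x. c * f (a *\<^sub>R x) |f c. smooth f}"
  then obtain g c where h: "h = (\<lambda>x. c * g (a *\<^sub>R x))" "smooth g" by auto
  have d: "(\<lambda>x. g (a *\<^sub>R x)) differentiable (at x)" for x
    by (rule differentiable_dilate[OF smooth_differentiable[OF h(2)]])
  show "h differentiable_on UNIV"
    unfolding h(1) by (intro differentiable_onI differentiable_mult differentiable_const d)
  have "partial i h = (\<lambda>x. (c * complex_of_real a) * partial i g (a *\<^sub>R x))"
    unfolding h(1)
    by (rule ext) (simp add: partial_mult d partial_const partial_dilate[OF smooth_differentiable[OF h(2)]])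
  then show "partial i h \<in> {\<lambda>x. c * f (a *\<^sub>R x) |f c. smooth f}"
    using smooth_partial[OF h(2), of i] by blast
qed

lemma partials_dilate:
  assumes "smooth f"
  shows "partials \<alpha> (\<lambda>x. f (a *\<^sub>R x)) = (\<lambda>x. complex_of_real (a ^ length \<alpha>) * partials \<alpha> f (a *\<^sub>R x))"
proof (induction \<alpha>)
  case (Cons i \<alpha>)
  have d: "(\<lambda>x. partials \<alpha> f (a *\<^sub>R x)) differentiable (at x)" for x
    by (rule differentiable_dilate[OF smooth_differentiable[OF smooth_partials[OF assms]]])
  show ?case unfolding partials.simps Cons
    by (rule ext) (simp add: partial_mult d partial_const
        partial_dilate[OF smooth_differentiable[OF smooth_partials[OF assms]]])
qed auto

section \<open>The Schwartz space\<close>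

lemma schwartz_smooth: "f \<in> schwartz \<Longrightarrow> smooth f" by (simp add: schwartz_def)

lemma schwartz_differentiable: "f \<in> schwartz \<Longrightarrow> f differentiable (at x)"
  by (simp add: schwartz_smooth smooth_differentiable)

lemma schwartz_continuous: "f \<in> schwartz \<Longrightarrow> continuous_on UNIV f"
  by (meson continuous_at_imp_continuous_on differentiable_imp_continuous_within schwartz_differentiable)

lemma schwartz_measurable [measurable_dest]: "f \<in> schwartz \<Longrightarrow> f \<in> borel_measurable borel"
  by (intro borel_measurable_continuous_onI schwartz_continuous)

lemma finite_multiindices: "finite {\<alpha>::'n::finite list. length \<alpha> \<le> k}"
  using finite_lists_length_le[of "UNIV::'n set" k] by simp

lemma seminorm_bdd:
  assumes "f \<in> schwartz"
  shows "bdd_above ((\<lambda>(\<alpha>, x). (1 + norm x) ^ k * norm (partials \<alpha> f x)) ` ({\<alpha>. length \<alpha> \<le> k} \<times> UNIV))"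
proof -
  have "\<exists>C. \<forall>x. (1 + norm x) ^ k * norm (partials \<alpha> f x) \<le> C" for \<alpha>
    using assms by (force simp: schwartz_def bounded_iff abs_mult)
  then obtain C where C: "\<And>\<alpha> x. (1 + norm x) ^ k * norm (partials \<alpha> f x) \<le> C \<alpha>" by metis
  have "C \<alpha> \<le> Max (C ` {\<alpha>. length \<alpha> \<le> k})" if "length \<alpha> \<le> k" for \<alpha>
    using that by (intro Max_ge) (auto simp: finite_multiindices)
  then show ?thesis using C by (intro bdd_aboveI[where M="Max (C ` {\<alpha>. length \<alpha> \<le> k})"]) (auto intro: order_trans)
qed

lemma one_plus_norm_pos [simp]: "0 < 1 + norm x" "0 < (1 + norm x) ^ k" "0 \<le> 1 + norm x" "1 + norm x \<noteq> 0"
  using norm_ge_zero[of x] by (simp_all add: add_pos_nonneg add_nonneg_eq_0_iff)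

lemma seminorm_ge:
  assumes "f \<in> schwartz" "length \<alpha> \<le> k"
  shows "(1 + norm x) ^ k * norm (partials \<alpha> f x) \<le> schwartz_seminorm k f"
  unfolding schwartz_seminorm_def using assms
  by (intro cSUP_upper2[where x = "(\<alpha>, x)"] seminorm_bdd) auto

lemma seminorm_leI:
  fixes f :: "real^'n::finite \<Rightarrow> complex"
  assumes "\<And>\<alpha> x. length \<alpha> \<le> k \<Longrightarrow> (1 + norm x) ^ k * norm (partials \<alpha> f x) \<le> C"
  shows "schwartz_seminorm k f \<le> C"
  unfolding schwartz_seminorm_def using assms
  by (intro cSUP_least) (auto intro: exI[of _ "[]"])

lemma seminorm_nonneg: "f \<in> schwartz \<Longrightarrow> 0 \<le> schwartz_seminorm k f"
  by (rule order_trans[OF _ seminorm_ge[of f "[]" k 0]]) auto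

lemma partials_le_seminorm:
  assumes "f \<in> schwartz" "length \<alpha> \<le> k"
  shows "norm (partials \<alpha> f x) \<le> schwartz_seminorm k f / (1 + norm x) ^ k"
  using seminorm_ge[OF assms, of x] by (simp add: pos_le_divide_eq mult.commute)

lemma seminorm_mono:
  assumes "f \<in> schwartz" "k \<le> l" shows "schwartz_seminorm k f \<le> schwartz_seminorm l f"
proof (rule seminorm_leI)
  fix \<alpha> :: "'a list" and x :: "real^'a" assume "length \<alpha> \<le> k"
  have "(1 + norm x) ^ k * norm (partials \<alpha> f x) \<le> (1 + norm x) ^ l * norm (partials \<alpha> f x)"
    by (intro mult_right_mono power_increasing) (use assms in auto)
  also have "\<dots> \<le> schwartz_seminorm l f"
    using \<open>length \<alpha> \<le> k\<close> assms by (intro seminorm_ge) auto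
  finally show "(1 + norm x) ^ k * norm (partials \<alpha> f x) \<le> schwartz_seminorm l f" .
qed

lemma schwartzI:
  fixes f :: "real^'n::finite \<Rightarrow> complex"
  assumes "smooth f" "\<And>\<alpha> k. \<exists>C. \<forall>x. (1 + norm x) ^ k * norm (partials \<alpha> f x) \<le> C"
  shows "f \<in> schwartz"
  using assms unfolding schwartz_def bounded_iff by (force simp: abs_mult)

text \<open>Since partial derivatives of members are members, decay has to be checked only for the members
themselves.\<close>

lemma schwartz_coinduct:
  fixes f :: "real^'n::finite \<Rightarrow> complex"
  assumes "f \<in> A" and d: "\<And>f. f \<in> A \<Longrightarrow> f differentiable_on UNIV"
    and p: "\<And>f i. f \<in> A \<Longrightarrow> partial i f \<in> A"
    and b: "\<And>f k. f \<in> A \<Longrightarrow> \<exists>C. \<forall>x. (1 + norm x) ^ k * norm (f x) \<le> C"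
  shows "f \<in> schwartz"
proof (rule schwartzI)
  show "smooth f" by (rule smooth_coinduct[OF assms(1-3)])
  have "partials \<alpha> f \<in> A" for \<alpha> using assms(1) p by (induction \<alpha>) auto
  then show "\<exists>C. \<forall>x. (1 + norm x) ^ k * norm (partials \<alpha> f x) \<le> C" for \<alpha> k
    using b by blast
qed

lemma schwartz_partials: "f \<in> schwartz \<Longrightarrow> partials \<alpha> f \<in> schwartz"
  unfolding schwartz_def by (auto simp: smooth_partials simp flip: partials_append)

lemma schwartz_partial: "f \<in> schwartz \<Longrightarrow> partial i f \<in> schwartz"
  using schwartz_partials[of f "[i]"] by simp

lemma seminorm_partial: "f \<in> schwartz \<Longrightarrow> schwartz_seminorm k (partial i f) \<le> schwartz_seminorm (Suc k) f"
proof (rule seminorm_leI)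
  fix \<alpha> :: "'a list" and x :: "real^'a" assume f: "f \<in> schwartz" "length \<alpha> \<le> k"
  have "(1 + norm x) ^ k * norm (partials \<alpha> (partial i f) x) \<le> (1 + norm x) ^ (Suc k) * norm (partials (\<alpha> @ [i]) f x)"
    unfolding partials_append partials.simps by (intro mult_right_mono power_increasing) auto
  also have "\<dots> \<le> schwartz_seminorm (Suc k) f" using f by (intro seminorm_ge) auto
  finally show "(1 + norm x) ^ k * norm (partials \<alpha> (partial i f) x) \<le> schwartz_seminorm (Suc k) f" .
qed

lemma schwartz_seminormI:
  fixes f :: "real^'n::finite \<Rightarrow> complex"
  assumes "smooth f" "\<And>k. \<exists>C. \<forall>\<alpha> x. length \<alpha> \<le> k \<longrightarrow> (1 + norm x) ^ k * norm (partials \<alpha> f x) \<le> C"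
  shows "f \<in> schwartz"
proof (rule schwartzI[OF assms(1)])
  fix \<alpha> :: "'n list" and k
  obtain C where C: "\<And>\<beta> x. length \<beta> \<le> max k (length \<alpha>) \<Longrightarrow> (1 + norm x) ^ max k (length \<alpha>) * norm (partials \<beta> f x) \<le> C"
    using assms(2) by metis
  have "(1 + norm x) ^ k * norm (partials \<alpha> f x) \<le> (1 + norm x) ^ max k (length \<alpha>) * norm (partials \<alpha> f x)" for x
    by (intro mult_right_mono power_increasing) auto
  then show "\<exists>C. \<forall>x. (1 + norm x) ^ k * norm (partials \<alpha> f x) \<le> C"
    using C[of \<alpha>] by (meson max.cobounded2 order_trans)
qed

lemma schwartz_add:
  assumes "f \<in> schwartz" "g \<in> schwartz" shows "(\<lambda>x. f x + g x) \<in> schwartz"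
    and "schwartz_seminorm k (\<lambda>x. f x + g x) \<le> schwartz_seminorm k f + schwartz_seminorm k g"
proof -
  have sm: "smooth f" "smooth g" using assms by (auto simp: schwartz_smooth)
  have *: "(1 + norm x) ^ k * norm (partials \<alpha> (\<lambda>x. f x + g x) x) \<le> schwartz_seminorm k f + schwartz_seminorm k g"
    if "length \<alpha> \<le> k" for \<alpha> x k
    unfolding partials_add[OF sm]
    by (rule order_trans[OF mult_left_mono[OF norm_triangle_ineq]])
       (auto simp: distrib_left intro!: add_mono seminorm_ge assms that)
  show "(\<lambda>x. f x + g x) \<in> schwartz"
    using * by (intro schwartz_seminormI smooth_add sm) blast
  show "schwartz_seminorm k (\<lambda>x. f x + g x) \<le> schwartz_seminorm k f + schwartz_seminorm k g"
    by (rule seminorm_leI[OF *])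
qed

lemma schwartz_cmult:
  assumes "f \<in> schwartz" shows "(\<lambda>x. c * f x) \<in> schwartz"
    and "schwartz_seminorm k (\<lambda>x. c * f x) \<le> norm c * schwartz_seminorm k f"
proof -
  have sm: "smooth f" using assms by (auto simp: schwartz_smooth)
  have *: "(1 + norm x) ^ k * norm (partials \<alpha> (\<lambda>x. c * f x) x) \<le> norm c * schwartz_seminorm k f"
    if "length \<alpha> \<le> k" for \<alpha> x k
    unfolding partials_cmult[OF sm] norm_mult
    using mult_left_mono[OF seminorm_ge[OF assms that, of x] norm_ge_zero[of c]] by (simp add: mult_ac)
  show "(\<lambda>x. c * f x) \<in> schwartz"
    using * by (intro schwartz_seminormI smooth_mult sm smooth_const) blast
  show "schwartz_seminorm k (\<lambda>x. c * f x) \<le> norm c * schwartz_seminorm k f"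
    by (rule seminorm_leI[OF *])
qed

lemma schwartz_zero: "(\<lambda>x. 0) \<in> schwartz"
proof (rule schwartzI[OF smooth_const])
  have "partials \<alpha> (\<lambda>x. 0) = (\<lambda>x::real^'a. 0)" for \<alpha> using partials_cmult[of "\<lambda>x. 0" \<alpha> 0] by simp
  then show "\<exists>C. \<forall>x::real^'a. (1 + norm x) ^ k * norm (partials \<alpha> (\<lambda>x. 0) x) \<le> C" for k \<alpha> by auto
qed

lemma schwartz_sum:
  "(\<And>i. i \<in> I \<Longrightarrow> f i \<in> schwartz) \<Longrightarrow> (\<lambda>x. \<Sum>i\<in>I. f i x) \<in> schwartz"
  by (induction I rule: infinite_finite_induct) (auto simp: schwartz_zero schwartz_add)

lemma schwartz_diff: "f \<in> schwartz \<Longrightarrow> g \<in> schwartz \<Longrightarrow> (\<lambda>x. f x - g x) \<in> schwartz"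
  using schwartz_add(1)[OF _ schwartz_cmult(1)[of g "-1"], of f] by (simp only: mult_minus1 diff_conv_add_uminus)

lemma schwartz_mult_bounded:
  assumes "smooth m" "f \<in> schwartz" "\<And>\<alpha>. \<exists>C. \<forall>x. norm (partials \<alpha> m x) \<le> C"
  shows "(\<lambda>x. m x * f x) \<in> schwartz"
proof (rule schwartz_seminormI[OF smooth_mult[OF assms(1) schwartz_smooth[OF assms(2)]]])
  fix k
  obtain C where C: "\<And>\<alpha> x. norm (partials \<alpha> m x) \<le> C \<alpha>" using assms(3) by metis
  define A where "A = Max (C ` {\<alpha>. length \<alpha> \<le> k})"
  have CA: "C \<alpha> \<le> A" if "length \<alpha> \<le> k" for \<alpha>
    unfolding A_def using that by (intro Max_ge) (auto simp: finite_multiindices)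
  have "(1 + norm x) ^ k * norm (partials \<alpha> (\<lambda>x. m x * f x) x) \<le> 2 ^ k * A * schwartz_seminorm k f"
    if \<alpha>: "length \<alpha> \<le> k" for \<alpha> x
  proof -
    have A: "A \<ge> 0" using C[of "[]" x] CA[of "[]"] using norm_ge_zero[of "m x"] by (simp del: norm_ge_zero)
    have "norm (partials \<alpha> (\<lambda>x. m x * f x) x) \<le> 2 ^ length \<alpha> * (A * (schwartz_seminorm k f / (1 + norm x) ^ k))"
      using assms \<alpha> A C CA by (intro partials_mult_bound partials_le_seminorm order_trans[OF C CA]) (auto simp: schwartz_smooth)
    also have "\<dots> \<le> 2 ^ k * (A * (schwartz_seminorm k f / (1 + norm x) ^ k))"
      using A seminorm_nonneg[OF assms(2)] \<alpha> by (intro mult_right_mono power_increasing) auto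
    finally show ?thesis by (simp add: divide_le_eq pos_le_divide_eq mult_ac)
  qed
  then show "\<exists>C. \<forall>\<alpha> x. length \<alpha> \<le> k \<longrightarrow> (1 + norm x) ^ k * norm (partials \<alpha> (\<lambda>x. m x * f x) x) \<le> C" by blast
qed

lemma schwartz_bounded: "f \<in> schwartz \<Longrightarrow> \<exists>C. \<forall>x. norm (f x) \<le> C"
  using seminorm_ge[of f "[]" 0] by auto

lemma schwartz_mult: "f \<in> schwartz \<Longrightarrow> g \<in> schwartz \<Longrightarrow> (\<lambda>x. f x * g x) \<in> schwartz"
  by (rule schwartz_mult_bounded[OF schwartz_smooth _ schwartz_bounded[OF schwartz_partials]])

text \<open>The estimate in terms of the next seminorm is the form in which continuity of multiplication by a
coordinate enters the continuity of the Fourier transform.\<close>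

lemma schwartz_coord_mult:
  fixes f :: "real^'n::finite \<Rightarrow> complex"
  assumes "f \<in> schwartz"
  shows "(\<lambda>x. complex_of_real (x $ j) * f x) \<in> schwartz"
    and "schwartz_seminorm k (\<lambda>x. complex_of_real (x $ j) * f x) \<le> (1 + real k) * schwartz_seminorm (Suc k) f"
proof -
  have *: "(1 + norm x) ^ k * norm (partials \<alpha> (\<lambda>x. complex_of_real (x $ j) * f x) x)
      \<le> (1 + real k) * schwartz_seminorm (Suc k) f" if \<alpha>: "length \<alpha> \<le> k" for k \<alpha> x
  proof -
    let ?s = "schwartz_seminorm (Suc k) f / (1 + norm x) ^ Suc k"
    have s: "?s \<ge> 0" using seminorm_nonneg[OF assms] by simp
    have "norm (partials \<alpha> (\<lambda>x. complex_of_real (x $ j) * f x) x) \<le> (norm x + length \<alpha>) * ?s"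
      using partials_coord_mult_bound[OF schwartz_smooth[OF assms] zero_less_one, of \<alpha> x ?s j]
        partials_le_seminorm[OF assms, of _ "Suc k" x] \<alpha> by simp
    also have "\<dots> \<le> ((1 + real k) * (1 + norm x)) * ?s"
    proof (intro mult_right_mono s)
      have "real k * norm x \<ge> 0" by simp
      then show "norm x + real (length \<alpha>) \<le> (1 + real k) * (1 + norm x)"
        using \<alpha> unfolding ring_distribs mult_1_left mult_1_right by linarith
    qed
    finally show ?thesis by (simp add: divide_le_eq pos_le_divide_eq mult_ac)
  qed
  show "(\<lambda>x. complex_of_real (x $ j) * f x) \<in> schwartz"
    using * by (intro schwartz_seminormI smooth_mult schwartz_smooth[OF assms] smooth_coord) blast
  show "schwartz_seminorm k (\<lambda>x. complex_of_real (x $ j) * f x) \<le> (1 + real k) * schwartz_seminorm (Suc k) f"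
    using * by (intro seminorm_leI) simp
qed

lemma partials_eq_0_open:
  assumes "open U" "\<And>x. x \<in> U \<Longrightarrow> f x = 0" "x \<in> U"
  shows "partials \<alpha> f x = 0"
  using assms(3)
proof (induction \<alpha> arbitrary: x)
  case (Cons i \<alpha>)
  have "((\<lambda>x. 0) has_derivative (\<lambda>h. 0)) (at x)" by simp
  then have "(partials \<alpha> f has_derivative (\<lambda>h. 0)) (at x)"
    by (rule has_derivative_transform_within_open[OF _ \<open>open U\<close> Cons.prems]) (simp add: Cons.IH)
  then show ?case by (simp add: partial_eqI)
qed (use assms in simp)

lemma partials_eq_0_outside:
  assumes "\<And>x. norm x > \<rho> \<Longrightarrow> f x = 0" "norm x > \<rho>"
  shows "partials \<alpha> f x = 0"
  by (rule partials_eq_0_open[of "{x. norm x > \<rho>}"]) (use assms in \<open>auto intro!: open_Collect_less continuous_intros\<close>)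

lemma schwartz_compact_support:
  assumes "smooth f" "\<And>x. norm x > \<rho> \<Longrightarrow> f x = 0"
  shows "f \<in> schwartz"
proof (rule schwartzI[OF assms(1)])
  fix \<alpha> k
  have "continuous_on UNIV (partials \<alpha> f)"
    using assms(1) unfolding smooth_def by (auto intro: differentiable_imp_continuous_on)
  then have "continuous_on (cball 0 \<rho>) (\<lambda>x. (1 + norm x) ^ k * norm (partials \<alpha> f x))"
    by (intro continuous_intros) (auto intro: continuous_on_subset)
  then have "bounded ((\<lambda>x. (1 + norm x) ^ k * norm (partials \<alpha> f x)) ` cball 0 \<rho>)"
    by (intro compact_imp_bounded compact_continuous_image) auto
  then obtain C where C: "C > 0" "\<And>x. norm x \<le> \<rho> \<Longrightarrow> (1 + norm x) ^ k * norm (partials \<alpha> f x) \<le> C"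
    by (force simp: bounded_pos abs_mult)
  have "(1 + norm x) ^ k * norm (partials \<alpha> f x) \<le> C" for x
    using C partials_eq_0_outside[of \<rho> f x \<alpha>, OF assms(2)] by (cases "norm x \<le> \<rho>") auto
  then show "\<exists>C. \<forall>x. (1 + norm x) ^ k * norm (partials \<alpha> f x) \<le> C" by blast
qed

lemma schwartz_dilate:
  assumes "f \<in> schwartz" "a \<noteq> 0"
  shows "(\<lambda>x. f (a *\<^sub>R x)) \<in> schwartz"
proof (rule schwartzI[OF smooth_dilate[OF schwartz_smooth[OF assms(1)]]])
  fix \<alpha> k
  obtain C where C: "\<And>x. (1 + norm x) ^ k * norm (partials \<alpha> f x) \<le> C"
    using assms(1) unfolding schwartz_def bounded_iff by (fastforce simp: abs_mult)
  define b where "b = max 1 (1 / \<bar>a\<bar>)"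
  have b: "1 + norm x \<le> b * (1 + norm (a *\<^sub>R x))" for x :: "real^'a"
  proof -
    have "norm x = (1 / \<bar>a\<bar>) * norm (a *\<^sub>R x)" using assms by simp
    also have "\<dots> \<le> b * norm (a *\<^sub>R x)" unfolding b_def by (intro mult_right_mono) auto
    finally show ?thesis unfolding b_def by (simp add: distrib_left add_mono)
  qed
  have "(1 + norm x) ^ k * norm (partials \<alpha> (\<lambda>x. f (a *\<^sub>R x)) x) \<le> b ^ k * \<bar>a\<bar> ^ length \<alpha> * C" for x
  proof -
    have "(1 + norm x) ^ k * norm (partials \<alpha> (\<lambda>x. f (a *\<^sub>R x)) x)
       \<le> (b * (1 + norm (a *\<^sub>R x))) ^ k * (\<bar>a\<bar> ^ length \<alpha> * norm (partials \<alpha> f (a *\<^sub>R x)))"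
      using b by (subst partials_dilate[OF schwartz_smooth[OF assms(1)]])
        (auto simp: norm_mult norm_power intro!: mult_right_mono power_mono)
    also have "\<dots> = b ^ k * \<bar>a\<bar> ^ length \<alpha> * ((1 + norm (a *\<^sub>R x)) ^ k * norm (partials \<alpha> f (a *\<^sub>R x)))"
      by (simp add: power_mult_distrib)
    also have "\<dots> \<le> b ^ k * \<bar>a\<bar> ^ length \<alpha> * C" using C[of "a *\<^sub>R x"] by (intro mult_left_mono) (simp_all add: b_def del: norm_scaleR)
    finally show ?thesis .
  qed
  then show "\<exists>C. \<forall>x. (1 + norm x) ^ k * norm (partials \<alpha> (\<lambda>x. f (a *\<^sub>R x)) x) \<le> C" by blast
qed

section \<open>The Fourier transform on the Schwartz space\<close>

lemma nn_integral_affine: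
  fixes f :: "'a::euclidean_space \<Rightarrow> ennreal"
  assumes [measurable]: "f \<in> borel_measurable borel" and c: "c \<noteq> 0"
  shows "(\<integral>\<^sup>+x. f x \<partial>lborel) = \<bar>c\<bar> ^ DIM('a) * (\<integral>\<^sup>+x. f (t + c *\<^sub>R x) \<partial>lborel)"
  by (subst lborel_affine[OF c, of t])
     (simp add: nn_integral_density nn_integral_distr nn_integral_cmult ennreal_power)

lemma integral_affine:
  fixes f :: "'a::euclidean_space \<Rightarrow> 'b::{banach,second_countable_topology}"
  assumes [measurable]: "f \<in> borel_measurable borel" and c: "c \<noteq> 0"
  shows "(\<integral>x. f x \<partial>lborel) = \<bar>c\<bar> ^ DIM('a) *\<^sub>R (\<integral>x. f (t + c *\<^sub>R x) \<partial>lborel)"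
  by (subst lborel_affine[OF c, of t])
     (simp add: integral_density integral_distr)

lemma integrable_affine:
  fixes f :: "'a::euclidean_space \<Rightarrow> 'b::{banach,second_countable_topology}"
  assumes f: "integrable lborel f" and c: "c \<noteq> 0"
  shows "integrable lborel (\<lambda>x. f (t + c *\<^sub>R x))"
proof -
  have [measurable]: "f \<in> borel_measurable borel" using f by auto
  have "integrable (density (distr lborel borel (\<lambda>x. t + c *\<^sub>R x)) (\<lambda>_. ennreal (\<bar>c\<bar> ^ DIM('a)))) f"
    using f lborel_affine[OF c, of t] by simp
  then have "integrable lborel (\<lambda>x. \<bar>c\<bar> ^ DIM('a) *\<^sub>R f (t + c *\<^sub>R x))"
    by (subst (asm) integrable_density) (simp_all add: integrable_distr_eq)
  then have "integrable lborel (\<lambda>x. (1 / \<bar>c\<bar> ^ DIM('a)) *\<^sub>R (\<bar>c\<bar> ^ DIM('a) *\<^sub>R f (t + c *\<^sub>R x)))"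
    by (rule integrable_scaleR_right)
  then show ?thesis using c by simp
qed

lemma integral_prod_basis:
  fixes f :: "'a::euclidean_space \<Rightarrow> real \<Rightarrow> complex"
  assumes int: "\<And>b. b \<in> Basis \<Longrightarrow> integrable lborel (f b)"
  shows "(\<integral>x. (\<Prod>b\<in>Basis. f b (x \<bullet> b)) \<partial>lborel) = (\<Prod>b\<in>Basis. (\<integral>x. f b x \<partial>lborel))"
proof -
  interpret product_sigma_finite "\<lambda>_::'a. lborel::real measure" ..
  have [measurable]: "\<And>b. b \<in> Basis \<Longrightarrow> f b \<in> borel_measurable borel" using int by auto
  have "(\<integral>x. (\<Prod>b\<in>Basis. f b (x \<bullet> b)) \<partial>lborel) =
     (\<integral>x. (\<Prod>b\<in>Basis. f b (x b)) \<partial>(\<Pi>\<^sub>M b\<in>Basis. lborel))"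
    by (subst lborel_eq) (simp add: integral_distr)
  also have "\<dots> = (\<Prod>b\<in>Basis. (\<integral>x. f b x \<partial>lborel))"
    by (rule product_integral_prod) (auto simp: int)
  finally show ?thesis .
qed

text \<open>The weight is dominated by the product over the coordinates of the integrable functions
\<open>1 / (1 + x\<^sup>2)\<close>. It dominates Schwartz functions by \<open>schwartz_moment\<close>, so that it serves in every domination
argument below.\<close>

lemma weight_integrable:
  "integrable lborel (\<lambda>x::'a::euclidean_space. 1 / (1 + norm x) ^ (2 * DIM('a)))"
proof (rule integrableI_bounded)
  have 1: "set_integrable lborel UNIV (\<lambda>x::real. inverse (1 + x^2))"
    using integrable_inverse_1_plus_square by (simp add: einterval_def)
  have fin: "(\<integral>\<^sup>+x. ennreal (inverse (1 + x^2)) \<partial>(lborel::real measure)) < \<infinity>"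
    using 1 unfolding set_integrable_def integrable_iff_bounded by (simp add: power2_eq_square)
  have "(\<integral>\<^sup>+(x::'a). ennreal (norm (1 / (1 + norm x) ^ (2 * DIM('a)))) \<partial>lborel)
     \<le> (\<integral>\<^sup>+(x::'a). (\<Prod>b\<in>Basis. ennreal (inverse (1 + (x \<bullet> b)^2))) \<partial>lborel)"
  proof (rule nn_integral_mono)
    fix x :: 'a
    have le: "1 + (x \<bullet> b)^2 \<le> (1 + norm x)^2" if "b \<in> Basis" for b
    proof -
      have "(x \<bullet> b)^2 \<le> (norm x)^2" using Basis_le_norm[OF that, of x]
        by (metis abs_le_square_iff abs_norm_cancel)
      then show ?thesis using norm_ge_zero[of x] by (simp add: power2_sum del: norm_ge_zero)
    qed
    have "1 / (1 + norm x) ^ (2 * DIM('a)) = (\<Prod>b\<in>(Basis::'a set). inverse ((1 + norm x)^2))"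
      by (simp add: power_mult inverse_eq_divide power_one_over)
    also have "\<dots> \<le> (\<Prod>b\<in>Basis. inverse (1 + (x \<bullet> b)^2))"
      using le by (intro prod_mono) (auto intro!: le_imp_inverse_le add_pos_nonneg)
    finally show "ennreal (norm (1 / (1 + norm x) ^ (2 * DIM('a)))) \<le> (\<Prod>b\<in>Basis. ennreal (inverse (1 + (x \<bullet> b)^2)))"
      by (subst prod_ennreal) (auto intro!: ennreal_leI)
  qed
  also have "\<dots> = (\<Prod>b\<in>(Basis::'a set). (\<integral>\<^sup>+x. ennreal (inverse (1 + x^2)) \<partial>lborel))"
    by (subst nn_integral_lborel_prod[symmetric]) auto
  also have "\<dots> < \<infinity>"
    using fin by (simp add: power_less_top_ennreal)
  finally show "(\<integral>\<^sup>+(x::'a). ennreal (norm (1 / (1 + norm x) ^ (2 * DIM('a)))) \<partial>lborel) < \<infinity>" .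
qed simp

lemma schwartz_moment:
  fixes f :: "real^'n::finite \<Rightarrow> complex"
  assumes "f \<in> schwartz"
  shows "norm x ^ k * norm (f x) \<le> schwartz_seminorm (2 * CARD('n) + k) f * (1 / (1 + norm x) ^ (2 * CARD('n)))"
proof -
  have "(1 + norm x) ^ (2 * CARD('n)) * (norm x ^ k * norm (f x)) \<le> (1 + norm x) ^ (2 * CARD('n)) * ((1 + norm x) ^ k * norm (f x))"
    by (intro mult_left_mono mult_right_mono power_mono) auto
  also have "\<dots> \<le> schwartz_seminorm (2 * CARD('n) + k) f"
    using seminorm_ge[OF assms, of "[]" "2 * CARD('n) + k" x] by (simp add: power_add mult_ac)
  finally show ?thesis by (simp add: pos_le_divide_eq mult_ac)
qed

lemma schwartz_moment_integrable:
  fixes f :: "real^'n::finite \<Rightarrow> complex"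
  assumes "f \<in> schwartz"
  shows "integrable lborel (\<lambda>x. norm x ^ k * norm (f x))"
proof (rule Bochner_Integration.integrable_bound[OF integrable_mult_right])
  show "integrable lborel (\<lambda>x::real^'n. 1 / (1 + norm x) ^ (2 * CARD('n)))"
    using weight_integrable[where 'a="real^'n"] by simp
  show "AE x in lborel. norm (norm x ^ k * norm (f x)) \<le> norm (schwartz_seminorm (2 * CARD('n) + k) f * (1 / (1 + norm x) ^ (2 * CARD('n))))"
    using schwartz_moment[OF assms, of _ k] seminorm_nonneg[OF assms] by (auto simp: abs_mult)
qed (use schwartz_measurable[OF assms] in measurable)

lemma schwartz_integrable:
  fixes f :: "real^'n::finite \<Rightarrow> complex"
  assumes "f \<in> schwartz" shows "integrable lborel f"
  using schwartz_moment_integrable[OF assms, of 0] schwartz_measurable[OF assms]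
  by (simp add: integrable_norm_iff)

lemma schwartz_L1_le:
  fixes f :: "real^'n::finite \<Rightarrow> complex"
  assumes "f \<in> schwartz"
  shows "(\<integral>x. norm (f x) \<partial>lborel) \<le> (\<integral>(x::real^'n). 1 / (1 + norm x) ^ (2 * CARD('n)) \<partial>lborel) * schwartz_seminorm (2 * CARD('n)) f"
proof -
  have "(\<integral>x. norm (f x) \<partial>lborel) \<le> (\<integral>(x::real^'n). schwartz_seminorm (2 * CARD('n)) f * (1 / (1 + norm x) ^ (2 * CARD('n))) \<partial>lborel)"
  proof (rule Bochner_Integration.integral_mono)
    show "integrable lborel (\<lambda>x. schwartz_seminorm (2 * CARD('n)) f * (1 / (1 + norm (x::real^'n)) ^ (2 * CARD('n))))"
      using weight_integrable[where 'a="real^'n"] by (intro integrable_mult_right) simp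
    show "norm (f x) \<le> schwartz_seminorm (2 * CARD('n)) f * (1 / (1 + norm x) ^ (2 * CARD('n)))" for x
      using schwartz_moment[OF assms, of x 0] by simp
  qed (intro integrable_norm schwartz_integrable assms)
  then show ?thesis unfolding integral_mult_right_zero by (simp only: mult.commute)
qed

lemma continuous_cis [continuous_intros]: "continuous_on S f \<Longrightarrow> continuous_on S (\<lambda>x. cis (f x))"
  unfolding cis_conv_exp by (intro continuous_intros)

lemma measurable_cis [measurable (raw)]: "f \<in> borel_measurable M \<Longrightarrow> (\<lambda>x. cis (f x)) \<in> borel_measurable M"
  by (rule measurable_compose[of f M borel cis])
     (auto intro!: borel_measurable_continuous_onI continuous_intros)

lemma integrable_cis_mult:
  fixes f :: "'a::euclidean_space \<Rightarrow> complex"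
  assumes "integrable lborel f"
  shows "integrable lborel (\<lambda>x. cis (- (x \<bullet> \<xi>)) * f x)" "integrable lborel (\<lambda>x. cis (x \<bullet> \<xi>) * f x)"
  using assms by (auto intro!: Bochner_Integration.integrable_bound[OF assms] simp: norm_mult)

lemma norm_fourier_le:
  fixes f :: "real^'n::finite \<Rightarrow> complex"
  assumes "integrable lborel f"
  shows "norm (fourier f \<xi>) \<le> (\<integral>x. norm (f x) \<partial>lborel)"
  unfolding fourier_def
  by (rule order_trans[OF integral_norm_bound]) (simp add: norm_mult)

text \<open>Multiplication by \<open>- \<i> x\<^sub>j\<close>, which the Fourier transform turns into \<open>\<partial>\<^sub>j\<close>.\<close>

definition coord_op :: "'n::finite \<Rightarrow> (real^'n \<Rightarrow> complex) \<Rightarrow> real^'n \<Rightarrow> complex" where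
  "coord_op j f = (\<lambda>x. - \<i> * (complex_of_real (x $ j) * f x))"

lemma coord_op_schwartz:
  assumes "f \<in> schwartz"
  shows "coord_op j f \<in> schwartz" "schwartz_seminorm k (coord_op j f) \<le> (1 + real k) * schwartz_seminorm (Suc k) f"
  unfolding coord_op_def
  using schwartz_cmult[OF schwartz_coord_mult(1)[OF assms], where c="- \<i>"] schwartz_coord_mult(2)[OF assms, of k j]
  by (auto intro: order_trans)

text \<open>The exponential minus its linearisation is bounded by the square of its argument, hence the error is
quadratic in the increment with the second moment of \<open>f\<close> as constant.\<close>

lemma fourier_has_derivative:
  fixes f :: "real^'n::finite \<Rightarrow> complex"
  assumes f: "f \<in> schwartz"
  shows "(fourier f has_derivative (\<lambda>h. \<Sum>j\<in>UNIV. complex_of_real (h $ j) * fourier (coord_op j f) \<xi>)) (at \<xi>)"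
proof (rule has_derivativeI_sandwich[of 1])
  define K where "K = (\<integral>x. norm x ^ 2 * norm (f x) \<partial>lborel)"
  show "bounded_linear (\<lambda>h. \<Sum>j\<in>UNIV. complex_of_real (h $ j) * fourier (coord_op j f) \<xi>)"
    by (intro bounded_linear_sum bounded_linear_mult_const bounded_linear_of_real[THEN bounded_linear_compose] bounded_linear_vec_nth)
  have int: "integrable lborel (\<lambda>x. cis (- (x \<bullet> \<xi>)) * g x)" if "g \<in> schwartz" for g \<xi>
    by (intro integrable_cis_mult schwartz_integrable that)
  show "norm (fourier f y - fourier f \<xi> - (\<Sum>j\<in>UNIV. complex_of_real ((y - \<xi>) $ j) * fourier (coord_op j f) \<xi>)) / norm (y - \<xi>) \<le> K * norm (y - \<xi>)"
    if "y \<noteq> \<xi>" for y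
  proof -
    define h where "h = y - \<xi>"
    have eq: "fourier f y - fourier f \<xi> - (\<Sum>j\<in>UNIV. complex_of_real (h $ j) * fourier (coord_op j f) \<xi>)
      = (\<integral>x. cis (- (x \<bullet> y)) * f x - cis (- (x \<bullet> \<xi>)) * f x - (\<Sum>j\<in>UNIV. complex_of_real (h $ j) * (cis (- (x \<bullet> \<xi>)) * coord_op j f x)) \<partial>lborel)"
      unfolding fourier_def
      by (simp add: int[OF f] int[OF coord_op_schwartz(1)[OF f]])
    have pt: "norm (cis (- (x \<bullet> y)) * f x - cis (- (x \<bullet> \<xi>)) * f x - (\<Sum>j\<in>UNIV. complex_of_real (h $ j) * (cis (- (x \<bullet> \<xi>)) * coord_op j f x)))
       \<le> norm h ^ 2 * (norm x ^ 2 * norm (f x))" for x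
    proof -
      have "(\<Sum>j\<in>UNIV. complex_of_real (h $ j) * (cis (- (x \<bullet> \<xi>)) * coord_op j f x))
         = cis (- (x \<bullet> \<xi>)) * f x * (- \<i> * complex_of_real (x \<bullet> h))"
        unfolding coord_op_def inner_vec_def by (simp add: sum_distrib_left mult_ac sum_negf)
      moreover have "cis (- (x \<bullet> y)) = cis (- (x \<bullet> \<xi>)) * cis (- (x \<bullet> h))"
        by (simp add: cis_mult h_def inner_diff_right)
      ultimately have "cis (- (x \<bullet> y)) * f x - cis (- (x \<bullet> \<xi>)) * f x - (\<Sum>j\<in>UNIV. complex_of_real (h $ j) * (cis (- (x \<bullet> \<xi>)) * coord_op j f x))
        = cis (- (x \<bullet> \<xi>)) * f x * (cis (- (x \<bullet> h)) - (1 + \<i> * complex_of_real (- (x \<bullet> h))))"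
        by (simp add: algebra_simps)
      then have eq2: "norm (cis (- (x \<bullet> y)) * f x - cis (- (x \<bullet> \<xi>)) * f x - (\<Sum>j\<in>UNIV. complex_of_real (h $ j) * (cis (- (x \<bullet> \<xi>)) * coord_op j f x)))
        = norm (f x) * norm (cis (- (x \<bullet> h)) - (1 + \<i> * complex_of_real (- (x \<bullet> h))))"
        by (simp add: norm_mult)
      have "norm (cis (- (x \<bullet> h)) - (1 + \<i> * complex_of_real (- (x \<bullet> h)))) \<le> \<bar>- (x \<bullet> h)\<bar> ^ 2 / 2"
        using iexp_approx1[of "- (x \<bullet> h)" 1] by (simp add: cis_conv_exp numeral_2_eq_2)
      also have "\<dots> \<le> (norm x * norm h) ^ 2"
        using power_mono[OF Cauchy_Schwarz_ineq2[of x h] abs_ge_zero, of 2] zero_le_power2[of "x \<bullet> h"]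
        unfolding power2_abs abs_minus_cancel by linarith
      finally have "norm (f x) * norm (cis (- (x \<bullet> h)) - (1 + \<i> * complex_of_real (- (x \<bullet> h)))) \<le> norm (f x) * (norm x * norm h) ^ 2"
        by (intro mult_left_mono) auto
      with eq2 show ?thesis by (simp only: power_mult_distrib mult_ac)
    qed
    have "norm (\<integral>x. cis (- (x \<bullet> y)) * f x - cis (- (x \<bullet> \<xi>)) * f x - (\<Sum>j\<in>UNIV. complex_of_real (h $ j) * (cis (- (x \<bullet> \<xi>)) * coord_op j f x)) \<partial>lborel)
       \<le> (\<integral>x. norm h ^ 2 * (norm x ^ 2 * norm (f x)) \<partial>lborel)"
      by (rule Bochner_Integration.integral_norm_bound_integral)
         (use schwartz_moment_integrable[OF f, of 2] pt in \<open>auto intro!: Bochner_Integration.integrable_diff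
             Bochner_Integration.integrable_sum integrable_mult_right int f coord_op_schwartz(1)[OF f]\<close>)
    also have "\<dots> = norm h ^ 2 * K" by (simp add: K_def)
    finally have "norm (fourier f y - fourier f \<xi> - (\<Sum>j\<in>UNIV. complex_of_real (h $ j) * fourier (coord_op j f) \<xi>)) \<le> norm h ^ 2 * K"
      unfolding eq .
    then show ?thesis using that unfolding h_def
      by (simp add: divide_le_eq power2_eq_square mult_ac)
  qed
  show "((\<lambda>y. K * norm (y - \<xi>)) \<longlongrightarrow> 0) (at \<xi>)"
    by (auto intro!: tendsto_eq_intros)
qed simp

lemma partial_fourier:
  assumes "f \<in> schwartz"
  shows "partial j (fourier f) = fourier (coord_op j f)"
proof
  fix \<xi>
  have "partial j (fourier f) \<xi> = (\<Sum>i\<in>UNIV. complex_of_real (axis j 1 $ i) * fourier (coord_op i f) \<xi>)"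
    by (rule partial_eqI[OF fourier_has_derivative[OF assms]])
  also have "\<dots> = (\<Sum>i\<in>UNIV. if i = j then fourier (coord_op i f) \<xi> else 0)"
    by (intro sum.cong) (auto simp: axis_def)
  finally show "partial j (fourier f) \<xi> = fourier (coord_op j f) \<xi>" by simp
qed

lemma smooth_fourier: "f \<in> schwartz \<Longrightarrow> smooth (fourier f)"
  by (rule smooth_coinduct[where A="fourier ` schwartz"])
     (auto simp: partial_fourier coord_op_schwartz intro!: differentiable_onI differentiableI[OF fourier_has_derivative])

text \<open>The integral of a difference quotient vanishes by translation invariance; the decay of the derivative
and the mean value theorem give a dominating function for the passage to the limit.\<close>

lemma integral_partial_eq_0:
  fixes g :: "real^'n::finite \<Rightarrow> complex"
  assumes d: "\<And>x. g differentiable (at x)" and int: "integrable lborel g"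
    and bd: "\<And>x. norm (partial i g x) \<le> C / (1 + norm x) ^ (2 * CARD('n))"
    and m: "partial i g \<in> borel_measurable borel"
  shows "(\<integral>x. partial i g x \<partial>lborel) = 0"
proof -
  define h where "h n = 1 / real (Suc n)" for n
  define e :: "real^'n" where "e = axis i 1"
  define D where "D n x = (g (h n *\<^sub>R e + 1 *\<^sub>R x) - g x) / complex_of_real (h n)" for n x
  have h: "0 < h n" "h n \<le> 1" for n by (auto simp: h_def)
  have [simp]: "norm e = 1" by (simp add: e_def)
  have C: "C \<ge> 0" using order_trans[OF norm_ge_zero bd[of 0]] by simp
  have gm [measurable]: "g \<in> borel_measurable borel" using int by auto
  have der: "((\<lambda>t. g (x + t *\<^sub>R e)) has_vector_derivative partial i g (x + t *\<^sub>R e)) (at t)" for x t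
  proof -
    have 1: "((\<lambda>t. x + t *\<^sub>R e) has_derivative (\<lambda>t. t *\<^sub>R e)) (at t)" by (auto intro!: derivative_eq_intros)
    have 2: "(g has_derivative frechet_derivative g (at (x + t *\<^sub>R e))) (at (x + t *\<^sub>R e))"
      using d by (simp add: frechet_derivative_works)
    have "frechet_derivative g (at (x + t *\<^sub>R e)) (s *\<^sub>R e) = s *\<^sub>R partial i g (x + t *\<^sub>R e)" for s
      using linear_cmul[OF has_derivative_linear[OF 2]] by (simp add: partial_def e_def)
    then show ?thesis
      using has_derivative_compose[of "\<lambda>t. x + t *\<^sub>R e" "\<lambda>t. t *\<^sub>R e" t UNIV g, OF 1 2]
      unfolding has_vector_derivative_def by simp
  qed
  have "(\<lambda>n. \<integral>x. D n x \<partial>lborel) \<longlonglongrightarrow> (\<integral>x. partial i g x \<partial>lborel)"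
  proof (rule integral_dominated_convergence[where w="\<lambda>x. C * 2 ^ (2 * CARD('n)) * (1 / (1 + norm x) ^ (2 * CARD('n)))"])
    show "integrable lborel (\<lambda>x::real^'n. C * 2 ^ (2 * CARD('n)) * (1 / (1 + norm x) ^ (2 * CARD('n))))"
      using weight_integrable[where 'a="real^'n"] by (intro integrable_mult_right) simp
    have hl: "h \<longlonglongrightarrow> 0" unfolding h_def by (rule lim_1_over_n[THEN LIMSEQ_Suc])
    have "(\<lambda>n. D n x) \<longlonglongrightarrow> partial i g x" for x
    proof -
      have "((\<lambda>t. norm (g (x + t *\<^sub>R e) - g x - t *\<^sub>R partial i g x) / norm t) \<longlongrightarrow> 0) (at 0)"
        using der[of x 0] unfolding has_vector_derivative_def has_derivative_at by simp
      then have "(\<lambda>n. norm (g (x + h n *\<^sub>R e) - g x - h n *\<^sub>R partial i g x) / norm (h n)) \<longlonglongrightarrow> 0"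
        by (rule filterlim_compose) (use hl h in \<open>auto simp: filterlim_at intro!: always_eventually less_imp_neq[symmetric]\<close>)
      moreover have "norm (g (x + h n *\<^sub>R e) - g x - h n *\<^sub>R partial i g x) / norm (h n) = norm (D n x - partial i g x)" for n
      proof -
        have "D n x - partial i g x = (g (x + h n *\<^sub>R e) - g x - h n *\<^sub>R partial i g x) / complex_of_real (h n)"
          using h[of n] by (simp add: D_def field_simps scaleR_conv_of_real)
        then show ?thesis by (simp add: norm_divide)
      qed
      ultimately show ?thesis by (simp add: LIM_zero_iff tendsto_norm_zero_iff)
    qed
    then show "AE x in lborel. (\<lambda>n. D n x) \<longlonglongrightarrow> partial i g x" by simp
    have "norm (D n x) \<le> C * 2 ^ (2 * CARD('n)) * (1 / (1 + norm x) ^ (2 * CARD('n)))" for n x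
    proof -
      have "\<exists>t\<in>{0<..<h n}. norm (g (x + h n *\<^sub>R e) - g (x + 0 *\<^sub>R e)) \<le> norm ((h n - 0) *\<^sub>R partial i g (x + t *\<^sub>R e))"
        using der unfolding has_vector_derivative_def
        by (intro mvt_general h) (auto intro!: has_derivative_continuous_on intro: has_derivative_at_withinI)
      then obtain t where t: "0 < t" "t < h n" "norm (g (x + h n *\<^sub>R e) - g x) \<le> h n * norm (partial i g (x + t *\<^sub>R e))"
        using h[of n] by auto
      have "norm (D n x) \<le> norm (partial i g (x + t *\<^sub>R e))"
        using t(3) h[of n] by (simp add: D_def norm_divide divide_le_eq add.commute mult.commute)
      also have "\<dots> \<le> C / (1 + norm (x + t *\<^sub>R e)) ^ (2 * CARD('n))" by (rule bd)
      also have "\<dots> \<le> C / ((1 + norm x) / 2) ^ (2 * CARD('n))"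
      proof -
        have "norm x \<le> norm (x + t *\<^sub>R e) + norm (t *\<^sub>R e)" by (metis add_diff_cancel norm_triangle_ineq4)
        then have "(1 + norm x) / 2 \<le> 1 + norm (x + t *\<^sub>R e)" using t h[of n] norm_ge_zero[of "x + t *\<^sub>R e"]
          by (simp del: norm_ge_zero)
        then show ?thesis using C by (intro divide_left_mono power_mono) auto
      qed
      finally show ?thesis by (simp add: power_divide)
    qed
    then show "\<And>n. AE x in lborel. norm (D n x) \<le> C * 2 ^ (2 * CARD('n)) * (1 / (1 + norm x) ^ (2 * CARD('n)))" by simp
  qed (use m in \<open>auto simp: D_def\<close>)
  moreover have "(\<integral>x. D n x \<partial>lborel) = 0" for n
  proof -
    have "(\<integral>x. g (h n *\<^sub>R e + 1 *\<^sub>R x) \<partial>lborel) = (\<integral>x. g x \<partial>lborel)"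
      using integral_affine[OF gm, of 1 "h n *\<^sub>R e"] by simp
    then show ?thesis unfolding D_def
      using int integrable_affine[OF int, of 1 "h n *\<^sub>R e"] by simp
  qed
  ultimately have "(\<lambda>n. 0) \<longlonglongrightarrow> (\<integral>x. partial i g x \<partial>lborel)" by simp
  then show ?thesis using LIMSEQ_unique tendsto_const by blast
qed

text \<open>Apply \<open>integral_partial_eq_0\<close> to the product of \<open>f\<close> with the exponential.\<close>

lemma fourier_partial:
  fixes f :: "real^'n::finite \<Rightarrow> complex"
  assumes f: "f \<in> schwartz"
  shows "fourier (partial j f) \<xi> = \<i> * complex_of_real (\<xi> $ j) * fourier f \<xi>"
proof -
  define g where "g = (\<lambda>x. cis (- (x \<bullet> \<xi>)) * f x)"
  have dc: "((\<lambda>x::real^'n. cis (- (x \<bullet> \<xi>))) has_derivative (\<lambda>h. - \<i> * complex_of_real (h \<bullet> \<xi>) * cis (- (x \<bullet> \<xi>)))) (at x)" for x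
  proof -
    have "((\<lambda>x. - \<i> * complex_of_real (x \<bullet> \<xi>)) has_derivative (\<lambda>h. - \<i> * complex_of_real (h \<bullet> \<xi>))) (at x)"
      by (intro derivative_intros)
    from has_derivative_compose[OF this DERIV_exp[unfolded has_field_derivative_def]]
    show ?thesis unfolding cis_conv_exp by (simp add: mult_ac)
  qed
  have "partial j g x = cis (- (x \<bullet> \<xi>)) * partial j f x - \<i> * complex_of_real (\<xi> $ j) * (cis (- (x \<bullet> \<xi>)) * f x)" for x
    unfolding g_def using dc schwartz_differentiable[OF f]
    by (subst partial_mult) (auto simp: differentiableI[OF dc] partial_eqI[OF dc] inner_axis' algebra_simps)
  then have pg: "partial j g = (\<lambda>x. cis (- (x \<bullet> \<xi>)) * partial j f x - \<i> * complex_of_real (\<xi> $ j) * (cis (- (x \<bullet> \<xi>)) * f x))"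
    by auto
  have fj: "partial j f \<in> schwartz" by (rule schwartz_partial[OF f])
  note int = integrable_cis_mult(1)[OF schwartz_integrable[OF f]] integrable_cis_mult(1)[OF schwartz_integrable[OF fj]]
  have "0 = (\<integral>x. partial j g x \<partial>lborel)"
  proof (rule integral_partial_eq_0[symmetric])
    show "g differentiable (at x)" for x unfolding g_def
      by (intro differentiable_mult differentiableI[OF dc] schwartz_differentiable f)
    show "integrable lborel g" unfolding g_def by (rule int)
    show "partial j g \<in> borel_measurable borel" unfolding pg
      using schwartz_measurable[OF f] schwartz_measurable[OF fj] by measurable
    fix x :: "real^'n"
    let ?A = "\<lambda>f. schwartz_seminorm (2 * CARD('n)) f" let ?w = "1 / (1 + norm x) ^ (2 * CARD('n))"
    have "norm (partial j g x) \<le> norm (partial j f x) + \<bar>\<xi> $ j\<bar> * norm (f x)"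
      unfolding pg by (rule order_trans[OF norm_triangle_ineq4]) (simp add: norm_mult)
    also have "\<dots> \<le> ?A (partial j f) * ?w + \<bar>\<xi> $ j\<bar> * (?A f * ?w)"
      using schwartz_moment[OF fj, of x 0] schwartz_moment[OF f, of x 0]
      by (intro add_mono mult_left_mono) auto
    finally show "norm (partial j g x) \<le> (?A (partial j f) + \<bar>\<xi> $ j\<bar> * ?A f) / (1 + norm x) ^ (2 * CARD('n))"
      by (simp add: add_divide_distrib)
  qed
  also have "\<dots> = fourier (partial j f) \<xi> - \<i> * complex_of_real (\<xi> $ j) * fourier f \<xi>"
    unfolding pg fourier_def using int by simp
  finally show ?thesis by simp
qed

text \<open>By \<open>fourier_partial\<close> a factor \<open>\<xi>\<^sub>i\<close> is paid for by a derivative of \<open>f\<close>.\<close>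

lemma fourier_decay:
  "\<exists>C k'. C \<ge> 0 \<and> (\<forall>f\<in>schwartz. \<forall>\<xi>::real^'n::finite. (1 + norm \<xi>) ^ k * norm (fourier f \<xi>) \<le> C * schwartz_seminorm k' f)"
proof (induction k)
  case 0
  have "norm (fourier f \<xi>) \<le> (\<integral>(x::real^'n). 1 / (1 + norm x) ^ (2 * CARD('n)) \<partial>lborel) * schwartz_seminorm (2 * CARD('n)) f"
    if "f \<in> schwartz" for f and \<xi> :: "real^'n"
    using norm_fourier_le[OF schwartz_integrable[OF that], of \<xi>] schwartz_L1_le[OF that] by linarith
  then show ?case
    by (intro exI[of _ "(\<integral>(x::real^'n). 1 / (1 + norm x) ^ (2 * CARD('n)) \<partial>lborel)"] exI[of _ "2 * CARD('n)"]) auto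
next
  case (Suc k)
  then obtain C k' where C: "C \<ge> 0" and
    *: "\<And>f \<xi>. f \<in> schwartz \<Longrightarrow> (1 + norm (\<xi>::real^'n)) ^ k * norm (fourier f \<xi>) \<le> C * schwartz_seminorm k' f" by blast
  have "(1 + norm \<xi>) ^ Suc k * norm (fourier f \<xi>) \<le> (C * (1 + real CARD('n))) * schwartz_seminorm (Suc k') f"
    if f: "f \<in> schwartz" for f and \<xi> :: "real^'n"
  proof -
    have "(1 + norm \<xi>) ^ Suc k * norm (fourier f \<xi>) \<le> (1 + norm \<xi>) ^ k * ((1 + (\<Sum>i\<in>UNIV. \<bar>\<xi> $ i\<bar>)) * norm (fourier f \<xi>))"
      using norm_le_l1_cart[of \<xi>] by (simp add: mult.assoc mult_left_mono mult_right_mono)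
    also have "\<dots> = (1 + norm \<xi>) ^ k * norm (fourier f \<xi>) + (\<Sum>i\<in>UNIV. (1 + norm \<xi>) ^ k * norm (fourier (partial i f) \<xi>))"
      by (simp add: fourier_partial[OF f] norm_mult sum_distrib_left sum_distrib_right algebra_simps)
    also have "\<dots> \<le> C * schwartz_seminorm (Suc k') f + (\<Sum>i\<in>(UNIV::'n set). C * schwartz_seminorm (Suc k') f)"
    proof (intro add_mono sum_mono)
      show "(1 + norm \<xi>) ^ k * norm (fourier f \<xi>) \<le> C * schwartz_seminorm (Suc k') f"
        by (rule order_trans[OF *[OF f]]) (intro mult_left_mono seminorm_mono f C, simp)
      show "(1 + norm \<xi>) ^ k * norm (fourier (partial i f) \<xi>) \<le> C * schwartz_seminorm (Suc k') f" for i
        by (rule order_trans[OF *[OF schwartz_partial[OF f]]]) (intro mult_left_mono seminorm_partial f C)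
    qed
    also have "\<dots> = (C * (1 + real CARD('n))) * schwartz_seminorm (Suc k') f" by (simp add: algebra_simps)
    finally show ?thesis .
  qed
  then show ?case using C by (intro exI[of _ "C * (1 + real CARD('n))"] exI[of _ "Suc k'"]) auto
qed

lemma fourier_partials_decay:
  "\<exists>C k'. C \<ge> 0 \<and> (\<forall>f\<in>schwartz. \<forall>\<xi>::real^'n::finite. (1 + norm \<xi>) ^ k * norm (partials \<alpha> (fourier f) \<xi>) \<le> C * schwartz_seminorm k' f)"
proof (induction \<alpha> rule: rev_induct)
  case Nil then show ?case using fourier_decay by simp
next
  case (snoc j \<alpha>)
  then obtain C k' where C: "C \<ge> 0" and
    *: "\<And>f \<xi>. f \<in> schwartz \<Longrightarrow> (1 + norm (\<xi>::real^'n)) ^ k * norm (partials \<alpha> (fourier f) \<xi>) \<le> C * schwartz_seminorm k' f" by blast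
  have "(1 + norm \<xi>) ^ k * norm (partials (\<alpha> @ [j]) (fourier f) \<xi>) \<le> C * (1 + real k') * schwartz_seminorm (Suc k') f"
    if f: "f \<in> schwartz" for f and \<xi> :: "real^'n"
    using *[OF coord_op_schwartz(1)[OF f], of \<xi> j] mult_left_mono[OF coord_op_schwartz(2)[OF f, of k' j] C]
    unfolding partials_append by (simp add: partial_fourier[OF f] mult.assoc)
  then show ?case using C by (intro exI[of _ "C * (1 + real k')"] exI[of _ "Suc k'"]) auto
qed

theorem fourier_schwartz:
  assumes "f \<in> schwartz" shows "fourier f \<in> schwartz"
proof (rule schwartzI[OF smooth_fourier[OF assms]])
  fix \<alpha> k show "\<exists>C. \<forall>x. (1 + norm x) ^ k * norm (partials \<alpha> (fourier f) x) \<le> C"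
    using fourier_partials_decay[of k \<alpha>] assms by blast
qed

text \<open>Continuity of the Fourier transform on the Schwartz space, which makes the Fourier transform of a
tempered distribution tempered.\<close>

theorem fourier_seminorm:
  "\<exists>C k'. C \<ge> 0 \<and> (\<forall>f\<in>schwartz. schwartz_seminorm k (fourier (f :: real^'n::finite \<Rightarrow> complex)) \<le> C * schwartz_seminorm k' f)"
proof -
  let ?A = "{\<alpha>::'n list. length \<alpha> \<le> k}"
  have "\<forall>\<alpha>::'n list. \<exists>C k'. C \<ge> 0 \<and> (\<forall>f\<in>schwartz. \<forall>\<xi>. (1 + norm \<xi>) ^ k * norm (partials \<alpha> (fourier f) \<xi>) \<le> C * schwartz_seminorm k' f)"
    using fourier_partials_decay by blast
  then obtain C k' where C: "\<And>\<alpha>. C \<alpha> \<ge> 0"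
    and *: "\<And>\<alpha> f \<xi>. f \<in> schwartz \<Longrightarrow> (1 + norm (\<xi>::real^'n)) ^ k * norm (partials \<alpha> (fourier f) \<xi>) \<le> C \<alpha> * schwartz_seminorm (k' \<alpha>) f"
    by metis
  define K where "K = Max (k' ` ?A)"
  have "schwartz_seminorm k (fourier f) \<le> (\<Sum>\<alpha>\<in>?A. C \<alpha>) * schwartz_seminorm K f" if f: "f \<in> schwartz" for f :: "real^'n \<Rightarrow> complex"
  proof (rule seminorm_leI)
    fix \<alpha> :: "'n list" and \<xi> assume \<alpha>: "length \<alpha> \<le> k"
    have "(1 + norm \<xi>) ^ k * norm (partials \<alpha> (fourier f) \<xi>) \<le> C \<alpha> * schwartz_seminorm (k' \<alpha>) f" by (rule *[OF f])
    also have "\<dots> \<le> (\<Sum>\<alpha>\<in>?A. C \<alpha>) * schwartz_seminorm K f"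
      using C \<alpha> finite_multiindices unfolding K_def
      by (intro mult_mono seminorm_mono f seminorm_nonneg sum_nonneg member_le_sum Max_ge) auto
    finally show "(1 + norm \<xi>) ^ k * norm (partials \<alpha> (fourier f) \<xi>) \<le> (\<Sum>\<alpha>\<in>?A. C \<alpha>) * schwartz_seminorm K f" .
  qed
  then show ?thesis using C by (intro exI[of _ "\<Sum>\<alpha>\<in>?A. C \<alpha>"] exI[of _ K]) (auto intro: sum_nonneg)
qed

section \<open>Fourier inversion\<close>

definition gaussian :: "'a::euclidean_space \<Rightarrow> real" where
  "gaussian x = exp (- (norm x)\<^sup>2 / 2)"

text \<open>In this form integrals and characteristic functions of Gaussians follow from the standard normal
distribution in one dimension.\<close>

lemma gaussian_prod: "gaussian (x::'a::euclidean_space) = sqrt (2 * pi) ^ DIM('a) * (\<Prod>b\<in>Basis. std_normal_density (x \<bullet> b))"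
proof -
  have "(\<Prod>b\<in>Basis. std_normal_density (x \<bullet> b)) = (1 / sqrt (2 * pi)) ^ DIM('a) * exp (\<Sum>b\<in>Basis. - (x \<bullet> b)\<^sup>2 / 2)"
    by (simp only: std_normal_density_def prod.distrib exp_sum[OF finite_Basis] prod_constant)
  also have "(\<Sum>b\<in>Basis. - (x \<bullet> b)\<^sup>2 / 2) = - (norm x)\<^sup>2 / 2"
    unfolding power2_norm_eq_inner by (subst euclidean_inner) (simp add: power2_eq_square sum_negf sum_divide_distrib)
  finally show ?thesis by (simp add: gaussian_def power_one_over)
qed

lemma gaussian_le: "gaussian x \<le> 1" and gaussian_pos: "gaussian x > 0"
  by (auto simp: gaussian_def)

lemma gaussian_measurable [measurable]: "gaussian \<in> borel_measurable borel"
  unfolding gaussian_def[abs_def] by measurable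

lemma char_std_normal_integral:
  "(\<integral>x. cis (t * x) * complex_of_real (std_normal_density x) \<partial>lborel) = complex_of_real (exp (- t\<^sup>2 / 2))"
proof -
  have "complex_of_real (exp (- t\<^sup>2 / 2)) = (CLINT x|std_normal_distribution. iexp (t * x))"
    using char_std_normal_distribution by (metis char_def)
  also have "\<dots> = (\<integral>x. std_normal_density x *\<^sub>R iexp (t * x) \<partial>lborel)"
    by (subst integral_density) auto
  finally show ?thesis by (simp add: cis_conv_exp scaleR_conv_of_real mult_ac)
qed

lemma integrable_gaussian: "integrable lborel (gaussian :: 'a::euclidean_space \<Rightarrow> real)"
proof (rule integrableI_bounded)
  have "(\<integral>\<^sup>+(x::'a). ennreal (\<Prod>b\<in>Basis. std_normal_density (x \<bullet> b)) \<partial>lborel) =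
     (\<Prod>b\<in>(Basis::'a set). (\<integral>\<^sup>+x. ennreal (std_normal_density x) \<partial>lborel))"
    by (subst nn_integral_lborel_prod[symmetric]) (auto simp: prod_ennreal)
  also have "(\<integral>\<^sup>+x. ennreal (std_normal_density x) \<partial>lborel) = 1"
    by (subst nn_integral_eq_integral) auto
  finally have *: "(\<integral>\<^sup>+(x::'a). ennreal (\<Prod>b\<in>Basis. std_normal_density (x \<bullet> b)) \<partial>lborel) = 1" by simp
  have pt: "ennreal (norm (gaussian x)) = ennreal (sqrt (2 * pi) ^ DIM('a)) * ennreal (\<Prod>b\<in>Basis. std_normal_density (x \<bullet> b))" for x :: 'a
    using gaussian_pos[of x] by (subst ennreal_mult[symmetric]) (auto simp: gaussian_prod intro!: prod_nonneg)
  have "(\<integral>\<^sup>+(x::'a). ennreal (norm (gaussian x)) \<partial>lborel)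
     = (\<integral>\<^sup>+(x::'a). ennreal (sqrt (2 * pi) ^ DIM('a)) * ennreal (\<Prod>b\<in>Basis. std_normal_density (x \<bullet> b)) \<partial>lborel)"
    by (simp only: pt)
  also have "\<dots> = ennreal (sqrt (2 * pi) ^ DIM('a))"
    by (subst nn_integral_cmult) (auto simp: *)
  finally show "(\<integral>\<^sup>+(x::'a). ennreal (norm (gaussian x)) \<partial>lborel) < \<infinity>" by simp
qed simp

lemma fourier_gaussian:
  "(\<integral>x. cis (x \<bullet> \<xi>) * complex_of_real (gaussian x) \<partial>lborel)
     = complex_of_real (sqrt (2 * pi) ^ DIM('a) * gaussian (\<xi>::'a::euclidean_space))"
proof -
  have c: "cis (sum f A) = (\<Prod>a\<in>A. cis (f a))" if "finite A" for f :: "'a \<Rightarrow> real" and A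
    using that by induction (simp_all add: cis_mult[symmetric])
  have "cis (x \<bullet> \<xi>) * complex_of_real (gaussian x) = complex_of_real (sqrt (2 * pi) ^ DIM('a)) *
      (\<Prod>b\<in>Basis. cis ((\<xi> \<bullet> b) * (x \<bullet> b)) * complex_of_real (std_normal_density (x \<bullet> b)))" for x
    unfolding gaussian_prod prod.distrib by (subst euclidean_inner) (simp add: c mult_ac)
  then have "(\<integral>x. cis (x \<bullet> \<xi>) * complex_of_real (gaussian x) \<partial>lborel) = complex_of_real (sqrt (2 * pi) ^ DIM('a)) *
      (\<integral>x. (\<Prod>b\<in>Basis. cis ((\<xi> \<bullet> b) * (x \<bullet> b)) * complex_of_real (std_normal_density (x \<bullet> b))) \<partial>lborel)"
    by simp
  also have "(\<integral>x. (\<Prod>b\<in>Basis. cis ((\<xi> \<bullet> b) * (x \<bullet> b)) * complex_of_real (std_normal_density (x \<bullet> b))) \<partial>lborel)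
     = (\<Prod>b\<in>Basis. (\<integral>x. cis ((\<xi> \<bullet> b) * x) * complex_of_real (std_normal_density x) \<partial>lborel))"
  proof (rule integral_prod_basis)
    show "integrable lborel (\<lambda>x. cis ((\<xi> \<bullet> b) * x) * complex_of_real (std_normal_density x))" for b
      by (rule Bochner_Integration.integrable_bound[OF integrable_normal_density[of 1 0]]) (auto simp: norm_mult)
  qed
  also have "\<dots> = complex_of_real (\<Prod>b\<in>Basis. exp (- (\<xi> \<bullet> b)\<^sup>2 / 2))"
    by (simp add: char_std_normal_integral)
  also have "(\<Prod>b\<in>Basis. exp (- (\<xi> \<bullet> b)\<^sup>2 / 2)) = gaussian \<xi>"
    unfolding gaussian_def power2_norm_eq_inner
    by (subst (2) euclidean_inner) (simp add: exp_sum[symmetric] power2_eq_square sum_negf sum_divide_distrib)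
  finally show ?thesis by simp
qed

lemma integral_gaussian: "(\<integral>x. gaussian (x::'a::euclidean_space) \<partial>lborel) = sqrt (2 * pi) ^ DIM('a)"
proof -
  have "complex_of_real (\<integral>x. gaussian (x::'a) \<partial>lborel) = complex_of_real (sqrt (2 * pi) ^ DIM('a))"
    using fourier_gaussian[of "0::'a"] by (simp add: gaussian_def)
  then show ?thesis using of_real_eq_iff by blast
qed

lemma integrable_product_bound:
  fixes h :: "'a::euclidean_space \<Rightarrow> 'b::euclidean_space \<Rightarrow> complex"
  assumes [measurable]: "case_prod h \<in> borel_measurable (borel \<Otimes>\<^sub>M borel)"
    and f: "integrable lborel f" and g: "integrable lborel g"
    and le: "\<And>x y. norm (h x y) \<le> f x * g y"
  shows "integrable (lborel \<Otimes>\<^sub>M lborel) (case_prod h)"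
proof (rule lborel_pair.Fubini_integrable)
  have *: "integrable lborel (\<lambda>y. h x y)" for x
    by (rule Bochner_Integration.integrable_bound[OF integrable_mult_right[OF g, of "f x"]])
       (use le[of x] in \<open>auto intro!: AE_I2 order_trans[OF le abs_ge_self]\<close>)
  then show "AE x in lborel. integrable lborel (\<lambda>y. case_prod h (x, y))" by simp
  show "integrable lborel (\<lambda>x. \<integral>y. norm (case_prod h (x, y)) \<partial>lborel)"
  proof (rule Bochner_Integration.integrable_bound[OF integrable_mult_left[OF f, of "\<integral>y. g y \<partial>lborel"]])
    show "AE x in lborel. norm (\<integral>y. norm (case_prod h (x, y)) \<partial>lborel) \<le> norm (f x * (\<integral>y. g y \<partial>lborel))"
    proof (rule AE_I2)
      fix x
      have "(\<integral>y. norm (h x y) \<partial>lborel) \<le> (\<integral>y. f x * g y \<partial>lborel)"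
        by (intro Bochner_Integration.integral_mono integrable_norm * integrable_mult_right g le)
      then show "norm (\<integral>y. norm (case_prod h (x, y)) \<partial>lborel) \<le> norm (f x * (\<integral>y. g y \<partial>lborel))"
        by (simp add: integral_nonneg_AE)
    qed
  qed measurable
qed simp

text \<open>Under a Gaussian factor \<open>gaussian (\<xi> / n)\<close> the order of integration can be exchanged, and the
integral becomes the average of \<open>f\<close> over a Gaussian of width \<open>1 / n\<close> about \<open>x\<close>. Both sides converge as the factor
tends to \<open>1\<close>.\<close>

theorem fourier_inversion_pointwise:
  fixes f :: "real^'n::finite \<Rightarrow> complex"
  assumes f: "f \<in> schwartz"
  shows "(\<integral>\<xi>. cis (x \<bullet> \<xi>) * fourier f \<xi> \<partial>lborel) = complex_of_real ((2 * pi) ^ CARD('n)) * f x"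
proof -
  let ?c = "sqrt (2 * pi) ^ CARD('n)"
  define J where "J n = (\<integral>\<xi>. cis (x \<bullet> \<xi>) * complex_of_real (gaussian (\<xi> /\<^sub>R real (Suc n))) * fourier f \<xi> \<partial>lborel)" for n
  note fm [measurable] = schwartz_measurable[OF f] schwartz_measurable[OF fourier_schwartz[OF f]]
  have fint: "integrable lborel f" "integrable lborel (fourier f)"
    by (auto intro: schwartz_integrable fourier_schwartz f)
  obtain B where B: "\<And>x. norm (f x) \<le> B" using schwartz_bounded[OF f] by blast
  \<comment> \<open>removing the Gaussian factor in frequency\<close>
  have J1: "J \<longlonglongrightarrow> (\<integral>\<xi>. cis (x \<bullet> \<xi>) * fourier f \<xi> \<partial>lborel)"
    unfolding J_def
  proof (rule integral_dominated_convergence[where w="\<lambda>\<xi>. norm (fourier f \<xi>)"])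
    have "(\<lambda>n. gaussian (\<xi> /\<^sub>R real (Suc n))) \<longlonglongrightarrow> gaussian (0::real^'n)" for \<xi> :: "real^'n"
    proof -
      have "(\<lambda>n. inverse (real (Suc n)) *\<^sub>R \<xi>) \<longlonglongrightarrow> 0 *\<^sub>R \<xi>"
        by (intro tendsto_intros LIMSEQ_inverse_real_of_nat)
      moreover have "continuous_on UNIV (gaussian :: real^'n \<Rightarrow> real)"
        unfolding gaussian_def[abs_def] by (intro continuous_intros) auto
      ultimately show ?thesis by (intro continuous_on_tendsto_compose[of UNIV gaussian]) auto
    qed
    then have "(\<lambda>n. cis (x \<bullet> \<xi>) * complex_of_real (gaussian (\<xi> /\<^sub>R real (Suc n))) * fourier f \<xi>) \<longlonglongrightarrow>
       cis (x \<bullet> \<xi>) * complex_of_real (gaussian (0::real^'n)) * fourier f \<xi>" for \<xi>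
      by (intro tendsto_intros)
    then show "AE \<xi> in lborel. (\<lambda>n. cis (x \<bullet> \<xi>) * complex_of_real (gaussian (\<xi> /\<^sub>R real (Suc n))) * fourier f \<xi>) \<longlonglongrightarrow>
       cis (x \<bullet> \<xi>) * fourier f \<xi>" by (simp add: gaussian_def)
    show "AE \<xi> in lborel. norm (cis (x \<bullet> \<xi>) * complex_of_real (gaussian (\<xi> /\<^sub>R real (Suc n))) * fourier f \<xi>) \<le> norm (fourier f \<xi>)" for n
      by (intro AE_I2) (auto simp: norm_mult gaussian_le abs_of_pos[OF gaussian_pos] less_imp_le[OF gaussian_pos] intro!: mult_left_le_one_le)
  qed (use fint in auto)
  \<comment> \<open>after exchanging the integrals: the Gaussian average around \<open>x\<close>\<close>
  have Jn: "J n = (\<integral>w. f (x + (1 / real (Suc n)) *\<^sub>R w) * complex_of_real (?c * gaussian w) \<partial>lborel)" for n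
  proof -
    let ?m = "real (Suc n)"
    have gi: "integrable lborel (\<lambda>\<xi>::real^'n. gaussian (\<xi> /\<^sub>R ?m))"
      using integrable_affine[OF integrable_gaussian, of "inverse ?m" "0::real^'n"] by simp
    have "J n = (\<integral>\<xi>. (\<integral>y. cis ((x - y) \<bullet> \<xi>) * complex_of_real (gaussian (\<xi> /\<^sub>R ?m)) * f y \<partial>lborel) \<partial>lborel)"
    proof -
      have "cis ((x - y) \<bullet> \<xi>) = cis (x \<bullet> \<xi>) * cis (- (y \<bullet> \<xi>))" for y \<xi>
        by (simp add: cis_mult inner_diff_left)
      then have "cis ((x - y) \<bullet> \<xi>) * complex_of_real (gaussian (\<xi> /\<^sub>R ?m)) * f y
        = (cis (x \<bullet> \<xi>) * complex_of_real (gaussian (\<xi> /\<^sub>R ?m))) * (cis (- (y \<bullet> \<xi>)) * f y)" for y \<xi>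
        by (simp only: mult_ac)
      then show ?thesis unfolding J_def fourier_def by (simp only: integral_mult_right_zero)
    qed
    also have "\<dots> = (\<integral>y. (\<integral>\<xi>. cis ((x - y) \<bullet> \<xi>) * complex_of_real (gaussian (\<xi> /\<^sub>R ?m)) * f y \<partial>lborel) \<partial>lborel)"
      by (rule lborel_pair.Fubini_integral[symmetric], rule integrable_product_bound[OF _ gi integrable_norm[OF fint(1)]])
         (auto simp: norm_mult gaussian_pos less_imp_le)
    also have "\<dots> = (\<integral>y. complex_of_real (?m ^ CARD('n) * (?c * gaussian (?m *\<^sub>R (x - y)))) * f y \<partial>lborel)"
    proof -
      have "(\<integral>\<xi>. cis ((x - y) \<bullet> \<xi>) * complex_of_real (gaussian (\<xi> /\<^sub>R ?m)) \<partial>lborel)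
        = complex_of_real (?m ^ CARD('n) * (?c * gaussian (?m *\<^sub>R (x - y))))" for y
        by (subst integral_affine[of _ ?m 0])
           (use fourier_gaussian[of "?m *\<^sub>R (x - y)"] in \<open>simp_all add: inner_commute mult.commute scaleR_conv_of_real[where 'a=complex]\<close>)
      then show ?thesis by simp
    qed
    also have "\<dots> = (\<integral>w. f (x + (1 / ?m) *\<^sub>R w) * complex_of_real (?c * gaussian w) \<partial>lborel)"
      by (subst integral_affine[of _ "1 / ?m" x])
         (use of_nat_neq_0[of n, where 'a=complex] in
           \<open>simp_all add: gaussian_def scaleR_conv_of_real[where 'a=complex] power_one_over field_simps\<close>)
    finally show ?thesis .
  qed
  have "(\<lambda>n. \<integral>w. f (x + (1 / real (Suc n)) *\<^sub>R w) * complex_of_real (?c * gaussian w) \<partial>lborel)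
     \<longlonglongrightarrow> (\<integral>w. f x * complex_of_real (?c * gaussian (w::real^'n)) \<partial>lborel)"
  proof (rule integral_dominated_convergence[where w="\<lambda>w. B * (?c * gaussian w)"])
    show "integrable lborel (\<lambda>w::real^'n. B * (?c * gaussian w))"
      by (intro integrable_mult_right integrable_gaussian)
    have "(\<lambda>n. f (x + (1 / real (Suc n)) *\<^sub>R w)) \<longlonglongrightarrow> f x" for w
    proof -
      have "(\<lambda>n. x + (1 / real (Suc n)) *\<^sub>R w) \<longlonglongrightarrow> x + 0 *\<^sub>R w"
        by (intro tendsto_intros lim_1_over_n[THEN LIMSEQ_Suc])
      then show ?thesis
        using schwartz_continuous[OF f] by (intro continuous_on_tendsto_compose[of UNIV f]) auto
    qed
    then show "AE w in lborel. (\<lambda>n. f (x + (1 / real (Suc n)) *\<^sub>R w) * complex_of_real (?c * gaussian w)) \<longlonglongrightarrow> f x * complex_of_real (?c * gaussian w)"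
      by (intro AE_I2 tendsto_intros)
    show "AE w in lborel. norm (f (x + (1 / real (Suc n)) *\<^sub>R w) * complex_of_real (?c * gaussian w)) \<le> B * (?c * gaussian w)" for n
      using B by (intro AE_I2) (auto simp: norm_mult abs_mult norm_power abs_of_pos[OF gaussian_pos] less_imp_le[OF gaussian_pos]
          intro!: mult_right_mono mult_nonneg_nonneg)
  qed auto
  then have "J \<longlonglongrightarrow> (\<integral>w. f x * complex_of_real (?c * gaussian (w::real^'n)) \<partial>lborel)"
    unfolding Jn[symmetric] .
  with J1 have "(\<integral>\<xi>. cis (x \<bullet> \<xi>) * fourier f \<xi> \<partial>lborel) = (\<integral>w. f x * complex_of_real (?c * gaussian (w::real^'n)) \<partial>lborel)"
    by (rule LIMSEQ_unique)
  also have "\<dots> = f x * complex_of_real (?c * ?c)"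
    by (simp only: integral_mult_right_zero integral_complex_of_real of_real_mult integral_gaussian[where 'a="real^'n"] DIM_cart)
       simp
  also have "?c * ?c = (2 * pi) ^ CARD('n)"
    using power_mult_distrib[of "sqrt (2 * pi)" "sqrt (2 * pi)" "CARD('n)"] by simp
  finally show ?thesis by simp
qed

lemma inv_fourier_eq: "inv_fourier g x = complex_of_real (1 / (2 * pi) ^ CARD('n)) * fourier g (- x :: real^'n::finite)"
  by (simp add: inv_fourier_def fourier_def inner_commute)

theorem inv_fourier_fourier: "f \<in> schwartz \<Longrightarrow> inv_fourier (fourier f) = f"
  by (rule ext) (simp add: inv_fourier_def fourier_inversion_pointwise)

lemma inv_fourier_schwartz:
  fixes g :: "real^'n::finite \<Rightarrow> complex"
  assumes "g \<in> schwartz" shows "inv_fourier g \<in> schwartz"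
  unfolding inv_fourier_eq[abs_def]
  using schwartz_cmult(1)[OF schwartz_dilate[OF fourier_schwartz[OF assms], of "-1"]] by (simp del: of_real_divide)

theorem fourier_inv_fourier:
  fixes f :: "real^'n::finite \<Rightarrow> complex"
  assumes f: "f \<in> schwartz" shows "fourier (inv_fourier f) = f"
proof
  fix \<xi> :: "real^'n"
  have [measurable]: "fourier f \<in> borel_measurable borel" by (rule schwartz_measurable[OF fourier_schwartz[OF f]])
  have "fourier (inv_fourier f) \<xi> = complex_of_real (1 / (2 * pi) ^ CARD('n)) * (\<integral>x. cis (- (x \<bullet> \<xi>)) * fourier f (- x) \<partial>lborel)"
    unfolding inv_fourier_eq[abs_def] fourier_def[of "\<lambda>x. _ * fourier f (- x)"]
    by (simp only: mult.left_commute[of "cis _"] integral_mult_right_zero)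
  also have "(\<integral>x. cis (- (x \<bullet> \<xi>)) * fourier f (- x) \<partial>lborel) = (\<integral>x. cis (\<xi> \<bullet> x) * fourier f x \<partial>lborel)"
    by (subst integral_affine[of _ "-1" 0]) (simp_all add: inner_commute)
  finally show "fourier (inv_fourier f) \<xi> = f \<xi>" by (simp add: fourier_inversion_pointwise[OF f])
qed

section \<open>Lebesgue norms and the Schur test\<close>

lemma enn_powr_ennreal: "0 \<le> x \<Longrightarrow> enn_powr (ennreal x) a = ennreal (x powr a)"
  by (simp add: enn_powr_def)

lemma enn_powr_top [simp]: "enn_powr \<top> a = \<top>"
  by (simp add: enn_powr_def)

lemma enn_powr_0 [simp]: "enn_powr 0 a = 0"
  by (simp add: enn_powr_def)

lemma enn_powr_mono: "x \<le> y \<Longrightarrow> 0 \<le> a \<Longrightarrow> enn_powr x a \<le> enn_powr y a"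
  by (cases x; cases y) (auto simp: enn_powr_ennreal intro!: ennreal_leI powr_mono2 simp: top_unique)

lemma enn_powr_one [simp]: "enn_powr x 1 = x"
  by (cases x) (auto simp: enn_powr_ennreal)

lemma enn_powr_enn_powr: "enn_powr (enn_powr x a) b = enn_powr x (a * b)"
  by (cases x) (auto simp: enn_powr_ennreal powr_powr)

lemma enn_powr_mult: "0 < a \<Longrightarrow> enn_powr (x * y) a = enn_powr x a * enn_powr y a"
  by (cases x; cases y)
     (auto simp: enn_powr_ennreal powr_mult ennreal_mult[symmetric] ennreal_top_mult ennreal_mult_top)

lemma enn_powr_eq_top [simp]: "enn_powr x a = \<top> \<longleftrightarrow> x = \<top>"
  by (cases x) (auto simp: enn_powr_ennreal)

lemma enn_powr_measurable [measurable (raw)]: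
  "f \<in> borel_measurable M \<Longrightarrow> (\<lambda>x. enn_powr (f x) a) \<in> borel_measurable M"
proof (rule measurable_compose[of f M borel "\<lambda>x. enn_powr x a"])
  have "{x \<in> space borel. x = (\<infinity>::ennreal)} \<in> sets borel" by simp
  then show "(\<lambda>x. enn_powr x a) \<in> borel_measurable borel"
    unfolding enn_powr_def by (intro measurable_If) auto
qed

lemma enn2real_ge_1: "1 \<le> p \<Longrightarrow> p \<noteq> \<infinity> \<Longrightarrow> 1 \<le> enn2real p"
  by (cases p) auto

lemma Lnorm_finite: "p \<noteq> \<infinity> \<Longrightarrow> Lnorm M p f = enn_powr (\<integral>\<^sup>+x. enn_powr (f x) (enn2real p) \<partial>M) (1 / enn2real p)"
  by (simp add: Lnorm_def)

lemma Lnorm_finite_leI: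
  assumes "p \<noteq> \<infinity>" "1 \<le> p" "(\<integral>\<^sup>+x. enn_powr (f x) (enn2real p) \<partial>M) \<le> enn_powr C (enn2real p)"
  shows "Lnorm M p f \<le> C"
proof -
  have "1 \<le> enn2real p" by (rule enn2real_ge_1) fact+
  then show ?thesis using enn_powr_mono[OF assms(3), of "1 / enn2real p"]
    by (simp add: Lnorm_finite[OF assms(1)] enn_powr_enn_powr)
qed

lemma Lnorm_finite_eq:
  assumes "p \<noteq> \<infinity>" "1 \<le> p"
  shows "enn_powr (Lnorm M p f) (enn2real p) = (\<integral>\<^sup>+x. enn_powr (f x) (enn2real p) \<partial>M)"
  using enn2real_ge_1[OF assms(2,1)]
  by (simp add: Lnorm_finite[OF assms(1)] enn_powr_enn_powr)

text \<open>Measurability of the smaller function is essential at \<open>p = \<infinity>\<close>, because the essential supremum of a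
function that is not measurable is \<open>\<top>\<close>.\<close>

lemma Lnorm_mono:
  assumes "1 \<le> p" "f \<in> borel_measurable M" "\<And>x. x \<in> space M \<Longrightarrow> f x \<le> g x"
  shows "Lnorm M p f \<le> Lnorm M p g"
proof (cases "p = \<infinity>")
  case True
  then show ?thesis using assms by (auto simp: Lnorm_def intro!: esssup_AE_mono)
next
  case False
  then show ?thesis using assms enn2real_ge_1[OF assms(1) False]
    by (auto simp: Lnorm_finite intro!: enn_powr_mono nn_integral_mono)
qed

text \<open>The integral of a nonnegative function is a supremum over simple functions below it, hence monotone
for arbitrary functions.\<close>

lemma Lnorm_mono_finite:
  assumes "1 \<le> p" "p \<noteq> \<infinity>" "\<And>x. x \<in> space M \<Longrightarrow> f x \<le> g x"
  shows "Lnorm M p f \<le> Lnorm M p g"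
  using assms enn2real_ge_1[OF assms(1,2)]
  by (auto simp: Lnorm_finite intro!: enn_powr_mono nn_integral_mono)

text \<open>The graph of the convex function \<open>x\<^sup>p\<close> lies above its tangent at \<open>m\<close>.\<close>

lemma Young_ennreal:
  assumes p: "1 \<le> p" and m: "0 \<le> m"
  shows "ennreal (p * m powr (p - 1)) * x \<le> enn_powr x p + ennreal ((p - 1) * m powr p)"
proof (cases x)
  case (real y)
  have "p * m powr (p - 1) * y \<le> y powr p + (p - 1) * m powr p"
  proof (cases "p = 1")
    case True then show ?thesis using real by auto
  next
    case False
    then have p: "p > 1" using p by simp
    define q where "q = p / (p - 1)"
    have q: "q > 1" "1 / p + 1 / q = 1" "(p - 1) * q = p"
      using p by (auto simp: q_def field_simps)
    have "y * m powr (p - 1) \<le> y powr p / p + (m powr (p - 1)) powr q / q"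
      by (rule Youngs_inequality) (use p q real in auto)
    also have "(m powr (p - 1)) powr q = m powr p" using q by (simp add: powr_powr)
    also have "m powr p / q = (p - 1) * m powr p / p" using p by (simp add: q_def)
    finally have "p * (y * m powr (p - 1)) \<le> p * (y powr p / p + (p - 1) * m powr p / p)"
      using p by (intro mult_left_mono) auto
    also have "\<dots> = y powr p + (p - 1) * m powr p" using p by (simp add: field_simps)
    finally show ?thesis by (simp add: mult_ac)
  qed
  then show ?thesis using real p m
    by (simp add: enn_powr_ennreal ennreal_mult[symmetric] ennreal_plus[symmetric] ennreal_leI del: ennreal_plus)
qed simp

text \<open>Jensen's inequality, obtained by integrating the tangent inequality against the weight.\<close>

lemma weighted_power_mean:
  assumes p: "1 \<le> p" and S: "0 < S" and [measurable]: "w \<in> borel_measurable M" "g \<in> borel_measurable M"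
    and w: "(\<integral>\<^sup>+x. w x \<partial>M) \<le> ennreal S"
  shows "enn_powr (\<integral>\<^sup>+x. w x * g x \<partial>M) p \<le> ennreal (S powr (p - 1)) * (\<integral>\<^sup>+x. w x * enn_powr (g x) p \<partial>M)"
proof (cases "(\<integral>\<^sup>+x. w x * enn_powr (g x) p \<partial>M)")
  case top
  then show ?thesis using S by (simp add: ennreal_mult_top)
next
  case (real I)
  have *: "ennreal (p * m powr (p - 1)) * (\<integral>\<^sup>+x. w x * g x \<partial>M) \<le> ennreal (I + (p - 1) * m powr p * S)"
    if m: "0 \<le> m" for m
  proof -
    have "ennreal (p * m powr (p - 1)) * (\<integral>\<^sup>+x. w x * g x \<partial>M) = (\<integral>\<^sup>+x. w x * (ennreal (p * m powr (p - 1)) * g x) \<partial>M)"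
      by (subst nn_integral_cmult[symmetric]) (auto simp: mult_ac)
    also have "\<dots> \<le> (\<integral>\<^sup>+x. w x * (enn_powr (g x) p + ennreal ((p - 1) * m powr p)) \<partial>M)"
      by (intro nn_integral_mono mult_left_mono Young_ennreal p m) auto
    also have "\<dots> = (\<integral>\<^sup>+x. w x * enn_powr (g x) p \<partial>M) + ennreal ((p - 1) * m powr p) * (\<integral>\<^sup>+x. w x \<partial>M)"
      by (simp add: distrib_left nn_integral_add nn_integral_multc mult.commute[of "ennreal _"])
    also have "\<dots> \<le> ennreal I + ennreal ((p - 1) * m powr p) * ennreal S"
      using real w by (intro add_mono mult_left_mono) auto
    also have "\<dots> = ennreal (I + (p - 1) * m powr p * S)"
      using p real S by (simp add: ennreal_mult)
    finally show ?thesis .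
  qed
  have "(\<integral>\<^sup>+x. w x * g x \<partial>M) \<noteq> \<top>"
    using *[of 1] p by (auto simp: ennreal_mult_top top_unique)
  then obtain A where A: "A \<ge> 0" "(\<integral>\<^sup>+x. w x * g x \<partial>M) = ennreal A" by (cases "(\<integral>\<^sup>+x. w x * g x \<partial>M)") auto
  have "A powr p \<le> S powr (p - 1) * I"
  proof (cases "A = 0")
    case True then show ?thesis using real by simp
  next
    case False
    \<comment> \<open>the tangent point is the mean of \<open>g\<close>\<close>
    define m where "m = A / S"
    have m: "m > 0" using False A S by (simp add: m_def)
    have mA: "A = m * S" using S by (simp add: m_def)
    have e: "m powr (p - 1) * m = m powr p" using m by (metis add.commute diff_add_cancel powr_add powr_one order_less_imp_le)
    have "p * m powr (p - 1) * A \<le> I + (p - 1) * m powr p * S"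
      using *[of m] m A p real S by (simp add: ennreal_mult[symmetric] del: ennreal_plus)
    moreover have "p * m powr (p - 1) * A = p * (m powr p * S)" unfolding e[symmetric] mA by (simp only: mult_ac)
    ultimately have "p * (m powr p * S) \<le> I + (p - 1) * (m powr p * S)" by (simp only: mult.assoc)
    then have "m powr p * S \<le> I" unfolding left_diff_distrib by linarith
    then have "S powr (p - 1) * (m powr p * S) \<le> S powr (p - 1) * I" by (intro mult_left_mono) auto
    moreover have "S powr (p - 1) * S = S powr p" using S by (metis add.commute diff_add_cancel powr_add powr_one order_less_imp_le)
    then have "S powr (p - 1) * (m powr p * S) = m powr p * S powr p" by (metis mult.assoc mult.commute)
    then have "S powr (p - 1) * (m powr p * S) = A powr p"
      unfolding mA using m S by (simp only: powr_mult less_imp_le)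
    ultimately show ?thesis by simp
  qed
  then show ?thesis using A real S by (simp add: enn_powr_ennreal ennreal_mult[symmetric] ennreal_leI)
qed

text \<open>For finite \<open>p\<close>, the power mean inequality with weight \<open>k x\<close> uses the bound for the integral in \<open>y\<close>, and after
an exchange of the integrals the other bound applies.\<close>

lemma Schur_test:
  assumes "sigma_finite_measure M1" "sigma_finite_measure M2" and p: "1 \<le> p" and S: "0 < S"
    and [measurable]: "case_prod k \<in> borel_measurable (M1 \<Otimes>\<^sub>M M2)" "g \<in> borel_measurable M2"
    and k1: "\<And>x. x \<in> space M1 \<Longrightarrow> (\<integral>\<^sup>+y. k x y \<partial>M2) \<le> ennreal S"
    and k2: "\<And>y. y \<in> space M2 \<Longrightarrow> (\<integral>\<^sup>+x. k x y \<partial>M1) \<le> ennreal S"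
  shows "Lnorm M1 p (\<lambda>x. \<integral>\<^sup>+y. k x y * g y \<partial>M2) \<le> ennreal S * Lnorm M2 p g"
proof -
  interpret M1: sigma_finite_measure M1 by fact
  interpret M2: sigma_finite_measure M2 by fact
  interpret P: pair_sigma_finite M1 M2 ..
  show ?thesis
  proof (cases "p = \<infinity>")
    case True
    have "(\<integral>\<^sup>+y. k x y * g y \<partial>M2) \<le> ennreal S * esssup M2 g" if x: "x \<in> space M1" for x
    proof -
      have [measurable]: "k x \<in> borel_measurable M2" using measurable_Pair2[OF assms(5) x] by simp
      have "(\<integral>\<^sup>+y. k x y * g y \<partial>M2) \<le> (\<integral>\<^sup>+y. k x y * esssup M2 g \<partial>M2)"
        using esssup_AE[of g M2] by (intro nn_integral_mono_AE) (auto intro!: mult_left_mono elim!: eventually_mono)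
      also have "\<dots> = (\<integral>\<^sup>+y. k x y \<partial>M2) * esssup M2 g" by (rule nn_integral_multc) measurable
      also have "\<dots> \<le> ennreal S * esssup M2 g" by (intro mult_right_mono k1 x) auto
      finally show ?thesis .
    qed
    then show ?thesis using True by (auto simp: Lnorm_def intro!: esssup_I)
  next
    case False
    let ?p = "enn2real p"
    have p1: "1 \<le> ?p" by (rule enn2real_ge_1[OF p False])
    have 1: "(\<integral>\<^sup>+x. enn_powr (\<integral>\<^sup>+y. k x y * g y \<partial>M2) ?p \<partial>M1)
       \<le> (\<integral>\<^sup>+x. ennreal (S powr (?p - 1)) * (\<integral>\<^sup>+y. k x y * enn_powr (g y) ?p \<partial>M2) \<partial>M1)"
    proof (rule nn_integral_mono)
      fix x assume x: "x \<in> space M1"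
      have [measurable]: "k x \<in> borel_measurable M2" using measurable_Pair2[OF assms(5) x] by simp
      show "enn_powr (\<integral>\<^sup>+y. k x y * g y \<partial>M2) ?p \<le> ennreal (S powr (?p - 1)) * (\<integral>\<^sup>+y. k x y * enn_powr (g y) ?p \<partial>M2)"
        by (rule weighted_power_mean[OF p1 S _ _ k1[OF x]]) auto
    qed
    have 2: "(\<integral>\<^sup>+x. ennreal (S powr (?p - 1)) * (\<integral>\<^sup>+y. k x y * enn_powr (g y) ?p \<partial>M2) \<partial>M1)
        = ennreal (S powr (?p - 1)) * (\<integral>\<^sup>+x. (\<integral>\<^sup>+y. k x y * enn_powr (g y) ?p \<partial>M2) \<partial>M1)"
      by (rule nn_integral_cmult) measurable
    have "(\<integral>\<^sup>+x. (\<integral>\<^sup>+y. k x y * enn_powr (g y) ?p \<partial>M2) \<partial>M1) = (\<integral>\<^sup>+y. (\<integral>\<^sup>+x. k x y * enn_powr (g y) ?p \<partial>M1) \<partial>M2)"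
      by (rule P.Fubini'[symmetric]) measurable
    also have "\<dots> = (\<integral>\<^sup>+y. (\<integral>\<^sup>+x. k x y \<partial>M1) * enn_powr (g y) ?p \<partial>M2)"
    proof (rule nn_integral_cong)
      fix y assume y: "y \<in> space M2"
      have [measurable]: "(\<lambda>x. k x y) \<in> borel_measurable M1" using measurable_Pair1[OF assms(5) y] by simp
      show "(\<integral>\<^sup>+x. k x y * enn_powr (g y) ?p \<partial>M1) = (\<integral>\<^sup>+x. k x y \<partial>M1) * enn_powr (g y) ?p"
        by (rule nn_integral_multc) measurable
    qed
    also have "\<dots> \<le> (\<integral>\<^sup>+y. ennreal S * enn_powr (g y) ?p \<partial>M2)"
      by (intro nn_integral_mono mult_right_mono k2) auto
    also have "\<dots> = ennreal S * (\<integral>\<^sup>+y. enn_powr (g y) ?p \<partial>M2)"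
      by (rule nn_integral_cmult) measurable
    finally have 3: "(\<integral>\<^sup>+x. (\<integral>\<^sup>+y. k x y * enn_powr (g y) ?p \<partial>M2) \<partial>M1) \<le> ennreal S * (\<integral>\<^sup>+y. enn_powr (g y) ?p \<partial>M2)" .
    have 4: "ennreal (S powr (?p - 1)) * (ennreal S * (\<integral>\<^sup>+y. enn_powr (g y) ?p \<partial>M2)) = enn_powr (ennreal S * Lnorm M2 p g) ?p"
    proof -
      have "S powr (?p - 1) * S = S powr ?p" using S by (metis add.commute diff_add_cancel powr_add powr_one order_less_imp_le)
      then have "ennreal (S powr (?p - 1)) * ennreal S = enn_powr (ennreal S) ?p"
        using S by (simp add: enn_powr_ennreal ennreal_mult[symmetric])
      then show ?thesis
        using p1 Lnorm_finite_eq[OF False p, of M2 g] by (simp add: enn_powr_mult mult.assoc[symmetric])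
    qed
    show ?thesis
      by (rule Lnorm_finite_leI[OF False p], rule order_trans[OF 1[unfolded 2] order_trans[OF mult_left_mono[OF 3] eq_refl[OF 4]]]) simp
  qed
qed

text \<open>Minkowski's inequality for series, from the power mean inequality with weights \<open>w l\<close> applied to
\<open>f l / w l\<close>, whose norm is at most \<open>1\<close>.\<close>

lemma Lnorm_sum_le:
  fixes f :: "'i::countable \<Rightarrow> 'a \<Rightarrow> ennreal"
  assumes p: "1 \<le> p" and [measurable]: "\<And>l. f l \<in> borel_measurable M"
    and w: "\<And>l. 0 < w l" and fw: "\<And>l. Lnorm M p (f l) \<le> ennreal (w l)"
    and S: "0 < S" "(\<integral>\<^sup>+l. ennreal (w l) \<partial>count_space UNIV) \<le> ennreal S"
  shows "Lnorm M p (\<lambda>x. \<integral>\<^sup>+l. f l x \<partial>count_space UNIV) \<le> ennreal S"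
proof -
  have meas: "(\<lambda>x. \<integral>\<^sup>+l. h l x \<partial>count_space UNIV) \<in> borel_measurable M"
    if [measurable]: "\<And>l. h l \<in> borel_measurable M" for h :: "'i \<Rightarrow> 'a \<Rightarrow> ennreal"
  proof -
    interpret sigma_finite_measure "count_space (UNIV :: 'i set)" by (rule sigma_finite_measure_count_space)
    have "(\<lambda>(l, x). h l x) \<in> borel_measurable (count_space UNIV \<Otimes>\<^sub>M M)"
      by (rule measurable_pair_measure_countable1) auto
    from measurable_compose[OF measurable_pair_swap' this]
    show ?thesis by (intro borel_measurable_nn_integral) (simp add: split_beta')
  qed
  show ?thesis
  proof (cases "p = \<infinity>")
    case True
    have "AE x in M. f l x \<le> ennreal (w l)" for l
      using esssup_AE[of "f l" M] fw[of l] True by (auto simp: Lnorm_def intro: order_trans)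
    then have "AE x in M. \<forall>l. f l x \<le> ennreal (w l)" by (simp add: AE_all_countable)
    then have "AE x in M. (\<integral>\<^sup>+l. f l x \<partial>count_space UNIV) \<le> ennreal S"
      by (rule AE_mp) (auto intro!: AE_I2 order_trans[OF nn_integral_mono S(2)])
    then show ?thesis using True meas by (auto simp: Lnorm_def intro!: esssup_I)
  next
    case False
    let ?p = "enn2real p"
    have p1: "1 \<le> ?p" by (rule enn2real_ge_1[OF p False])
    define g where "g l x = ennreal (1 / w l) * f l x" for l x
    have [measurable]: "g l \<in> borel_measurable M" for l unfolding g_def by measurable
    have fg: "f l x = ennreal (w l) * g l x" for l x
      unfolding g_def mult.assoc[symmetric] using w[of l] by (simp add: ennreal_mult[symmetric])
    have gl: "(\<integral>\<^sup>+x. enn_powr (g l x) ?p \<partial>M) \<le> 1" for l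
    proof -
      have "(\<integral>\<^sup>+x. enn_powr (g l x) ?p \<partial>M) = enn_powr (ennreal (1 / w l)) ?p * (\<integral>\<^sup>+x. enn_powr (f l x) ?p \<partial>M)"
        unfolding g_def using p1 by (simp add: enn_powr_mult nn_integral_cmult)
      also have "\<dots> = enn_powr (ennreal (1 / w l) * Lnorm M p (f l)) ?p"
        using p1 by (simp add: Lnorm_finite_eq[OF False p, symmetric] enn_powr_mult)
      also have "\<dots> \<le> enn_powr (ennreal (1 / w l) * ennreal (w l)) ?p"
        using p1 by (intro enn_powr_mono mult_left_mono fw) auto
      also have "ennreal (1 / w l) * ennreal (w l) = 1" using w[of l] by (simp add: ennreal_mult[symmetric])
      also have "enn_powr 1 ?p = 1" using enn_powr_ennreal[of 1 ?p] by simp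
      finally show ?thesis .
    qed
    have 1: "(\<integral>\<^sup>+x. enn_powr (\<integral>\<^sup>+l. f l x \<partial>count_space UNIV) ?p \<partial>M)
       \<le> (\<integral>\<^sup>+x. ennreal (S powr (?p - 1)) * (\<integral>\<^sup>+l. ennreal (w l) * enn_powr (g l x) ?p \<partial>count_space UNIV) \<partial>M)"
      unfolding fg by (intro nn_integral_mono weighted_power_mean p1 S) auto
    have 2: "(\<integral>\<^sup>+x. ennreal (S powr (?p - 1)) * (\<integral>\<^sup>+l. ennreal (w l) * enn_powr (g l x) ?p \<partial>count_space UNIV) \<partial>M)
       = ennreal (S powr (?p - 1)) * (\<integral>\<^sup>+x. (\<integral>\<^sup>+l. ennreal (w l) * enn_powr (g l x) ?p \<partial>count_space UNIV) \<partial>M)"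
      by (intro nn_integral_cmult meas) measurable
    have "(\<integral>\<^sup>+x. (\<integral>\<^sup>+l. ennreal (w l) * enn_powr (g l x) ?p \<partial>count_space UNIV) \<partial>M)
       = (\<integral>\<^sup>+l. (\<integral>\<^sup>+x. ennreal (w l) * enn_powr (g l x) ?p \<partial>M) \<partial>count_space UNIV)"
      by (rule nn_integral_count_space_nn_integral) auto
    also have "\<dots> = (\<integral>\<^sup>+l. ennreal (w l) * (\<integral>\<^sup>+x. enn_powr (g l x) ?p \<partial>M) \<partial>count_space UNIV)"
      by (intro nn_integral_cong nn_integral_cmult) measurable
    also have "\<dots> \<le> (\<integral>\<^sup>+l. ennreal (w l) * 1 \<partial>count_space UNIV)"
      by (intro nn_integral_mono mult_left_mono gl) auto
    also have "\<dots> \<le> ennreal S" using S by simp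
    finally have 3: "(\<integral>\<^sup>+x. (\<integral>\<^sup>+l. ennreal (w l) * enn_powr (g l x) ?p \<partial>count_space UNIV) \<partial>M) \<le> ennreal S" .
    have "(\<integral>\<^sup>+x. enn_powr (\<integral>\<^sup>+l. f l x \<partial>count_space UNIV) ?p \<partial>M) \<le> ennreal (S powr (?p - 1)) * ennreal S"
      by (rule order_trans[OF 1[unfolded 2] mult_left_mono[OF 3]]) simp
    also have "\<dots> = enn_powr (ennreal S) ?p"
    proof -
      have "S powr (?p - 1) * S = S powr ?p" using S by (metis add.commute diff_add_cancel powr_add powr_one order_less_imp_le)
      then show ?thesis using S by (simp add: enn_powr_ennreal ennreal_mult[symmetric])
    qed
    finally show ?thesis by (intro Lnorm_finite_leI[OF False p])
  qed
qed

lemma Lnorm_unit: "1 \<le> p \<Longrightarrow> Lnorm (count_space (UNIV :: unit set)) p g = g ()"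
proof (cases "p = \<infinity>")
  case True
  have g: "g = (\<lambda>_. g ())" by auto
  show ?thesis unfolding True Lnorm_def by (subst g, subst esssup_const) auto
next
  case False
  then show "1 \<le> p \<Longrightarrow> ?thesis" using enn2real_ge_1[of p]
    by (simp add: Lnorm_finite nn_integral_count_space_finite enn_powr_enn_powr UNIV_unit)
qed

text \<open>Integration against \<open>w\<close> is an integral operator into functions on a space of one point, so this is a
case of \<open>Schur_test\<close>.\<close>

lemma Lnorm_pairing_le:
  assumes "sigma_finite_measure M" "1 \<le> p" "0 < S"
    and [measurable]: "w \<in> borel_measurable M" "g \<in> borel_measurable M"
    and "(\<integral>\<^sup>+x. w x \<partial>M) \<le> ennreal S" "\<And>x. w x \<le> ennreal S"
  shows "(\<integral>\<^sup>+x. w x * g x \<partial>M) \<le> ennreal S * Lnorm M p g"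
proof -
  have "Lnorm (count_space (UNIV :: unit set)) p (\<lambda>_. \<integral>\<^sup>+x. w x * g x \<partial>M) \<le> ennreal S * Lnorm M p g"
    by (rule Schur_test)
       (use assms in \<open>auto simp: nn_integral_count_space_finite UNIV_unit intro: sigma_finite_measure_count_space\<close>)
  then show ?thesis using assms(2) by (simp add: Lnorm_unit)
qed

section \<open>Kernels of Fourier multipliers\<close>

text \<open>The convolution kernel of \<open>\<psi> \<mapsto> fourier (m * inv_fourier \<psi>)\<close>, which is the transpose of the operator
\<open>m(D)\<close>, acting on test functions.\<close>

definition conv_kernel :: "(real^'n::finite \<Rightarrow> complex) \<Rightarrow> real^'n \<Rightarrow> complex" where
  "conv_kernel m x = complex_of_real (1 / (2 * pi) ^ CARD('n)) * fourier m x"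

text \<open>By Young's inequality this number bounds \<open>m(D)\<close> on \<open>L\<^sup>p\<close> for every \<open>p\<close>.\<close>

definition kernel_norm :: "(real^'n::finite \<Rightarrow> complex) \<Rightarrow> real" where
  "kernel_norm m = (\<integral>x. norm (conv_kernel m x) \<partial>lborel)"

lemma conv_kernel_schwartz: "m \<in> schwartz \<Longrightarrow> conv_kernel m \<in> schwartz"
  unfolding conv_kernel_def[abs_def] by (intro schwartz_cmult fourier_schwartz)

lemma conv_kernel_measurable: "m \<in> schwartz \<Longrightarrow> conv_kernel m \<in> borel_measurable borel"
  by (intro schwartz_measurable conv_kernel_schwartz)

lemma kernel_norm_nonneg: "0 \<le> kernel_norm m"
  unfolding kernel_norm_def by (intro integral_nonneg_AE) auto

lemma nn_integral_kernel:
  assumes "m \<in> schwartz"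
  shows "(\<integral>\<^sup>+x. ennreal (norm (conv_kernel m x)) \<partial>lborel) = ennreal (kernel_norm m)"
  unfolding kernel_norm_def
  by (intro nn_integral_eq_integral integrable_norm schwartz_integrable conv_kernel_schwartz assms) auto

lemma norm_integral_le_nn_integral:
  fixes f :: "'a \<Rightarrow> 'b::{banach, second_countable_topology}"
  shows "ennreal (norm (integral\<^sup>L M f)) \<le> (\<integral>\<^sup>+x. ennreal (norm (f x)) \<partial>M)"
  by (cases "integrable M f") (simp_all add: integral_norm_bound_ennreal not_integrable_integral_eq)

lemma nn_integral_translate:
  fixes f :: "'a::euclidean_space \<Rightarrow> ennreal"
  assumes [measurable]: "f \<in> borel_measurable borel"
  shows "(\<integral>\<^sup>+x. f (x - y) \<partial>lborel) = (\<integral>\<^sup>+x. f x \<partial>lborel)" "(\<integral>\<^sup>+y. f (x - y) \<partial>lborel) = (\<integral>\<^sup>+x. f x \<partial>lborel)"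
  using nn_integral_affine[OF assms, of 1 "-y"] nn_integral_affine[OF assms, of "-1" x] by auto

lemma fourier_mult_inv_fourier:
  fixes m :: "real^'n::finite \<Rightarrow> complex"
  assumes m: "m \<in> schwartz" and \<psi>: "\<psi> \<in> schwartz"
  shows "fourier (\<lambda>\<xi>. m \<xi> * inv_fourier \<psi> \<xi>) x = (\<integral>y. conv_kernel m (x - y) * \<psi> y \<partial>lborel)"
proof -
  let ?c = "complex_of_real (1 / (2 * pi) ^ CARD('n))"
  note [measurable] = schwartz_measurable[OF m] schwartz_measurable[OF \<psi>]
  have e: "cis (- (x \<bullet> \<xi>)) * cis (y \<bullet> \<xi>) = cis (- (\<xi> \<bullet> (x - y)))" for \<xi> y
    by (simp add: cis_mult inner_diff_right inner_commute)
  have "fourier (\<lambda>\<xi>. m \<xi> * inv_fourier \<psi> \<xi>) x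
      = (\<integral>\<xi>. ?c * (\<integral>y. cis (- (\<xi> \<bullet> (x - y))) * m \<xi> * \<psi> y \<partial>lborel) \<partial>lborel)"
  proof -
    have "cis (- (\<xi> \<bullet> x)) * (m \<xi> * (?c * (\<integral>y. cis (\<xi> \<bullet> y) * \<psi> y \<partial>lborel)))
      = ?c * (\<integral>y. cis (- (\<xi> \<bullet> (x - y))) * m \<xi> * \<psi> y \<partial>lborel)" for \<xi>
    proof -
      have "cis (- (\<xi> \<bullet> (x - y))) * m \<xi> * \<psi> y = (cis (- (x \<bullet> \<xi>)) * m \<xi>) * (cis (\<xi> \<bullet> y) * \<psi> y)" for y
        unfolding e[symmetric] by (simp add: inner_commute mult_ac)
      then have "(\<integral>y. cis (- (\<xi> \<bullet> (x - y))) * m \<xi> * \<psi> y \<partial>lborel) = (cis (- (x \<bullet> \<xi>)) * m \<xi>) * (\<integral>y. cis (\<xi> \<bullet> y) * \<psi> y \<partial>lborel)"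
        by (simp only: integral_mult_right_zero)
      then show ?thesis by (simp only: inner_commute mult_ac)
    qed
    then show ?thesis unfolding fourier_def inv_fourier_def by (simp only: inner_commute)
  qed
  also have "\<dots> = ?c * (\<integral>\<xi>. (\<integral>y. cis (- (\<xi> \<bullet> (x - y))) * m \<xi> * \<psi> y \<partial>lborel) \<partial>lborel)"
    by (simp only: integral_mult_right_zero)
  also have "(\<integral>\<xi>. (\<integral>y. cis (- (\<xi> \<bullet> (x - y))) * m \<xi> * \<psi> y \<partial>lborel) \<partial>lborel)
     = (\<integral>y. (\<integral>\<xi>. cis (- (\<xi> \<bullet> (x - y))) * m \<xi> * \<psi> y \<partial>lborel) \<partial>lborel)"
    by (rule lborel_pair.Fubini_integral[symmetric],
        rule integrable_product_bound[OF _ integrable_norm[OF schwartz_integrable[OF m]] integrable_norm[OF schwartz_integrable[OF \<psi>]]])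
       (auto simp: norm_mult)
  also have "\<dots> = (\<integral>y. fourier m (x - y) * \<psi> y \<partial>lborel)"
    unfolding fourier_def by simp
  also have "?c * \<dots> = (\<integral>y. ?c * (fourier m (x - y) * \<psi> y) \<partial>lborel)"
    by (simp only: integral_mult_right_zero)
  finally show ?thesis by (simp only: conv_kernel_def mult.assoc)
qed

text \<open>A convolution is an integral operator to which \<open>Schur_test\<close> applies, with the integral of the kernel as both bounds.\<close>

lemma Young_convolution:
  fixes k :: "real^'n::finite \<Rightarrow> ennreal"
  assumes "1 \<le> p" "0 < S" and [measurable]: "k \<in> borel_measurable borel" "g \<in> borel_measurable lborel"
    and k: "(\<integral>\<^sup>+x. k x \<partial>lborel) \<le> ennreal S"
  shows "Lnorm lborel p (\<lambda>y. \<integral>\<^sup>+x. k (x - y) * g x \<partial>lborel) \<le> ennreal S * Lnorm lborel p g"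
    "Lnorm lborel p (\<lambda>x. \<integral>\<^sup>+y. k (x - y) * g y \<partial>lborel) \<le> ennreal S * Lnorm lborel p g"
  by (rule Schur_test; use assms in \<open>simp add: nn_integral_translate lborel.sigma_finite_measure_axioms\<close>)+

lemma kernel_mult:
  assumes "m1 \<in> schwartz" "m2 \<in> schwartz"
  shows "conv_kernel (\<lambda>\<xi>. m1 \<xi> * m2 \<xi>) x = (\<integral>y. conv_kernel m1 (x - y) * conv_kernel m2 y \<partial>lborel)"
proof -
  have "fourier (\<lambda>\<xi>. m1 \<xi> * m2 \<xi>) x = (\<integral>y. conv_kernel m1 (x - y) * fourier m2 y \<partial>lborel)"
    using fourier_mult_inv_fourier[OF assms(1) fourier_schwartz[OF assms(2)]]
    by (simp only: inv_fourier_fourier[OF assms(2)])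
  then show ?thesis unfolding conv_kernel_def[of "\<lambda>\<xi>. m1 \<xi> * m2 \<xi>"] conv_kernel_def[of m2]
    by (simp only: mult.left_commute[of "conv_kernel m1 _"] integral_mult_right_zero)
qed

text \<open>The kernel of a product is the convolution of the kernels.\<close>

lemma kernel_norm_mult:
  assumes m: "m1 \<in> schwartz" "m2 \<in> schwartz"
  shows "kernel_norm (\<lambda>\<xi>. m1 \<xi> * m2 \<xi>) \<le> kernel_norm m1 * kernel_norm m2"
proof -
  note [measurable] = conv_kernel_measurable[OF m(1)] conv_kernel_measurable[OF m(2)]
  have "ennreal (kernel_norm (\<lambda>\<xi>. m1 \<xi> * m2 \<xi>)) = (\<integral>\<^sup>+x. ennreal (norm (\<integral>y. conv_kernel m1 (x - y) * conv_kernel m2 y \<partial>lborel)) \<partial>lborel)"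
    by (subst nn_integral_kernel[symmetric]) (simp_all add: schwartz_mult kernel_mult m)
  also have "\<dots> \<le> (\<integral>\<^sup>+x. (\<integral>\<^sup>+y. ennreal (norm (conv_kernel m1 (x - y) * conv_kernel m2 y)) \<partial>lborel) \<partial>lborel)"
    by (intro nn_integral_mono norm_integral_le_nn_integral)
  also have "\<dots> = (\<integral>\<^sup>+x. (\<integral>\<^sup>+y. ennreal (norm (conv_kernel m1 (x - y))) * ennreal (norm (conv_kernel m2 y)) \<partial>lborel) \<partial>lborel)"
    by (simp add: norm_mult ennreal_mult)
  also have "\<dots> = (\<integral>\<^sup>+y. (\<integral>\<^sup>+x. ennreal (norm (conv_kernel m1 (x - y))) * ennreal (norm (conv_kernel m2 y)) \<partial>lborel) \<partial>lborel)"
    by (rule lborel_pair.Fubini') measurable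
  also have "\<dots> = (\<integral>\<^sup>+y. ennreal (kernel_norm m1) * ennreal (norm (conv_kernel m2 y)) \<partial>lborel)"
    by (subst nn_integral_multc) (auto simp: nn_integral_translate(1)[of "\<lambda>x. ennreal (norm (conv_kernel m1 x))"] nn_integral_kernel m)
  also have "\<dots> = ennreal (kernel_norm m1) * ennreal (kernel_norm m2)"
    by (subst nn_integral_cmult) (auto simp: nn_integral_kernel m)
  also have "\<dots> = ennreal (kernel_norm m1 * kernel_norm m2)"
    by (simp add: ennreal_mult kernel_norm_nonneg)
  finally show ?thesis by (subst (asm) ennreal_le_iff) (auto intro!: mult_nonneg_nonneg kernel_norm_nonneg)
qed

lemma kernel_cmult: "conv_kernel (\<lambda>\<xi>. c * m \<xi>) x = c * conv_kernel m x"
proof -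
  have "cis t * (c * m \<xi>) = c * (cis t * m \<xi>)" for t \<xi> by simp
  then show ?thesis unfolding conv_kernel_def fourier_def by (simp only: integral_mult_right_zero mult.left_commute)
qed

lemma kernel_norm_cmult: "kernel_norm (\<lambda>\<xi>. c * m \<xi>) = norm c * kernel_norm m"
  by (simp add: kernel_norm_def kernel_cmult norm_mult)

lemma kernel_add:
  assumes "m1 \<in> schwartz" "m2 \<in> schwartz"
  shows "conv_kernel (\<lambda>\<xi>. m1 \<xi> + m2 \<xi>) x = conv_kernel m1 x + conv_kernel m2 x"
  unfolding conv_kernel_def fourier_def
  using integrable_cis_mult(1)[OF schwartz_integrable[OF assms(1)]] integrable_cis_mult(1)[OF schwartz_integrable[OF assms(2)]]
  by (simp add: distrib_left)

lemma kernel_norm_add: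
  assumes "m1 \<in> schwartz" "m2 \<in> schwartz"
  shows "kernel_norm (\<lambda>\<xi>. m1 \<xi> + m2 \<xi>) \<le> kernel_norm m1 + kernel_norm m2"
proof -
  note int = integrable_norm[OF schwartz_integrable[OF conv_kernel_schwartz[OF assms(1)]]]
    integrable_norm[OF schwartz_integrable[OF conv_kernel_schwartz[OF assms(2)]]]
  have "kernel_norm (\<lambda>\<xi>. m1 \<xi> + m2 \<xi>) \<le> (\<integral>x. norm (conv_kernel m1 x) + norm (conv_kernel m2 x) \<partial>lborel)"
    unfolding kernel_norm_def kernel_add[OF assms]
    by (intro Bochner_Integration.integral_mono integrable_norm Bochner_Integration.integrable_add int
        schwartz_integrable conv_kernel_schwartz assms norm_triangle_ineq)
  then show ?thesis using int by (simp add: kernel_norm_def)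
qed

lemma kernel_dilate:
  fixes m :: "real^'n::finite \<Rightarrow> complex"
  assumes m: "m \<in> schwartz" and a: "a > 0"
  shows "conv_kernel (\<lambda>\<xi>. m (a *\<^sub>R \<xi>)) x = complex_of_real (1 / a ^ CARD('n)) * conv_kernel m ((1 / a) *\<^sub>R x)"
proof -
  note [measurable] = schwartz_measurable[OF m]
  have "fourier m ((1 / a) *\<^sub>R x) = complex_of_real (a ^ CARD('n)) * fourier (\<lambda>\<xi>. m (a *\<^sub>R \<xi>)) x"
    unfolding fourier_def using a by (subst integral_affine[of _ a 0]) (simp_all add: scaleR_conv_of_real[where 'a=complex])
  then show ?thesis using a by (simp add: conv_kernel_def)
qed

text \<open>Dilating the symbol rescales the kernel and preserves its integral, so that all dyadic
frequencies have the same cost.\<close>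

lemma kernel_norm_dilate:
  fixes m :: "real^'n::finite \<Rightarrow> complex"
  assumes m: "m \<in> schwartz" and a: "a > 0"
  shows "kernel_norm (\<lambda>\<xi>. m (a *\<^sub>R \<xi>)) = kernel_norm m"
proof -
  note [measurable] = conv_kernel_measurable[OF m]
  have "kernel_norm (\<lambda>\<xi>. m (a *\<^sub>R \<xi>)) = a ^ CARD('n) * (\<integral>x. norm (conv_kernel (\<lambda>\<xi>. m (a *\<^sub>R \<xi>)) (a *\<^sub>R x)) \<partial>lborel)"
    unfolding kernel_norm_def using a conv_kernel_measurable[OF schwartz_dilate[OF m, of a]]
    by (subst integral_affine[of _ a 0]) simp_all
  also have "\<dots> = kernel_norm m"
    unfolding kernel_dilate[OF assms] kernel_norm_def using a by (simp add: norm_mult norm_power norm_divide)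
  finally show ?thesis .
qed

section \<open>Matrix multipliers on distributions represented by \<open>L\<^sup>p\<close> functions\<close>

text \<open>The operator with matrix symbol \<open>m\<close>, applied to a vector of distributions through its transpose on test
functions.\<close>

definition matrix_multiplier ::
    "('m \<Rightarrow> 'm \<Rightarrow> real^'n::finite \<Rightarrow> complex) \<Rightarrow> ('m::finite \<Rightarrow> 'n distr) \<Rightarrow> 'm \<Rightarrow> 'n distr" where
  "matrix_multiplier m V i \<psi> = (\<Sum>j\<in>UNIV. V j (fourier (\<lambda>\<xi>. m i j \<xi> * inv_fourier \<psi> \<xi>)))"

lemma measurable_vec_lambda:
  fixes f :: "'m::finite \<Rightarrow> 'a \<Rightarrow> complex"
  assumes [measurable]: "\<And>i. f i \<in> borel_measurable M"
  shows "(\<lambda>x. \<chi> i. f i x) \<in> borel_measurable M"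
proof -
  have "bounded_linear (axis i :: complex \<Rightarrow> complex^'m)" for i
    by (intro linear_conv_bounded_linear[THEN iffD1] linearI) (auto simp: axis_def vec_eq_iff)
  then have m: "(axis i :: complex \<Rightarrow> complex^'m) \<in> borel_measurable borel" for i
    by (intro borel_measurable_continuous_onI linear_continuous_on)
  have "(\<lambda>x. \<chi> i. f i x) = (\<lambda>x. \<Sum>i\<in>UNIV. axis i (f i x))"
    by (auto simp: fun_eq_iff vec_eq_iff axis_def)
  then show ?thesis using measurable_compose[OF assms m] by simp
qed

lemma measurable_vec_nth_complex [measurable (raw)]:
  "f \<in> borel_measurable M \<Longrightarrow> (\<lambda>x. (f x :: complex^'m::finite) $ i) \<in> borel_measurable M"
  by (rule measurable_compose[of f M borel "\<lambda>v. v $ i"])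
     (auto intro!: borel_measurable_continuous_onI continuous_intros)

lemma schwartz_dual_bound:
  assumes "\<psi> \<in> schwartz"
  obtains S where "S > 0" "(\<integral>\<^sup>+x. ennreal (norm (\<psi> x)) \<partial>lborel) \<le> ennreal S" "\<And>x. norm (\<psi> x) \<le> S"
proof -
  obtain B where B: "\<And>x. norm (\<psi> x) \<le> B" using schwartz_bounded[OF assms] by blast
  define I where "I = (\<integral>x. norm (\<psi> x) \<partial>lborel)"
  have I: "(\<integral>\<^sup>+x. ennreal (norm (\<psi> x)) \<partial>lborel) = ennreal I"
    unfolding I_def by (intro nn_integral_eq_integral integrable_norm schwartz_integrable assms) auto
  show ?thesis
    by (rule that[of "max 1 (max B I)"]) (auto simp: I intro!: ennreal_leI order_trans[OF B])
qed

text \<open>Schwartz functions are integrable and bounded, hence belong to the dual of every \<open>L\<^sup>p\<close>.\<close>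

lemma pairing_finite:
  assumes "1 \<le> p" "\<psi> \<in> schwartz" and [measurable]: "g \<in> borel_measurable lborel" and "Lnorm lborel p g < \<infinity>"
  shows "(\<integral>\<^sup>+x. ennreal (norm (\<psi> x)) * g x \<partial>lborel) < \<infinity>"
proof -
  note [measurable] = schwartz_measurable[OF assms(2)]
  obtain S where S: "S > 0" "(\<integral>\<^sup>+x. ennreal (norm (\<psi> x)) \<partial>lborel) \<le> ennreal S" "\<And>x. norm (\<psi> x) \<le> S"
    using schwartz_dual_bound[OF assms(2)] by blast
  have "(\<integral>\<^sup>+x. ennreal (norm (\<psi> x)) * g x \<partial>lborel) \<le> ennreal S * Lnorm lborel p g"
    by (rule Lnorm_pairing_le) (use assms S in \<open>auto intro: lborel.sigma_finite_measure_axioms ennreal_leI\<close>)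
  also have "\<dots> < \<infinity>" using assms by (simp add: ennreal_mult_less_top)
  finally show ?thesis .
qed

text \<open>The convolution of \<open>f\<close> with the reflected kernels represents the image: Fubini's theorem moves the kernels
to the test function, and Young's inequality bounds the norm.\<close>

lemma matrix_multiplier_represents:
  fixes f :: "real^'n::finite \<Rightarrow> complex^'m::finite"
  assumes p: "1 \<le> p" and f: "represents f V" and fin: "Lnorm lborel p (\<lambda>x. ennreal (norm (f x))) < \<infinity>"
    and m: "\<And>i j. m i j \<in> schwartz" and c: "(\<Sum>i\<in>UNIV. \<Sum>j\<in>UNIV. kernel_norm (m i j)) \<le> c" "0 < c"
  shows "\<exists>F. represents F (matrix_multiplier m V) \<and>
     Lnorm lborel p (\<lambda>x. ennreal (norm (F x))) \<le> ennreal c * Lnorm lborel p (\<lambda>x. ennreal (norm (f x)))"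
proof -
  have fm [measurable]: "f \<in> borel_measurable borel" using f by (simp add: represents_def)
  note km [measurable] = conv_kernel_measurable[OF m]
  define K where "K x = (\<Sum>i\<in>UNIV. \<Sum>j\<in>UNIV. ennreal (norm (conv_kernel (m i j) x)))" for x
  have Km [measurable]: "K \<in> borel_measurable borel" unfolding K_def[abs_def] by measurable
  have Kint: "(\<integral>\<^sup>+x. K x \<partial>lborel) \<le> ennreal c"
  proof -
    have "(\<integral>\<^sup>+x. K x \<partial>lborel) = (\<Sum>i\<in>UNIV. \<Sum>j\<in>UNIV. ennreal (kernel_norm (m i j)))"
      unfolding K_def by (simp add: nn_integral_sum nn_integral_kernel m del: sum_ennreal)
    also have "\<dots> = ennreal (\<Sum>i\<in>UNIV. \<Sum>j\<in>UNIV. kernel_norm (m i j))"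
      by (simp add: sum_nonneg kernel_norm_nonneg)
    finally show ?thesis using c by (simp add: ennreal_leI)
  qed
  define G where "G y = (\<integral>\<^sup>+x. K (x - y) * ennreal (norm (f x)) \<partial>lborel)" for y
  have Gm [measurable]: "G \<in> borel_measurable borel" unfolding G_def by measurable
  have G: "Lnorm lborel p G \<le> ennreal c * Lnorm lborel p (\<lambda>x. ennreal (norm (f x)))"
    unfolding G_def by (rule Young_convolution(1)[OF p c(2) Km _ Kint]) simp
  define Fc where "Fc i j y = (\<integral>x. f x $ j * conv_kernel (m i j) (x - y) \<partial>lborel)" for i j y
  have Fcm [measurable]: "Fc i j \<in> borel_measurable borel" for i j
    unfolding Fc_def by measurable
  define F where "F y = (\<chi> i. \<Sum>j\<in>UNIV. Fc i j y)" for y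
  have Fm: "F \<in> borel_measurable borel" unfolding F_def by (rule measurable_vec_lambda) measurable
  have FG: "ennreal (norm (F y)) \<le> G y" for y
  proof -
    have "norm (F y) \<le> (\<Sum>i\<in>UNIV. norm (F y $ i))" unfolding norm_vec_def by (rule L2_set_le_sum) simp
    also have "\<dots> \<le> (\<Sum>i\<in>UNIV. \<Sum>j\<in>UNIV. norm (Fc i j y))" unfolding F_def by (auto intro!: sum_mono norm_sum)
    finally have "ennreal (norm (F y)) \<le> (\<Sum>i\<in>UNIV. \<Sum>j\<in>UNIV. ennreal (norm (Fc i j y)))"
      by (simp add: sum_nonneg ennreal_leI)
    also have "\<dots> \<le> (\<Sum>i\<in>UNIV. \<Sum>j\<in>UNIV. \<integral>\<^sup>+x. ennreal (norm (conv_kernel (m i j) (x - y))) * ennreal (norm (f x)) \<partial>lborel)"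
    proof (intro sum_mono)
      fix i j
      have "ennreal (norm (Fc i j y)) \<le> (\<integral>\<^sup>+x. ennreal (norm (f x $ j * conv_kernel (m i j) (x - y))) \<partial>lborel)"
        unfolding Fc_def by (rule norm_integral_le_nn_integral)
      also have "\<dots> \<le> (\<integral>\<^sup>+x. ennreal (norm (conv_kernel (m i j) (x - y))) * ennreal (norm (f x)) \<partial>lborel)"
      proof (rule nn_integral_mono)
        fix x
        have "norm (f x $ j * conv_kernel (m i j) (x - y)) \<le> norm (conv_kernel (m i j) (x - y)) * norm (f x)"
          by (simp add: norm_mult mult.commute mult_right_mono Finite_Cartesian_Product.norm_nth_le)
        then show "ennreal (norm (f x $ j * conv_kernel (m i j) (x - y))) \<le> ennreal (norm (conv_kernel (m i j) (x - y))) * ennreal (norm (f x))"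
          by (simp add: ennreal_mult[symmetric] ennreal_leI)
      qed
      finally show "ennreal (norm (Fc i j y)) \<le> (\<integral>\<^sup>+x. ennreal (norm (conv_kernel (m i j) (x - y))) * ennreal (norm (f x)) \<partial>lborel)" .
    qed
    also have "\<dots> = G y"
      unfolding G_def K_def by (simp add: sum_distrib_right nn_integral_sum del: sum_ennreal)
    finally show ?thesis .
  qed
  have "Lnorm lborel p (\<lambda>x. ennreal (norm (F x))) \<le> Lnorm lborel p G"
    using Fm by (intro Lnorm_mono p FG) simp
  note FL = order_trans[OF this G]
  have GL: "Lnorm lborel p G < \<infinity>" using fin by (intro le_less_trans[OF G]) (simp add: ennreal_mult_less_top)
  have "represents F (matrix_multiplier m V)"
    unfolding represents_def
  proof (intro conjI ballI allI)
    show "F \<in> borel_measurable lborel" using Fm by simp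
    fix \<psi> i assume \<psi>: "(\<psi> :: real^'n \<Rightarrow> complex) \<in> schwartz"
    note \<psi>m [measurable] = schwartz_measurable[OF \<psi>]
    have I1: "(\<integral>\<^sup>+x. ennreal (norm (\<psi> x)) * G x \<partial>lborel) < \<infinity>"
      by (rule pairing_finite[OF p \<psi> _ GL]) simp
    have Ki: "norm (f x $ j * conv_kernel (m i j) (x - y) * \<psi> y) \<le> norm (\<psi> y) * (norm (conv_kernel (m i j) (x - y)) * norm (f x))" for x y j
      by (simp add: norm_mult mult.commute mult_left_mono mult_right_mono Finite_Cartesian_Product.norm_nth_le)
    have KK: "ennreal (norm (conv_kernel (m i j) z)) \<le> K z" for j z
      unfolding K_def by (rule order_trans[OF member_le_sum[of j] member_le_sum[of i]]) auto
    have int2: "integrable (lborel \<Otimes>\<^sub>M lborel) (\<lambda>(y, x). f x $ j * conv_kernel (m i j) (x - y) * \<psi> y)" for j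
    proof (rule integrableI_bounded)
      have "(\<integral>\<^sup>+z. ennreal (norm (case z of (y, x) \<Rightarrow> f x $ j * conv_kernel (m i j) (x - y) * \<psi> y)) \<partial>(lborel \<Otimes>\<^sub>M lborel))
        = (\<integral>\<^sup>+y. (\<integral>\<^sup>+x. ennreal (norm (f x $ j * conv_kernel (m i j) (x - y) * \<psi> y)) \<partial>lborel) \<partial>lborel)"
        by (subst lborel.nn_integral_fst[symmetric]) auto
      also have "\<dots> \<le> (\<integral>\<^sup>+y. (\<integral>\<^sup>+x. ennreal (norm (\<psi> y)) * (K (x - y) * ennreal (norm (f x))) \<partial>lborel) \<partial>lborel)"
      proof (intro nn_integral_mono)
        fix x y
        have "ennreal (norm (f x $ j * conv_kernel (m i j) (x - y) * \<psi> y)) \<le> ennreal (norm (\<psi> y)) * (ennreal (norm (conv_kernel (m i j) (x - y))) * ennreal (norm (f x)))"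
          using Ki[of x j y] by (simp add: ennreal_mult[symmetric] ennreal_leI)
        also have "\<dots> \<le> ennreal (norm (\<psi> y)) * (K (x - y) * ennreal (norm (f x)))"
          by (intro mult_left_mono mult_right_mono KK) auto
        finally show "ennreal (norm (f x $ j * conv_kernel (m i j) (x - y) * \<psi> y)) \<le> ennreal (norm (\<psi> y)) * (K (x - y) * ennreal (norm (f x)))" .
      qed
      also have "\<dots> = (\<integral>\<^sup>+y. ennreal (norm (\<psi> y)) * G y \<partial>lborel)"
        unfolding G_def by (simp add: nn_integral_cmult)
      finally show "(\<integral>\<^sup>+z. ennreal (norm (case z of (y, x) \<Rightarrow> f x $ j * conv_kernel (m i j) (x - y) * \<psi> y)) \<partial>(lborel \<Otimes>\<^sub>M lborel)) < \<infinity>"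
        using I1 by simp
    qed measurable
    have Fcint: "integrable lborel (\<lambda>y. Fc i j y * \<psi> y)" for j
      using lborel_pair.integrable_fst[OF int2[of j]] unfolding Fc_def by simp
    have rep: "V j (fourier (\<lambda>\<xi>. m i j \<xi> * inv_fourier \<psi> \<xi>)) = (\<integral>y. Fc i j y * \<psi> y \<partial>lborel)" for j
    proof -
      have "fourier (\<lambda>\<xi>. m i j \<xi> * inv_fourier \<psi> \<xi>) \<in> schwartz"
        by (intro fourier_schwartz schwartz_mult m inv_fourier_schwartz \<psi>)
      then have "V j (fourier (\<lambda>\<xi>. m i j \<xi> * inv_fourier \<psi> \<xi>)) = (\<integral>x. f x $ j * fourier (\<lambda>\<xi>. m i j \<xi> * inv_fourier \<psi> \<xi>) x \<partial>lborel)"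
        using f by (simp add: represents_def)
      also have "\<dots> = (\<integral>x. (\<integral>y. f x $ j * conv_kernel (m i j) (x - y) * \<psi> y \<partial>lborel) \<partial>lborel)"
        by (simp only: fourier_mult_inv_fourier[OF m \<psi>] integral_mult_right_zero[symmetric] mult.assoc)
      also have "\<dots> = (\<integral>y. (\<integral>x. f x $ j * conv_kernel (m i j) (x - y) * \<psi> y \<partial>lborel) \<partial>lborel)"
        by (rule lborel_pair.Fubini_integral[OF int2])
      also have "\<dots> = (\<integral>y. Fc i j y * \<psi> y \<partial>lborel)" unfolding Fc_def by simp
      finally show ?thesis .
    qed
    show "integrable lborel (\<lambda>x. F x $ i * \<psi> x)"
      unfolding F_def using Fcint by (simp add: sum_distrib_right)
    show "matrix_multiplier m V i \<psi> = (\<integral>x. F x $ i * \<psi> x \<partial>lborel)"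
      unfolding F_def matrix_multiplier_def rep using Fcint by (simp add: sum_distrib_right)
  qed
  then show ?thesis using FL by blast
qed

text \<open>\<open>Lnorm_sum_le\<close> for a sum over \<^typ>\<open>bool\<close>; an \<open>e / 2\<close> is added to the weights to make them positive.\<close>

lemma Lnorm_triangle:
  assumes p: "1 \<le> p" and [measurable]: "f \<in> borel_measurable M" "g \<in> borel_measurable M"
  shows "Lnorm M p (\<lambda>x. f x + g x) \<le> Lnorm M p f + Lnorm M p g"
proof (cases "Lnorm M p f + Lnorm M p g = \<top>")
  case False
  then obtain a b where ab: "Lnorm M p f = ennreal a" "0 \<le> a" "Lnorm M p g = ennreal b" "0 \<le> b"
    by (cases "Lnorm M p f"; cases "Lnorm M p g") auto
  show ?thesis
  proof (rule ennreal_le_epsilon)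
    fix e :: real assume e: "0 < e"
    have "Lnorm M p (\<lambda>x. \<integral>\<^sup>+c. (if c then f x else g x) \<partial>count_space UNIV) \<le> ennreal (a + b + e)"
    proof (rule Lnorm_sum_le[OF p, where w = "\<lambda>c. (if c then a else b) + e / 2"])
      show "Lnorm M p (\<lambda>x. if c then f x else g x) \<le> ennreal ((if c then a else b) + e / 2)" for c
        using ab e by (auto intro!: ennreal_leI)
      show "(\<integral>\<^sup>+c. ennreal ((if c then a else b) + e / 2) \<partial>count_space UNIV) \<le> ennreal (a + b + e)"
        using ab e by (simp add: nn_integral_count_space_finite UNIV_bool ennreal_plus[symmetric] del: ennreal_plus)
    qed (use ab e in auto)
    then show "Lnorm M p (\<lambda>x. f x + g x) \<le> Lnorm M p f + Lnorm M p g + ennreal e"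
      using ab e by (simp add: nn_integral_count_space_finite UNIV_bool add.commute)
  qed
qed (metis top_greatest)

text \<open>The weights by which an error \<open>\<epsilon>\<close> is shared out among countably many terms.\<close>

lemma positive_summable_family:
  obtains \<delta> :: "'i::countable \<Rightarrow> real" where "\<And>l. 0 < \<delta> l" "(\<integral>\<^sup>+l. ennreal (\<delta> l) \<partial>count_space UNIV) \<le> 1"
proof
  define \<delta> where "\<delta> l = (1/2::real) ^ Suc (to_nat l)" for l :: 'i
  show "0 < \<delta> l" for l by (simp add: \<delta>_def)
  have "(\<integral>\<^sup>+l. ennreal (\<delta> l) \<partial>count_space UNIV) = (\<integral>\<^sup>+n. ennreal ((1/2) ^ Suc n) \<partial>count_space (range (to_nat :: 'i \<Rightarrow> nat)))"
    unfolding \<delta>_def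
    by (subst nn_integral_bij_count_space[where g="to_nat :: 'i \<Rightarrow> nat" and B="range to_nat", symmetric])
       (auto simp: bij_betw_def)
  also have "\<dots> \<le> (\<integral>\<^sup>+n. ennreal ((1/2) ^ Suc n) \<partial>count_space UNIV)"
    by (subst nn_integral_count_space_indicator) (auto intro!: nn_integral_mono simp: indicator_def NO_MATCH_def)
  also have "\<dots> = ennreal 1"
    unfolding nn_integral_count_space_nat
    by (subst suminf_ennreal_eq) (use power_half_series in auto)
  finally show "(\<integral>\<^sup>+l. ennreal (\<delta> l) \<partial>count_space UNIV) \<le> 1" by simp
qed

lemma tendsto_sum_count_space_int:
  fixes g :: "int \<Rightarrow> complex"
  assumes "integrable (count_space UNIV) g"
  shows "(\<lambda>n. \<Sum>l\<in>{- int n..int n}. g l) \<longlonglongrightarrow> (\<integral>l. g l \<partial>count_space UNIV)"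
proof -
  have "(\<lambda>n. \<integral>l. indicator {- int n..int n} l * g l \<partial>count_space UNIV) \<longlonglongrightarrow> (\<integral>l. g l \<partial>count_space UNIV)"
  proof (rule integral_dominated_convergence[where w="\<lambda>l. norm (g l)"])
    show "AE l in count_space UNIV. (\<lambda>n. indicator {- int n..int n} l * g l) \<longlonglongrightarrow> g l"
    proof (rule AE_I2)
      fix l
      have "\<forall>\<^sub>F n in sequentially. indicator {- int n..int n} l * g l = g l"
        using eventually_ge_at_top[of "nat \<bar>l\<bar>"] by eventually_elim (auto simp: indicator_def)
      then show "(\<lambda>n. indicator {- int n..int n} l * g l) \<longlonglongrightarrow> g l"
        by (rule tendsto_eventually)
    qed
  qed (use assms in \<open>auto simp: norm_mult indicator_def\<close>)
  moreover have "(\<integral>l. indicator {- int n..int n} l * g l \<partial>count_space UNIV) = (\<Sum>l\<in>{- int n..int n}. g l)" for n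
    by (subst lebesgue_integral_count_space_finite_support)
       (auto simp: indicator_def intro!: sum.mono_neutral_cong_left finite_subset[of _ "{- int n..int n}"])
  ultimately show ?thesis by simp
qed

text \<open>The norm of \<open>D l\<close> is an infimum, so \<open>D l\<close> is represented by a function whose norm exceeds it by little,
and \<open>matrix_multiplier_represents\<close> gives functions \<open>f l\<close> for the images with summable norms. Their sum converges
absolutely almost everywhere, and it represents \<open>V\<close> since the symmetric partial sums do so in the limit.\<close>

theorem distr_Lp_multiplier_series:
  fixes V :: "'m::finite \<Rightarrow> 'n::finite distr" and D :: "int \<Rightarrow> 'm \<Rightarrow> 'n distr"
    and m :: "int \<Rightarrow> 'm \<Rightarrow> 'm \<Rightarrow> real^'n \<Rightarrow> complex"
  assumes p: "1 \<le> p" and m: "\<And>l i j. m l i j \<in> schwartz"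
    and c: "\<And>l. 0 < c l" "\<And>l. (\<Sum>i\<in>UNIV. \<Sum>j\<in>UNIV. kernel_norm (m l i j)) \<le> c l"
    and fin: "\<And>l. distr_Lp p (D l) < \<infinity>"
    and V: "\<And>i \<psi>. \<psi> \<in> schwartz \<Longrightarrow> (\<lambda>n. \<Sum>l\<in>{- int n..int n}. matrix_multiplier (m l) (D l) i \<psi>) \<longlonglongrightarrow> V i \<psi>"
  shows "distr_Lp p V \<le> (\<integral>\<^sup>+l. ennreal (c l) * distr_Lp p (D l) \<partial>count_space UNIV)"
proof (rule ennreal_le_epsilon)
  let ?T = "\<integral>\<^sup>+l. ennreal (c l) * distr_Lp p (D l) \<partial>count_space UNIV"
  fix \<epsilon> :: real assume \<epsilon>: "0 < \<epsilon>" and T: "?T < \<top>"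
  then obtain T where T: "?T = ennreal T" "0 \<le> T" by (cases ?T) auto
  obtain a where a: "\<And>l. distr_Lp p (D l) = ennreal (a l)" "\<And>l. 0 \<le> a l"
  proof -
    have "\<exists>a. distr_Lp p (D l) = ennreal a \<and> 0 \<le> a" for l using fin[of l] by (cases "distr_Lp p (D l)") auto
    then show ?thesis using that by metis
  qed
  obtain \<delta> :: "int \<Rightarrow> real" where \<delta>: "\<And>l. 0 < \<delta> l" "(\<integral>\<^sup>+l. ennreal (\<delta> l) \<partial>count_space UNIV) \<le> 1"
    using positive_summable_family by blast
  \<comment> \<open>bounds for the norms of the \<open>f l\<close>, with sum at most \<open>T + \<epsilon>\<close>\<close>
  define w where "w l = c l * a l + \<epsilon> * \<delta> l" for l
  have w: "0 < w l" for l using c(1)[of l] a(2)[of l] \<delta>(1)[of l] \<epsilon> by (auto simp: w_def intro!: add_nonneg_pos)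
  have "(\<integral>\<^sup>+l. ennreal (w l) \<partial>count_space UNIV) = ?T + ennreal \<epsilon> * (\<integral>\<^sup>+l. ennreal (\<delta> l) \<partial>count_space UNIV)"
    unfolding w_def a using less_imp_le[OF c(1)] a(2) less_imp_le[OF \<delta>(1)] \<epsilon>
    by (simp add: nn_integral_add nn_integral_cmult[symmetric] ennreal_mult)
  also have "\<dots> \<le> ?T + ennreal \<epsilon> * 1" by (intro add_left_mono mult_left_mono \<delta>) auto
  finally have wS: "(\<integral>\<^sup>+l. ennreal (w l) \<partial>count_space UNIV) \<le> ennreal (T + \<epsilon>)"
    using T \<epsilon> by simp
  have "\<exists>F. represents F (matrix_multiplier (m l) (D l)) \<and> Lnorm lborel p (\<lambda>x. ennreal (norm (F x))) \<le> ennreal (w l)" for l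
  proof -
    have "distr_Lp p (D l) < ennreal (a l + \<epsilon> * \<delta> l / c l)"
      using c(1)[of l] a[of l] \<delta>(1)[of l] \<epsilon> by (auto intro!: ennreal_lessI add_nonneg_pos)
    then obtain f where f: "represents f (D l)" "Lnorm lborel p (\<lambda>x. ennreal (norm (f x))) < ennreal (a l + \<epsilon> * \<delta> l / c l)"
      unfolding distr_Lp_def INF_less_iff by auto
    have fin: "Lnorm lborel p (\<lambda>x. ennreal (norm (f x))) < \<infinity>" using f(2) by (rule less_le_trans) simp
    obtain F where F: "represents F (matrix_multiplier (m l) (D l))"
      "Lnorm lborel p (\<lambda>x. ennreal (norm (F x))) \<le> ennreal (c l) * Lnorm lborel p (\<lambda>x. ennreal (norm (f x)))"
      using matrix_multiplier_represents[OF p f(1) fin m c(2) c(1)] by blast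
    note F(2)
    also have "ennreal (c l) * Lnorm lborel p (\<lambda>x. ennreal (norm (f x))) \<le> ennreal (c l) * ennreal (a l + \<epsilon> * \<delta> l / c l)"
      using f(2) by (intro mult_left_mono) auto
    also have "\<dots> = ennreal (c l * (a l + \<epsilon> * \<delta> l / c l))"
      using c(1)[of l] a(2)[of l] \<delta>(1)[of l] \<epsilon> by (simp add: ennreal_mult)
    also have "c l * (a l + \<epsilon> * \<delta> l / c l) = w l"
      using c(1)[of l] by (simp add: w_def distrib_left)
    finally show ?thesis using F(1) by blast
  qed
  then obtain f where f: "\<And>l. represents (f l) (matrix_multiplier (m l) (D l))"
    and fw: "\<And>l. Lnorm lborel p (\<lambda>x. ennreal (norm (f l x))) \<le> ennreal (w l)" by metis
  have fm [measurable]: "f l \<in> borel_measurable borel" for l using f[of l] by (simp add: represents_def)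
  define G where "G x = (\<integral>\<^sup>+l. ennreal (norm (f l x)) \<partial>count_space UNIV)" for x
  have GL: "Lnorm lborel p G \<le> ennreal (T + \<epsilon>)" unfolding G_def
    by (rule Lnorm_sum_le[OF p, where w=w]) (use w fw wS T \<epsilon> in auto)
  interpret cs: sigma_finite_measure "count_space (UNIV::int set)" by (rule sigma_finite_measure_count_space)
  interpret P: pair_sigma_finite lborel "count_space (UNIV::int set)" ..
  interpret P': pair_sigma_finite "count_space (UNIV::int set)" "lborel :: (real^'n) measure" ..
  have swap: "(\<lambda>(x, l). h l x) \<in> borel_measurable (lborel \<Otimes>\<^sub>M count_space (UNIV::int set))"
    if [measurable]: "\<And>l. h l \<in> borel_measurable borel" for h :: "int \<Rightarrow> real^'n \<Rightarrow> 'b::topological_space"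
  proof -
    have "(\<lambda>(l, x). h l x) \<in> borel_measurable (count_space UNIV \<Otimes>\<^sub>M lborel)"
      by (rule measurable_pair_measure_countable1) auto
    from measurable_compose[OF measurable_pair_swap' this]
    show ?thesis by (simp add: split_beta')
  qed
  have Gm [measurable]: "G \<in> borel_measurable borel"
    using cs.borel_measurable_nn_integral[OF swap[of "\<lambda>l x. ennreal (norm (f l x))"]] unfolding G_def by simp
  define Fc where "Fc i x = (\<integral>l. f l x $ i \<partial>count_space UNIV)" for i x
  have Fcm [measurable]: "Fc i \<in> borel_measurable borel" for i
    using cs.borel_measurable_lebesgue_integral[OF swap[of "\<lambda>l x. f l x $ i"]] unfolding Fc_def by simp
  define F where "F x = (\<chi> i. Fc i x)" for x
  have Fm: "F \<in> borel_measurable borel" unfolding F_def by (rule measurable_vec_lambda) measurable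
  \<comment> \<open>where the series diverges absolutely the right-hand side is infinite\<close>
  have FG: "ennreal (norm (F x)) \<le> G x" for x
  proof (cases "integrable (count_space UNIV) (\<lambda>l. f l x)")
    case True
    then have "F x = (\<integral>l. f l x \<partial>count_space UNIV)"
      unfolding F_def Fc_def vec_eq_iff
      using integral_bounded_linear[OF bounded_linear_vec_nth True] by (simp add: vec_eq_iff)
    then show ?thesis unfolding G_def by (simp add: norm_integral_le_nn_integral)
  next
    case False
    then have "G x = \<infinity>" unfolding G_def integrable_iff_bounded by (simp add: less_top[symmetric])
    then show ?thesis by simp
  qed
  have FL: "Lnorm lborel p (\<lambda>x. ennreal (norm (F x))) \<le> ennreal (T + \<epsilon>)"
    using Fm by (intro order_trans[OF Lnorm_mono[OF p _ FG] GL]) simp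
  have "represents F V"
    unfolding represents_def
  proof (intro conjI ballI allI)
    show "F \<in> borel_measurable lborel" using Fm by simp
    fix \<psi> i assume \<psi>: "(\<psi> :: real^'n \<Rightarrow> complex) \<in> schwartz"
    note \<psi>m [measurable] = schwartz_measurable[OF \<psi>]
    have I1: "(\<integral>\<^sup>+x. ennreal (norm (\<psi> x)) * G x \<partial>lborel) < \<infinity>"
      by (rule pairing_finite[OF p \<psi>]) (use GL in \<open>auto intro: le_less_trans\<close>)
    have int2: "integrable (lborel \<Otimes>\<^sub>M count_space UNIV) (\<lambda>(x, l). f l x $ i * \<psi> x)"
    proof (rule integrableI_bounded)
      show m2: "(\<lambda>(x, l). f l x $ i * \<psi> x) \<in> borel_measurable (lborel \<Otimes>\<^sub>M count_space UNIV)"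
        by (rule swap) measurable
      have "(\<integral>\<^sup>+z. ennreal (norm (case z of (x, l) \<Rightarrow> f l x $ i * \<psi> x)) \<partial>(lborel \<Otimes>\<^sub>M count_space UNIV))
        = (\<integral>\<^sup>+x. (\<integral>\<^sup>+l. ennreal (norm (f l x $ i * \<psi> x)) \<partial>count_space UNIV) \<partial>lborel)"
        using m2 by (subst cs.nn_integral_fst[symmetric]) auto
      also have "\<dots> \<le> (\<integral>\<^sup>+x. (\<integral>\<^sup>+l. ennreal (norm (\<psi> x)) * ennreal (norm (f l x)) \<partial>count_space UNIV) \<partial>lborel)"
        by (intro nn_integral_mono)
           (auto simp: ennreal_mult[symmetric] norm_mult mult.commute intro!: ennreal_leI mult_left_mono Finite_Cartesian_Product.norm_nth_le)
      also have "\<dots> = (\<integral>\<^sup>+x. ennreal (norm (\<psi> x)) * G x \<partial>lborel)"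
        unfolding G_def by (simp add: nn_integral_cmult)
      finally show "(\<integral>\<^sup>+z. ennreal (norm (case z of (x, l) \<Rightarrow> f l x $ i * \<psi> x)) \<partial>(lborel \<Otimes>\<^sub>M count_space UNIV)) < \<infinity>"
        using I1 by simp
    qed
    have Fi: "(\<integral>l. f l x $ i * \<psi> x \<partial>count_space UNIV) = F x $ i * \<psi> x" for x
      unfolding F_def Fc_def by simp
    show "integrable lborel (\<lambda>x. F x $ i * \<psi> x)"
      using P.integrable_fst[OF int2] unfolding Fi .
    have "(\<integral>x. F x $ i * \<psi> x \<partial>lborel) = (\<integral>l. (\<integral>x. f l x $ i * \<psi> x \<partial>lborel) \<partial>count_space UNIV)"
      using P.Fubini_integral[OF int2] unfolding Fi by simp
    moreover have "(\<integral>x. f l x $ i * \<psi> x \<partial>lborel) = matrix_multiplier (m l) (D l) i \<psi>" for l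
      using f[of l] \<psi> by (simp add: represents_def)
    ultimately have eq: "(\<integral>x. F x $ i * \<psi> x \<partial>lborel) = (\<integral>l. matrix_multiplier (m l) (D l) i \<psi> \<partial>count_space UNIV)"
      by simp
    have "integrable (count_space UNIV) (\<lambda>l. matrix_multiplier (m l) (D l) i \<psi>)"
      using P.integrable_snd[OF int2] f \<psi> by (simp add: represents_def)
    from tendsto_sum_count_space_int[OF this] V[OF \<psi>, of i]
    show "V i \<psi> = (\<integral>x. F x $ i * \<psi> x \<partial>lborel)" unfolding eq by (rule LIMSEQ_unique[symmetric])
  qed
  then have "distr_Lp p V \<le> ennreal (T + \<epsilon>)"
    unfolding distr_Lp_def using FL by (intro INF_lower2[of F]) simp_all
  then show "distr_Lp p V \<le> ?T + ennreal \<epsilon>" using T \<epsilon> by simp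
qed

section \<open>Series of Schwartz functions\<close>

lemma frechet_derivative_sum_partial:
  fixes f :: "real^'n::finite \<Rightarrow> complex"
  assumes "f differentiable (at x)"
  shows "(f has_derivative (\<lambda>h. \<Sum>i\<in>UNIV. complex_of_real (h $ i) * partial i f x)) (at x)"
proof -
  let ?D = "frechet_derivative f (at x)"
  have D: "(f has_derivative ?D) (at x)" using assms by (simp add: frechet_derivative_works)
  note lin = has_derivative_linear[OF D]
  have "?D h = (\<Sum>i\<in>UNIV. complex_of_real (h $ i) * partial i f x)" for h
  proof -
    have "h = (\<Sum>i\<in>UNIV. h $ i *\<^sub>R axis i 1)"
      by (simp add: vec_eq_iff axis_def if_distrib sum.If_cases cong: if_cong)
    then have "?D h = ?D (\<Sum>i\<in>UNIV. h $ i *\<^sub>R axis i 1)" by simp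
    also have "\<dots> = (\<Sum>i\<in>UNIV. ?D (h $ i *\<^sub>R axis i 1))" by (rule linear_sum[OF lin])
    finally show ?thesis by (simp add: linear_cmul[OF lin] partial_def scaleR_conv_of_real[where 'a=complex])
  qed
  then show ?thesis using D by presburger
qed

definition schwartz_summable :: "(nat \<Rightarrow> real^'n::finite \<Rightarrow> complex) \<Rightarrow> bool" where
  "schwartz_summable f \<longleftrightarrow> (\<forall>k. f k \<in> schwartz) \<and> (\<forall>m. summable (\<lambda>k. schwartz_seminorm m (f k)))"

lemma schwartz_summable_partial:
  assumes "schwartz_summable f" shows "schwartz_summable (\<lambda>k. partial i (f k))"
proof -
  have fS: "\<And>k. f k \<in> schwartz" and s: "summable (\<lambda>k. schwartz_seminorm m (f k))" for m
    using assms by (auto simp: schwartz_summable_def)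
  have "summable (\<lambda>k. schwartz_seminorm m (partial i (f k)))" for m
    by (rule summable_comparison_test'[OF s[of "Suc m"], of 0])
       (simp add: seminorm_partial fS seminorm_nonneg schwartz_partial)
  then show ?thesis by (simp add: schwartz_summable_def schwartz_partial fS)
qed

lemma schwartz_summable_partials:
  "schwartz_summable f \<Longrightarrow> schwartz_summable (\<lambda>k. partials \<alpha> (f k))"
  by (induction \<alpha>) (auto intro: schwartz_summable_partial)

lemma schwartz_summable_weighted:
  assumes "schwartz_summable f"
  shows "summable (\<lambda>k. norm (f k x))" "summable (\<lambda>k. f k x)"
    "(1 + norm x) ^ m * norm (\<Sum>k. f k x) \<le> (\<Sum>k. schwartz_seminorm m (f k))"
proof -
  have fS: "\<And>k. f k \<in> schwartz" and s: "summable (\<lambda>k. schwartz_seminorm m (f k))" for m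
    using assms by (auto simp: schwartz_summable_def)
  have le: "(1 + norm x) ^ m * norm (f k x) \<le> schwartz_seminorm m (f k)" for m k
    using seminorm_ge[OF fS, of "[]" m x k] by simp
  show sn: "summable (\<lambda>k. norm (f k x))"
    by (rule summable_comparison_test'[OF s[of 0], of 0]) (use le[of 0] in simp)
  then show "summable (\<lambda>k. f k x)" by (rule summable_norm_cancel)
  have "(1 + norm x) ^ m * norm (\<Sum>k. f k x) \<le> (1 + norm x) ^ m * (\<Sum>k. norm (f k x))"
    by (intro mult_left_mono summable_norm sn) simp
  also have "\<dots> = (\<Sum>k. (1 + norm x) ^ m * norm (f k x))" by (rule suminf_mult[OF sn, symmetric])
  also have "\<dots> \<le> (\<Sum>k. schwartz_seminorm m (f k))"
    by (intro suminf_le le summable_mult sn s)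
  finally show "(1 + norm x) ^ m * norm (\<Sum>k. f k x) \<le> (\<Sum>k. schwartz_seminorm m (f k))" .
qed

text \<open>The series of partial derivatives converges uniformly because its terms are bounded by the first
seminorms.\<close>

lemma schwartz_summable_has_derivative:
  fixes f :: "nat \<Rightarrow> real^'n::finite \<Rightarrow> complex"
  assumes f: "schwartz_summable f"
  shows "((\<lambda>x. \<Sum>k. f k x) has_derivative (\<lambda>h. \<Sum>i\<in>UNIV. complex_of_real (h $ i) * (\<Sum>k. partial i (f k) x))) (at x)"
proof -
  have fS: "\<And>k. f k \<in> schwartz" using f by (auto simp: schwartz_summable_def)
  let ?f' = "\<lambda>k x h. \<Sum>i\<in>UNIV. complex_of_real (h $ i) * partial i (f k) x"
  let ?g' = "\<lambda>x h. \<Sum>i\<in>UNIV. complex_of_real (h $ i) * (\<Sum>k. partial i (f k) x)"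
  have s1: "summable (\<lambda>k. schwartz_seminorm 1 (f k))" using f by (auto simp: schwartz_summable_def)
  have "\<exists>g. \<forall>x\<in>UNIV. (\<lambda>k. f k x) sums g x \<and> (g has_derivative ?g' x) (at x within UNIV)"
  proof (rule has_derivative_series[where f'="?f'" and x = 0])
    show "(f k has_derivative ?f' k x) (at x within UNIV)" for k x
      by (simp add: frechet_derivative_sum_partial schwartz_differentiable fS)
    show "(\<lambda>k. f k 0) sums (\<Sum>k. f k 0)" by (intro summable_sums schwartz_summable_weighted f)
    fix e :: real assume e: "e > 0"
    define \<epsilon> where "\<epsilon> = e / (1 + CARD('n))"
    have \<epsilon>: "\<epsilon> > 0" using e by (simp add: \<epsilon>_def)
    have "(\<lambda>n. \<Sum>k. schwartz_seminorm 1 (f (k + n))) \<longlonglongrightarrow> 0"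
      by (rule suminf_exist_split2[OF s1])
    then have "\<forall>\<^sub>F n in sequentially. (\<Sum>k. schwartz_seminorm 1 (f (k + n))) < \<epsilon>"
      using \<epsilon> by (rule order_tendstoD)
    then show "\<forall>\<^sub>F n in sequentially. \<forall>x\<in>UNIV. \<forall>h. norm (sum (\<lambda>i. ?f' i x h) {..<n} - ?g' x h) \<le> e * norm h"
    proof eventually_elim
      case (elim n)
      show ?case
      proof (intro ballI allI)
        fix x h :: "real^'n"
        have tail: "norm ((\<Sum>k<n. partial i (f k) x) - (\<Sum>k. partial i (f k) x)) \<le> \<epsilon>" for i
        proof -
          have sp: "summable (\<lambda>k. partial i (f k) x)" "summable (\<lambda>k. norm (partial i (f k) x))"
            by (intro schwartz_summable_weighted schwartz_summable_partial f)+
          have "norm ((\<Sum>k<n. partial i (f k) x) - (\<Sum>k. partial i (f k) x)) = norm (\<Sum>k. partial i (f (k + n)) x)"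
            using suminf_split_initial_segment[OF sp(1), of n] by simp
          also have "\<dots> \<le> (\<Sum>k. norm (partial i (f (k + n)) x))"
            by (rule summable_norm[OF summable_ignore_initial_segment[OF sp(2)]])
          also have "\<dots> \<le> (\<Sum>k. schwartz_seminorm 1 (f (k + n)))"
          proof (rule suminf_le)
            show "norm (partial i (f (k + n)) x) \<le> schwartz_seminorm 1 (f (k + n))" for k
            proof -
              have "norm (partial i (f (k + n)) x) \<le> (1 + norm x) ^ 1 * norm (partials [i] (f (k + n)) x)"
                by (simp add: mult_left_le distrib_right)
              also have "\<dots> \<le> schwartz_seminorm 1 (f (k + n))" by (rule seminorm_ge[OF fS]) simp
              finally show ?thesis .
            qed
          qed (intro summable_ignore_initial_segment[OF sp(2)] summable_ignore_initial_segment[OF s1])+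
          finally show ?thesis using elim by simp
        qed
        have "sum (\<lambda>k. ?f' k x h) {..<n} - ?g' x h = (\<Sum>i\<in>UNIV. complex_of_real (h $ i) * ((\<Sum>k<n. partial i (f k) x) - (\<Sum>k. partial i (f k) x)))"
          by (subst sum.swap) (simp add: sum_distrib_left right_diff_distrib sum_subtractf)
        also have "norm \<dots> \<le> (\<Sum>i\<in>(UNIV::'n set). norm h * \<epsilon>)"
          by (intro sum_norm_le) (auto simp: norm_mult component_le_norm_cart tail intro!: mult_mono)
        also have "\<dots> = norm h * (CARD('n) * \<epsilon>)" by simp
        also have "\<dots> \<le> norm h * e"
          using e by (intro mult_left_mono) (auto simp: \<epsilon>_def field_simps)
        finally show "norm (sum (\<lambda>i. ?f' i x h) {..<n} - ?g' x h) \<le> e * norm h" by (simp add: mult.commute)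
      qed
    qed
  qed auto
  then obtain g where g: "\<And>x. (\<lambda>k. f k x) sums g x" "\<And>x. (g has_derivative ?g' x) (at x)" by auto
  have "g = (\<lambda>x. \<Sum>k. f k x)" using g(1) by (auto simp: sums_iff)
  then show ?thesis using g(2) by simp
qed

lemma partial_suminf:
  assumes "schwartz_summable f"
  shows "partial i (\<lambda>x. \<Sum>k. f k x) = (\<lambda>x. \<Sum>k. partial i (f k) x)"
proof
  fix x
  show "partial i (\<lambda>x. \<Sum>k. f k x) x = (\<Sum>k. partial i (f k) x)"
    by (subst partial_eqI[OF schwartz_summable_has_derivative[OF assms]])
       (simp add: axis_def if_distrib if_distribR sum.If_cases cong: if_cong)
qed

lemma partials_suminf:
  assumes "schwartz_summable f"
  shows "partials \<alpha> (\<lambda>x. \<Sum>k. f k x) = (\<lambda>x. \<Sum>k. partials \<alpha> (f k) x)"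
  by (induction \<alpha>) (simp_all add: partial_suminf schwartz_summable_partials assms)

lemma schwartz_suminf:
  fixes f :: "nat \<Rightarrow> real^'n::finite \<Rightarrow> complex"
  assumes "schwartz_summable f"
  shows "(\<lambda>x. \<Sum>k. f k x) \<in> schwartz"
proof (rule schwartz_coinduct[where A="{\<lambda>x. \<Sum>k. f k x |f. schwartz_summable f}"])
  fix h :: "real^'n \<Rightarrow> complex" and i k assume "h \<in> {\<lambda>x. \<Sum>k. f k x |f. schwartz_summable f}"
  then obtain f where h: "h = (\<lambda>x. \<Sum>k. f k x)" and f: "schwartz_summable f" by auto
  show "h differentiable_on UNIV" unfolding h
    by (rule differentiable_onI, rule differentiableI, rule schwartz_summable_has_derivative[OF f])
  show "partial i h \<in> {\<lambda>x. \<Sum>k. f k x |f. schwartz_summable f}"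
    unfolding h partial_suminf[OF f]
    by (intro CollectI exI[of _ "\<lambda>k. partial i (f k)"] conjI refl schwartz_summable_partial f)
  show "\<exists>C. \<forall>x. (1 + norm x) ^ k * norm (h x) \<le> C"
    unfolding h using schwartz_summable_weighted(3)[OF f] by blast
qed (use assms in blast)

lemma seminorm_suminf:
  assumes "schwartz_summable f"
  shows "schwartz_seminorm m (\<lambda>x. \<Sum>k. f k x) \<le> (\<Sum>k. schwartz_seminorm m (f k))"
proof (rule seminorm_leI)
  fix \<alpha> :: "'a list" and x assume \<alpha>: "length \<alpha> \<le> m"
  have fS: "\<And>k. f k \<in> schwartz" and s: "summable (\<lambda>k. schwartz_seminorm m (f k))" for m
    using assms by (auto simp: schwartz_summable_def)
  note sp = schwartz_summable_weighted(1)[OF schwartz_summable_partials[OF assms, of \<alpha>], of x]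
  have "(1 + norm x) ^ m * norm (\<Sum>k. partials \<alpha> (f k) x) \<le> (1 + norm x) ^ m * (\<Sum>k. norm (partials \<alpha> (f k) x))"
    by (intro mult_left_mono summable_norm sp) simp
  also have "\<dots> = (\<Sum>k. (1 + norm x) ^ m * norm (partials \<alpha> (f k) x))" by (rule suminf_mult[OF sp, symmetric])
  also have "\<dots> \<le> (\<Sum>k. schwartz_seminorm m (f k))"
    by (intro suminf_le seminorm_ge fS \<alpha> summable_mult sp s)
  finally show "(1 + norm x) ^ m * norm (partials \<alpha> (\<lambda>x. \<Sum>k. f k x) x) \<le> (\<Sum>k. schwartz_seminorm m (f k))"
    by (simp add: partials_suminf[OF assms])
qed

lemma temperedD:
  assumes "tempered T"
  shows "f \<in> schwartz \<Longrightarrow> g \<in> schwartz \<Longrightarrow> T (\<lambda>x. f x + g x) = T f + T g"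
    and "f \<in> schwartz \<Longrightarrow> T (\<lambda>x. c * f x) = c * T f"
    and "\<exists>C k. C \<ge> 0 \<and> (\<forall>f\<in>schwartz. norm (T f) \<le> C * schwartz_seminorm k f)"
proof -
  obtain C k where C: "\<And>f. f \<in> schwartz \<Longrightarrow> norm (T f) \<le> C * schwartz_seminorm k f"
    using assms unfolding tempered_def by blast
  have "norm (T f) \<le> \<bar>C\<bar> * schwartz_seminorm k f" if "f \<in> schwartz" for f
    using C[OF that] seminorm_nonneg[OF that, of k] by (smt (verit) mult_right_mono)
  then show "\<exists>C k. C \<ge> 0 \<and> (\<forall>f\<in>schwartz. norm (T f) \<le> C * schwartz_seminorm k f)"
    by (intro exI[of _ "\<bar>C\<bar>"] exI[of _ k]) auto
qed (use assms in \<open>auto simp: tempered_def\<close>)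

lemma tempered_zero: "tempered T \<Longrightarrow> T (\<lambda>x. 0) = 0"
  using temperedD(2)[OF _ schwartz_zero, of T 0] by simp

lemma tempered_sum:
  assumes "tempered T" "\<And>i. i \<in> I \<Longrightarrow> f i \<in> schwartz"
  shows "T (\<lambda>x. \<Sum>i\<in>I. f i x) = (\<Sum>i\<in>I. T (f i))"
  using assms(2)
  by (induction I rule: infinite_finite_induct)
     (auto simp: tempered_zero assms(1) temperedD(1)[OF assms(1)] schwartz_sum)

lemma tempered_diff:
  assumes "tempered T" "f \<in> schwartz" "g \<in> schwartz"
  shows "T (\<lambda>x. f x - g x) = T f - T g"
proof -
  have "T (\<lambda>x. f x + (- 1) * g x) = T f + (- 1) * T g"
    using temperedD(1)[OF assms(1,2) schwartz_cmult(1)[OF assms(3)]] temperedD(2)[OF assms(1,3)] by metis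
  then show ?thesis by simp
qed

text \<open>A tempered distribution is bounded by one seminorm, and the seminorm of the remainder tends to zero.\<close>

lemma tempered_suminf:
  assumes T: "tempered T" and f: "schwartz_summable f"
  shows "(\<lambda>k. T (f k)) sums T (\<lambda>x. \<Sum>k. f k x)"
proof -
  have fS: "\<And>k. f k \<in> schwartz" and s: "summable (\<lambda>k. schwartz_seminorm m (f k))" for m
    using f by (auto simp: schwartz_summable_def)
  obtain C m where C: "C \<ge> 0" "\<And>f. f \<in> schwartz \<Longrightarrow> norm (T f) \<le> C * schwartz_seminorm m f"
    using temperedD(3)[OF T] by blast
  have shift: "schwartz_summable (\<lambda>k. f (k + n))" for n
    using f unfolding schwartz_summable_def by (auto intro: summable_ignore_initial_segment)
  have le: "norm (T (\<lambda>x. \<Sum>k. f k x) - (\<Sum>k<n. T (f k))) \<le> C * (\<Sum>k. schwartz_seminorm m (f (k + n)))" for n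
  proof -
    have "T (\<lambda>x. \<Sum>k. f k x) - (\<Sum>k<n. T (f k)) = T (\<lambda>x. (\<Sum>k. f k x) - (\<Sum>k<n. f k x))"
      by (subst tempered_diff[OF T schwartz_suminf[OF f] schwartz_sum]) (simp_all add: fS tempered_sum[OF T])
    also have "(\<lambda>x. (\<Sum>k. f k x) - (\<Sum>k<n. f k x)) = (\<lambda>x. \<Sum>k. f (k + n) x)"
      using suminf_split_initial_segment[OF schwartz_summable_weighted(2)[OF f], of _ n] by (auto simp: fun_eq_iff)
    also have "norm (T \<dots>) \<le> C * schwartz_seminorm m (\<lambda>x. \<Sum>k. f (k + n) x)"
      by (intro C schwartz_suminf shift)
    also have "\<dots> \<le> C * (\<Sum>k. schwartz_seminorm m (f (k + n)))"
      by (intro mult_left_mono seminorm_suminf shift C)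
    finally show ?thesis .
  qed
  have lim: "(\<lambda>n. C * (\<Sum>k. schwartz_seminorm m (f (k + n)))) \<longlonglongrightarrow> 0"
    by (rule tendsto_mult_right_zero[OF suminf_exist_split2[OF s]])
  have "(\<lambda>n. T (\<lambda>x. \<Sum>k. f k x) - (\<Sum>k<n. T (f k))) \<longlonglongrightarrow> 0"
    by (rule Lim_null_comparison[OF always_eventually lim]) (use le in blast)
  then have "(\<lambda>n. T (\<lambda>x. \<Sum>k. f k x) - (T (\<lambda>x. \<Sum>k. f k x) - (\<Sum>k<n. T (f k)))) \<longlonglongrightarrow> T (\<lambda>x. \<Sum>k. f k x) - 0"
    by (intro tendsto_diff tendsto_const)
  then show ?thesis by (simp add: sums_def)
qed

lemma fourier_add:
  assumes "f \<in> schwartz" "g \<in> schwartz"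
  shows "fourier (\<lambda>x. f x + g x) = (\<lambda>\<xi>. fourier f \<xi> + fourier g \<xi>)"
  unfolding fourier_def
  using integrable_cis_mult(1)[OF schwartz_integrable[OF assms(1)]] integrable_cis_mult(1)[OF schwartz_integrable[OF assms(2)]]
  by (auto simp: distrib_left)

lemma fourier_cmult: "fourier (\<lambda>x. c * f x) = (\<lambda>\<xi>. c * fourier f \<xi>)"
proof
  fix \<xi>
  have "cis t * (c * f x) = c * (cis t * f x)" for t x by simp
  then show "fourier (\<lambda>x. c * f x) \<xi> = c * fourier f \<xi>"
    unfolding fourier_def by (simp only: integral_mult_right_zero)
qed

lemma tempered_distr_fourier:
  assumes "tempered T" shows "tempered (distr_fourier T)"
  unfolding tempered_def distr_fourier_def
proof (intro conjI ballI allI)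
  fix f g :: "real^'a \<Rightarrow> complex" assume "f \<in> schwartz" "g \<in> schwartz"
  then show "T (fourier (\<lambda>x. f x + g x)) = T (fourier f) + T (fourier g)"
    by (simp add: fourier_add temperedD(1)[OF assms] fourier_schwartz)
next
  fix f :: "real^'a \<Rightarrow> complex" and c assume "f \<in> schwartz"
  then show "T (fourier (\<lambda>x. c * f x)) = c * T (fourier f)"
    by (simp add: fourier_cmult temperedD(2)[OF assms] fourier_schwartz)
next
  obtain C k where C: "C \<ge> 0" "\<And>f. f \<in> schwartz \<Longrightarrow> norm (T f) \<le> C * schwartz_seminorm k f"
    using temperedD(3)[OF assms] by blast
  obtain C' k' where C': "\<And>f :: real^'a \<Rightarrow> complex. f \<in> schwartz \<Longrightarrow> schwartz_seminorm k (fourier f) \<le> C' * schwartz_seminorm k' f"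
    using fourier_seminorm by blast
  have "norm (T (fourier f)) \<le> C * C' * schwartz_seminorm k' f" if "f \<in> schwartz" for f :: "real^'a \<Rightarrow> complex"
    using C(2)[OF fourier_schwartz[OF that]] mult_left_mono[OF C'[OF that] C(1)] by simp
  then show "\<exists>C k. \<forall>f\<in>schwartz. norm (T (fourier f)) \<le> C * schwartz_seminorm k f" by blast
qed

section \<open>Powers of polynomial matrices on compactly supported functions\<close>

text \<open>Each derivative carries the weight \<open>\<delta>\<close>. With \<open>\<delta> = m + 1\<close> the size of multiplication by a polynomial becomes
independent of the number \<open>m\<close> of derivatives.\<close>

definition derivs_le :: "nat \<Rightarrow> real \<Rightarrow> real \<Rightarrow> (real^'n::finite \<Rightarrow> complex) \<Rightarrow> bool" where
  "derivs_le m \<delta> A f \<longleftrightarrow> (\<forall>\<alpha> x. length \<alpha> \<le> m \<longrightarrow> norm (partials \<alpha> f x) \<le> A * \<delta> ^ length \<alpha>)"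

inductive_set poly_fun :: "(real^'n::finite \<Rightarrow> complex) set" where
  const: "(\<lambda>x. c) \<in> poly_fun"
| coord: "(\<lambda>x. complex_of_real (x $ i)) \<in> poly_fun"
| add: "a \<in> poly_fun \<Longrightarrow> b \<in> poly_fun \<Longrightarrow> (\<lambda>x. a x + b x) \<in> poly_fun"
| mult: "a \<in> poly_fun \<Longrightarrow> b \<in> poly_fun \<Longrightarrow> (\<lambda>x. a x * b x) \<in> poly_fun"

lemma poly_fun_smooth: "b \<in> poly_fun \<Longrightarrow> smooth b"
  by (induction rule: poly_fun.induct) (auto intro: smooth_add smooth_mult)

lemma poly_fun_schwartz: "b \<in> poly_fun \<Longrightarrow> f \<in> schwartz \<Longrightarrow> (\<lambda>x. b x * f x) \<in> schwartz"
proof (induction arbitrary: f rule: poly_fun.induct)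
  case (add a b)
  then show ?case using schwartz_add(1)[of "\<lambda>x. a x * f x" "\<lambda>x. b x * f x"] by (simp add: distrib_right)
next
  case (mult a b)
  then show ?case using mult.IH(1)[of "\<lambda>x. b x * f x"] by (simp add: mult.assoc)
qed (auto intro: schwartz_cmult schwartz_coord_mult)

text \<open>Multiplication by \<open>b\<close> on functions that vanish outside the ball of radius \<open>\<rho>\<close> costs a factor \<open>R\<close>, whatever the
number of derivatives.\<close>

definition mult_growth_le :: "real \<Rightarrow> real \<Rightarrow> (real^'n::finite \<Rightarrow> complex) \<Rightarrow> bool" where
  "mult_growth_le \<rho> R b \<longleftrightarrow> (\<forall>m f A. smooth f \<longrightarrow> (\<forall>x. norm x > \<rho> \<longrightarrow> f x = 0) \<longrightarrow> A \<ge> 0 \<longrightarrow> derivs_le m (real m + 1) A f \<longrightarrow>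
    derivs_le m (real m + 1) (R * A) (\<lambda>x. b x * f x))"

lemma mult_growth_leD:
  "mult_growth_le \<rho> R b \<Longrightarrow> smooth f \<Longrightarrow> (\<And>x. norm x > \<rho> \<Longrightarrow> f x = 0) \<Longrightarrow> A \<ge> 0 \<Longrightarrow> derivs_le m (real m + 1) A f \<Longrightarrow>
    derivs_le m (real m + 1) (R * A) (\<lambda>x. b x * f x)"
  unfolding mult_growth_le_def by simp

text \<open>A coordinate is at most \<open>\<rho>\<close> on the support, and the at most \<open>m\<close> terms in which a derivative falls on it have
one derivative less, which saves the weight \<open>m + 1\<close>.\<close>

lemma poly_fun_derivs_le:
  assumes "b \<in> poly_fun" "\<rho> \<ge> 0"
  shows "\<exists>R\<ge>0. mult_growth_le \<rho> R b"
  using assms(1)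
proof induction
  case (const c)
  show ?case
    by (rule exI[of _ "norm c"])
       (auto simp: mult_growth_le_def derivs_le_def partials_cmult norm_mult mult.assoc intro!: mult_left_mono)
next
  case (coord i)
  show ?case unfolding mult_growth_le_def
  proof (intro exI[of _ "\<rho> + 1"] conjI allI impI)
    show "0 \<le> \<rho> + 1" using assms by simp
    fix m A and f :: "real^'a \<Rightarrow> complex"
    assume f: "smooth f" "\<forall>x. norm x > \<rho> \<longrightarrow> f x = 0" "A \<ge> 0" "derivs_le m (real m + 1) A f"
    show "derivs_le m (real m + 1) ((\<rho> + 1) * A) (\<lambda>x. complex_of_real (x $ i) * f x)"
      unfolding derivs_le_def
    proof (intro allI impI)
      fix \<alpha> :: "'a list" and x assume \<alpha>: "length \<alpha> \<le> m"
      show "norm (partials \<alpha> (\<lambda>x. complex_of_real (x $ i) * f x) x) \<le> (\<rho> + 1) * A * (real m + 1) ^ length \<alpha>"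
      proof (cases "norm x > \<rho>")
        case True
        then have "partials \<alpha> (\<lambda>x. complex_of_real (x $ i) * f x) x = 0"
          using f by (intro partials_eq_0_outside[where \<rho>=\<rho>]) auto
        then show ?thesis using assms f by simp
      next
        case False
        have "norm (partials \<alpha> (\<lambda>x. complex_of_real (x $ i) * f x) x) \<le> (norm x + length \<alpha> / (real m + 1)) * A * (real m + 1) ^ length \<alpha>"
          using f \<alpha> by (intro partials_coord_mult_bound) (auto simp: derivs_le_def)
        also have "\<dots> \<le> (\<rho> + 1) * A * (real m + 1) ^ length \<alpha>"
          using False f \<alpha> by (intro mult_right_mono add_mono) auto
        finally show ?thesis .
      qed
    qed
  qed
next
  case (add a b)
  then obtain R1 R2 where R: "R1 \<ge> 0" "R2 \<ge> 0" and R1: "mult_growth_le \<rho> R1 a" and R2: "mult_growth_le \<rho> R2 b"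
    by blast
  note 1 = mult_growth_leD[OF R1] and 2 = mult_growth_leD[OF R2]
  show ?case unfolding mult_growth_le_def
  proof (intro exI[of _ "R1 + R2"] conjI allI impI)
    fix m A and f :: "real^'a \<Rightarrow> complex"
    assume f: "smooth f" "\<forall>x. norm x > \<rho> \<longrightarrow> f x = 0" "A \<ge> 0" "derivs_le m (real m + 1) A f"
    have d: "derivs_le m (real m + 1) (R1 * A) (\<lambda>x. a x * f x)" "derivs_le m (real m + 1) (R2 * A) (\<lambda>x. b x * f x)"
      using 1[OF f(1) _ f(3,4)] 2[OF f(1) _ f(3,4)] f(2) by auto
    have e: "(\<lambda>x. (a x + b x) * f x) = (\<lambda>x. a x * f x + b x * f x)" by (simp add: distrib_right)
    show "derivs_le m (real m + 1) ((R1 + R2) * A) (\<lambda>x. (a x + b x) * f x)"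
      unfolding derivs_le_def e
    proof (intro allI impI)
      fix \<alpha> :: "'a list" and x assume \<alpha>: "length \<alpha> \<le> m"
      have "norm (partials \<alpha> (\<lambda>x. a x * f x) x + partials \<alpha> (\<lambda>x. b x * f x) x) \<le> R1 * A * (real m + 1) ^ length \<alpha> + R2 * A * (real m + 1) ^ length \<alpha>"
        using d \<alpha> unfolding derivs_le_def by (intro norm_triangle_le add_mono) auto
      then show "norm (partials \<alpha> (\<lambda>x. a x * f x + b x * f x) x) \<le> (R1 + R2) * A * (real m + 1) ^ length \<alpha>"
        by (subst partials_add) (auto intro!: smooth_mult poly_fun_smooth[OF add.hyps(1)] poly_fun_smooth[OF add.hyps(2)] f(1) simp: distrib_right)
    qed
  qed (use R in auto)
next
  case (mult a b)
  then obtain R1 R2 where R: "R1 \<ge> 0" "R2 \<ge> 0" and R1: "mult_growth_le \<rho> R1 a" and R2: "mult_growth_le \<rho> R2 b"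
    by blast
  note 1 = mult_growth_leD[OF R1] and 2 = mult_growth_leD[OF R2]
  show ?case unfolding mult_growth_le_def
  proof (intro exI[of _ "R1 * R2"] conjI allI impI)
    fix m A and f :: "real^'a \<Rightarrow> complex"
    assume f: "smooth f" "\<forall>x. norm x > \<rho> \<longrightarrow> f x = 0" "A \<ge> 0" "derivs_le m (real m + 1) A f"
    have d: "derivs_le m (real m + 1) (R2 * A) (\<lambda>x. b x * f x)" using 2[OF f(1) _ f(3,4)] f(2) by auto
    have "derivs_le m (real m + 1) (R1 * (R2 * A)) (\<lambda>x. a x * (b x * f x))"
      using f R by (intro 1 smooth_mult poly_fun_smooth[OF mult.hyps(2)] d) auto
    then show "derivs_le m (real m + 1) (R1 * R2 * A) (\<lambda>x. a x * b x * f x)" by (simp add: mult.assoc)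
  qed (use R in auto)
qed

primrec matpow :: "('m::finite \<Rightarrow> 'm \<Rightarrow> 'a \<Rightarrow> complex) \<Rightarrow> nat \<Rightarrow> 'm \<Rightarrow> 'm \<Rightarrow> 'a \<Rightarrow> complex" where
  "matpow B 0 = (\<lambda>i j x. if i = j then 1 else 0)"
| "matpow B (Suc k) = (\<lambda>i j x. \<Sum>l\<in>UNIV. B l j x * matpow B k i l x)"

text \<open>The rate \<open>R\<close> must be the same for all seminorms: it is the radius outside of which the resolvent series
converges in the Schwartz space. Only the constant \<open>C\<close> depends on the seminorm.\<close>

lemma matpow_bound:
  fixes B :: "'m::finite \<Rightarrow> 'm \<Rightarrow> real^'n::finite \<Rightarrow> complex"
  assumes B: "\<And>i j. B i j \<in> poly_fun" and g: "smooth g" "\<And>x. norm x > \<rho> \<Longrightarrow> g x = 0"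
  shows "\<exists>R>0. \<forall>m. \<exists>C\<ge>0. \<forall>k i j. (\<lambda>x. matpow B k i j x * g x) \<in> schwartz \<and> schwartz_seminorm m (\<lambda>x. matpow B k i j x * g x) \<le> C * R ^ k"
proof -
  define \<rho>' where "\<rho>' = max 0 \<rho>"
  have \<rho>: "\<rho>' \<ge> 0" and g0: "\<And>x. norm x > \<rho>' \<Longrightarrow> g x = 0" using g(2) by (auto simp: \<rho>'_def)
  have "\<exists>r. \<forall>i j. r i j \<ge> 0 \<and> mult_growth_le \<rho>' (r i j) (B i j)"
    using poly_fun_derivs_le[OF B \<rho>] by metis
  then obtain r where r0: "\<And>i j. r i j \<ge> 0" and "\<And>i j. mult_growth_le \<rho>' (r i j) (B i j)" by blast
  note r = mult_growth_leD[OF this(2)]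
  define R where "R = 1 + (\<Sum>i\<in>UNIV. \<Sum>j\<in>UNIV. r i j)"
  have R: "R > 0" "R \<ge> 0" unfolding R_def using r0 by (auto intro!: add_pos_nonneg add_nonneg_nonneg sum_nonneg)
  have R': "(\<Sum>l\<in>UNIV. r l j) \<le> R" for j
  proof -
    have "(\<Sum>l\<in>UNIV. r l j) \<le> (\<Sum>l\<in>UNIV. \<Sum>j\<in>UNIV. r l j)"
      by (intro sum_mono member_le_sum) (auto simp: r0)
    then show ?thesis by (simp add: R_def)
  qed
  have sm: "smooth (matpow B k i j)" for k i j
    by (induction k arbitrary: j) (auto intro!: smooth_sum smooth_mult poly_fun_smooth[OF B])
  have sch: "(\<lambda>x. matpow B k i j x * g x) \<in> schwartz" for k i j
    by (rule schwartz_compact_support[of _ \<rho>]) (auto intro!: smooth_mult sm g simp: g(2))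
  show ?thesis
  proof (rule exI[of _ R], intro conjI allI R)
    fix m
    have gS: "g \<in> schwartz" by (rule schwartz_compact_support[OF g])
    define A where "A = schwartz_seminorm m g"
    have A: "A \<ge> 0" using seminorm_nonneg[OF gS] by (simp add: A_def)
    have dg: "derivs_le m (real m + 1) A g"
      unfolding derivs_le_def
    proof (intro allI impI)
      fix \<alpha> :: "'n list" and x assume "length \<alpha> \<le> m"
      have "norm (partials \<alpha> g x) \<le> (1 + norm x) ^ m * norm (partials \<alpha> g x)"
        by (simp add: mult_left_le mult_le_cancel_right1)
      also have "\<dots> \<le> A" unfolding A_def by (rule seminorm_ge) fact+
      also have "\<dots> \<le> A * (real m + 1) ^ length \<alpha>" using A by (simp add: mult_le_cancel_left1)
      finally show "norm (partials \<alpha> g x) \<le> A * (real m + 1) ^ length \<alpha>" .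
    qed
    have d: "derivs_le m (real m + 1) (R ^ k * A) (\<lambda>x. matpow B k i j x * g x)" for k i j
    proof (induction k arbitrary: j)
      case 0
      show ?case using dg A by (cases "i = j") (auto simp: derivs_le_def partials_cmult[of "\<lambda>x. 0" _ 0, simplified])
    next
      case (Suc k)
      have each: "derivs_le m (real m + 1) (r l j * (R ^ k * A)) (\<lambda>x. B l j x * (matpow B k i l x * g x))" for l
        using A R by (intro r Suc smooth_mult sm g) (auto simp: g0)
      have e: "(\<lambda>x. matpow B (Suc k) i j x * g x) = (\<lambda>x. \<Sum>l\<in>UNIV. B l j x * (matpow B k i l x * g x))"
        by (simp add: sum_distrib_right mult.assoc)
      show ?case unfolding derivs_le_def e
      proof (intro allI impI)
        fix \<alpha> :: "'n list" and x assume \<alpha>: "length \<alpha> \<le> m"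
        have "norm (\<Sum>l\<in>UNIV. partials \<alpha> (\<lambda>x. B l j x * (matpow B k i l x * g x)) x)
            \<le> (\<Sum>l\<in>UNIV. r l j * (R ^ k * A) * (real m + 1) ^ length \<alpha>)"
          using each \<alpha> by (intro sum_norm_le) (auto simp: derivs_le_def)
        also have "\<dots> = (\<Sum>l\<in>UNIV. r l j) * (R ^ k * A * (real m + 1) ^ length \<alpha>)"
          by (simp add: sum_distrib_right mult.assoc)
        also have "\<dots> \<le> R * (R ^ k * A * (real m + 1) ^ length \<alpha>)"
          using A R by (intro mult_right_mono R') auto
        finally show "norm (partials \<alpha> (\<lambda>x. \<Sum>l\<in>UNIV. B l j x * (matpow B k i l x * g x)) x) \<le> R ^ Suc k * A * (real m + 1) ^ length \<alpha>"
          by (subst partials_sum) (auto intro!: smooth_mult poly_fun_smooth[OF B] sm g simp: mult_ac)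
      qed
    qed
    have "schwartz_seminorm m (\<lambda>x. matpow B k i j x * g x) \<le> ((1 + \<rho>') ^ m * A * (real m + 1) ^ m) * R ^ k" for k i j
    proof (rule seminorm_leI)
      fix \<alpha> :: "'n list" and x assume \<alpha>: "length \<alpha> \<le> m"
      show "(1 + norm x) ^ m * norm (partials \<alpha> (\<lambda>x. matpow B k i j x * g x) x) \<le> (1 + \<rho>') ^ m * A * (real m + 1) ^ m * R ^ k"
      proof (cases "norm x > \<rho>'")
        case True
        then have "partials \<alpha> (\<lambda>x. matpow B k i j x * g x) x = 0"
          by (intro partials_eq_0_outside[where \<rho>=\<rho>']) (auto simp: g0)
        then show ?thesis using A R \<rho> by simp
      next
        case False
        have "norm (partials \<alpha> (\<lambda>x. matpow B k i j x * g x) x) \<le> R ^ k * A * (real m + 1) ^ length \<alpha>"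
          using d \<alpha> by (auto simp: derivs_le_def)
        also have "\<dots> \<le> R ^ k * A * (real m + 1) ^ m"
          using A R \<alpha> by (intro mult_left_mono power_increasing) auto
        finally have "(1 + norm x) ^ m * norm (partials \<alpha> (\<lambda>x. matpow B k i j x * g x) x) \<le> (1 + \<rho>') ^ m * (R ^ k * A * (real m + 1) ^ m)"
          using False \<rho> by (intro mult_mono power_mono) auto
        then show ?thesis by (simp add: mult_ac)
      qed
    qed
    then show "\<exists>C\<ge>0. \<forall>k i j. (\<lambda>x. matpow B k i j x * g x) \<in> schwartz \<and> schwartz_seminorm m (\<lambda>x. matpow B k i j x * g x) \<le> C * R ^ k"
      using sch A \<rho> by (intro exI[of _ "(1 + \<rho>') ^ m * A * (real m + 1) ^ m"]) auto
  qed
qed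

section \<open>A Laplace transform argument\<close>

lemma higher_deriv_exp: "(deriv ^^ k) (\<lambda>u. a * exp (c * u)) = (\<lambda>u::complex. a * c ^ k * exp (c * u))"
proof (induction k)
  case (Suc k)
  have "deriv (\<lambda>u. a * c ^ k * exp (c * u)) u = a * c ^ Suc k * exp (c * u)" for u
    by (rule DERIV_imp_deriv) (auto intro!: derivative_eq_intros)
  then show ?case by (simp add: Suc)
qed simp

text \<open>Cauchy's formula for the derivatives of the exponential, term by term.\<close>

lemma contour_integral_exp_series:
  fixes a :: "nat \<Rightarrow> complex"
  assumes a: "\<And>k. norm (a k) \<le> C * R ^ k" and R: "0 \<le> R" "R < r"
  shows "(\<lambda>z. \<Sum>k. a k * exp (c * z) / z ^ Suc k) contour_integrable_on circlepath 0 r"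
    and "contour_integral (circlepath 0 r) (\<lambda>z. \<Sum>k. a k * exp (c * z) / z ^ Suc k) = 2 * pi * \<i> * (\<Sum>k. a k * c ^ k / fact k)"
proof -
  have r: "r > 0" using R by simp
  define E where "E = exp (norm c * r)"
  have int: "((\<lambda>z. a k * exp (c * z) / z ^ Suc k) has_contour_integral (2 * pi * \<i>) * (a k * c ^ k / fact k)) (circlepath 0 r)" for k
    using Cauchy_has_contour_integral_higher_derivative_circlepath[of 0 r "\<lambda>u. a k * exp (c * u)" 0 k] r
    by (force simp: higher_deriv_exp intro!: continuous_intros holomorphic_intros)
  have sumint: "((\<lambda>z. \<Sum>k<n. a k * exp (c * z) / z ^ Suc k) has_contour_integral (\<Sum>k<n. (2 * pi * \<i>) * (a k * c ^ k / fact k))) (circlepath 0 r)" for n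
    by (intro has_contour_integral_sum int) auto
  have ul: "uniform_limit (sphere 0 r) (\<lambda>n z. \<Sum>k<n. a k * exp (c * z) / z ^ Suc k) (\<lambda>z. \<Sum>k. a k * exp (c * z) / z ^ Suc k) sequentially"
  proof (rule Weierstrass_m_test)
    fix k and z :: complex assume "z \<in> sphere 0 r"
    then have z: "norm z = r" by simp
    have "norm (a k * exp (c * z) / z ^ Suc k) \<le> (C * R ^ k) * E / r ^ Suc k"
    proof -
      have "norm (exp (c * z)) \<le> exp (norm (c * z))" by (rule norm_exp)
      also have "\<dots> = E" unfolding E_def norm_mult z ..
      finally show ?thesis unfolding norm_mult norm_divide norm_power z
        using r a[of k] order_trans[OF norm_ge_zero a[of k]] by (intro divide_right_mono mult_mono) auto
    qed
    then show "norm (a k * exp (c * z) / z ^ Suc k) \<le> (C * E / r) * (R / r) ^ k"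
      by (simp add: field_simps power_divide)
  next
    show "summable (\<lambda>k. C * E / r * (R / r) ^ k)"
      using R r by (intro summable_mult summable_geometric) auto
  qed
  note lim = contour_integral_uniform_limit_circlepath[OF always_eventually ul _ r]
  have ev: "\<forall>n. (\<lambda>z. \<Sum>k<n. a k * exp (c * z) / z ^ Suc k) contour_integrable_on circlepath 0 r"
    using sumint has_contour_integral_integrable by blast
  show "(\<lambda>z. \<Sum>k. a k * exp (c * z) / z ^ Suc k) contour_integrable_on circlepath 0 r"
    by (rule lim(1)[OF ev]) simp
  have "(\<lambda>n. \<Sum>k<n. (2 * pi * \<i>) * (a k * c ^ k / fact k)) \<longlonglongrightarrow> contour_integral (circlepath 0 r) (\<lambda>z. \<Sum>k. a k * exp (c * z) / z ^ Suc k)"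
    using lim(2)[OF ev] contour_integral_unique[OF sumint] by simp
  then have "(\<lambda>k. (2 * pi * \<i>) * (a k * c ^ k / fact k)) sums contour_integral (circlepath 0 r) (\<lambda>z. \<Sum>k. a k * exp (c * z) / z ^ Suc k)"
    by (simp add: sums_def)
  then have s: "(\<Sum>k. (2 * pi * \<i>) * (a k * c ^ k / fact k)) = contour_integral (circlepath 0 r) (\<lambda>z. \<Sum>k. a k * exp (c * z) / z ^ Suc k)"
    and "summable (\<lambda>k. (2 * pi * \<i>) * (a k * c ^ k / fact k))" by (auto simp: sums_iff)
  then have "summable (\<lambda>k. a k * c ^ k / fact k)" by (subst (asm) summable_cmult_iff) auto
  then show "contour_integral (circlepath 0 r) (\<lambda>z. \<Sum>k. a k * exp (c * z) / z ^ Suc k) = 2 * pi * \<i> * (\<Sum>k. a k * c ^ k / fact k)"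
    unfolding s[symmetric] by (rule suminf_mult)
qed

text \<open>Variation of constants gives \<open>y z t = exp (z t) y z 0 - (\<integral>\<^sub>0\<^sup>t exp (z (t - \<tau>)) x \<tau> d\<tau>)\<close>. The integral is an entire
function of \<open>z\<close>, so the contour integrals of the other two terms over \<open>|z| = r\<close> agree. By Laurent expansion
they are \<open>2 \<pi> \<i>\<close> times the two sides of the claim. In the application \<open>y z\<close> is the pairing with a resolvent, \<open>x\<close>
is the pairing with the test function itself, and \<open>a k\<close>, \<open>b k\<close> are the pairings with the \<open>k\<close>-th powers of the operator at the two times.\<close>

lemma laplace_flow:
  fixes x :: "real \<Rightarrow> complex" and y :: "complex \<Rightarrow> real \<Rightarrow> complex" and a b :: "nat \<Rightarrow> complex"
  assumes t: "0 \<le> t" and x: "continuous_on {0..t} x"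
    and y: "\<And>z \<tau>. norm z = r \<Longrightarrow> \<tau> \<in> {0..t} \<Longrightarrow> (y z has_vector_derivative z * y z \<tau> - x \<tau>) (at \<tau> within {0..t})"
    and y0: "\<And>z. norm z = r \<Longrightarrow> (\<lambda>k. a k / z ^ Suc k) sums y z 0"
    and yt: "\<And>z. norm z = r \<Longrightarrow> (\<lambda>k. b k / z ^ Suc k) sums y z t"
    and a: "\<And>k. norm (a k) \<le> C * R ^ k" and b: "\<And>k. norm (b k) \<le> C' * R ^ k" and R: "0 \<le> R" "R < r"
  shows "b 0 = (\<Sum>k. a k * of_real t ^ k / fact k)"
proof -
  have r: "r > 0" using R by simp
  \<comment> \<open>the entire function that disappears under the contour integral\<close>
  define F where "F z = integral (cbox 0 t) (\<lambda>\<tau>. exp (z * of_real (t - \<tau>)) * x \<tau>)" for z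
  have hol: "F holomorphic_on UNIV"
    unfolding F_def
  proof (rule leibniz_rule_holomorphic)
    show "((\<lambda>z. exp (z * of_real (t - \<tau>)) * x \<tau>) has_field_derivative of_real (t - \<tau>) * exp (z * of_real (t - \<tau>)) * x \<tau>) (at z within UNIV)" for z \<tau>
      by (auto intro!: derivative_eq_intros)
    show "(\<lambda>\<tau>. exp (z * of_real (t - \<tau>)) * x \<tau>) integrable_on cbox 0 t" for z
      using x by (intro integrable_continuous continuous_intros) auto
    show "continuous_on (UNIV \<times> cbox 0 t) (\<lambda>(z, \<tau>). of_real (t - \<tau>) * exp (z * of_real (t - \<tau>)) * x \<tau>)"
      using x by (auto simp: split_beta' intro!: continuous_intros continuous_on_compose2[OF x])
  qed auto
  let ?Y0 = "\<lambda>z. \<Sum>k. a k * exp (of_real t * z) / z ^ Suc k" and ?Yt = "\<lambda>z. \<Sum>k. b k * exp (0 * z) / z ^ Suc k"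
  have eq: "F z = ?Y0 z - ?Yt z" if z: "norm z = r" for z
  proof -
    have "((\<lambda>\<tau>. - (exp (z * of_real (t - \<tau>)) * x \<tau>)) has_integral (exp (z * of_real (t - t)) * y z t - exp (z * of_real (t - 0)) * y z 0)) {0..t}"
    proof (rule fundamental_theorem_of_calculus[OF t])
      fix \<tau> assume \<tau>: "\<tau> \<in> {0..t}"
      have e: "((\<lambda>\<tau>. exp (z * of_real (t - \<tau>))) has_vector_derivative - z * exp (z * of_real (t - \<tau>))) (at \<tau> within {0..t})"
      proof -
        have "((\<lambda>w. exp (z * (of_real t - w))) has_field_derivative - z * exp (z * (of_real t - of_real \<tau>))) (at (of_real \<tau>))"
          by (auto intro!: derivative_eq_intros)
        from has_vector_derivative_real_field[OF this] show ?thesis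
          by (auto intro: has_vector_derivative_at_within)
      qed
      show "((\<lambda>\<tau>. exp (z * of_real (t - \<tau>)) * y z \<tau>) has_vector_derivative - (exp (z * of_real (t - \<tau>)) * x \<tau>)) (at \<tau> within {0..t})"
        using has_vector_derivative_mult[OF e y[OF z \<tau>]] by (simp add: algebra_simps)
    qed
    then have "F z = exp (z * of_real t) * y z 0 - y z t"
      unfolding F_def by (simp add: integral_unique has_integral_neg_iff integral_neg)
    moreover have "?Y0 z = exp (z * of_real t) * y z 0"
      using sums_unique[OF sums_mult[OF y0[OF z], of "exp (z * of_real t)"]] by (simp add: mult_ac)
    moreover have "?Yt z = y z t" using sums_unique[OF yt[OF z]] by simp
    ultimately show ?thesis by simp
  qed
  note ca = contour_integral_exp_series[OF a R, of "of_real t"] and cb = contour_integral_exp_series[OF b R, of 0]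
  have "contour_integral (circlepath 0 r) F = 0"
    by (rule contour_integral_unique, rule Cauchy_theorem_convex_simple[OF hol convex_UNIV]) simp_all
  moreover have "contour_integral (circlepath 0 r) F = contour_integral (circlepath 0 r) (\<lambda>z. ?Y0 z - ?Yt z)"
    by (rule contour_integral_eq) (use r eq in auto)
  moreover have "\<dots> = 2 * pi * \<i> * (\<Sum>k. a k * of_real t ^ k / fact k) - 2 * pi * \<i> * (\<Sum>k. b k * 0 ^ k / fact k)"
    by (subst contour_integral_diff[OF ca(1) cb(1)]) (simp only: ca(2) cb(2))
  moreover have "(\<Sum>k. b k * 0 ^ k / fact k) = b 0"
    using suminf_finite[of "{0}" "\<lambda>k. b k * 0 ^ k / fact k"] by simp
  ultimately show ?thesis by simp
qed

section \<open>Evolution by a polynomial symbol\<close>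

definition matexp :: "('m::finite \<Rightarrow> 'm \<Rightarrow> 'a \<Rightarrow> complex) \<Rightarrow> real \<Rightarrow> 'm \<Rightarrow> 'm \<Rightarrow> 'a \<Rightarrow> complex" where
  "matexp B t i j x = (\<Sum>k. of_real (t ^ k / fact k) * matpow B k i j x)"

text \<open>If \<open>g = 0\<close> the series of the \<open>c k\<close> may diverge. In the application \<open>g\<close> is the value of a cut-off
at some point.\<close>

lemma suminf_mult2_unconditional:
  fixes c :: "nat \<Rightarrow> 'a::{real_normed_field}"
  assumes "summable (\<lambda>k. c k * g)"
  shows "(\<Sum>k. c k * g) = (\<Sum>k. c k) * g"
proof (cases "g = 0")
  case False
  then have "summable c" using summable_mult2[OF assms, of "1 / g"] by simp
  then show ?thesis by (rule suminf_mult2[symmetric])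
qed simp

text \<open>The hypothesis controls the derivative only for fixed test functions, so the equation cannot be tested
against \<open>exp ((t - \<tau>) B) g\<close> without a uniform bound for the curve \<open>X\<close>. The resolvent \<open>(z - B)\<^sup>-\<^sup>1 g\<close> is a fixed test
function for each \<open>z\<close>, and \<open>laplace_flow\<close> passes from resolvents to the exponential.\<close>

theorem polynomial_flow:
  fixes B :: "'m::finite \<Rightarrow> 'm \<Rightarrow> real^'n::finite \<Rightarrow> complex" and X :: "real \<Rightarrow> 'm \<Rightarrow> 'n distr"
  assumes B: "\<And>i j. B i j \<in> poly_fun"
    and X: "\<And>t i. 0 \<le> t \<Longrightarrow> tempered (X t i)"
    and D: "\<And>G t. (\<And>i. G i \<in> schwartz) \<Longrightarrow> 0 \<le> t \<Longrightarrow>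
      ((\<lambda>\<tau>. \<Sum>i\<in>UNIV. X \<tau> i (G i)) has_vector_derivative (\<Sum>j\<in>UNIV. X t j (\<lambda>\<xi>. \<Sum>i\<in>UNIV. B i j \<xi> * G i \<xi>))) (at t within {0..})"
    and g: "smooth g" "\<And>x. norm x > \<rho> \<Longrightarrow> g x = 0" and t: "0 \<le> t"
  shows "(\<lambda>\<xi>. matexp B t i j \<xi> * g \<xi>) \<in> schwartz"
    and "X t i g = (\<Sum>j\<in>UNIV. X 0 j (\<lambda>\<xi>. matexp B t i j \<xi> * g \<xi>))"
proof -
  let ?P = "\<lambda>k j x. matpow B k i j x * g x"
  obtain R where R: "R > 0" and ex: "\<forall>m. \<exists>C\<ge>0. \<forall>k i j. (\<lambda>x. matpow B k i j x * g x) \<in> schwartz \<and> schwartz_seminorm m (\<lambda>x. matpow B k i j x * g x) \<le> C * R ^ k"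
    using matpow_bound[of B g \<rho>, OF B g(1)] g(2) by blast
  have "\<forall>m. \<exists>C. C \<ge> 0 \<and> (\<forall>k j. ?P k j \<in> schwartz \<and> schwartz_seminorm m (?P k j) \<le> C * R ^ k)"
    using ex by blast
  from choice[OF this] obtain C where "\<forall>m. C m \<ge> 0 \<and> (\<forall>k j. ?P k j \<in> schwartz \<and> schwartz_seminorm m (?P k j) \<le> C m * R ^ k)"
    by blast
  then have C: "\<And>m. C m \<ge> 0" and PS: "\<And>k j. ?P k j \<in> schwartz" and Ple: "\<And>m k j. schwartz_seminorm m (?P k j) \<le> C m * R ^ k"
    by blast+
  have S1: "schwartz_summable (\<lambda>k x. c k * ?P k j x)" if c: "summable (\<lambda>k. norm (c k) * R ^ k)" for c :: "nat \<Rightarrow> complex" and j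
    unfolding schwartz_summable_def
  proof (intro conjI allI)
    show "(\<lambda>x. c k * ?P k j x) \<in> schwartz" for k by (intro schwartz_cmult PS)
    fix m
    show "summable (\<lambda>k. schwartz_seminorm m (\<lambda>x. c k * ?P k j x))"
    proof (rule summable_comparison_test'[OF summable_mult[OF c, of "C m"], of 0])
      fix k :: nat
      have "schwartz_seminorm m (\<lambda>x. c k * ?P k j x) \<le> norm (c k) * schwartz_seminorm m (?P k j)"
        by (rule schwartz_cmult[OF PS])
      also have "\<dots> \<le> norm (c k) * (C m * R ^ k)" by (intro mult_left_mono Ple) auto
      finally show "norm (schwartz_seminorm m (\<lambda>x. c k * ?P k j x)) \<le> C m * (norm (c k) * R ^ k)"
        using seminorm_nonneg[OF schwartz_cmult(1)[OF PS], of m "c k" k j] by (simp add: mult_ac)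
    qed
  qed
  have e: "summable (\<lambda>k. norm (complex_of_real (t ^ k / fact k)) * R ^ k)"
  proof -
    have "summable (\<lambda>k. (t * R) ^ k /\<^sub>R fact k)" by (rule summable_exp_generic)
    moreover have "norm (complex_of_real (t ^ k / fact k)) * R ^ k = (t * R) ^ k /\<^sub>R fact k" for k
      using t by (subst norm_of_real) (simp add: power_mult_distrib divide_inverse mult_ac)
    ultimately show ?thesis by simp
  qed
  have exp_eq: "(\<lambda>\<xi>. matexp B t i j \<xi> * g \<xi>) = (\<lambda>\<xi>. \<Sum>k. of_real (t ^ k / fact k) * ?P k j \<xi>)" for j
  proof
    fix \<xi>
    have "summable (\<lambda>k. (of_real (t ^ k / fact k) * matpow B k i j \<xi>) * g \<xi>)"
      using schwartz_summable_weighted(2)[OF S1[OF e, of j], of \<xi>] by (simp only: mult.assoc)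
    from suminf_mult2_unconditional[OF this]
    show "matexp B t i j \<xi> * g \<xi> = (\<Sum>k. of_real (t ^ k / fact k) * ?P k j \<xi>)"
      unfolding matexp_def by (simp only: mult.assoc)
  qed
  show "(\<lambda>\<xi>. matexp B t i j \<xi> * g \<xi>) \<in> schwartz"
    unfolding exp_eq by (rule schwartz_suminf[OF S1[OF e]])
  define coef where "coef s k = (\<Sum>j\<in>UNIV. X s j (?P k j))" for s k
  have coef_bound: "\<exists>K. \<forall>k. norm (coef s k) \<le> K * R ^ k" if s: "0 \<le> s" for s
  proof -
    have "\<exists>K. \<forall>k. norm (X s j (?P k j)) \<le> K * R ^ k" for j
    proof -
      obtain c m where c: "c \<ge> 0" "\<And>f. f \<in> schwartz \<Longrightarrow> norm (X s j f) \<le> c * schwartz_seminorm m f"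
        using temperedD(3)[OF X[OF s]] by blast
      have "norm (X s j (?P k j)) \<le> (c * C m) * R ^ k" for k
        using c(2)[OF PS[of k j]] mult_left_mono[OF Ple[of m k j] c(1)] by simp
      then show ?thesis by blast
    qed
    then obtain K where K: "\<And>j k. norm (X s j (?P k j)) \<le> K j * R ^ k" by metis
    have "norm (coef s k) \<le> (\<Sum>j\<in>UNIV. K j) * R ^ k" for k
      unfolding coef_def sum_distrib_right by (intro sum_norm_le K)
    then show ?thesis by blast
  qed
  obtain K0 where K0: "\<And>k. norm (coef 0 k) \<le> K0 * R ^ k" using coef_bound[of 0] by auto
  obtain Kt where Kt: "\<And>k. norm (coef t k) \<le> Kt * R ^ k" using coef_bound[OF t] by auto
  \<comment> \<open>the resolvent of \<open>B\<close> applied to \<open>g\<close> in component \<open>i\<close>, as a Neumann series for \<open>|z| = R + 1\<close>\<close>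
  define Y where "Y z j = (\<lambda>x. \<Sum>k. (1 / z ^ Suc k) * ?P k j x)" for z j
  define y where "y z \<tau> = (\<Sum>j\<in>UNIV. X \<tau> j (Y z j))" for z \<tau>
  have zs: "summable (\<lambda>k. norm (1 / z ^ Suc k) * R ^ k)" if z: "norm z = R + 1" for z :: complex
  proof -
    have "summable (\<lambda>k. (1 / (R + 1)) * (R / (R + 1)) ^ k)"
      using R by (intro summable_mult summable_geometric) auto
    then show ?thesis using z R by (simp add: norm_divide norm_mult norm_power power_divide)
  qed
  have YS: "Y z j \<in> schwartz" if "norm z = R + 1" for z j
    unfolding Y_def by (rule schwartz_suminf[OF S1[OF zs[OF that]]])
  have ysum: "(\<lambda>k. coef s k / z ^ Suc k) sums y z s" if z: "norm z = R + 1" and s: "0 \<le> s" for z s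
  proof -
    have "(\<lambda>k. X s j (\<lambda>x. (1 / z ^ Suc k) * ?P k j x)) sums X s j (Y z j)" for j
      unfolding Y_def by (rule tempered_suminf[OF X[OF s] S1[OF zs[OF z]]])
    then have "(\<lambda>k. (1 / z ^ Suc k) * X s j (?P k j)) sums X s j (Y z j)" for j
      unfolding temperedD(2)[OF X[OF s] PS] .
    then have "(\<lambda>k. \<Sum>j\<in>UNIV. (1 / z ^ Suc k) * X s j (?P k j)) sums y z s"
      unfolding y_def by (intro sums_sum)
    then show ?thesis unfolding coef_def by (simp only: sum_distrib_left[symmetric]) (simp add: field_simps)
  qed
  \<comment> \<open>the resolvent equation\<close>
  have BY: "(\<lambda>\<xi>. \<Sum>l\<in>UNIV. B l j \<xi> * Y z l \<xi>) = (\<lambda>\<xi>. z * Y z j \<xi> - (if i = j then 1 else 0) * g \<xi>)" if z: "norm z = R + 1" for z j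
  proof
    fix \<xi>
    have z0: "z \<noteq> 0" using z R by auto
    have sm: "summable (\<lambda>k. (1 / z ^ Suc k) * ?P k l \<xi>)" for l
      by (rule schwartz_summable_weighted(2)[OF S1[OF zs[OF z]]])
    have "(\<Sum>l\<in>UNIV. B l j \<xi> * Y z l \<xi>) = (\<Sum>l\<in>UNIV. \<Sum>k. B l j \<xi> * ((1 / z ^ Suc k) * ?P k l \<xi>))"
      unfolding Y_def by (intro sum.cong refl suminf_mult[symmetric] sm)
    also have "\<dots> = (\<Sum>k. \<Sum>l\<in>UNIV. B l j \<xi> * ((1 / z ^ Suc k) * ?P k l \<xi>))"
      by (intro suminf_sum[symmetric] summable_mult sm)
    also have "\<dots> = (\<Sum>k. z * ((1 / z ^ Suc (Suc k)) * ?P (Suc k) j \<xi>))"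
      using z0 by (simp add: sum_distrib_left sum_distrib_right mult_ac)
    also have "\<dots> = z * (\<Sum>k. (1 / z ^ Suc (Suc k)) * ?P (Suc k) j \<xi>)"
      by (rule suminf_mult, subst summable_Suc_iff) (rule sm)
    also have "(\<Sum>k. (1 / z ^ Suc (Suc k)) * ?P (Suc k) j \<xi>) = Y z j \<xi> - (1 / z ^ Suc 0) * ?P 0 j \<xi>"
      unfolding Y_def using suminf_split_head[OF sm] by simp
    finally show "(\<Sum>l\<in>UNIV. B l j \<xi> * Y z l \<xi>) = z * Y z j \<xi> - (if i = j then 1 else 0) * g \<xi>"
      using z0 by (simp add: right_diff_distrib)
  qed
  have gS: "g \<in> schwartz" by (rule schwartz_compact_support[OF g])
  have D1: "((\<lambda>\<tau>. X \<tau> i g) has_vector_derivative (\<Sum>j\<in>UNIV. X s j (\<lambda>\<xi>. \<Sum>l\<in>UNIV. B l j \<xi> * (if l = i then g \<xi> else 0)))) (at s within {0..})" if s: "0 \<le> s" for s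
  proof -
    have eqv: "(\<Sum>l\<in>UNIV. X \<tau> l (\<lambda>\<xi>. if l = i then g \<xi> else 0)) = X \<tau> i g" if "0 \<le> \<tau>" for \<tau>
    proof -
      have "(\<Sum>l\<in>UNIV. X \<tau> l (\<lambda>\<xi>. if l = i then g \<xi> else 0)) = (\<Sum>l\<in>UNIV. if l = i then X \<tau> i g else 0)"
        by (intro sum.cong) (auto simp: tempered_zero[OF X[OF that]])
      then show ?thesis by simp
    qed
    have GS: "(\<lambda>\<xi>. if l = i then g \<xi> else 0) \<in> schwartz" for l
      using gS schwartz_zero by (cases "l = i") auto
    show ?thesis
      by (rule has_vector_derivative_transform[OF _ _ D[of "\<lambda>l \<xi>. if l = i then g \<xi> else 0", OF GS s]])
         (use s eqv in auto)
  qed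
  have "coef t 0 = (\<Sum>k. coef 0 k * of_real t ^ k / fact k)"
  proof (rule laplace_flow[where r = "R + 1" and R = R and x = "\<lambda>\<tau>. X \<tau> i g" and y = y])
    show "continuous_on {0..t} (\<lambda>\<tau>. X \<tau> i g)"
      unfolding continuous_on_eq_continuous_within
    proof
      fix \<tau> assume \<tau>: "\<tau> \<in> {0..t}"
      show "continuous (at \<tau> within {0..t}) (\<lambda>\<tau>. X \<tau> i g)"
        by (rule has_vector_derivative_continuous, rule has_vector_derivative_within_subset[OF D1]) (use \<tau> in auto)
    qed
    show "(y z has_vector_derivative z * y z \<tau> - X \<tau> i g) (at \<tau> within {0..t})" if z: "norm z = R + 1" and \<tau>: "\<tau> \<in> {0..t}" for z \<tau>
    proof -
      have \<tau>0: "0 \<le> \<tau>" using \<tau> by simp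
      have "(y z has_vector_derivative (\<Sum>j\<in>UNIV. X \<tau> j (\<lambda>\<xi>. \<Sum>l\<in>UNIV. B l j \<xi> * Y z l \<xi>))) (at \<tau> within {0..})"
        unfolding y_def by (rule D[OF YS[OF z] \<tau>0])
      also have "(\<Sum>j\<in>UNIV. X \<tau> j (\<lambda>\<xi>. \<Sum>l\<in>UNIV. B l j \<xi> * Y z l \<xi>)) = (\<Sum>j\<in>UNIV. z * X \<tau> j (Y z j) - (if i = j then X \<tau> i g else 0))"
      proof (intro sum.cong refl)
        fix j
        have "X \<tau> j (\<lambda>\<xi>. z * Y z j \<xi> - (if i = j then 1 else 0) * g \<xi>) = X \<tau> j (\<lambda>\<xi>. z * Y z j \<xi>) - X \<tau> j (\<lambda>\<xi>. (if i = j then 1 else 0) * g \<xi>)"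
          by (intro tempered_diff X \<tau>0 schwartz_cmult YS z gS)
        also have "\<dots> = z * X \<tau> j (Y z j) - (if i = j then 1 else 0) * X \<tau> j g"
          by (simp only: temperedD(2)[OF X[OF \<tau>0] YS[OF z]] temperedD(2)[OF X[OF \<tau>0] gS])
        finally show "X \<tau> j (\<lambda>\<xi>. \<Sum>l\<in>UNIV. B l j \<xi> * Y z l \<xi>) = z * X \<tau> j (Y z j) - (if i = j then X \<tau> i g else 0)"
          unfolding BY[OF z] by simp
      qed
      also have "\<dots> = z * y z \<tau> - X \<tau> i g" by (simp add: sum_subtractf y_def sum_distrib_left)
      finally show ?thesis by (rule has_vector_derivative_within_subset) auto
    qed
    show "(\<lambda>k. coef 0 k / z ^ Suc k) sums y z 0" if "norm z = R + 1" for z by (rule ysum[OF that]) simp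
    show "(\<lambda>k. coef t k / z ^ Suc k) sums y z t" if "norm z = R + 1" for z by (rule ysum[OF that t])
  qed (use t R K0 Kt in auto)
  also have "coef t 0 = X t i g"
  proof -
    have "coef t 0 = (\<Sum>j\<in>UNIV. if i = j then X t i g else 0)" unfolding coef_def
      by (intro sum.cong) (auto simp: tempered_zero[OF X[OF t]])
    then show ?thesis by simp
  qed
  also have "(\<Sum>k. coef 0 k * of_real t ^ k / fact k) = (\<Sum>j\<in>UNIV. X 0 j (\<lambda>\<xi>. matexp B t i j \<xi> * g \<xi>))"
  proof -
    have "(\<lambda>k. X 0 j (\<lambda>x. of_real (t ^ k / fact k) * ?P k j x)) sums X 0 j (\<lambda>\<xi>. matexp B t i j \<xi> * g \<xi>)" for j
      unfolding exp_eq by (rule tempered_suminf[OF X S1[OF e]]) simp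
    then have "(\<lambda>k. of_real (t ^ k / fact k) * X 0 j (?P k j)) sums X 0 j (\<lambda>\<xi>. matexp B t i j \<xi> * g \<xi>)" for j
      unfolding temperedD(2)[OF X[OF order_refl] PS] .
    then have "(\<lambda>k. \<Sum>j\<in>UNIV. of_real (t ^ k / fact k) * X 0 j (?P k j)) sums (\<Sum>j\<in>UNIV. X 0 j (\<lambda>\<xi>. matexp B t i j \<xi> * g \<xi>))"
      by (intro sums_sum)
    then have "(\<lambda>k. coef 0 k * of_real t ^ k / fact k) sums (\<Sum>j\<in>UNIV. X 0 j (\<lambda>\<xi>. matexp B t i j \<xi> * g \<xi>))"
      unfolding coef_def by (simp only: sum_distrib_left[symmetric]) (simp add: mult_ac)
    then show ?thesis by (simp add: sums_iff)
  qed
  finally show "X t i g = (\<Sum>j\<in>UNIV. X 0 j (\<lambda>\<xi>. matexp B t i j \<xi> * g \<xi>))" .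
qed

section \<open>The linear system in Fourier variables\<close>

definition space_index :: "'n + 'n \<Rightarrow> 'n" where "space_index = case_sum id id"

lemma space_index_simps [simp]: "space_index (Inl i) = i" "space_index (Inr i) = i" by (simp_all add: space_index_def)

text \<open>The matrix \<open>A\<close> by which the system acts on gradients, up to the factor \<open>|\<xi>|\<^sup>2\<close>. The index \<^const>\<open>True\<close> stands
for \<open>\<nabla>q\<close> and \<^const>\<open>False\<close> for \<open>u\<close>, as does \<^const>\<open>isl\<close> for the components of the pair; \<open>\<nu>\<close> will be \<open>\<lambda> + 2\<mu>\<close>.\<close>

definition acoustic_mat :: "real \<Rightarrow> real \<Rightarrow> bool \<Rightarrow> bool \<Rightarrow> real" where
  "acoustic_mat \<nu> \<kappa> a b = (if a then (if b then 0 else 1) else (if b then - \<kappa> else - \<nu>))"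

text \<open>The matrix \<open>|\<xi>|\<^sup>2 (A P - \<mu> (1 - P))\<close> with \<open>P\<close> the projection onto the line of \<open>\<xi>\<close>. In the rows of \<open>\<nabla>q\<close> the second
term annihilates gradients. It is included so that both components decay on the range of \<open>1 - P\<close>, without which
the exponential would not be a symbol with decay.\<close>

definition sys_symbol :: "real \<Rightarrow> real \<Rightarrow> real \<Rightarrow> 'n + 'n \<Rightarrow> 'n + 'n \<Rightarrow> real^'n::finite \<Rightarrow> complex" where
  "sys_symbol \<mu> \<nu> \<kappa> i j \<xi> = complex_of_real (acoustic_mat \<nu> \<kappa> (isl i) (isl j) * (\<xi> $ space_index i * \<xi> $ space_index j)
     - (if isl i = isl j then \<mu> * ((if space_index i = space_index j then (\<Sum>k\<in>UNIV. (\<xi> $ k)\<^sup>2) else 0) - \<xi> $ space_index i * \<xi> $ space_index j) else 0))"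

lemma poly_fun_sum: "(\<And>k. k \<in> K \<Longrightarrow> f k \<in> poly_fun) \<Longrightarrow> (\<lambda>x. \<Sum>k\<in>K. f k x) \<in> poly_fun"
  by (induction K rule: infinite_finite_induct) (auto intro: poly_fun.intros)

lemma poly_fun_cmult: "f \<in> poly_fun \<Longrightarrow> (\<lambda>x. c * f x) \<in> poly_fun"
  by (intro poly_fun.mult poly_fun.const)

lemma poly_fun_norm2: "(\<lambda>\<xi>::real^'n::finite. \<Sum>k\<in>UNIV. (complex_of_real (\<xi> $ k))\<^sup>2) \<in> poly_fun"
  unfolding power2_eq_square by (intro poly_fun_sum poly_fun.intros)

lemma sys_symbol_poly: "sys_symbol \<mu> \<nu> \<kappa> i j \<in> poly_fun"
proof -
  have eq: "sys_symbol \<mu> \<nu> \<kappa> i j = (\<lambda>\<xi>. complex_of_real (acoustic_mat \<nu> \<kappa> (isl i) (isl j)) * (complex_of_real (\<xi> $ space_index i) * complex_of_real (\<xi> $ space_index j))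
     + (complex_of_real (if isl i = isl j \<and> space_index i = space_index j then - \<mu> else 0) * (\<Sum>k\<in>UNIV. (complex_of_real (\<xi> $ k))\<^sup>2)
      + complex_of_real (if isl i = isl j then \<mu> else 0) * (complex_of_real (\<xi> $ space_index i) * complex_of_real (\<xi> $ space_index j))))"
    by (auto simp: sys_symbol_def fun_eq_iff algebra_simps)
  show ?thesis unfolding eq by (intro poly_fun.add poly_fun_cmult poly_fun.mult poly_fun.coord poly_fun_norm2)
qed

lemma sum_UNIV_Plus: "(\<Sum>l\<in>(UNIV::('a::finite + 'b::finite) set). f l) = (\<Sum>i\<in>UNIV. f (Inl i)) + (\<Sum>i\<in>UNIV. f (Inr i))"
  by (subst UNIV_Plus_UNIV[symmetric], subst sum.Plus) simp_all

lemma tempered_distr_partial: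
  assumes "tempered T" shows "tempered (distr_partial i T)"
  unfolding tempered_def distr_partial_def
proof (intro conjI ballI allI)
  fix f g :: "real^'a \<Rightarrow> complex" assume fg: "f \<in> schwartz" "g \<in> schwartz"
  have "partial i (\<lambda>x. f x + g x) = (\<lambda>x. partial i f x + partial i g x)"
    using fg by (simp add: fun_eq_iff partial_add schwartz_differentiable)
  then show "- T (partial i (\<lambda>x. f x + g x)) = - T (partial i f) + - T (partial i g)"
    using fg by (simp add: temperedD(1)[OF assms] schwartz_partial)
next
  fix f :: "real^'a \<Rightarrow> complex" and c assume f: "f \<in> schwartz"
  have "partial i (\<lambda>x. c * f x) = (\<lambda>x. c * partial i f x)"
    using partials_cmult[OF schwartz_smooth[OF f], of "[i]"] by simp
  then show "- T (partial i (\<lambda>x. c * f x)) = c * - T (partial i f)"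
    using f by (simp add: temperedD(2)[OF assms] schwartz_partial)
next
  obtain C k where C: "C \<ge> 0" "\<And>f. f \<in> schwartz \<Longrightarrow> norm (T f) \<le> C * schwartz_seminorm k f"
    using temperedD(3)[OF assms] by blast
  have "norm (- T (partial i f)) \<le> C * schwartz_seminorm (Suc k) f" if "f \<in> schwartz" for f
    using C(2)[OF schwartz_partial[OF that], of i] mult_left_mono[OF seminorm_partial[OF that, of k i] C(1)] by simp
  then show "\<exists>C k. \<forall>f\<in>schwartz. norm (- T (partial i f)) \<le> C * schwartz_seminorm k f" by blast
qed

lemma tempered_grad_pair:
  "tempered q \<Longrightarrow> (\<And>i. tempered (u i)) \<Longrightarrow> tempered (grad_pair q u k)"
  unfolding grad_pair_def by (cases k) (auto simp: tempered_distr_partial)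

text \<open>The transposed Fourier transform turns the derivatives into multiplication by coordinates. In the row of
\<open>\<partial>\<^sub>iq\<close> the terms with factor \<open>\<mu>\<close> cancel because \<open>\<xi>\<^sub>i \<xi>\<^sub>j (\<partial>\<^sub>jq)\<close> and \<open>\<xi>\<^sub>j \<xi>\<^sub>j (\<partial>\<^sub>iq)\<close> coincide in Fourier variables.\<close>

lemma linear_solution_flow:
  fixes q :: "real \<Rightarrow> 'n::finite distr" and u :: "real \<Rightarrow> 'n \<Rightarrow> 'n distr"
  assumes sol: "linear_solution \<mu> lam \<kappa> q0 u0 q u" and g: "g \<in> schwartz" and t: "0 \<le> t"
  defines "X \<equiv> \<lambda>\<tau> k. distr_fourier (grad_pair (q \<tau>) (u \<tau>) k)"
  shows "((\<lambda>\<tau>. X \<tau> k g) has_vector_derivative (\<Sum>j\<in>UNIV. X t j (\<lambda>\<xi>. sys_symbol \<mu> (lam + 2 * \<mu>) \<kappa> k j \<xi> * g \<xi>))) (at t within {0..})"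
proof -
  define m where "m i h = (\<lambda>\<xi>::real^'n. complex_of_real (\<xi> $ i) * h \<xi>)" for i and h :: "real^'n \<Rightarrow> complex"
  define Q where "Q \<tau> = distr_fourier (q \<tau>)" for \<tau>
  define U where "U \<tau> i = distr_fourier (u \<tau> i)" for \<tau> i
  have T: "tempered (Q \<tau>)" "tempered (U \<tau> i)" if "0 \<le> \<tau>" for \<tau> i
    using sol that by (auto simp: linear_solution_def Q_def U_def intro: tempered_distr_fourier)
  have mS [simp]: "m i h \<in> schwartz" if "h \<in> schwartz" for i h unfolding m_def by (rule schwartz_coord_mult[OF that])
  have co: "coord_op i h = (\<lambda>\<xi>. - \<i> * m i h \<xi>)" for i h by (simp add: coord_op_def m_def)
  have mc: "m i (\<lambda>\<xi>. c * h \<xi>) = (\<lambda>\<xi>. c * m i h \<xi>)" for i h c by (simp add: m_def fun_eq_iff)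
  have mm: "m i (m j h) = m j (m i h)" for i j h by (simp add: m_def fun_eq_iff)
  have F1: "partial i (fourier h) = fourier (\<lambda>\<xi>. - \<i> * m i h \<xi>)" if "h \<in> schwartz" for i h
    by (simp add: partial_fourier[OF that] co)
  have F2: "partial j (partial i (fourier h)) = fourier (\<lambda>\<xi>. (- 1) * m j (m i h) \<xi>)" if "h \<in> schwartz" for i j h
    unfolding F1[OF that] F1[OF schwartz_cmult(1)[OF mS[OF that]]] by (simp only: mc mult.assoc[symmetric]) simp
  have F3: "partial l (partial j (partial i (fourier h))) = fourier (\<lambda>\<xi>. \<i> * m l (m j (m i h)) \<xi>)" if "h \<in> schwartz" for i j l h
    unfolding F2[OF that] F1[OF schwartz_cmult(1)[OF mS[OF mS[OF that]]]] by (simp only: mc mult.assoc[symmetric]) simp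
  have Xl: "X \<tau> (Inl i) h = \<i> * Q \<tau> (m i h)" if "h \<in> schwartz" "0 \<le> \<tau>" for \<tau> i h
    unfolding X_def Q_def grad_pair_def distr_fourier_def distr_partial_def sum.case F1[OF that(1)]
    using temperedD(2)[OF T(1)[OF that(2)] mS[OF that(1)], of "- \<i>"] by (simp add: Q_def distr_fourier_def)
  have Xr: "X \<tau> (Inr i) h = U \<tau> i h" for \<tau> i h
    unfolding X_def U_def grad_pair_def by simp
  note QU = Q_def U_def distr_fourier_def
  have Qd: "((\<lambda>\<tau>. Q \<tau> h) has_vector_derivative (\<Sum>j\<in>UNIV. - \<i> * U t j (m j h))) (at t within {0..})" if h: "h \<in> schwartz" for h
  proof -
    have "((\<lambda>\<tau>. q \<tau> (fourier h)) has_vector_derivative - distr_div (u t) (fourier h)) (at t within {0..})"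
      using sol fourier_schwartz[OF h] t by (simp add: linear_solution_def)
    also have "- distr_div (u t) (fourier h) = (\<Sum>j\<in>UNIV. U t j (\<lambda>\<xi>. - \<i> * m j h \<xi>))"
      unfolding distr_div_def distr_partial_def F1[OF h] by (simp add: sum_negf QU)
    also have "\<dots> = (\<Sum>j\<in>UNIV. - \<i> * U t j (m j h))"
      by (intro sum.cong refl temperedD(2) T t mS h)
    finally show ?thesis by (simp add: QU)
  qed
  have negU: "U t j (\<lambda>\<xi>. (- 1) * f \<xi>) = - U t j f" if "f \<in> schwartz" for j f
    by (subst temperedD(2)[OF T(2)[OF t] that]) simp
  have Ud: "((\<lambda>\<tau>. U \<tau> i h) has_vector_derivative
      (\<mu> *\<^sub>R (\<Sum>j\<in>UNIV. - U t i (m j (m j h))) + (lam + \<mu>) *\<^sub>R (\<Sum>j\<in>UNIV. - U t j (m i (m j h)))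
        + \<kappa> *\<^sub>R (\<Sum>j\<in>UNIV. - X t (Inl j) (m i (m j h))))) (at t within {0..})" if h: "h \<in> schwartz" for i h
  proof -
    have "((\<lambda>\<tau>. u \<tau> i (fourier h)) has_vector_derivative \<mu> *\<^sub>R distr_laplacian (u t i) (fourier h)
          + (lam + \<mu>) *\<^sub>R distr_partial i (distr_div (u t)) (fourier h)
          + \<kappa> *\<^sub>R distr_partial i (distr_laplacian (q t)) (fourier h)) (at t within {0..})"
      using sol fourier_schwartz[OF h] t by (simp add: linear_solution_def)
    also have "distr_laplacian (u t i) (fourier h) = (\<Sum>j\<in>UNIV. U t i (\<lambda>\<xi>. (- 1) * m j (m j h) \<xi>))"
      unfolding distr_laplacian_def distr_partial_def F2[OF h] by (simp add: QU)
    also have "\<dots> = (\<Sum>j\<in>UNIV. - U t i (m j (m j h)))"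
      by (simp only: negU[OF mS[OF mS[OF h]]])
    also have "distr_partial i (distr_div (u t)) (fourier h) = (\<Sum>j\<in>UNIV. U t j (\<lambda>\<xi>. (- 1) * m j (m i h) \<xi>))"
      unfolding distr_div_def distr_partial_def F2[OF h] by (simp add: QU sum_negf)
    also have "\<dots> = (\<Sum>j\<in>UNIV. - U t j (m i (m j h)))"
      by (simp only: negU[OF mS[OF mS[OF h]]] mm[of _ i])
    also have "distr_partial i (distr_laplacian (q t)) (fourier h) = (\<Sum>j\<in>UNIV. - Q t (\<lambda>\<xi>. \<i> * m j (m j (m i h)) \<xi>))"
      unfolding distr_laplacian_def distr_partial_def F3[OF h] by (simp add: QU sum_negf)
    also have "\<dots> = (\<Sum>j\<in>UNIV. - X t (Inl j) (m i (m j h)))"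
      by (simp only: temperedD(2)[OF T(1)[OF t] mS[OF mS[OF mS[OF h]]]] Xl[OF mS[OF mS[OF h]] t] mm[of _ i])
    finally show ?thesis by (simp add: QU)
  qed
  have TX: "tempered (X t j)" for j
    unfolding X_def using sol t by (auto simp: linear_solution_def intro!: tempered_distr_fourier tempered_grad_pair)
  have lin: "X t j (\<lambda>\<xi>. (c * (complex_of_real (\<xi> $ a) * complex_of_real (\<xi> $ b)) + d * (\<Sum>k\<in>UNIV. (complex_of_real (\<xi> $ k))\<^sup>2)) * g \<xi>)
     = c * X t j (m a (m b g)) + d * (\<Sum>k\<in>UNIV. X t j (m k (m k g)))" for j c d a b
  proof -
    have "(\<lambda>\<xi>. (c * (complex_of_real (\<xi> $ a) * complex_of_real (\<xi> $ b)) + d * (\<Sum>k\<in>UNIV. (complex_of_real (\<xi> $ k))\<^sup>2)) * g \<xi>)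
      = (\<lambda>\<xi>. c * m a (m b g) \<xi> + d * (\<Sum>k\<in>UNIV. m k (m k g) \<xi>))"
      by (simp add: fun_eq_iff m_def algebra_simps sum_distrib_left sum_distrib_right power2_eq_square)
    then show ?thesis
      by (simp add: temperedD(1)[OF TX] temperedD(2)[OF TX] tempered_sum[OF TX] schwartz_cmult schwartz_sum g)
  qed
  have sy: "X t j (\<lambda>\<xi>. sys_symbol \<mu> (lam + 2 * \<mu>) \<kappa> k j \<xi> * g \<xi>)
     = complex_of_real (acoustic_mat (lam + 2 * \<mu>) \<kappa> (isl k) (isl j) + (if isl k = isl j then \<mu> else 0)) * X t j (m (space_index k) (m (space_index j) g))
       + complex_of_real (if isl k = isl j \<and> space_index k = space_index j then - \<mu> else 0) * (\<Sum>l\<in>UNIV. X t j (m l (m l g)))" for j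
  proof -
    have "sys_symbol \<mu> (lam + 2 * \<mu>) \<kappa> k j \<xi> = complex_of_real (acoustic_mat (lam + 2 * \<mu>) \<kappa> (isl k) (isl j) + (if isl k = isl j then \<mu> else 0))
        * (complex_of_real (\<xi> $ space_index k) * complex_of_real (\<xi> $ space_index j))
       + complex_of_real (if isl k = isl j \<and> space_index k = space_index j then - \<mu> else 0) * (\<Sum>k\<in>UNIV. (complex_of_real (\<xi> $ k))\<^sup>2)" for \<xi>
      by (auto simp: sys_symbol_def algebra_simps)
    then show ?thesis by (simp only: lin)
  qed
  have dsum: "(\<Sum>j\<in>UNIV. complex_of_real (if i = j then c else 0) * f j) = complex_of_real c * f i" for i :: 'n and c f
    using sum.delta'[of UNIV i "\<lambda>j. complex_of_real c * f j"] by (simp add: if_distrib if_distribR cong: if_cong)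
  have dsum2: "(\<Sum>j\<in>UNIV. complex_of_real a * f j + complex_of_real (if i = j then c else 0) * h j)
      = complex_of_real a * (\<Sum>j\<in>UNIV. f j) + complex_of_real c * h i" for i :: 'n and a c f h
    by (simp only: sum.distrib sum_distrib_left[symmetric] dsum)
  show ?thesis
  proof (cases k)
    case (Inl i)
    have "(\<Sum>j\<in>UNIV. X t j (\<lambda>\<xi>. sys_symbol \<mu> (lam + 2 * \<mu>) \<kappa> k j \<xi> * g \<xi>))
       = \<mu> * (\<Sum>j\<in>UNIV. X t (Inl j) (m i (m j g))) - \<mu> * (\<Sum>l\<in>UNIV. X t (Inl i) (m l (m l g))) + (\<Sum>j\<in>UNIV. U t j (m i (m j g)))"
      unfolding sum_UNIV_Plus sy unfolding Inl by (simp add: acoustic_mat_def sum.distrib dsum sum_distrib_left[symmetric] Xr)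
    \<comment> \<open>the symmetry of second derivatives of \<open>q\<close>\<close>
    also have "(\<Sum>j\<in>UNIV. X t (Inl j) (m i (m j g))) = (\<Sum>l\<in>UNIV. X t (Inl i) (m l (m l g)))"
      by (intro sum.cong refl) (simp add: Xl[OF mS[OF mS[OF g]] t], simp add: m_def mult_ac)
    finally have eq: "(\<Sum>j\<in>UNIV. X t j (\<lambda>\<xi>. sys_symbol \<mu> (lam + 2 * \<mu>) \<kappa> k j \<xi> * g \<xi>)) = (\<Sum>j\<in>UNIV. U t j (m i (m j g)))" by simp
    have "((\<lambda>\<tau>. \<i> * Q \<tau> (m i g)) has_vector_derivative \<i> * (\<Sum>j\<in>UNIV. - \<i> * U t j (m j (m i g)))) (at t within {0..})"
      using has_vector_derivative_mult_right[OF Qd[OF mS[OF g]], of \<i> i] by simp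
    also have "\<i> * (\<Sum>j\<in>UNIV. - \<i> * U t j (m j (m i g))) = (\<Sum>j\<in>UNIV. U t j (m i (m j g)))"
      by (simp add: sum_distrib_left mm[of _ i] mult.assoc[symmetric])
    finally have "((\<lambda>\<tau>. \<i> * Q \<tau> (m i g)) has_vector_derivative (\<Sum>j\<in>UNIV. U t j (m i (m j g)))) (at t within {0..})" .
    then show ?thesis unfolding eq unfolding Inl
      by (rule has_vector_derivative_transform[rotated 2]) (use t Xl[OF g] in auto)
  next
    case (Inr i)
    have eq: "(\<Sum>j\<in>UNIV. X t j (\<lambda>\<xi>. sys_symbol \<mu> (lam + 2 * \<mu>) \<kappa> k j \<xi> * g \<xi>))
       = - \<kappa> * (\<Sum>j\<in>UNIV. X t (Inl j) (m i (m j g))) - (lam + \<mu>) * (\<Sum>j\<in>UNIV. U t j (m i (m j g)))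
          - \<mu> * (\<Sum>l\<in>UNIV. U t i (m l (m l g)))"
      unfolding sum_UNIV_Plus sy unfolding Inr
      by (simp only: sum.disc space_index_simps simp_thms if_True if_False acoustic_mat_def dsum2 Xr of_real_0 mult_zero_left add_0_right sum_distrib_left[symmetric])
         (simp add: algebra_simps)
    show ?thesis unfolding eq unfolding Inr Xr
      by (rule has_vector_derivative_eq_rhs[OF Ud[OF g]])
         (simp add: sum_negf scaleR_conv_of_real algebra_simps)
  qed
qed

section \<open>Closed form of the exponential of the symbol\<close>

primrec acoustic_pow :: "real \<Rightarrow> real \<Rightarrow> nat \<Rightarrow> bool \<Rightarrow> bool \<Rightarrow> real" where
  "acoustic_pow \<nu> \<kappa> 0 = (\<lambda>a b. if a = b then 1 else 0)"
| "acoustic_pow \<nu> \<kappa> (Suc k) = (\<lambda>a b. acoustic_pow \<nu> \<kappa> k a True * acoustic_mat \<nu> \<kappa> True b + acoustic_pow \<nu> \<kappa> k a False * acoustic_mat \<nu> \<kappa> False b)"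

definition ray_proj :: "real^'n::finite \<Rightarrow> 'n \<Rightarrow> 'n \<Rightarrow> real" where
  "ray_proj \<xi> i j = \<xi> $ i * \<xi> $ j / (norm \<xi>)\<^sup>2"

lemma norm2_sum: "(norm (\<xi>::real^'n::finite))\<^sup>2 = (\<Sum>k\<in>UNIV. (\<xi> $ k)\<^sup>2)"
  unfolding power2_norm_eq_inner inner_vec_def by (simp add: power2_eq_square)

lemma ray_proj_sum: "\<xi> \<noteq> 0 \<Longrightarrow> (\<Sum>k\<in>UNIV. ray_proj \<xi> k j * ray_proj \<xi> i k) = ray_proj \<xi> i j"
proof -
  assume "\<xi> \<noteq> 0"
  then have n: "(norm \<xi>)\<^sup>2 \<noteq> 0" by simp
  have "(\<Sum>k\<in>UNIV. ray_proj \<xi> k j * ray_proj \<xi> i k) = (\<xi> $ i * \<xi> $ j / ((norm \<xi>)\<^sup>2 * (norm \<xi>)\<^sup>2)) * (\<Sum>k\<in>UNIV. (\<xi> $ k)\<^sup>2)"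
    unfolding sum_distrib_left by (intro sum.cong refl) (simp add: ray_proj_def power2_eq_square)
  moreover have e: "a / (N * N) * N = a / N" if "N \<noteq> 0" for a N :: real using that by simp
  ultimately show ?thesis unfolding norm2_sum[symmetric] by (simp only: ray_proj_def e[OF n])
qed

lemma sys_symbol_proj:
  assumes "\<xi> \<noteq> 0"
  shows "sys_symbol \<mu> \<nu> \<kappa> i j \<xi> = complex_of_real ((norm \<xi>)\<^sup>2 * (acoustic_mat \<nu> \<kappa> (isl i) (isl j) * ray_proj \<xi> (space_index i) (space_index j)
     - (if isl i = isl j then \<mu> * ((if space_index i = space_index j then 1 else 0) - ray_proj \<xi> (space_index i) (space_index j)) else 0)))"
  using assms unfolding sys_symbol_def norm2_sum[symmetric] ray_proj_def of_real_eq_iff by (simp add: field_simps)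

text \<open>\<open>P\<close> and \<open>1 - P\<close> are complementary projections, so powers can be taken separately on their ranges.\<close>

lemma matpow_sys_symbol:
  assumes \<xi>: "\<xi> \<noteq> 0"
  shows "matpow (sys_symbol \<mu> \<nu> \<kappa>) k i j \<xi> = complex_of_real (((norm \<xi>)\<^sup>2) ^ k * (acoustic_pow \<nu> \<kappa> k (isl i) (isl j) * ray_proj \<xi> (space_index i) (space_index j)
     + (if isl i = isl j then (- \<mu>) ^ k * ((if space_index i = space_index j then 1 else 0) - ray_proj \<xi> (space_index i) (space_index j)) else 0)))"
proof (induction k arbitrary: j)
  case 0
  show ?case by (cases i; cases j) auto
next
  case (Suc k)
  let ?r = "(norm \<xi>)\<^sup>2" and ?p = "ray_proj \<xi>" and ?a = "acoustic_pow \<nu> \<kappa> k" and ?A = "acoustic_mat \<nu> \<kappa>"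
  let ?d = "\<lambda>i j. if i = j then 1 else 0 :: real"
  have key: "(\<Sum>l\<in>UNIV. (A * ?p l j' + B * (?d l j' - ?p l j')) * (C * ?p i' l + D * (?d i' l - ?p i' l)))
     = A * C * ?p i' j' + B * D * (?d i' j' - ?p i' j')" for A B C D :: real and i' j'
  proof -
    have pp: "(\<Sum>l\<in>UNIV. ?p l j' * ?p i' l) = ?p i' j'" by (rule ray_proj_sum[OF \<xi>])
    have delta: "(\<Sum>l\<in>UNIV. (if l = j' then 1 else 0) * f l) = f j'" for f :: "'a \<Rightarrow> real"
    proof -
      have "(\<Sum>l\<in>UNIV. (if l = j' then 1 else 0) * f l) = (\<Sum>l\<in>UNIV. if l = j' then f l else 0)"
        by (intro sum.cong) auto
      then show ?thesis by simp
    qed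
    have delta': "(\<Sum>l\<in>UNIV. f l * (if i' = l then 1 else 0)) = f i'" for f :: "'a \<Rightarrow> real"
    proof -
      have "(\<Sum>l\<in>UNIV. f l * (if i' = l then 1 else 0)) = (\<Sum>l\<in>UNIV. if i' = l then f l else 0)"
        by (intro sum.cong) auto
      then show ?thesis by simp
    qed
    have pd: "(\<Sum>l\<in>UNIV. ?p l j' * ?d i' l) = ?p i' j'" by (rule delta')
    have dp: "(\<Sum>l\<in>UNIV. ?d l j' * ?p i' l) = ?p i' j'" by (rule delta)
    have dd: "(\<Sum>l\<in>UNIV. ?d l j' * ?d i' l) = ?d i' j'" by (rule delta)
    have "(A * ?p l j' + B * (?d l j' - ?p l j')) * (C * ?p i' l + D * (?d i' l - ?p i' l))
      = (A - B) * (C - D) * (?p l j' * ?p i' l) + (A - B) * D * (?p l j' * ?d i' l) + B * (C - D) * (?d l j' * ?p i' l) + B * D * (?d l j' * ?d i' l)" for l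
      by (simp only: algebra_simps)
    then show ?thesis
      by (simp only: sum.distrib sum_distrib_left[symmetric] pp pd dp dd) (simp only: algebra_simps)
  qed
  have S: "sys_symbol \<mu> \<nu> \<kappa> l j \<xi> = complex_of_real (?r * (?A (isl l) (isl j) * ?p (space_index l) (space_index j)
     + (if isl l = isl j then - \<mu> else 0) * (?d (space_index l) (space_index j) - ?p (space_index l) (space_index j))))" for l
    by (subst sys_symbol_proj[OF \<xi>]) (auto simp: algebra_simps)
  have M: "matpow (sys_symbol \<mu> \<nu> \<kappa>) k i l \<xi> = complex_of_real (?r ^ k * (?a (isl i) (isl l) * ?p (space_index i) (space_index l)
     + (if isl i = isl l then (- \<mu>) ^ k else 0) * (?d (space_index i) (space_index l) - ?p (space_index i) (space_index l))))" for l
    by (subst Suc) auto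
  have each: "(\<Sum>l\<in>UNIV. (r1 * (A * ?p l j' + B * (?d l j' - ?p l j'))) * (r2 * (C * ?p i' l + D * (?d i' l - ?p i' l))))
     = r1 * r2 * (A * C * ?p i' j' + B * D * (?d i' j' - ?p i' j'))" for A B C D r1 r2 :: real and i' j'
    unfolding key[symmetric] sum_distrib_left by (intro sum.cong refl) (simp only: mult_ac)
  have "matpow (sys_symbol \<mu> \<nu> \<kappa>) (Suc k) i j \<xi> = complex_of_real (\<Sum>l\<in>UNIV.
     (?r * (?A (isl l) (isl j) * ?p (space_index l) (space_index j) + (if isl l = isl j then - \<mu> else 0) * (?d (space_index l) (space_index j) - ?p (space_index l) (space_index j))))
     * (?r ^ k * (?a (isl i) (isl l) * ?p (space_index i) (space_index l) + (if isl i = isl l then (- \<mu>) ^ k else 0) * (?d (space_index i) (space_index l) - ?p (space_index i) (space_index l)))))"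
    unfolding matpow.simps S M by (simp only: of_real_mult[symmetric] of_real_sum[symmetric])
  also have "(\<Sum>l\<in>UNIV.
     (?r * (?A (isl l) (isl j) * ?p (space_index l) (space_index j) + (if isl l = isl j then - \<mu> else 0) * (?d (space_index l) (space_index j) - ?p (space_index l) (space_index j))))
     * (?r ^ k * (?a (isl i) (isl l) * ?p (space_index i) (space_index l) + (if isl i = isl l then (- \<mu>) ^ k else 0) * (?d (space_index i) (space_index l) - ?p (space_index i) (space_index l)))))
    = ?r ^ Suc k * (acoustic_pow \<nu> \<kappa> (Suc k) (isl i) (isl j) * ?p (space_index i) (space_index j)
     + (if isl i = isl j then (- \<mu>) ^ Suc k * (?d (space_index i) (space_index j) - ?p (space_index i) (space_index j)) else 0))"
    by (cases "isl i"; cases "isl j"; simp only: sum_UNIV_Plus sum.disc space_index_simps simp_thms if_True if_False each;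
        simp add: algebra_simps)
  finally show ?case .
qed

text \<open>The entries of the matrix exponential of \<open>\<tau> A\<close>.\<close>

definition acoustic_flow :: "real \<Rightarrow> real \<Rightarrow> bool \<Rightarrow> bool \<Rightarrow> real \<Rightarrow> real" where
  "acoustic_flow \<nu> \<kappa> a b \<tau> = (\<Sum>k. (acoustic_pow \<nu> \<kappa> k a b / fact k) * \<tau> ^ k)"

lemma acoustic_pow_bound: "\<bar>acoustic_pow \<nu> \<kappa> k a b\<bar> \<le> (1 + \<bar>\<nu>\<bar> + \<bar>\<kappa>\<bar>) ^ k"
proof (induction k arbitrary: b)
  case (Suc k)
  have "\<bar>acoustic_pow \<nu> \<kappa> (Suc k) a b\<bar> \<le> \<bar>acoustic_pow \<nu> \<kappa> k a True\<bar> * \<bar>acoustic_mat \<nu> \<kappa> True b\<bar> + \<bar>acoustic_pow \<nu> \<kappa> k a False\<bar> * \<bar>acoustic_mat \<nu> \<kappa> False b\<bar>"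
    by (simp add: abs_mult[symmetric] abs_triangle_ineq)
  also have "\<dots> \<le> (1 + \<bar>\<nu>\<bar> + \<bar>\<kappa>\<bar>) ^ k * \<bar>acoustic_mat \<nu> \<kappa> True b\<bar> + (1 + \<bar>\<nu>\<bar> + \<bar>\<kappa>\<bar>) ^ k * \<bar>acoustic_mat \<nu> \<kappa> False b\<bar>"
    by (intro add_mono mult_right_mono Suc) auto
  also have "\<dots> = (1 + \<bar>\<nu>\<bar> + \<bar>\<kappa>\<bar>) ^ k * (\<bar>acoustic_mat \<nu> \<kappa> True b\<bar> + \<bar>acoustic_mat \<nu> \<kappa> False b\<bar>)" by (simp add: distrib_left)
  also have "\<dots> \<le> (1 + \<bar>\<nu>\<bar> + \<bar>\<kappa>\<bar>) ^ k * (1 + \<bar>\<nu>\<bar> + \<bar>\<kappa>\<bar>)"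
    by (intro mult_left_mono) (auto simp: acoustic_mat_def)
  finally show ?case by (simp add: mult.commute)
qed simp

lemma acoustic_flow_summable: "summable (\<lambda>k. (acoustic_pow \<nu> \<kappa> k a b / fact k) * \<tau> ^ k)"
proof (rule summable_comparison_test'[where N=0])
  show "summable (\<lambda>k. ((1 + \<bar>\<nu>\<bar> + \<bar>\<kappa>\<bar>) * \<bar>\<tau>\<bar>) ^ k /\<^sub>R fact k)" by (rule summable_exp_generic)
  show "norm (acoustic_pow \<nu> \<kappa> k a b / fact k * \<tau> ^ k) \<le> ((1 + \<bar>\<nu>\<bar> + \<bar>\<kappa>\<bar>) * \<bar>\<tau>\<bar>) ^ k /\<^sub>R fact k" for k
    using acoustic_pow_bound[of \<nu> \<kappa> k a b]
    by (simp add: abs_mult power_abs power_mult_distrib divide_inverse mult_ac mult_left_mono)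
qed

text \<open>The derivative of the exponential of \<open>\<tau> A\<close> is its product with \<open>A\<close> from the right.\<close>

lemma acoustic_flow_deriv:
  "(acoustic_flow \<nu> \<kappa> a b has_real_derivative (acoustic_flow \<nu> \<kappa> a True \<tau> * acoustic_mat \<nu> \<kappa> True b + acoustic_flow \<nu> \<kappa> a False \<tau> * acoustic_mat \<nu> \<kappa> False b)) (at \<tau>)"
proof -
  let ?c = "\<lambda>b k. acoustic_pow \<nu> \<kappa> k a b / fact k"
  have "((\<lambda>\<tau>. \<Sum>k. ?c b k * \<tau> ^ k) has_real_derivative (\<Sum>k. diffs (?c b) k * \<tau> ^ k)) (at \<tau>)"
    by (rule termdiffs_strong_converges_everywhere) (rule acoustic_flow_summable)
  also have "(\<Sum>k. diffs (?c b) k * \<tau> ^ k) = (\<Sum>k. (?c True k * \<tau> ^ k) * acoustic_mat \<nu> \<kappa> True b + (?c False k * \<tau> ^ k) * acoustic_mat \<nu> \<kappa> False b)"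
  proof (intro suminf_cong)
    fix k
    have "diffs (?c b) k = acoustic_pow \<nu> \<kappa> (Suc k) a b / fact k"
      by (simp add: diffs_def fact_Suc del: acoustic_pow.simps of_nat_Suc)
    then show "diffs (?c b) k * \<tau> ^ k = (?c True k * \<tau> ^ k) * acoustic_mat \<nu> \<kappa> True b + (?c False k * \<tau> ^ k) * acoustic_mat \<nu> \<kappa> False b"
      by (simp only: acoustic_pow.simps) (simp add: field_simps)
  qed
  also have "\<dots> = acoustic_flow \<nu> \<kappa> a True \<tau> * acoustic_mat \<nu> \<kappa> True b + acoustic_flow \<nu> \<kappa> a False \<tau> * acoustic_mat \<nu> \<kappa> False b"
    unfolding acoustic_flow_def
    by (subst suminf_add[symmetric]) (intro summable_mult2 acoustic_flow_summable suminf_mult2[symmetric] arg_cong2[of _ _ _ _ "(+)"])+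
  finally show ?thesis unfolding acoustic_flow_def .
qed

theorem matexp_sys_symbol:
  assumes \<xi>: "\<xi> \<noteq> 0"
  shows "matexp (sys_symbol \<mu> \<nu> \<kappa>) t i j \<xi> = complex_of_real (ray_proj \<xi> (space_index i) (space_index j) * acoustic_flow \<nu> \<kappa> (isl i) (isl j) (t * (norm \<xi>)\<^sup>2)
     + (if isl i = isl j then ((if space_index i = space_index j then 1 else 0) - ray_proj \<xi> (space_index i) (space_index j)) * exp (- \<mu> * (t * (norm \<xi>)\<^sup>2)) else 0))"
proof -
  let ?n = "if isl i = isl j then (if space_index i = space_index j then 1 else 0) - ray_proj \<xi> (space_index i) (space_index j) else 0"
  have tm: "of_real (t ^ k / fact k) * matpow (sys_symbol \<mu> \<nu> \<kappa>) k i j \<xi>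
    = complex_of_real (ray_proj \<xi> (space_index i) (space_index j) * ((acoustic_pow \<nu> \<kappa> k (isl i) (isl j) / fact k) * (t * (norm \<xi>)\<^sup>2) ^ k)
       + ?n * ((- \<mu> * (t * (norm \<xi>)\<^sup>2)) ^ k /\<^sub>R fact k))" for k
  proof -
    have "(- \<mu> * (t * (norm \<xi>)\<^sup>2)) ^ k = (- \<mu>) ^ k * (t ^ k * ((norm \<xi>)\<^sup>2) ^ k)" by (simp only: power_mult_distrib)
    then show ?thesis
      unfolding matpow_sys_symbol[OF \<xi>] of_real_mult[symmetric] of_real_eq_iff
      by (simp add: power_mult_distrib divide_inverse algebra_simps)
  qed
  have "(\<lambda>k. ray_proj \<xi> (space_index i) (space_index j) * ((acoustic_pow \<nu> \<kappa> k (isl i) (isl j) / fact k) * (t * (norm \<xi>)\<^sup>2) ^ k)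
       + ?n * ((- \<mu> * (t * (norm \<xi>)\<^sup>2)) ^ k /\<^sub>R fact k)) sums
     (ray_proj \<xi> (space_index i) (space_index j) * acoustic_flow \<nu> \<kappa> (isl i) (isl j) (t * (norm \<xi>)\<^sup>2) + ?n * exp (- \<mu> * (t * (norm \<xi>)\<^sup>2)))"
    unfolding acoustic_flow_def by (intro sums_add sums_mult summable_sums acoustic_flow_summable exp_converges)
  then have "(\<lambda>k. of_real (t ^ k / fact k) * matpow (sys_symbol \<mu> \<nu> \<kappa>) k i j \<xi>) sums
     complex_of_real (ray_proj \<xi> (space_index i) (space_index j) * acoustic_flow \<nu> \<kappa> (isl i) (isl j) (t * (norm \<xi>)\<^sup>2) + ?n * exp (- \<mu> * (t * (norm \<xi>)\<^sup>2)))"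
    unfolding tm by (rule sums_of_real)
  then show ?thesis unfolding matexp_def by (auto simp: sums_iff)
qed

section \<open>Decay and regularity of the exponential\<close>

text \<open>The energy \<open>x\<^sup>2 + \<kappa> y\<^sup>2\<close> dissipates only \<open>y\<close>. Subtracting a small multiple of \<open>x y\<close> yields an equivalent functional
\<open>V\<close> that dissipates \<open>x\<close> as well and satisfies \<open>V' \<le> - c V\<close>.\<close>

lemma damped_decay:
  fixes x y :: "real \<Rightarrow> real"
  assumes \<nu>: "\<nu> > 0" and \<kappa>: "\<kappa> > 0"
    and x: "\<And>\<tau>. (x has_real_derivative - \<kappa> * y \<tau>) (at \<tau>)"
    and y: "\<And>\<tau>. (y has_real_derivative x \<tau> - \<nu> * y \<tau>) (at \<tau>)"
  shows "\<exists>K c. c > 0 \<and> (\<forall>\<tau>\<ge>0. \<bar>x \<tau>\<bar> \<le> K * exp (- c * \<tau>) \<and> \<bar>y \<tau>\<bar> \<le> K * exp (- c * \<tau>))"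
proof -
  \<comment> \<open>small enough for equivalence with the energy and for the dissipation of \<open>y\<close> to absorb the mixed term\<close>
  define \<epsilon> where "\<epsilon> = min (min 1 \<kappa>) (\<kappa> * \<nu> / (\<kappa> + \<nu>\<^sup>2 / 2))"
  define c where "c = min (\<epsilon> / 3) (2 * \<nu> / 3)"
  define V where "V \<tau> = (x \<tau>)\<^sup>2 + \<kappa> * (y \<tau>)\<^sup>2 - \<epsilon> * (x \<tau> * y \<tau>)" for \<tau>
  have d: "\<kappa> + \<nu>\<^sup>2 / 2 > 0" using \<kappa> by (simp add: add_pos_nonneg)
  have \<epsilon>: "\<epsilon> > 0" "\<epsilon> \<le> 1" "\<epsilon> \<le> \<kappa>" "\<epsilon> * (\<kappa> + \<nu>\<^sup>2 / 2) \<le> \<kappa> * \<nu>"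
  proof -
    show "\<epsilon> > 0" "\<epsilon> \<le> 1" "\<epsilon> \<le> \<kappa>" using \<nu> \<kappa> d by (auto simp: \<epsilon>_def)
    have "\<epsilon> \<le> \<kappa> * \<nu> / (\<kappa> + \<nu>\<^sup>2 / 2)" by (simp add: \<epsilon>_def)
    then show "\<epsilon> * (\<kappa> + \<nu>\<^sup>2 / 2) \<le> \<kappa> * \<nu>" using d by (simp add: pos_le_divide_eq)
  qed
  have c: "c > 0" "3 * c \<le> \<epsilon>" "3 * c \<le> 2 * \<nu>" using \<epsilon> \<nu> by (auto simp: c_def)
  have cross: "\<epsilon> * \<bar>a * b\<bar> \<le> (a\<^sup>2 + \<kappa> * b\<^sup>2) / 2" for a b
  proof -
    have "2 * \<bar>a * b\<bar> \<le> a\<^sup>2 + b\<^sup>2"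
      using sum_squares_bound[of "\<bar>a\<bar>" "\<bar>b\<bar>"] by (simp add: abs_mult mult.assoc)
    then have "\<epsilon> * (2 * \<bar>a * b\<bar>) \<le> \<epsilon> * (a\<^sup>2 + b\<^sup>2)" using \<epsilon> by (intro mult_left_mono) auto
    also have "\<dots> \<le> 1 * a\<^sup>2 + \<kappa> * b\<^sup>2" unfolding distrib_left using \<epsilon> by (intro add_mono mult_right_mono) auto
    finally show ?thesis by simp
  qed
  have c1: "\<epsilon> * (x \<tau> * y \<tau>) \<le> \<epsilon> * \<bar>x \<tau> * y \<tau>\<bar>" and c2: "- (\<epsilon> * (x \<tau> * y \<tau>)) \<le> \<epsilon> * \<bar>x \<tau> * y \<tau>\<bar>" for \<tau>
    using mult_left_mono[OF abs_ge_self[of "x \<tau> * y \<tau>"] less_imp_le[OF \<epsilon>(1)]]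
      mult_left_mono[OF abs_ge_minus_self[of "x \<tau> * y \<tau>"] less_imp_le[OF \<epsilon>(1)]] by simp_all
  have V1: "(x \<tau>)\<^sup>2 + \<kappa> * (y \<tau>)\<^sup>2 \<le> 2 * V \<tau>" for \<tau>
    using cross[of "x \<tau>" "y \<tau>"] c1[of \<tau>] unfolding V_def by argo
  have V2: "V \<tau> \<le> 3 / 2 * ((x \<tau>)\<^sup>2 + \<kappa> * (y \<tau>)\<^sup>2)" for \<tau>
    using cross[of "x \<tau>" "y \<tau>"] c1[of \<tau>] c2[of \<tau>] unfolding V_def by argo
  let ?V' = "\<lambda>\<tau>. - 2 * \<kappa> * \<nu> * (y \<tau>)\<^sup>2 + \<epsilon> * \<kappa> * (y \<tau>)\<^sup>2 - \<epsilon> * (x \<tau>)\<^sup>2 + \<epsilon> * \<nu> * (x \<tau> * y \<tau>)"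
  have VD: "(V has_real_derivative ?V' \<tau>) (at \<tau>)" for \<tau>
    unfolding V_def[abs_def]
    by (rule derivative_eq_intros x y refl)+ (simp add: power2_eq_square algebra_simps)
  have V': "?V' \<tau> + c * V \<tau> \<le> 0" for \<tau>
  proof -
    have "\<nu> * (x \<tau> * y \<tau>) \<le> (x \<tau>)\<^sup>2 / 2 + \<nu>\<^sup>2 / 2 * (y \<tau>)\<^sup>2"
      using zero_le_power2[of "x \<tau> - \<nu> * y \<tau>"] by (simp add: power2_eq_square algebra_simps)
    then have "\<epsilon> * (\<nu> * (x \<tau> * y \<tau>)) \<le> \<epsilon> * ((x \<tau>)\<^sup>2 / 2 + \<nu>\<^sup>2 / 2 * (y \<tau>)\<^sup>2)" using \<epsilon> by (intro mult_left_mono) auto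
    moreover have "\<epsilon> * (\<kappa> + \<nu>\<^sup>2 / 2) * (y \<tau>)\<^sup>2 \<le> \<kappa> * \<nu> * (y \<tau>)\<^sup>2" by (rule mult_right_mono[OF \<epsilon>(4)]) simp
    moreover have "c * V \<tau> \<le> c * (3 / 2 * ((x \<tau>)\<^sup>2 + \<kappa> * (y \<tau>)\<^sup>2))" using c V2 by (intro mult_left_mono) auto
    moreover have "3 * c * (x \<tau>)\<^sup>2 \<le> \<epsilon> * (x \<tau>)\<^sup>2" by (rule mult_right_mono[OF c(2)]) simp
    moreover have "3 * c * (\<kappa> * (y \<tau>)\<^sup>2) \<le> 2 * \<nu> * (\<kappa> * (y \<tau>)\<^sup>2)" using \<kappa> by (intro mult_right_mono[OF c(3)]) auto
    ultimately show ?thesis by (simp add: algebra_simps)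
  qed
  have Ve: "V \<tau> * exp (c * \<tau>) \<le> V 0 * exp (c * 0)" if "\<tau> \<ge> 0" for \<tau>
  proof (rule DERIV_nonpos_imp_nonincreasing[OF that])
    fix s
    have "((\<lambda>\<tau>. V \<tau> * exp (c * \<tau>)) has_real_derivative (?V' s + c * V s) * exp (c * s)) (at s)"
      by (rule derivative_eq_intros VD refl)+ (simp add: algebra_simps)
    moreover have "(?V' s + c * V s) * exp (c * s) \<le> 0" using V'[of s] by (intro mult_nonpos_nonneg) auto
    ultimately show "\<exists>y. ((\<lambda>\<tau>. V \<tau> * exp (c * \<tau>)) has_real_derivative y) (at s) \<and> y \<le> 0" by blast
  qed
  define K where "K = sqrt (2 * V 0) + sqrt (2 * V 0 / \<kappa>)"
  have V0: "V 0 \<ge> 0"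
  proof -
    have "0 \<le> (x 0)\<^sup>2 + \<kappa> * (y 0)\<^sup>2" using \<kappa> by simp
    then show ?thesis using V1[of 0] by linarith
  qed
  have "\<bar>x \<tau>\<bar> \<le> K * exp (- (c / 2) * \<tau>) \<and> \<bar>y \<tau>\<bar> \<le> K * exp (- (c / 2) * \<tau>)" if \<tau>: "\<tau> \<ge> 0" for \<tau>
  proof -
    have Vt: "V \<tau> \<le> V 0 * exp (- c * \<tau>)"
      using Ve[OF \<tau>] by (simp add: exp_minus field_simps)
    have e: "exp (- c * \<tau>) = (exp (- (c / 2) * \<tau>))\<^sup>2" by (simp add: power2_eq_square exp_add[symmetric])
    have "(x \<tau>)\<^sup>2 \<le> (x \<tau>)\<^sup>2 + \<kappa> * (y \<tau>)\<^sup>2" using \<kappa> by simp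
    also have "\<dots> \<le> 2 * V 0 * (exp (- (c / 2) * \<tau>))\<^sup>2" using V1[of \<tau>] Vt unfolding e by simp
    finally have "\<bar>x \<tau>\<bar> \<le> sqrt (2 * V 0 * (exp (- (c / 2) * \<tau>))\<^sup>2)" by (rule real_le_rsqrt[of "\<bar>x \<tau>\<bar>", unfolded power2_abs])
    then have xb: "\<bar>x \<tau>\<bar> \<le> sqrt (2 * V 0) * exp (- (c / 2) * \<tau>)" by (simp add: real_sqrt_mult)
    have "\<kappa> * (y \<tau>)\<^sup>2 \<le> (x \<tau>)\<^sup>2 + \<kappa> * (y \<tau>)\<^sup>2" by simp
    also have "\<dots> \<le> 2 * V 0 * (exp (- (c / 2) * \<tau>))\<^sup>2" using V1[of \<tau>] Vt unfolding e by simp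
    finally have "(y \<tau>)\<^sup>2 \<le> 2 * V 0 / \<kappa> * (exp (- (c / 2) * \<tau>))\<^sup>2" using \<kappa> by (simp add: field_simps)
    then have "\<bar>y \<tau>\<bar> \<le> sqrt (2 * V 0 / \<kappa> * (exp (- (c / 2) * \<tau>))\<^sup>2)" by (rule real_le_rsqrt[of "\<bar>y \<tau>\<bar>", unfolded power2_abs])
    then have yb: "\<bar>y \<tau>\<bar> \<le> sqrt (2 * V 0 / \<kappa>) * exp (- (c / 2) * \<tau>)"
      by (simp only: real_sqrt_mult[of "2 * V 0 / \<kappa>"] real_sqrt_abs abs_exp_cancel)
    have "sqrt (2 * V 0) * exp (- (c / 2) * \<tau>) \<le> K * exp (- (c / 2) * \<tau>)" "sqrt (2 * V 0 / \<kappa>) * exp (- (c / 2) * \<tau>) \<le> K * exp (- (c / 2) * \<tau>)"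
      using V0 \<kappa> unfolding K_def by (auto intro!: mult_right_mono)
    then show ?thesis using xb yb by linarith
  qed
  then show ?thesis using c by (intro exI[of _ K] exI[of _ "c / 2"]) auto
qed

lemma acoustic_flow_decay:
  assumes "\<nu> > 0" "\<kappa> > 0"
  shows "\<exists>K c. c > 0 \<and> (\<forall>\<tau>\<ge>0. \<bar>acoustic_flow \<nu> \<kappa> a True \<tau>\<bar> \<le> K * exp (- c * \<tau>) \<and> \<bar>acoustic_flow \<nu> \<kappa> a False \<tau>\<bar> \<le> K * exp (- c * \<tau>))"
proof (rule damped_decay[OF assms])
  show "(acoustic_flow \<nu> \<kappa> a True has_real_derivative - \<kappa> * acoustic_flow \<nu> \<kappa> a False \<tau>) (at \<tau>)" for \<tau>
    using acoustic_flow_deriv[of \<nu> \<kappa> a True \<tau>] by (simp add: acoustic_mat_def mult.commute)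
  show "(acoustic_flow \<nu> \<kappa> a False has_real_derivative acoustic_flow \<nu> \<kappa> a True \<tau> - \<nu> * acoustic_flow \<nu> \<kappa> a False \<tau>) (at \<tau>)" for \<tau>
    using acoustic_flow_deriv[of \<nu> \<kappa> a False \<tau>] by (simp add: acoustic_mat_def mult.commute)
qed

lemma poly_exp_bounded:
  assumes c: "c > 0"
  shows "\<exists>M\<ge>0. \<forall>s\<ge>0. (1 + s) ^ m * exp (- c * s\<^sup>2) \<le> (M::real)"
proof -
  define n where "n = Suc m"
  define M where "M = 2 ^ n * ((real n / c) ^ n * exp c)"
  have "(1 + s) ^ m * exp (- c * s\<^sup>2) \<le> M" if s: "s \<ge> 0" for s :: real
  proof -
    have "2 * s \<le> s\<^sup>2 + 1" using zero_le_power2[of "s - 1"] by (simp add: power2_diff)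
    moreover have "0 \<le> s\<^sup>2" by simp
    ultimately have "1 + s \<le> 2 * (1 + s\<^sup>2)" unfolding distrib_left by argo
    then have "(1 + s) ^ n \<le> (2 * (1 + s\<^sup>2)) ^ n" using s by (intro power_mono) auto
    moreover have "(1 + s) ^ m \<le> (1 + s) ^ n" unfolding n_def using s by (intro power_increasing) auto
    ultimately have 1: "(1 + s) ^ m \<le> 2 ^ n * (1 + s\<^sup>2) ^ n" unfolding power_mult_distrib by linarith
    have "c * (1 + s\<^sup>2) / real n \<le> exp (c * (1 + s\<^sup>2) / real n)"
      using exp_ge_add_one_self[of "c * (1 + s\<^sup>2) / real n"] by linarith
    then have "(c * (1 + s\<^sup>2) / real n) ^ n \<le> exp (c * (1 + s\<^sup>2) / real n) ^ n"
      using c by (intro power_mono) auto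
    also have "\<dots> = exp (real n * (c * (1 + s\<^sup>2) / real n))" by (rule exp_of_nat_mult[symmetric])
    also have "\<dots> = exp (c * (1 + s\<^sup>2))" by (simp add: n_def)
    finally have le: "(c * (1 + s\<^sup>2) / real n) ^ n \<le> exp (c * (1 + s\<^sup>2))" .
    have "1 + s\<^sup>2 = real n / c * (c * (1 + s\<^sup>2) / real n)" using c by (simp add: n_def)
    then have "(1 + s\<^sup>2) ^ n = (real n / c) ^ n * (c * (1 + s\<^sup>2) / real n) ^ n" by (metis power_mult_distrib)
    also have "\<dots> \<le> (real n / c) ^ n * exp (c * (1 + s\<^sup>2))" using c by (intro mult_left_mono le) simp
    finally have "(1 + s\<^sup>2) ^ n \<le> (real n / c) ^ n * exp (c * (1 + s\<^sup>2))" .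
    then have "(1 + s) ^ m * exp (- c * s\<^sup>2) \<le> (2 ^ n * ((real n / c) ^ n * exp (c * (1 + s\<^sup>2)))) * exp (- c * s\<^sup>2)"
      using 1 by (intro mult_right_mono order_trans[OF 1] mult_left_mono) auto
    also have "\<dots> = 2 ^ n * ((real n / c) ^ n * (exp (c * (1 + s\<^sup>2)) * exp (- c * s\<^sup>2)))" by (simp only: mult.assoc)
    also have "exp (c * (1 + s\<^sup>2)) * exp (- c * s\<^sup>2) = exp c" by (simp add: exp_add[symmetric] distrib_left)
    finally show ?thesis by (simp add: M_def)
  qed
  then show ?thesis using c by (intro exI[of _ M]) (auto simp: M_def)
qed

lemma poly_fun_partial: "b \<in> poly_fun \<Longrightarrow> partial i b \<in> poly_fun"
proof (induction rule: poly_fun.induct)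
  case (const c) then show ?case by (simp add: partial_const poly_fun.const)
next
  case (coord j)
  have "partial i (\<lambda>x::real^'a. complex_of_real (x $ j)) = (\<lambda>x. if j = i then 1 else 0)" by (simp add: fun_eq_iff partial_coord)
  then show ?case by (simp add: poly_fun.const)
next
  case (add a b)
  have "partial i (\<lambda>x. a x + b x) = (\<lambda>x. partial i a x + partial i b x)"
    using add by (simp add: fun_eq_iff partial_add smooth_differentiable poly_fun_smooth)
  then show ?case using add by (simp add: poly_fun.add)
next
  case (mult a b)
  have "partial i (\<lambda>x. a x * b x) = (\<lambda>x. partial i a x * b x + a x * partial i b x)"
    using mult by (simp add: fun_eq_iff partial_mult smooth_differentiable poly_fun_smooth)
  then show ?case using mult by (auto intro!: poly_fun.add poly_fun.mult)
qed

lemma poly_fun_growth: "b \<in> poly_fun \<Longrightarrow> \<exists>C n. C \<ge> 0 \<and> (\<forall>x. norm (b x) \<le> C * (1 + norm x) ^ n)"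
proof (induction rule: poly_fun.induct)
  case (const c) then show ?case by (intro exI[of _ "norm c"] exI[of _ 0]) auto
next
  case (coord j)
  have "norm (complex_of_real (x $ j)) \<le> 1 * (1 + norm x) ^ 1" for x :: "real^'a"
    using component_le_norm_cart[of x j] by simp
  then show ?case by (intro exI[of _ 1] exI[of _ 1]) auto
next
  case (add a b)
  then obtain C n C' n' where C: "C \<ge> 0" "\<And>x. norm (a x) \<le> C * (1 + norm x) ^ n"
    and C': "C' \<ge> 0" "\<And>x. norm (b x) \<le> C' * (1 + norm x) ^ n'" by blast
  have "norm (a x + b x) \<le> (C + C') * (1 + norm x) ^ (n + n')" for x
  proof -
    have "norm (a x + b x) \<le> C * (1 + norm x) ^ n + C' * (1 + norm x) ^ n'"
      by (rule norm_triangle_le[OF add_mono[OF C(2) C'(2)]])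
    also have "\<dots> \<le> C * (1 + norm x) ^ (n + n') + C' * (1 + norm x) ^ (n + n')"
      using C C' by (intro add_mono mult_left_mono power_increasing) auto
    finally show ?thesis by (simp add: distrib_right)
  qed
  then show ?case using C C' by (intro exI[of _ "C + C'"] exI[of _ "n + n'"]) auto
next
  case (mult a b)
  then obtain C n C' n' where C: "C \<ge> 0" "\<And>x. norm (a x) \<le> C * (1 + norm x) ^ n"
    and C': "C' \<ge> 0" "\<And>x. norm (b x) \<le> C' * (1 + norm x) ^ n'" by blast
  have "norm (a x * b x) \<le> (C * C') * (1 + norm x) ^ (n + n')" for x
  proof -
    have "norm (a x * b x) \<le> (C * (1 + norm x) ^ n) * (C' * (1 + norm x) ^ n')"
      unfolding norm_mult using C C' by (intro mult_mono) auto
    then show ?thesis by (simp add: power_add mult_ac)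
  qed
  then show ?case using C C' by (intro exI[of _ "C * C'"] exI[of _ "n + n'"]) auto
qed

lemma radial_has_derivative:
  fixes f :: "real \<Rightarrow> real" and \<xi> :: "real^'n::finite"
  assumes "(f has_real_derivative f') (at (\<xi> \<bullet> \<xi>))"
  shows "((\<lambda>\<xi>. complex_of_real (f (\<xi> \<bullet> \<xi>))) has_derivative (\<lambda>h. complex_of_real (f' * (2 * (\<xi> \<bullet> h))))) (at \<xi>)"
proof -
  have 1: "((\<lambda>\<xi>::real^'n. \<xi> \<bullet> \<xi>) has_derivative (\<lambda>h. \<xi> \<bullet> h + h \<bullet> \<xi>)) (at \<xi>)"
    by (intro derivative_intros)
  from has_derivative_compose[OF 1 assms[unfolded has_field_derivative_def]]
  have "((\<lambda>\<xi>. f (\<xi> \<bullet> \<xi>)) has_derivative (\<lambda>h. f' * (\<xi> \<bullet> h + h \<bullet> \<xi>))) (at \<xi>)" .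
  then have "((\<lambda>\<xi>. complex_of_real (f (\<xi> \<bullet> \<xi>))) has_derivative (\<lambda>h. complex_of_real (f' * (\<xi> \<bullet> h + h \<bullet> \<xi>)))) (at \<xi>)"
    by (rule has_derivative_of_real)
  then show ?thesis by (simp add: inner_commute)
qed

lemma partial_radial:
  fixes f :: "real \<Rightarrow> real" and \<xi> :: "real^'n::finite"
  assumes "(f has_real_derivative f') (at (\<xi> \<bullet> \<xi>))"
  shows "partial i (\<lambda>\<xi>. complex_of_real (f (\<xi> \<bullet> \<xi>))) \<xi> = 2 * complex_of_real (\<xi> $ i) * complex_of_real f'"
  by (subst partial_eqI[OF radial_has_derivative[OF assms]]) (simp add: inner_axis)

text \<open>Since \<open>x\<close> and \<open>y\<close> solve a linear system with constant coefficients, functions of this form with polynomial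
\<open>p\<close> and \<open>r\<close> are closed under partial derivatives, and \<open>schwartz_coinduct\<close> reduces the claim to their decay.\<close>

lemma radial_schwartz:
  fixes x y :: "real \<Rightarrow> real"
  assumes x: "\<And>\<tau>. (x has_real_derivative a * x \<tau> + b * y \<tau>) (at \<tau>)"
    and y: "\<And>\<tau>. (y has_real_derivative c * x \<tau> + d * y \<tau>) (at \<tau>)"
    and decay: "e > 0" "\<And>\<tau>. \<tau> \<ge> 0 \<Longrightarrow> \<bar>x \<tau>\<bar> \<le> K * exp (- e * \<tau>)" "\<And>\<tau>. \<tau> \<ge> 0 \<Longrightarrow> \<bar>y \<tau>\<bar> \<le> K * exp (- e * \<tau>)"
    and pr: "p \<in> poly_fun" "r \<in> poly_fun"
  shows "(\<lambda>\<xi>::real^'n::finite. p \<xi> * complex_of_real (x (\<xi> \<bullet> \<xi>)) + r \<xi> * complex_of_real (y (\<xi> \<bullet> \<xi>))) \<in> schwartz"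
proof (rule schwartz_coinduct[where A="{\<lambda>\<xi>. p \<xi> * complex_of_real (x (\<xi> \<bullet> \<xi>)) + r \<xi> * complex_of_real (y (\<xi> \<bullet> \<xi>)) |p r. p \<in> poly_fun \<and> r \<in> poly_fun}"])
  show "(\<lambda>\<xi>. p \<xi> * complex_of_real (x (\<xi> \<bullet> \<xi>)) + r \<xi> * complex_of_real (y (\<xi> \<bullet> \<xi>)))
    \<in> {\<lambda>\<xi>. p \<xi> * complex_of_real (x (\<xi> \<bullet> \<xi>)) + r \<xi> * complex_of_real (y (\<xi> \<bullet> \<xi>)) |p r. p \<in> poly_fun \<and> r \<in> poly_fun}"
    using pr by blast
  fix h :: "real^'n \<Rightarrow> complex" and i k
  assume "h \<in> {\<lambda>\<xi>. p \<xi> * complex_of_real (x (\<xi> \<bullet> \<xi>)) + r \<xi> * complex_of_real (y (\<xi> \<bullet> \<xi>)) |p r. p \<in> poly_fun \<and> r \<in> poly_fun}"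
  then obtain p r where h: "h = (\<lambda>\<xi>. p \<xi> * complex_of_real (x (\<xi> \<bullet> \<xi>)) + r \<xi> * complex_of_real (y (\<xi> \<bullet> \<xi>)))"
    and p: "p \<in> poly_fun" and r: "r \<in> poly_fun" by blast
  have dx: "(\<lambda>\<xi>::real^'n. complex_of_real (x (\<xi> \<bullet> \<xi>))) differentiable (at \<xi>)"
    and dy: "(\<lambda>\<xi>::real^'n. complex_of_real (y (\<xi> \<bullet> \<xi>))) differentiable (at \<xi>)" for \<xi>
    using radial_has_derivative[OF x] radial_has_derivative[OF y] by (auto intro: differentiableI)
  note dp = smooth_differentiable[OF poly_fun_smooth[OF p]] and dr = smooth_differentiable[OF poly_fun_smooth[OF r]]
  show "h differentiable_on UNIV" unfolding h
    by (intro differentiable_onI differentiable_add differentiable_mult dx dy dp dr)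
  have "partial i h \<xi> = (partial i p \<xi> + 2 * complex_of_real (\<xi> $ i) * (complex_of_real a * p \<xi> + complex_of_real c * r \<xi>)) * complex_of_real (x (\<xi> \<bullet> \<xi>))
      + (partial i r \<xi> + 2 * complex_of_real (\<xi> $ i) * (complex_of_real b * p \<xi> + complex_of_real d * r \<xi>)) * complex_of_real (y (\<xi> \<bullet> \<xi>))" for \<xi>
    unfolding h
    by (subst partial_add) (simp_all add: partial_mult differentiable_mult dx dy dp dr partial_radial[OF x] partial_radial[OF y] algebra_simps)
  then have "partial i h = (\<lambda>\<xi>. (partial i p \<xi> + 2 * complex_of_real (\<xi> $ i) * (complex_of_real a * p \<xi> + complex_of_real c * r \<xi>)) * complex_of_real (x (\<xi> \<bullet> \<xi>))
      + (partial i r \<xi> + 2 * complex_of_real (\<xi> $ i) * (complex_of_real b * p \<xi> + complex_of_real d * r \<xi>)) * complex_of_real (y (\<xi> \<bullet> \<xi>)))" by blast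
  moreover define P' where "P' = (\<lambda>\<xi>. partial i p \<xi> + 2 * complex_of_real (\<xi> $ i) * (complex_of_real a * p \<xi> + complex_of_real c * r \<xi>))"
  moreover define R' where "R' = (\<lambda>\<xi>. partial i r \<xi> + 2 * complex_of_real (\<xi> $ i) * (complex_of_real b * p \<xi> + complex_of_real d * r \<xi>))"
  ultimately have h': "partial i h = (\<lambda>\<xi>. P' \<xi> * complex_of_real (x (\<xi> \<bullet> \<xi>)) + R' \<xi> * complex_of_real (y (\<xi> \<bullet> \<xi>)))" by simp
  have "(\<lambda>\<xi>. partial i p \<xi> + 2 * complex_of_real (\<xi> $ i) * (complex_of_real a * p \<xi> + complex_of_real c * r \<xi>)) \<in> poly_fun"
    "(\<lambda>\<xi>. partial i r \<xi> + 2 * complex_of_real (\<xi> $ i) * (complex_of_real b * p \<xi> + complex_of_real d * r \<xi>)) \<in> poly_fun"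
    by (intro poly_fun.add poly_fun.mult poly_fun.const poly_fun.coord poly_fun_partial p r)+
  then have "P' \<in> poly_fun" "R' \<in> poly_fun" unfolding P'_def R'_def .
  with h' show "partial i h \<in> {\<lambda>\<xi>. p \<xi> * complex_of_real (x (\<xi> \<bullet> \<xi>)) + r \<xi> * complex_of_real (y (\<xi> \<bullet> \<xi>)) |p r. p \<in> poly_fun \<and> r \<in> poly_fun}"
    by blast
  obtain C n C' n' where C: "C \<ge> 0" "\<And>x. norm (p x) \<le> C * (1 + norm x) ^ n"
    and C': "C' \<ge> 0" "\<And>x. norm (r x) \<le> C' * (1 + norm x) ^ n'" using poly_fun_growth[OF p] poly_fun_growth[OF r] by blast
  have K: "K \<ge> 0" using order_trans[OF abs_ge_zero decay(2)[of 0]] by simp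
  obtain M where M: "M \<ge> 0" "\<And>s. s \<ge> 0 \<Longrightarrow> (1 + s) ^ (k + n + n') * exp (- e * s\<^sup>2) \<le> M"
    using poly_exp_bounded[OF decay(1)] by blast
  have "(1 + norm \<xi>) ^ k * norm (h \<xi>) \<le> (C + C') * K * M" for \<xi>
  proof -
    let ?E = "exp (- e * (norm \<xi>)\<^sup>2)" let ?w = "1 + norm \<xi>"
    have xx: "\<bar>x (\<xi> \<bullet> \<xi>)\<bar> \<le> K * ?E" and yy: "\<bar>y (\<xi> \<bullet> \<xi>)\<bar> \<le> K * ?E"
      using decay(2,3)[of "\<xi> \<bullet> \<xi>"] by (auto simp: power2_norm_eq_inner)
    have "norm (h \<xi>) \<le> (C * ?w ^ n) * (K * ?E) + (C' * ?w ^ n') * (K * ?E)"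
      unfolding h
    proof (intro norm_triangle_le add_mono)
      show "norm (p \<xi> * complex_of_real (x (\<xi> \<bullet> \<xi>))) \<le> (C * ?w ^ n) * (K * ?E)"
        unfolding norm_mult norm_of_real using C(1) K by (intro mult_mono C(2) xx) auto
      show "norm (r \<xi> * complex_of_real (y (\<xi> \<bullet> \<xi>))) \<le> (C' * ?w ^ n') * (K * ?E)"
        unfolding norm_mult norm_of_real using C'(1) K by (intro mult_mono C'(2) yy) auto
    qed
    also have "\<dots> \<le> (C * ?w ^ (n + n')) * (K * ?E) + (C' * ?w ^ (n + n')) * (K * ?E)"
      using C C' K by (intro add_mono mult_right_mono mult_left_mono power_increasing) auto
    also have "\<dots> = ((C + C') * K) * (?w ^ (n + n') * ?E)" by (simp add: algebra_simps)
    finally have "?w ^ k * norm (h \<xi>) \<le> ?w ^ k * (((C + C') * K) * (?w ^ (n + n') * ?E))" by (intro mult_left_mono) auto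
    also have "\<dots> = ((C + C') * K) * (?w ^ (k + n + n') * ?E)" by (simp add: power_add mult_ac)
    also have "\<dots> \<le> ((C + C') * K) * M" using C C' K M(2)[of "norm \<xi>"] by (intro mult_left_mono) auto
    finally show ?thesis .
  qed
  then show "\<exists>C. \<forall>\<xi>. (1 + norm \<xi>) ^ k * norm (h \<xi>) \<le> C" by blast
qed

lemma poly_fun_inner: "(\<lambda>\<xi>::real^'n::finite. complex_of_real ((\<xi> \<bullet> \<xi>) ^ K)) \<in> poly_fun"
proof -
  have eq: "(\<lambda>\<xi>::real^'n. complex_of_real (\<xi> \<bullet> \<xi>)) = (\<lambda>\<xi>. \<Sum>k\<in>UNIV. (complex_of_real (\<xi> $ k))\<^sup>2)"
    by (simp add: inner_vec_def power2_eq_square)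
  have 1: "(\<lambda>\<xi>::real^'n. complex_of_real (\<xi> \<bullet> \<xi>)) \<in> poly_fun" unfolding eq by (rule poly_fun_norm2)
  show ?thesis
  proof (induction K)
    case 0
    show ?case using poly_fun.const[of 1] by simp
  next
    case (Suc K)
    have "(\<lambda>\<xi>::real^'n. complex_of_real ((\<xi> \<bullet> \<xi>) ^ Suc K)) = (\<lambda>\<xi>. complex_of_real (\<xi> \<bullet> \<xi>) * complex_of_real ((\<xi> \<bullet> \<xi>) ^ K))" by simp
    then show ?case using poly_fun.mult[OF 1 Suc] by (simp only:)
  qed
qed

lemma acoustic_flow_schwartz:
  assumes "\<nu> > 0" "\<kappa> > 0"
  shows "(\<lambda>\<xi>::real^'n::finite. complex_of_real ((\<xi> \<bullet> \<xi>) ^ K * acoustic_flow \<nu> \<kappa> a b (\<xi> \<bullet> \<xi>))) \<in> schwartz"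
proof -
  obtain C c where c: "c > 0" "\<And>\<tau>. \<tau> \<ge> 0 \<Longrightarrow> \<bar>acoustic_flow \<nu> \<kappa> a True \<tau>\<bar> \<le> C * exp (- c * \<tau>)" "\<And>\<tau>. \<tau> \<ge> 0 \<Longrightarrow> \<bar>acoustic_flow \<nu> \<kappa> a False \<tau>\<bar> \<le> C * exp (- c * \<tau>)"
    using acoustic_flow_decay[OF assms, of a] by blast
  have x: "(acoustic_flow \<nu> \<kappa> a True has_real_derivative 0 * acoustic_flow \<nu> \<kappa> a True \<tau> + - \<kappa> * acoustic_flow \<nu> \<kappa> a False \<tau>) (at \<tau>)" for \<tau>
    using acoustic_flow_deriv[of \<nu> \<kappa> a True \<tau>] by (simp add: acoustic_mat_def mult.commute)
  have y: "(acoustic_flow \<nu> \<kappa> a False has_real_derivative 1 * acoustic_flow \<nu> \<kappa> a True \<tau> + - \<nu> * acoustic_flow \<nu> \<kappa> a False \<tau>) (at \<tau>)" for \<tau>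
    using acoustic_flow_deriv[of \<nu> \<kappa> a False \<tau>] by (simp add: acoustic_mat_def mult.commute)
  have S: "(\<lambda>\<xi>::real^'n. p \<xi> * complex_of_real (acoustic_flow \<nu> \<kappa> a True (\<xi> \<bullet> \<xi>)) + r \<xi> * complex_of_real (acoustic_flow \<nu> \<kappa> a False (\<xi> \<bullet> \<xi>))) \<in> schwartz"
    if "p \<in> poly_fun" "r \<in> poly_fun" for p r
    using c that by (intro radial_schwartz[OF x y c(1)]) auto
  show ?thesis
  proof (cases b)
    case True
    then show ?thesis using S[OF poly_fun_inner[of K] poly_fun.const[of 0]] by simp
  next
    case False
    then show ?thesis using S[OF poly_fun.const[of 0] poly_fun_inner[of K]] by simp
  qed
qed

lemma heat_schwartz:
  assumes "\<mu> > 0"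
  shows "(\<lambda>\<xi>::real^'n::finite. complex_of_real ((\<xi> \<bullet> \<xi>) ^ K * exp (- \<mu> * (\<xi> \<bullet> \<xi>)))) \<in> schwartz"
proof -
  have x: "((\<lambda>\<tau>. exp (- \<mu> * \<tau>)) has_real_derivative (- \<mu>) * exp (- \<mu> * \<tau>) + 0 * 0) (at \<tau>)" for \<tau>
    by (auto intro!: derivative_eq_intros)
  have y: "((\<lambda>\<tau>. 0) has_real_derivative 0 * exp (- \<mu> * \<tau>) + 0 * 0) (at \<tau>)" for \<tau> by simp
  have "(\<lambda>\<xi>::real^'n. complex_of_real ((\<xi> \<bullet> \<xi>) ^ K) * complex_of_real (exp (- \<mu> * (\<xi> \<bullet> \<xi>))) + 0 * complex_of_real 0) \<in> schwartz"
    by (rule radial_schwartz[where x="\<lambda>\<tau>. exp (- \<mu> * \<tau>)" and y="\<lambda>_. 0" and K=1 and e=\<mu>, OF x y assms _ _ poly_fun_inner[of K] poly_fun.const[of 0]]) auto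
  then show ?thesis by simp
qed

text \<open>Derivatives of quotients of this form are again such quotients with a higher power of \<open>|\<xi>|\<^sup>2\<close> in the
denominator, which is bounded below where \<open>g\<close> does not vanish.\<close>

lemma schwartz_div_norm_power:
  fixes g :: "real^'n::finite \<Rightarrow> complex"
  assumes g: "g \<in> schwartz" "\<And>\<xi>. norm \<xi> < c \<Longrightarrow> g \<xi> = 0" and c: "c > 0"
  shows "(\<lambda>\<xi>. g \<xi> * complex_of_real (inverse ((\<xi> \<bullet> \<xi>) ^ k))) \<in> schwartz"
proof (rule schwartz_coinduct[where A="{\<lambda>\<xi>. g \<xi> * complex_of_real (inverse ((\<xi> \<bullet> \<xi>) ^ k)) |g k. g \<in> schwartz \<and> (\<forall>\<xi>. norm \<xi> < c \<longrightarrow> g \<xi> = 0)}"])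
  show "(\<lambda>\<xi>. g \<xi> * complex_of_real (inverse ((\<xi> \<bullet> \<xi>) ^ k))) \<in> {\<lambda>\<xi>. g \<xi> * complex_of_real (inverse ((\<xi> \<bullet> \<xi>) ^ k)) |g k. g \<in> schwartz \<and> (\<forall>\<xi>. norm \<xi> < c \<longrightarrow> g \<xi> = 0)}"
    using g by blast
  fix h :: "real^'n \<Rightarrow> complex" and i m
  assume "h \<in> {\<lambda>\<xi>. g \<xi> * complex_of_real (inverse ((\<xi> \<bullet> \<xi>) ^ k)) |g k. g \<in> schwartz \<and> (\<forall>\<xi>. norm \<xi> < c \<longrightarrow> g \<xi> = 0)}"
  then obtain g k where h: "h = (\<lambda>\<xi>. g \<xi> * complex_of_real (inverse ((\<xi> \<bullet> \<xi>) ^ k)))" and gS: "g \<in> schwartz"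
    and g0: "\<And>\<xi>. norm \<xi> < c \<Longrightarrow> g \<xi> = 0" by blast
  have op: "open {\<xi>::real^'n. norm \<xi> < c}" by (intro open_Collect_less continuous_intros)
  have h0: "(h has_derivative (\<lambda>_. 0)) (at \<xi>)" if "norm \<xi> < c" for \<xi>
    by (rule has_derivative_transform_within_open[OF _ op, where f="\<lambda>_. 0"]) (use that g0 in \<open>auto simp: h\<close>)
  have g'0: "partial i g \<xi> = 0" if "norm \<xi> < c" for \<xi>
    by (rule partial_eqI[THEN trans, OF has_derivative_transform_within_open[OF _ op, where f="\<lambda>_. 0" and f'="\<lambda>_. 0"]]) (use that g0 in auto)
  have rad: "((\<lambda>s. inverse (s ^ k)) has_real_derivative - real k * inverse (s ^ Suc k)) (at s)" if "s \<noteq> 0" for s :: real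
  proof (cases k)
    case (Suc n)
    have "((\<lambda>s. s ^ Suc n) has_real_derivative real (Suc n) * s ^ n) (at s)"
      using DERIV_pow[of "Suc n" s] by simp
    from DERIV_inverse'[OF this] have d: "((\<lambda>s. inverse (s ^ Suc n)) has_real_derivative - (inverse (s ^ Suc n) * (real (Suc n) * s ^ n) * inverse (s ^ Suc n))) (at s)"
      using that by simp
    have "- (inverse (s ^ Suc n) * (real (Suc n) * s ^ n) * inverse (s ^ Suc n)) = - real (Suc n) * inverse (s ^ Suc (Suc n))"
      using that by (simp add: field_simps)
    from DERIV_cong[OF d this] show ?thesis unfolding Suc .
  qed simp
  have sn: "\<xi> \<bullet> \<xi> \<noteq> 0" if "\<not> norm \<xi> < c" for \<xi> :: "real^'n" using that c by auto
  have dw: "(\<lambda>\<xi>. complex_of_real (inverse ((\<xi> \<bullet> \<xi>) ^ k))) differentiable (at \<xi>)" if "\<not> norm \<xi> < c" for \<xi> :: "real^'n"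
    by (rule differentiableI[OF radial_has_derivative[OF rad[OF sn[OF that]]]])
  have "h differentiable (at \<xi>)" for \<xi>
  proof (cases "norm \<xi> < c")
    case True then show ?thesis using h0 by (auto intro: differentiableI)
  next
    case False
    then show ?thesis unfolding h by (intro differentiable_mult schwartz_differentiable gS dw)
  qed
  then show "h differentiable_on UNIV" by (rule differentiable_onI)
  let ?g' = "\<lambda>\<xi>. complex_of_real ((\<xi> \<bullet> \<xi>) ^ 1) * partial i g \<xi> - (2 * of_nat k) * (complex_of_real (\<xi> $ i) * g \<xi>)"
  have "partial i h \<xi> = ?g' \<xi> * complex_of_real (inverse ((\<xi> \<bullet> \<xi>) ^ Suc k))" for \<xi>
  proof (cases "norm \<xi> < c")
    case True
    then show ?thesis using partial_eqI[OF h0[OF True]] g0[OF True] g'0[OF True] by simp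
  next
    case False
    note s = sn[OF False]
    have weq: "complex_of_real (inverse ((\<xi> \<bullet> \<xi>) ^ k)) = complex_of_real (\<xi> \<bullet> \<xi>) * complex_of_real (inverse ((\<xi> \<bullet> \<xi>) ^ Suc k))"
      using s unfolding of_real_mult[symmetric] of_real_eq_iff by simp
    have alg: "dg * (S * w) + g0 * (2 * x * (- kk * w)) = (S * dg - (2 * kk) * (x * g0)) * w" for dg S w g0 x kk :: complex
      by (simp add: algebra_simps)
    show ?thesis
      unfolding h partial_mult[OF schwartz_differentiable[OF gS] dw[OF False]] partial_radial[OF rad[OF s]] weq
      by (simp only: of_real_mult of_real_minus of_real_of_nat_eq power_one_right alg)
  qed
  then have "partial i h = (\<lambda>\<xi>. ?g' \<xi> * complex_of_real (inverse ((\<xi> \<bullet> \<xi>) ^ Suc k)))" by blast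
  moreover define g' where "g' = ?g'"
  ultimately have h': "partial i h = (\<lambda>\<xi>. g' \<xi> * complex_of_real (inverse ((\<xi> \<bullet> \<xi>) ^ Suc k)))" by simp
  have "?g' \<in> schwartz"
    by (intro schwartz_diff poly_fun_schwartz[OF poly_fun_inner] schwartz_partial schwartz_cmult schwartz_coord_mult gS)
  moreover have "\<forall>\<xi>. norm \<xi> < c \<longrightarrow> ?g' \<xi> = 0" using g0 g'0 by simp
  ultimately have "g' \<in> schwartz" "\<forall>\<xi>. norm \<xi> < c \<longrightarrow> g' \<xi> = 0" unfolding g'_def .
  with h' show "partial i h \<in> {\<lambda>\<xi>. g \<xi> * complex_of_real (inverse ((\<xi> \<bullet> \<xi>) ^ k)) |g k. g \<in> schwartz \<and> (\<forall>\<xi>. norm \<xi> < c \<longrightarrow> g \<xi> = 0)}"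
    by blast
  have "(1 + norm \<xi>) ^ m * norm (h \<xi>) \<le> schwartz_seminorm m g * inverse (c ^ (2 * k))" for \<xi>
  proof (cases "norm \<xi> < c")
    case True
    then show ?thesis using g0[OF True] seminorm_nonneg[OF gS] c by (simp add: h)
  next
    case False
    have "(1 + norm \<xi>) ^ m * norm (h \<xi>) = ((1 + norm \<xi>) ^ m * norm (partials [] g \<xi>)) * inverse (norm \<xi> ^ (2 * k))"
      unfolding h by (simp add: norm_mult norm_inverse norm_power power_mult power2_norm_eq_inner mult.assoc)
    also have "\<dots> \<le> schwartz_seminorm m g * inverse (c ^ (2 * k))"
      using False c seminorm_nonneg[OF gS] by (intro mult_mono seminorm_ge gS le_imp_inverse_le power_mono) auto
    finally show ?thesis .
  qed
  then show "\<exists>C. \<forall>\<xi>. (1 + norm \<xi>) ^ m * norm (h \<xi>) \<le> C" by blast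
qed

section \<open>Frequency-localised propagators\<close>

text \<open>The kernels are dilates of a single Schwartz function, and their difference tends to zero by dominated
convergence.\<close>

lemma kernel_norm_diff_tendsto:
  fixes H :: "real^'n::finite \<Rightarrow> complex"
  assumes H: "H \<in> schwartz" and t0: "t0 > 0"
  shows "((\<lambda>t. kernel_norm (\<lambda>\<xi>. complex_of_real (t powr s) * H (sqrt t *\<^sub>R \<xi>) - complex_of_real (t0 powr s) * H (sqrt t0 *\<^sub>R \<xi>))) \<longlongrightarrow> 0)
     (at t0 within {t0 / 2..2 * t0})"
  unfolding tendsto_at_iff_sequentially
proof (intro allI impI)
  fix X :: "nat \<Rightarrow> real" assume X: "\<forall>i. X i \<in> {t0 / 2..2 * t0} - {t0}" "X \<longlonglongrightarrow> t0"
  then have Xp: "t0 / 2 \<le> X n" "X n \<le> 2 * t0" "X n > 0" for n using t0 by (auto simp: field_simps dest!: spec[of _ n])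
  let ?k = "conv_kernel H"
  define G where "G t x = complex_of_real (t powr s / (sqrt t) ^ CARD('n)) * ?k ((1 / sqrt t) *\<^sub>R x)" for t x
  have kS: "?k \<in> schwartz" by (rule conv_kernel_schwartz[OF H])
  have Hd: "(\<lambda>\<xi>. complex_of_real (t powr s) * H (sqrt t *\<^sub>R \<xi>)) \<in> schwartz" if "t > 0" for t
    using that by (intro schwartz_cmult schwartz_dilate H) auto
  have kG: "conv_kernel (\<lambda>\<xi>. complex_of_real (t powr s) * H (sqrt t *\<^sub>R \<xi>) - complex_of_real (t0 powr s) * H (sqrt t0 *\<^sub>R \<xi>)) x = G t x - G t0 x" if t: "t > 0" for t x
  proof -
    have one: "conv_kernel (\<lambda>\<xi>. complex_of_real (t powr s) * H (sqrt t *\<^sub>R \<xi>)) x = G t x" if "t > 0" for t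
      using that by (simp add: kernel_cmult kernel_dilate[OF H] G_def)
    have "(\<lambda>\<xi>. complex_of_real (t powr s) * H (sqrt t *\<^sub>R \<xi>) - complex_of_real (t0 powr s) * H (sqrt t0 *\<^sub>R \<xi>))
      = (\<lambda>\<xi>. complex_of_real (t powr s) * H (sqrt t *\<^sub>R \<xi>) + (- 1) * (complex_of_real (t0 powr s) * H (sqrt t0 *\<^sub>R \<xi>)))" by simp
    then show ?thesis
      by (simp only: kernel_add[OF Hd[OF t] schwartz_cmult(1)[OF Hd[OF t0]]] kernel_cmult[of "- 1"] one[OF t] one[OF t0]) simp
  qed
  define A where "A = (\<Squnion>t\<in>{t0 / 2..2 * t0}. t powr s / (sqrt t) ^ CARD('n))"
  have "compact ((\<lambda>t. t powr s / (sqrt t) ^ CARD('n)) ` {t0 / 2..2 * t0})"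
    using t0 by (intro compact_continuous_image continuous_intros) auto
  then have "bdd_above ((\<lambda>t. t powr s / (sqrt t) ^ CARD('n)) ` {t0 / 2..2 * t0})"
    by (intro bounded_imp_bdd_above compact_imp_bounded)
  then have A: "t powr s / (sqrt t) ^ CARD('n) \<le> A" if "t \<in> {t0 / 2..2 * t0}" for t
    unfolding A_def using that by (intro cSUP_upper)
  have A0: "0 \<le> A" using order_trans[OF _ A[of t0]] t0 by (auto simp: field_simps)
  define b where "b = max 1 (sqrt (2 * t0))"
  define S where "S = schwartz_seminorm (2 * CARD('n)) ?k"
  have S0: "0 \<le> S" unfolding S_def by (rule seminorm_nonneg[OF kS])
  let ?w = "\<lambda>x::real^'n. (A * (S * b ^ (2 * CARD('n)))) * (1 / (1 + norm x) ^ (2 * CARD('n)))"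
  have Gb: "norm (G t x) \<le> ?w x" if t: "t \<in> {t0 / 2..2 * t0}" for t x
  proof -
    have tp: "t > 0" using t t0 by auto
    have "1 + norm x \<le> b * (1 + norm ((1 / sqrt t) *\<^sub>R x))"
    proof -
      have "norm x = sqrt t * norm ((1 / sqrt t) *\<^sub>R x)" using tp by simp
      also have "\<dots> \<le> b * norm ((1 / sqrt t) *\<^sub>R x)" using t by (intro mult_right_mono) (auto simp: b_def max_def)
      finally show ?thesis unfolding distrib_left by (intro add_mono) (auto simp: b_def)
    qed
    then have "(1 + norm x) ^ (2 * CARD('n)) \<le> (b * (1 + norm ((1 / sqrt t) *\<^sub>R x))) ^ (2 * CARD('n))"
      by (intro power_mono) auto
    then have pw: "(1 + norm x) ^ (2 * CARD('n)) \<le> b ^ (2 * CARD('n)) * (1 + norm ((1 / sqrt t) *\<^sub>R x)) ^ (2 * CARD('n))"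
      by (simp only: power_mult_distrib)
    have div: "W \<le> B * N \<Longrightarrow> 0 < W \<Longrightarrow> 0 < N \<Longrightarrow> 1 / N \<le> B * (1 / W)" for W B N :: real
      by (simp add: field_simps)
    have le: "1 / (1 + norm ((1 / sqrt t) *\<^sub>R x)) ^ (2 * CARD('n)) \<le> b ^ (2 * CARD('n)) * (1 / (1 + norm x) ^ (2 * CARD('n)))"
      by (rule div[OF pw]) (intro zero_less_power one_plus_norm_pos)+
    have "norm (?k ((1 / sqrt t) *\<^sub>R x)) \<le> S * (1 / (1 + norm ((1 / sqrt t) *\<^sub>R x)) ^ (2 * CARD('n)))"
      using schwartz_moment[OF kS, of "(1 / sqrt t) *\<^sub>R x" 0] unfolding S_def by simp
    also have "\<dots> \<le> S * (b ^ (2 * CARD('n)) * (1 / (1 + norm x) ^ (2 * CARD('n))))"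
      using S0 le by (intro mult_left_mono)
    finally have "norm (G t x) \<le> A * (S * (b ^ (2 * CARD('n)) * (1 / (1 + norm x) ^ (2 * CARD('n)))))"
      unfolding G_def norm_mult norm_of_real using A[OF t] tp A0 by (intro mult_mono) auto
    then show ?thesis by (simp only: mult.assoc)
  qed
  have Gm: "G t \<in> borel_measurable borel" for t
    unfolding G_def using schwartz_measurable[OF kS] by measurable
  have "(\<lambda>n. \<integral>x. norm (G (X n) x - G t0 x) \<partial>lborel) \<longlonglongrightarrow> (\<integral>x. norm (G t0 x - G t0 x) \<partial>lborel)"
  proof (rule integral_dominated_convergence[where w="\<lambda>x. 2 * ?w x"])
    show "integrable lborel (\<lambda>x::real^'n. 2 * ?w x)"
      using weight_integrable[where 'a="real^'n"] by (intro integrable_mult_right) simp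
    have "(\<lambda>n. G (X n) x) \<longlonglongrightarrow> G t0 x" for x
    proof -
      have "(\<lambda>n. (1 / sqrt (X n)) *\<^sub>R x) \<longlonglongrightarrow> (1 / sqrt t0) *\<^sub>R x"
        using t0 X(2) by (intro tendsto_intros) auto
      then have "(\<lambda>n. ?k ((1 / sqrt (X n)) *\<^sub>R x)) \<longlonglongrightarrow> ?k ((1 / sqrt t0) *\<^sub>R x)"
        by (intro continuous_on_tendsto_compose[OF schwartz_continuous[OF kS]]) auto
      then show ?thesis unfolding G_def using t0 X(2) by (intro tendsto_intros) auto
    qed
    then show "AE x in lborel. (\<lambda>n. norm (G (X n) x - G t0 x)) \<longlonglongrightarrow> norm (G t0 x - G t0 x)"
      by (intro AE_I2 tendsto_intros)
    have "norm (norm (G (X n) x - G t0 x)) \<le> 2 * ?w x" for n x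
      using norm_triangle_ineq4[of "G (X n) x" "G t0 x"] Gb[of "X n" x] Gb[of t0 x] Xp[of n] t0 by simp
    then show "AE x in lborel. norm (norm (G (X n) x - G t0 x)) \<le> 2 * ?w x" for n by simp
  qed (use Gm in measurable)
  then show "((\<lambda>t. kernel_norm (\<lambda>\<xi>. complex_of_real (t powr s) * H (sqrt t *\<^sub>R \<xi>) - complex_of_real (t0 powr s) * H (sqrt t0 *\<^sub>R \<xi>))) \<circ> X) \<longlonglongrightarrow> 0"
    unfolding comp_def kernel_norm_def kG[OF Xp(3)] by simp
qed

text \<open>The propagator at time \<open>t\<close>, localised by \<open>\<Phi>\<close> to frequencies of order \<open>1 / a\<close>.\<close>

definition block_symbol :: "real \<Rightarrow> real \<Rightarrow> real \<Rightarrow> (real^'n::finite \<Rightarrow> complex) \<Rightarrow> real \<Rightarrow> real \<Rightarrow> 'n + 'n \<Rightarrow> 'n + 'n \<Rightarrow> real^'n \<Rightarrow> complex" where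
  "block_symbol \<mu> \<nu> \<kappa> \<Phi> a t i j \<xi> = \<Phi> (a *\<^sub>R \<xi>) * matexp (sys_symbol \<mu> \<nu> \<kappa>) t i j \<xi>"

text \<open>The next four functions are the factors of the localised propagator, see \<open>block_symbol_decomp\<close>. A power \<open>K\<close> of
\<open>|\<xi>|\<^sup>2\<close> is moved from the factors that carry the angular dependence and the cut-off \<open>\<Phi>\<close> to those that depend on time.\<close>

definition long_angular :: "(real^'n::finite \<Rightarrow> complex) \<Rightarrow> nat \<Rightarrow> 'n \<Rightarrow> 'n \<Rightarrow> real^'n \<Rightarrow> complex" where
  "long_angular \<Phi> K i j \<xi> = (complex_of_real (\<xi> $ i) * (complex_of_real (\<xi> $ j) * \<Phi> \<xi>)) * complex_of_real (inverse ((\<xi> \<bullet> \<xi>) ^ Suc K))"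

definition trans_angular :: "(real^'n::finite \<Rightarrow> complex) \<Rightarrow> nat \<Rightarrow> 'n \<Rightarrow> 'n \<Rightarrow> real^'n \<Rightarrow> complex" where
  "trans_angular \<Phi> K i j \<xi> = (if i = j then 1 else 0) * (\<Phi> \<xi> * complex_of_real (inverse ((\<xi> \<bullet> \<xi>) ^ K))) - long_angular \<Phi> K i j \<xi>"

definition long_radial :: "real \<Rightarrow> real \<Rightarrow> nat \<Rightarrow> bool \<Rightarrow> bool \<Rightarrow> real^'n::finite \<Rightarrow> complex" where
  "long_radial \<nu> \<kappa> K a b \<xi> = complex_of_real ((\<xi> \<bullet> \<xi>) ^ K * acoustic_flow \<nu> \<kappa> a b (\<xi> \<bullet> \<xi>))"

definition trans_radial :: "real \<Rightarrow> nat \<Rightarrow> real^'n::finite \<Rightarrow> complex" where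
  "trans_radial \<mu> K \<xi> = complex_of_real ((\<xi> \<bullet> \<xi>) ^ K * exp (- \<mu> * (\<xi> \<bullet> \<xi>)))"

context
  fixes \<mu> \<nu> \<kappa> c :: real and \<Phi> :: "real^'n::finite \<Rightarrow> complex"
  assumes \<mu>: "\<mu> > 0" and \<nu>: "\<nu> > 0" and \<kappa>: "\<kappa> > 0" and c: "c > 0"
    and \<Phi>: "\<Phi> \<in> schwartz" and \<Phi>0: "\<And>\<xi>. norm \<xi> < c \<Longrightarrow> \<Phi> \<xi> = 0"
begin

lemma long_angular_schwartz: "long_angular \<Phi> K i j \<in> schwartz"
proof -
  have "(\<lambda>\<xi>. (complex_of_real (\<xi> $ i) * (complex_of_real (\<xi> $ j) * \<Phi> \<xi>)) * complex_of_real (inverse ((\<xi> \<bullet> \<xi>) ^ Suc K))) \<in> schwartz"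
    by (rule schwartz_div_norm_power[OF _ _ c]) (auto intro!: schwartz_coord_mult \<Phi> simp: \<Phi>0)
  then show ?thesis unfolding long_angular_def[abs_def] .
qed

lemma trans_angular_schwartz: "trans_angular \<Phi> K i j \<in> schwartz"
  unfolding trans_angular_def[abs_def]
  by (intro schwartz_diff schwartz_cmult schwartz_div_norm_power[OF \<Phi> \<Phi>0 c] long_angular_schwartz)

lemma long_radial_schwartz: "(long_radial \<nu> \<kappa> K a b :: real^'n \<Rightarrow> complex) \<in> schwartz"
  unfolding long_radial_def[abs_def] by (rule acoustic_flow_schwartz[OF \<nu> \<kappa>])

lemma trans_radial_schwartz: "(trans_radial \<mu> K :: real^'n \<Rightarrow> complex) \<in> schwartz"
  unfolding trans_radial_def[abs_def] by (rule heat_schwartz[OF \<mu>])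

text \<open>The factors \<open>(a\<^sup>2 |\<xi>|\<^sup>2)\<^bsup>-K\<^esup>\<close> and \<open>(t |\<xi>|\<^sup>2)\<^sup>K\<close> multiply to \<open>(a\<^sup>2 / t)\<^bsup>-K\<^esup>\<close>, which the constant in front cancels. Each factor
is a dilate of a Schwartz function that depends neither on \<open>a\<close> nor on \<open>t\<close>: the angular factors because \<open>\<Phi>\<close>
vanishes near the origin, the radial factors because of the decay of the exponential.\<close>

lemma block_symbol_decomp:
  assumes a: "a > 0" and t: "t > 0"
  shows "block_symbol \<mu> \<nu> \<kappa> \<Phi> a t i j \<xi> = complex_of_real ((a\<^sup>2 / t) ^ K) *
     (long_angular \<Phi> K (space_index i) (space_index j) (a *\<^sub>R \<xi>) * long_radial \<nu> \<kappa> K (isl i) (isl j) (sqrt t *\<^sub>R \<xi>)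
      + (if isl i = isl j then 1 else 0) * (trans_angular \<Phi> K (space_index i) (space_index j) (a *\<^sub>R \<xi>) * trans_radial \<mu> K (sqrt t *\<^sub>R \<xi>)))"
proof (cases "\<xi> = 0")
  case True
  have "\<Phi> 0 = 0" using \<Phi>0[of 0] c by simp
  then show ?thesis using True by (simp add: block_symbol_def long_angular_def trans_angular_def)
next
  case False
  define r where "r = \<xi> \<bullet> \<xi>"
  have r: "r > 0" using False by (simp add: r_def)
  have n2: "(norm \<xi>)\<^sup>2 = r" by (simp add: r_def power2_norm_eq_inner)
  have ra: "(a *\<^sub>R \<xi>) \<bullet> (a *\<^sub>R \<xi>) = a\<^sup>2 * r" and rt: "(sqrt t *\<^sub>R \<xi>) \<bullet> (sqrt t *\<^sub>R \<xi>) = t * r"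
    using t by (simp_all add: r_def power2_eq_square)
  have can: "(a\<^sup>2 / t) ^ K * (inverse ((a\<^sup>2 * r) ^ K) * (t * r) ^ K) = 1"
    using a t r by (simp add: power_mult_distrib power_divide field_simps)
  let ?P = "complex_of_real (ray_proj \<xi> (space_index i) (space_index j))" and ?i = "complex_of_real (inverse ((a\<^sup>2 * r) ^ K))"
  have A1: "long_angular \<Phi> K (space_index i) (space_index j) (a *\<^sub>R \<xi>) = \<Phi> (a *\<^sub>R \<xi>) * ?P * ?i"
  proof -
    have "(a * \<xi> $ space_index i) * (a * \<xi> $ space_index j) * inverse ((a\<^sup>2 * r) ^ Suc K) = ray_proj \<xi> (space_index i) (space_index j) * inverse ((a\<^sup>2 * r) ^ K)"
    proof -
      have "(a * x) * (a * y) * inverse ((a\<^sup>2 * r) ^ Suc K) = x * y / r * inverse ((a\<^sup>2 * r) ^ K)" for x y :: real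
        using a r by (simp add: field_simps power2_eq_square)
      then show ?thesis by (simp only: ray_proj_def n2)
    qed
    then have "complex_of_real (a * \<xi> $ space_index i) * complex_of_real (a * \<xi> $ space_index j) * complex_of_real (inverse ((a\<^sup>2 * r) ^ Suc K)) = ?P * ?i"
      by (simp only: of_real_mult[symmetric])
    then show ?thesis unfolding long_angular_def ra by (simp add: mult_ac)
  qed
  have A2: "trans_angular \<Phi> K (space_index i) (space_index j) (a *\<^sub>R \<xi>) = \<Phi> (a *\<^sub>R \<xi>) * ((if space_index i = space_index j then 1 else 0) - ?P) * ?i"
    unfolding trans_angular_def A1 ra by (simp add: algebra_simps)
  have can': "complex_of_real ((a\<^sup>2 / t) ^ K) * (?i * complex_of_real ((t * r) ^ K)) = 1"
    using can by (simp only: of_real_mult[symmetric]) simp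
  let ?L = "complex_of_real (acoustic_flow \<nu> \<kappa> (isl i) (isl j) (t * r))" and ?E = "complex_of_real (exp (- \<mu> * (t * r)))"
  have alg: "X * (F * P * Y * (Z * L) + D * (F * Q * Y * (Z * E))) = (X * (Y * Z)) * (F * (P * L + D * (Q * E)))" for X F P Y Z L D Q E :: complex
    by (simp add: algebra_simps)
  have "complex_of_real ((a\<^sup>2 / t) ^ K) *
     (long_angular \<Phi> K (space_index i) (space_index j) (a *\<^sub>R \<xi>) * long_radial \<nu> \<kappa> K (isl i) (isl j) (sqrt t *\<^sub>R \<xi>)
      + (if isl i = isl j then 1 else 0) * (trans_angular \<Phi> K (space_index i) (space_index j) (a *\<^sub>R \<xi>) * trans_radial \<mu> K (sqrt t *\<^sub>R \<xi>)))
     = \<Phi> (a *\<^sub>R \<xi>) * (?P * ?L + (if isl i = isl j then 1 else 0) * (((if space_index i = space_index j then 1 else 0) - ?P) * ?E))"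
    unfolding A1 A2 long_radial_def trans_radial_def rt of_real_mult alg
    using can' by (simp only: of_real_mult[symmetric] mult_1_left of_real_power[symmetric])
  also have "\<dots> = block_symbol \<mu> \<nu> \<kappa> \<Phi> a t i j \<xi>"
    unfolding block_symbol_def matexp_sys_symbol[OF False] n2 by simp
  finally show ?thesis by simp
qed

lemma block_symbol_eq:
  assumes a: "a > 0" and t: "t > 0"
  shows "block_symbol \<mu> \<nu> \<kappa> \<Phi> a t i j = (\<lambda>\<xi>. complex_of_real ((a\<^sup>2 / t) ^ K) *
     (long_angular \<Phi> K (space_index i) (space_index j) (a *\<^sub>R \<xi>) * long_radial \<nu> \<kappa> K (isl i) (isl j) (sqrt t *\<^sub>R \<xi>)
      + (if isl i = isl j then 1 else 0) * (trans_angular \<Phi> K (space_index i) (space_index j) (a *\<^sub>R \<xi>) * trans_radial \<mu> K (sqrt t *\<^sub>R \<xi>))))"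
  by (rule ext, rule block_symbol_decomp[OF assms])

lemma block_symbol_parts_schwartz:
  assumes a: "a > 0" and t: "t > 0"
  shows "(\<lambda>\<xi>. long_angular \<Phi> K i j (a *\<^sub>R \<xi>)) \<in> schwartz" "(\<lambda>\<xi>. trans_angular \<Phi> K i j (a *\<^sub>R \<xi>)) \<in> schwartz"
    "(\<lambda>\<xi>::real^'n. long_radial \<nu> \<kappa> K b d (sqrt t *\<^sub>R \<xi>)) \<in> schwartz" "(\<lambda>\<xi>::real^'n. trans_radial \<mu> K (sqrt t *\<^sub>R \<xi>)) \<in> schwartz"
  using a t by (auto intro!: schwartz_dilate long_angular_schwartz trans_angular_schwartz long_radial_schwartz trans_radial_schwartz)

lemma block_symbol_schwartz:
  assumes a: "a > 0" and t: "t > 0"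
  shows "block_symbol \<mu> \<nu> \<kappa> \<Phi> a t i j \<in> schwartz"
  unfolding block_symbol_eq[OF assms, of i j 0]
  by (intro schwartz_cmult schwartz_add schwartz_mult block_symbol_parts_schwartz[OF a t])

text \<open>Kernel norms are submultiplicative and invariant under dilations, so of all the dependence on \<open>a\<close> and \<open>t\<close> only the
constant in \<open>block_symbol_decomp\<close> remains.\<close>

lemma block_symbol_kernel_norm:
  "\<exists>C\<ge>0. \<forall>a>0. \<forall>t>0. \<forall>i j. kernel_norm (block_symbol \<mu> \<nu> \<kappa> \<Phi> a t i j) \<le> C * (a\<^sup>2 / t) ^ K"
proof -
  define Q where "Q i j b d = kernel_norm (long_angular \<Phi> K i j) * kernel_norm (long_radial \<nu> \<kappa> K b d :: real^'n \<Rightarrow> complex)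
     + kernel_norm (trans_angular \<Phi> K i j) * kernel_norm (trans_radial \<mu> K :: real^'n \<Rightarrow> complex)" for i j b d
  have Q0: "Q i j b d \<ge> 0" for i j b d unfolding Q_def by (intro add_nonneg_nonneg mult_nonneg_nonneg kernel_norm_nonneg)
  define C where "C = (\<Sum>i\<in>UNIV. \<Sum>j\<in>UNIV. \<Sum>b\<in>UNIV. \<Sum>d\<in>UNIV. Q i j b d)"
  have QC: "Q i j b d \<le> C" for i j b d
  proof -
    have "Q i j b d \<le> (\<Sum>d\<in>UNIV. Q i j b d)" by (rule member_le_sum) (auto simp: Q0)
    also have "\<dots> \<le> (\<Sum>b\<in>UNIV. \<Sum>d\<in>UNIV. Q i j b d)" by (rule member_le_sum) (auto simp: Q0 sum_nonneg)
    also have "\<dots> \<le> (\<Sum>j\<in>UNIV. \<Sum>b\<in>UNIV. \<Sum>d\<in>UNIV. Q i j b d)" by (rule member_le_sum) (auto simp: Q0 sum_nonneg)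
    also have "\<dots> \<le> C" unfolding C_def by (rule member_le_sum) (auto simp: Q0 sum_nonneg)
    finally show ?thesis .
  qed
  have "kernel_norm (block_symbol \<mu> \<nu> \<kappa> \<Phi> a t i j) \<le> C * (a\<^sup>2 / t) ^ K" if a: "a > 0" and t: "t > 0" for a t i j
  proof -
    note S = block_symbol_parts_schwartz[OF a t]
    have st: "sqrt t > 0" using t by simp
    let ?D = "if isl i = isl j then 1 else 0 :: complex"
    have 1: "kernel_norm (\<lambda>\<xi>. long_angular \<Phi> K (space_index i) (space_index j) (a *\<^sub>R \<xi>) * long_radial \<nu> \<kappa> K (isl i) (isl j) (sqrt t *\<^sub>R \<xi>))
      \<le> kernel_norm (long_angular \<Phi> K (space_index i) (space_index j)) * kernel_norm (long_radial \<nu> \<kappa> K (isl i) (isl j) :: real^'n \<Rightarrow> complex)"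
      using kernel_norm_mult[OF S(1,3)] by (simp only: kernel_norm_dilate[OF long_angular_schwartz a] kernel_norm_dilate[OF long_radial_schwartz st])
    have 2: "kernel_norm (\<lambda>\<xi>. trans_angular \<Phi> K (space_index i) (space_index j) (a *\<^sub>R \<xi>) * trans_radial \<mu> K (sqrt t *\<^sub>R \<xi>))
      \<le> kernel_norm (trans_angular \<Phi> K (space_index i) (space_index j)) * kernel_norm (trans_radial \<mu> K :: real^'n \<Rightarrow> complex)"
      using kernel_norm_mult[OF S(2,4)] by (simp only: kernel_norm_dilate[OF trans_angular_schwartz a] kernel_norm_dilate[OF trans_radial_schwartz st])
    have "kernel_norm (block_symbol \<mu> \<nu> \<kappa> \<Phi> a t i j) = (a\<^sup>2 / t) ^ K * kernel_norm (\<lambda>\<xi>. long_angular \<Phi> K (space_index i) (space_index j) (a *\<^sub>R \<xi>) * long_radial \<nu> \<kappa> K (isl i) (isl j) (sqrt t *\<^sub>R \<xi>)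
      + ?D * (trans_angular \<Phi> K (space_index i) (space_index j) (a *\<^sub>R \<xi>) * trans_radial \<mu> K (sqrt t *\<^sub>R \<xi>)))"
      unfolding block_symbol_eq[OF a t, of i j K] kernel_norm_cmult norm_of_real using t by simp
    also have "\<dots> \<le> (a\<^sup>2 / t) ^ K * (kernel_norm (\<lambda>\<xi>. long_angular \<Phi> K (space_index i) (space_index j) (a *\<^sub>R \<xi>) * long_radial \<nu> \<kappa> K (isl i) (isl j) (sqrt t *\<^sub>R \<xi>))
        + norm ?D * kernel_norm (\<lambda>\<xi>. trans_angular \<Phi> K (space_index i) (space_index j) (a *\<^sub>R \<xi>) * trans_radial \<mu> K (sqrt t *\<^sub>R \<xi>)))"
      unfolding kernel_norm_cmult[symmetric] using t
      by (intro mult_left_mono kernel_norm_add schwartz_mult schwartz_cmult S) auto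
    also have "\<dots> \<le> (a\<^sup>2 / t) ^ K * Q (space_index i) (space_index j) (isl i) (isl j)"
    proof (intro mult_left_mono)
      have "norm ?D * kernel_norm (\<lambda>\<xi>. trans_angular \<Phi> K (space_index i) (space_index j) (a *\<^sub>R \<xi>) * trans_radial \<mu> K (sqrt t *\<^sub>R \<xi>))
         \<le> 1 * (kernel_norm (trans_angular \<Phi> K (space_index i) (space_index j)) * kernel_norm (trans_radial \<mu> K :: real^'n \<Rightarrow> complex))"
        using 2 by (intro mult_mono) (auto simp: kernel_norm_nonneg)
      then show "kernel_norm (\<lambda>\<xi>. long_angular \<Phi> K (space_index i) (space_index j) (a *\<^sub>R \<xi>) * long_radial \<nu> \<kappa> K (isl i) (isl j) (sqrt t *\<^sub>R \<xi>))
        + norm ?D * kernel_norm (\<lambda>\<xi>. trans_angular \<Phi> K (space_index i) (space_index j) (a *\<^sub>R \<xi>) * trans_radial \<mu> K (sqrt t *\<^sub>R \<xi>)) \<le> Q (space_index i) (space_index j) (isl i) (isl j)"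
        using 1 unfolding Q_def by linarith
    qed (use t in simp)
    also have "\<dots> \<le> (a\<^sup>2 / t) ^ K * C" using t by (intro mult_left_mono QC) simp
    finally show ?thesis by (simp add: mult.commute)
  qed
  moreover have "C \<ge> 0" unfolding C_def by (intro sum_nonneg Q0)
  ultimately show ?thesis by blast
qed

text \<open>With \<open>K = 0\<close> only the radial factors depend on time, and \<open>kernel_norm_diff_tendsto\<close> applies to them. The bound is uniform
in the frequency.\<close>

lemma block_symbol_time_continuous:
  assumes t0: "t0 > 0"
  shows "\<exists>e. (e \<longlongrightarrow> 0) (at t0 within {t0 / 2..2 * t0}) \<and> (\<forall>t\<in>{t0 / 2..2 * t0}. \<forall>a>0. \<forall>i j.
     kernel_norm (\<lambda>\<xi>. complex_of_real (t powr s) * block_symbol \<mu> \<nu> \<kappa> \<Phi> a t i j \<xi> - complex_of_real (t0 powr s) * block_symbol \<mu> \<nu> \<kappa> \<Phi> a t0 i j \<xi>) \<le> e t)"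
proof -
  define d where "d H t \<xi> = complex_of_real (t powr s) * H (sqrt t *\<^sub>R \<xi>) - complex_of_real (t0 powr s) * H (sqrt t0 *\<^sub>R \<xi>)" for H and t and \<xi> :: "real^'n"
  define e1 where "e1 i j b b' t = kernel_norm (long_angular \<Phi> 0 i j) * kernel_norm (d (long_radial \<nu> \<kappa> 0 b b') t)
     + kernel_norm (trans_angular \<Phi> 0 i j) * kernel_norm (d (trans_radial \<mu> 0) t)" for i j b b' t
  define e where "e t = (\<Sum>i\<in>UNIV. \<Sum>j\<in>UNIV. \<Sum>b\<in>UNIV. \<Sum>b'\<in>UNIV. e1 i j b b' t)" for t
  have e1n: "e1 i j b b' t \<ge> 0" for i j b b' t unfolding e1_def by (intro add_nonneg_nonneg mult_nonneg_nonneg kernel_norm_nonneg)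
  have e1e: "e1 i j b b' t \<le> e t" for i j b b' t
  proof -
    have "e1 i j b b' t \<le> (\<Sum>b'\<in>UNIV. e1 i j b b' t)" by (rule member_le_sum) (auto simp: e1n)
    also have "\<dots> \<le> (\<Sum>b\<in>UNIV. \<Sum>b'\<in>UNIV. e1 i j b b' t)" by (rule member_le_sum) (auto simp: e1n sum_nonneg)
    also have "\<dots> \<le> (\<Sum>j\<in>UNIV. \<Sum>b\<in>UNIV. \<Sum>b'\<in>UNIV. e1 i j b b' t)" by (rule member_le_sum) (auto simp: e1n sum_nonneg)
    also have "\<dots> \<le> e t" unfolding e_def by (rule member_le_sum) (auto simp: e1n sum_nonneg)
    finally show ?thesis .
  qed
  have dl: "((\<lambda>t. kernel_norm (d H t)) \<longlongrightarrow> 0) (at t0 within {t0 / 2..2 * t0})" if "H \<in> schwartz" for H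
    using kernel_norm_diff_tendsto[OF that t0, of s] by (simp add: d_def[abs_def])
  have "(e1 i j b b' \<longlongrightarrow> kernel_norm (long_angular \<Phi> 0 i j) * 0 + kernel_norm (trans_angular \<Phi> 0 i j) * 0) (at t0 within {t0 / 2..2 * t0})" for i j b b'
    unfolding e1_def[abs_def] by (intro tendsto_add tendsto_mult tendsto_const dl long_radial_schwartz trans_radial_schwartz)
  then have "(e1 i j b b' \<longlongrightarrow> 0) (at t0 within {t0 / 2..2 * t0})" for i j b b' by simp
  then have "(e \<longlongrightarrow> (\<Sum>i\<in>(UNIV::'n set). \<Sum>j\<in>(UNIV::'n set). \<Sum>b\<in>(UNIV::bool set). \<Sum>b'\<in>(UNIV::bool set). 0)) (at t0 within {t0 / 2..2 * t0})"
    unfolding e_def[abs_def] by (intro tendsto_sum)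
  then have lim: "(e \<longlongrightarrow> 0) (at t0 within {t0 / 2..2 * t0})" by simp
  have "kernel_norm (\<lambda>\<xi>. complex_of_real (t powr s) * block_symbol \<mu> \<nu> \<kappa> \<Phi> a t i j \<xi> - complex_of_real (t0 powr s) * block_symbol \<mu> \<nu> \<kappa> \<Phi> a t0 i j \<xi>) \<le> e t"
    if t: "t \<in> {t0 / 2..2 * t0}" and a: "a > 0" for t a i j
  proof -
    have tp: "t > 0" using t t0 by auto
    let ?D = "if isl i = isl j then 1 else 0 :: complex"
    have dS: "d H t \<in> schwartz" if "H \<in> schwartz" for H
      unfolding d_def[abs_def] using tp t0 by (intro schwartz_diff schwartz_cmult schwartz_dilate that) auto
    note S = block_symbol_parts_schwartz[OF a tp] and S0 = block_symbol_parts_schwartz[OF a t0]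
    have eq: "(\<lambda>\<xi>. complex_of_real (t powr s) * block_symbol \<mu> \<nu> \<kappa> \<Phi> a t i j \<xi> - complex_of_real (t0 powr s) * block_symbol \<mu> \<nu> \<kappa> \<Phi> a t0 i j \<xi>)
      = (\<lambda>\<xi>. long_angular \<Phi> 0 (space_index i) (space_index j) (a *\<^sub>R \<xi>) * d (long_radial \<nu> \<kappa> 0 (isl i) (isl j)) t \<xi> + ?D * (trans_angular \<Phi> 0 (space_index i) (space_index j) (a *\<^sub>R \<xi>) * d (trans_radial \<mu> 0) t \<xi>))"
      unfolding block_symbol_eq[OF a tp, of i j 0] block_symbol_eq[OF a t0, of i j 0] d_def by (simp add: algebra_simps fun_eq_iff)
    have 1: "kernel_norm (\<lambda>\<xi>. long_angular \<Phi> 0 (space_index i) (space_index j) (a *\<^sub>R \<xi>) * d (long_radial \<nu> \<kappa> 0 (isl i) (isl j)) t \<xi>)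
      \<le> kernel_norm (long_angular \<Phi> 0 (space_index i) (space_index j)) * kernel_norm (d (long_radial \<nu> \<kappa> 0 (isl i) (isl j)) t)"
      using kernel_norm_mult[OF S(1) dS[OF long_radial_schwartz]] by (simp only: kernel_norm_dilate[OF long_angular_schwartz a])
    have 2: "kernel_norm (\<lambda>\<xi>. trans_angular \<Phi> 0 (space_index i) (space_index j) (a *\<^sub>R \<xi>) * d (trans_radial \<mu> 0) t \<xi>)
      \<le> kernel_norm (trans_angular \<Phi> 0 (space_index i) (space_index j)) * kernel_norm (d (trans_radial \<mu> 0) t)"
      using kernel_norm_mult[OF S(2) dS[OF trans_radial_schwartz]] by (simp only: kernel_norm_dilate[OF trans_angular_schwartz a])
    have 3: "norm ?D * kernel_norm (\<lambda>\<xi>. trans_angular \<Phi> 0 (space_index i) (space_index j) (a *\<^sub>R \<xi>) * d (trans_radial \<mu> 0) t \<xi>)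
       \<le> 1 * (kernel_norm (trans_angular \<Phi> 0 (space_index i) (space_index j)) * kernel_norm (d (trans_radial \<mu> 0) t))"
      using 2 by (intro mult_mono) (auto simp: kernel_norm_nonneg)
    have "kernel_norm (\<lambda>\<xi>. long_angular \<Phi> 0 (space_index i) (space_index j) (a *\<^sub>R \<xi>) * d (long_radial \<nu> \<kappa> 0 (isl i) (isl j)) t \<xi> + ?D * (trans_angular \<Phi> 0 (space_index i) (space_index j) (a *\<^sub>R \<xi>) * d (trans_radial \<mu> 0) t \<xi>))
      \<le> kernel_norm (\<lambda>\<xi>. long_angular \<Phi> 0 (space_index i) (space_index j) (a *\<^sub>R \<xi>) * d (long_radial \<nu> \<kappa> 0 (isl i) (isl j)) t \<xi>)
       + norm ?D * kernel_norm (\<lambda>\<xi>. trans_angular \<Phi> 0 (space_index i) (space_index j) (a *\<^sub>R \<xi>) * d (trans_radial \<mu> 0) t \<xi>)"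
      unfolding kernel_norm_cmult[symmetric]
      by (intro kernel_norm_add schwartz_mult schwartz_cmult S dS long_radial_schwartz trans_radial_schwartz)
    also have "\<dots> \<le> e1 (space_index i) (space_index j) (isl i) (isl j) t" using 1 3 unfolding e1_def by linarith
    also have "\<dots> \<le> e t" by (rule e1e)
    finally show ?thesis unfolding eq .
  qed
  then show ?thesis using lim by blast
qed

end

section \<open>The Littlewood--Paley decomposition\<close>

lemma dilated_schwartz: "m \<in> schwartz \<Longrightarrow> dilated m l \<in> schwartz"
  unfolding dilated_def[abs_def] by (intro schwartz_dilate) auto

lemma dilated_smooth: "smooth m \<Longrightarrow> smooth (dilated m l)"
  unfolding dilated_def[abs_def] by (rule smooth_dilate)

text \<open>A cut-off to an annulus that equals \<open>1\<close> on the support of \<open>\<phi>\<close>. It allows to multiply a block of the initial value by the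
localised propagator instead of the full one.\<close>

definition fat_cutoff :: "(real^'n::finite \<Rightarrow> complex) \<Rightarrow> real^'n \<Rightarrow> complex" where
  "fat_cutoff chi \<xi> = dilated chi 2 \<xi> - dilated chi (- 1) \<xi>"

context
  fixes phi chi :: "real^'n::finite \<Rightarrow> complex"
  assumes lp: "littlewood_paley phi chi"
begin

lemma lp_smooth: "smooth phi" "smooth chi"
  using lp by (simp_all add: littlewood_paley_def)

lemma lp_phi_outside: "norm \<xi> < 3/4 \<or> 8/3 < norm \<xi> \<Longrightarrow> phi \<xi> = 0"
proof (rule ccontr)
  assume *: "norm \<xi> < 3/4 \<or> 8/3 < norm \<xi>" "phi \<xi> \<noteq> 0"
  then have "\<xi> \<in> closure {\<xi>. phi \<xi> \<noteq> 0}" by (intro subsetD[OF closure_subset]) simp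
  then show False using lp * by (auto simp: littlewood_paley_def)
qed

lemma lp_chi_outside: "4/3 < norm \<xi> \<Longrightarrow> chi \<xi> = 0"
proof (rule ccontr)
  assume *: "4/3 < norm \<xi>" "chi \<xi> \<noteq> 0"
  then have "\<xi> \<in> closure {\<xi>. chi \<xi> \<noteq> 0}" by (intro subsetD[OF closure_subset]) simp
  then have "\<xi> \<in> cball 0 (4/3)" using lp unfolding littlewood_paley_def by blast
  then show False using * by simp
qed

lemma lp_schwartz: "phi \<in> schwartz" "chi \<in> schwartz"
  by (rule schwartz_compact_support[OF lp_smooth(1), of "8/3"], simp add: lp_phi_outside)
     (rule schwartz_compact_support[OF lp_smooth(2), of "4/3"], simp add: lp_chi_outside)

text \<open>All \<open>\<phi>(2\<^bsup>-l\<^esup> \<xi>)\<close> with \<open>l \<ge> 0\<close> vanish at such \<open>\<xi>\<close>.\<close>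

lemma lp_chi_inside: "norm \<xi> < 3/4 \<Longrightarrow> chi \<xi> = 1"
proof -
  assume \<xi>: "norm \<xi> < 3/4"
  have z: "dilated phi l \<xi> = 0" if "l \<in> {0..}" for l
  proof -
    have "(2::real) powi (- l) \<le> 1" using that by (simp add: power_int_minus inverse_le_1_iff one_le_power_int)
    then have "2 powi (- l) * norm \<xi> \<le> norm \<xi>" by (simp add: mult_left_le_one_le)
    then show ?thesis using \<xi> unfolding dilated_def by (intro lp_phi_outside) auto
  qed
  have "((\<lambda>l. dilated phi l \<xi>) has_sum 0) {0..}" by (rule has_sum_0) (rule z)
  moreover have "((\<lambda>l. dilated phi l \<xi>) has_sum (1 - chi \<xi>)) {0..}" using lp by (simp add: littlewood_paley_def)
  ultimately have "0 = 1 - chi \<xi>" by (rule has_sum_unique)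
  then show ?thesis by simp
qed

text \<open>The difference of the identities \<open>\<chi> + (\<Sum>l\<ge>0. \<phi>(2\<^bsup>-l\<^esup> \<cdot>)) = 1\<close> at \<open>\<xi>\<close> and at \<open>\<xi> / 2\<close>, dilated.\<close>

lemma lp_step: "dilated chi l \<xi> + dilated phi l \<xi> = dilated chi (l + 1) \<xi>"
proof -
  have s: "((\<lambda>l. dilated phi l \<xi>) has_sum (1 - chi \<xi>)) {0..}" for \<xi>
    using lp by (simp add: littlewood_paley_def)
  have base: "chi \<eta> + phi \<eta> = dilated chi 1 \<eta>" for \<eta>
  proof -
    have "((\<lambda>l. dilated phi (l + 1) \<eta>) has_sum (1 - dilated chi 1 \<eta>)) {0..}"
    proof -
      have "dilated phi (l + 1) \<eta> = dilated phi l ((2 powi (- 1)) *\<^sub>R \<eta>)" for l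
        by (simp add: dilated_def power_int_diff)
      then show ?thesis using s[of "(2 powi (- 1)) *\<^sub>R \<eta>"] by (simp add: dilated_def)
    qed
    then have "((\<lambda>l. dilated phi l \<eta>) has_sum (1 - dilated chi 1 \<eta>)) ((\<lambda>l. l + 1) ` {0::int..})"
      by (subst has_sum_reindex) (auto simp: comp_def)
    moreover have "(\<lambda>l. l + 1) ` {0::int..} = {1..}"
      by (auto simp: image_iff intro!: bexI[of _ "_ - 1"])
    ultimately have "((\<lambda>l. dilated phi l \<eta>) has_sum (dilated phi 0 \<eta> + (1 - dilated chi 1 \<eta>))) (insert 0 {1..})"
      by (intro has_sum_insert) auto
    moreover have "insert 0 {1::int..} = {0..}" by auto
    ultimately have "((\<lambda>l. dilated phi l \<eta>) has_sum (dilated phi 0 \<eta> + (1 - dilated chi 1 \<eta>))) {0..}" by simp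
    from has_sum_unique[OF s[of \<eta>] this] have "1 - chi \<eta> = dilated phi 0 \<eta> + (1 - dilated chi 1 \<eta>)" .
    then show ?thesis by (simp add: dilated_def algebra_simps)
  qed
  show ?thesis using base[of "(2 powi (- l)) *\<^sub>R \<xi>"]
    by (simp add: dilated_def power_int_diff)
qed

lemma lp_partial_sum: "(\<Sum>l\<in>{- int n..int n}. dilated phi l \<xi>) = dilated chi (int n + 1) \<xi> - dilated chi (- int n) \<xi>"
proof (induction n)
  case 0
  show ?case using lp_step[of 0 \<xi>] by (simp add: algebra_simps)
next
  case (Suc n)
  have "{- int (Suc n)..int (Suc n)} = insert (- int n - 1) (insert (int n + 1) {- int n..int n})" by auto
  then have "(\<Sum>l\<in>{- int (Suc n)..int (Suc n)}. dilated phi l \<xi>)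
     = dilated phi (- int n - 1) \<xi> + (dilated phi (int n + 1) \<xi> + (\<Sum>l\<in>{- int n..int n}. dilated phi l \<xi>))" by simp
  moreover have "- int n - 1 = - int (Suc n)" "int n + 1 = int (Suc n)" by simp_all
  ultimately show ?case using Suc lp_step[of "- int n - 1" \<xi>] lp_step[of "int n + 1" \<xi>] by (simp only:) (simp add: algebra_simps)
qed

lemma fat_cutoff_schwartz: "fat_cutoff chi \<in> schwartz"
  unfolding fat_cutoff_def[abs_def] by (intro schwartz_diff dilated_schwartz lp_schwartz)

lemma fat_cutoff_inside: "norm \<xi> < 3/8 \<Longrightarrow> fat_cutoff chi \<xi> = 0"
  by (simp add: fat_cutoff_def dilated_def lp_chi_inside power_int_def power2_eq_square)

lemma fat_cutoff_phi: "fat_cutoff chi \<xi> * phi \<xi> = phi \<xi>"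
proof (cases "norm \<xi> < 3/4 \<or> 8/3 < norm \<xi>")
  case True then show ?thesis by (simp add: lp_phi_outside)
next
  case False
  then have "dilated chi 2 \<xi> = 1" "dilated chi (- 1) \<xi> = 0"
    unfolding dilated_def by (auto intro!: lp_chi_inside lp_chi_outside simp: power_int_def power2_eq_square)
  then show ?thesis by (simp add: fat_cutoff_def)
qed

text \<open>The function \<open>1 - \<chi>(2\<^bsup>-n-1\<^esup> \<xi>)\<close> has bounded derivatives and vanishes for \<open>|\<xi>|\<close> below a multiple of \<open>2\<^sup>n\<close>, where the next seminorm
of \<open>\<psi>\<close> gains the factor \<open>2\<^bsup>-n\<^esup>\<close>.\<close>

lemma lp_high_frequency:
  assumes T: "tempered T" and \<psi>: "\<psi> \<in> schwartz"
  shows "(\<lambda>n. T (\<lambda>\<xi>. dilated chi (int n + 1) \<xi> * \<psi> \<xi>)) \<longlonglongrightarrow> T \<psi>"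
proof -
  define h where "h \<xi> = 1 + (- 1) * chi \<xi>" for \<xi>
  have hs: "smooth h" unfolding h_def[abs_def] by (intro smooth_add smooth_const smooth_mult lp_smooth)
  define a where "a = (\<lambda>n. (2::real) powi (- (int n + 1)))"
  have a: "0 < a n" "a n \<le> 1" "a n = (1/2) ^ Suc n" for n
  proof -
    have "int n + 1 = int (Suc n)" by simp
    then show *: "a n = (1/2) ^ Suc n" unfolding a_def by (simp only: power_int_minus power_int_of_nat power_one_over inverse_eq_divide)
    show "0 < a n" unfolding * by simp
    show "a n \<le> 1" unfolding * by (rule power_le_one) auto
  qed
  obtain C k where C: "C \<ge> 0" "\<And>f. f \<in> schwartz \<Longrightarrow> norm (T f) \<le> C * schwartz_seminorm k f"
    using temperedD(3)[OF T] by blast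
  define A where "A = 1 + schwartz_seminorm k chi"
  have A: "norm (partials \<beta> h x) \<le> A" if "length \<beta> \<le> k" for \<beta> x
  proof -
    have "partials \<beta> h x = partials \<beta> (\<lambda>\<xi>. 1) x + (- 1) * partials \<beta> chi x"
      unfolding h_def[abs_def] by (subst partials_add) (simp_all only: partials_cmult[OF lp_smooth(2)] lp_smooth smooth_mult smooth_const)
    moreover have "norm (partials \<beta> (\<lambda>\<xi>::real^'n. 1) x) \<le> 1"
    proof -
      have "partials \<beta> (\<lambda>\<xi>::real^'n. 1) \<in> {\<lambda>\<xi>. 0, \<lambda>\<xi>. 1}" for \<beta>
        by (induction \<beta>) (auto simp: partial_const)
      from this[of \<beta>] show ?thesis by auto
    qed
    moreover have "norm (partials \<beta> chi x) \<le> schwartz_seminorm k chi"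
    proof -
      have "1 * norm (partials \<beta> chi x) \<le> (1 + norm x) ^ k * norm (partials \<beta> chi x)"
        by (intro mult_right_mono one_le_power) auto
      then show ?thesis using seminorm_ge[OF lp_schwartz(2) that, of x] by simp
    qed
    ultimately show ?thesis unfolding A_def
      using norm_triangle_ineq[of "partials \<beta> (\<lambda>\<xi>. 1) x" "(- 1) * partials \<beta> chi x"] by simp
  qed
  have A0: "0 \<le> A" unfolding A_def using seminorm_nonneg[OF lp_schwartz(2), of k] by simp
  let ?h = "\<lambda>n \<xi>. h (a n *\<^sub>R \<xi>)"
  have hA: "norm (partials \<beta> (?h n) x) \<le> A" if "length \<beta> \<le> k" for n \<beta> x
  proof -
    have "norm (partials \<beta> (?h n) x) = \<bar>a n\<bar> ^ length \<beta> * norm (partials \<beta> h (a n *\<^sub>R x))"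
      by (simp add: partials_dilate[OF hs] norm_mult norm_power)
    also have "\<dots> \<le> 1 * A" using a(1,2)[of n] by (intro mult_mono A that power_le_one) auto
    finally show ?thesis by simp
  qed
  have hz: "?h n x = 0" if "norm x < 3/4 / a n" for n x
  proof -
    have "norm (a n *\<^sub>R x) < 3/4" using that a(1)[of n] by (simp add: field_simps)
    then show ?thesis by (simp add: h_def lp_chi_inside del: norm_scaleR)
  qed
  let ?S = "schwartz_seminorm (Suc k) \<psi>"
  have S0: "0 \<le> ?S" by (rule seminorm_nonneg[OF \<psi>])
  have sem: "schwartz_seminorm k (\<lambda>\<xi>. ?h n \<xi> * \<psi> \<xi>) \<le> 2 ^ k * A * ?S * (4/3) * a n" for n
  proof (rule seminorm_leI)
    fix \<alpha> :: "'n list" and x :: "real^'n" assume \<alpha>: "length \<alpha> \<le> k"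
    show "(1 + norm x) ^ k * norm (partials \<alpha> (\<lambda>\<xi>. ?h n \<xi> * \<psi> \<xi>) x) \<le> 2 ^ k * A * ?S * (4/3) * a n"
    proof (cases "norm x < 3/4 / a n")
      case True
      have "partials \<alpha> (\<lambda>\<xi>. ?h n \<xi> * \<psi> \<xi>) x = 0"
        by (rule partials_eq_0_open[of "ball 0 (3/4 / a n)"]) (use True in \<open>auto simp: hz\<close>)
      then show ?thesis using A0 S0 a(1)[of n] by simp
    next
      case False
      have "norm (partials \<alpha> (\<lambda>\<xi>. ?h n \<xi> * \<psi> \<xi>) x) \<le> 2 ^ length \<alpha> * (A * (?S / (1 + norm x) ^ Suc k))"
        using \<alpha> by (intro partials_mult_bound smooth_dilate hs A0 hA partials_le_seminorm \<psi>) (use \<psi> in \<open>auto simp: schwartz_def\<close>)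
      also have "\<dots> \<le> 2 ^ k * (A * (?S / (1 + norm x) ^ Suc k))"
        using \<alpha> A0 S0 by (intro mult_right_mono power_increasing mult_nonneg_nonneg divide_nonneg_nonneg) auto
      finally have "(1 + norm x) ^ k * norm (partials \<alpha> (\<lambda>\<xi>. ?h n \<xi> * \<psi> \<xi>) x) \<le> (1 + norm x) ^ k * (2 ^ k * (A * (?S / (1 + norm x) ^ Suc k)))"
        by (intro mult_left_mono) auto
      also have "\<dots> = 2 ^ k * A * ?S * (1 / (1 + norm x))"
      proof -
        have "N ^ k * (c * (A * (?S / N ^ Suc k))) = c * A * ?S * (1 / N)" if "N > 0" for N c :: real
          using that by (simp add: field_simps)
        then show ?thesis by (simp only: one_plus_norm_pos)
      qed
      also have "\<dots> \<le> 2 ^ k * A * ?S * (4/3 * a n)"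
      proof (intro mult_left_mono)
        have "3/4 / a n \<le> 1 + norm x" using False norm_ge_zero[of x] by linarith
        then show "1 / (1 + norm x) \<le> 4/3 * a n"
          using a(1)[of n] one_plus_norm_pos(1)[of x] by (simp add: field_simps)
      qed (use A0 S0 in auto)
      finally show ?thesis by (simp only: mult.assoc)
    qed
  qed
  have cS: "(\<lambda>\<xi>. dilated chi (int n + 1) \<xi> * \<psi> \<xi>) \<in> schwartz" for n
    by (intro schwartz_mult dilated_schwartz lp_schwartz \<psi>)
  define Q where "Q = C * (2 ^ k * A * ?S * (4/3))"
  have le: "norm (T \<psi> - T (\<lambda>\<xi>. dilated chi (int n + 1) \<xi> * \<psi> \<xi>)) \<le> Q * (1/2) ^ Suc n" for n
  proof -
    have eq: "(\<lambda>\<xi>. \<psi> \<xi> - dilated chi (int n + 1) \<xi> * \<psi> \<xi>) = (\<lambda>\<xi>. ?h n \<xi> * \<psi> \<xi>)"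
      by (simp add: fun_eq_iff h_def dilated_def a_def algebra_simps)
    have "T \<psi> - T (\<lambda>\<xi>. dilated chi (int n + 1) \<xi> * \<psi> \<xi>) = T (\<lambda>\<xi>. \<psi> \<xi> - dilated chi (int n + 1) \<xi> * \<psi> \<xi>)"
      by (rule tempered_diff[OF T \<psi> cS, symmetric])
    also have "norm \<dots> \<le> C * schwartz_seminorm k (\<lambda>\<xi>. ?h n \<xi> * \<psi> \<xi>)"
      unfolding eq by (rule C(2)) (use schwartz_diff[OF \<psi> cS[of n]] eq in simp)
    also have "\<dots> \<le> C * (2 ^ k * A * ?S * (4/3) * a n)" by (intro mult_left_mono sem C(1))
    finally show ?thesis unfolding Q_def by (simp only: a(3) mult.assoc)
  qed
  have "(\<lambda>n. Q * (1/2) ^ Suc n) \<longlonglongrightarrow> Q * 0"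
    by (rule tendsto_mult[OF tendsto_const LIMSEQ_Suc[OF LIMSEQ_power_zero]]) simp
  then have "(\<lambda>n. Q * (1/2) ^ Suc n) \<longlonglongrightarrow> 0" by simp
  then have "(\<lambda>n. T \<psi> - T (\<lambda>\<xi>. dilated chi (int n + 1) \<xi> * \<psi> \<xi>)) \<longlonglongrightarrow> 0"
    by (rule Lim_null_comparison[OF always_eventually[OF allI[OF le]]])
  from tendsto_diff[OF tendsto_const[of "T \<psi>"] this] show ?thesis by simp
qed

end

section \<open>The solution, block by block\<close>

lemma Lnorm_le_sum:
  assumes "1 \<le> p" "f \<in> borel_measurable M" "g \<in> borel_measurable M" "h \<in> borel_measurable M"
    and "\<And>x. x \<in> space M \<Longrightarrow> h x \<le> f x + g x"
  shows "Lnorm M p h \<le> Lnorm M p f + Lnorm M p g"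
  by (rule order_trans[OF Lnorm_mono[OF assms(1,4,5)] Lnorm_triangle[OF assms(1-3)]])

text \<open>Add representing functions whose norms are close to the infima.\<close>

lemma distr_Lp_triangle:
  fixes V U :: "'m::finite \<Rightarrow> 'n::finite distr"
  assumes p: "1 \<le> p"
  shows "distr_Lp p (\<lambda>i \<psi>. V i \<psi> + U i \<psi>) \<le> distr_Lp p V + distr_Lp p U"
proof -
  let ?N = "\<lambda>f::real^'n \<Rightarrow> complex^'m. Lnorm lborel p (\<lambda>x. ennreal (norm (f x)))"
  have le: "distr_Lp p (\<lambda>i \<psi>. V i \<psi> + U i \<psi>) \<le> ?N f + ?N g" if f: "represents f V" and g: "represents g U" for f g
  proof -
    have [measurable]: "f \<in> borel_measurable lborel" "g \<in> borel_measurable lborel"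
      using f g by (simp_all add: represents_def)
    have "represents (\<lambda>x. f x + g x) (\<lambda>i \<psi>. V i \<psi> + U i \<psi>)"
      using f g unfolding represents_def by (auto simp: distrib_right)
    then have "distr_Lp p (\<lambda>i \<psi>. V i \<psi> + U i \<psi>) \<le> ?N (\<lambda>x. f x + g x)"
      unfolding distr_Lp_def by (intro INF_lower) simp
    also have "\<dots> \<le> ?N f + ?N g"
      by (rule Lnorm_le_sum[OF p]) (auto simp: ennreal_plus[symmetric] norm_triangle_ineq simp del: ennreal_plus intro!: ennreal_leI)
    finally show ?thesis .
  qed
  show ?thesis
  proof (rule ennreal_le_epsilon)
    fix e :: real assume fin: "distr_Lp p V + distr_Lp p U < top" and e: "0 < e"
    have "distr_Lp p V < distr_Lp p V + ennreal (e / 2)" "distr_Lp p U < distr_Lp p U + ennreal (e / 2)"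
    proof -
      have "distr_Lp p V \<noteq> top" "distr_Lp p U \<noteq> top" using fin by auto
      then show "distr_Lp p V < distr_Lp p V + ennreal (e / 2)" "distr_Lp p U < distr_Lp p U + ennreal (e / 2)"
        using e by (simp_all add: ennreal_add_left_cancel_less[of _ 0, simplified])
    qed
    then obtain f g where f: "represents f V" "?N f < distr_Lp p V + ennreal (e / 2)"
      and g: "represents g U" "?N g < distr_Lp p U + ennreal (e / 2)"
      unfolding distr_Lp_def INF_less_iff by blast
    have "distr_Lp p (\<lambda>i \<psi>. V i \<psi> + U i \<psi>) \<le> ?N f + ?N g" by (rule le[OF f(1) g(1)])
    also have "\<dots> \<le> (distr_Lp p V + ennreal (e / 2)) + (distr_Lp p U + ennreal (e / 2))"
      using f(2) g(2) by (intro add_mono) auto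
    also have "\<dots> = distr_Lp p V + distr_Lp p U + (ennreal (e / 2) + ennreal (e / 2))" by (simp add: ac_simps)
    also have "ennreal (e / 2) + ennreal (e / 2) = ennreal e" using e by (subst ennreal_plus[symmetric]) auto
    finally show "distr_Lp p (\<lambda>i \<psi>. V i \<psi> + U i \<psi>) \<le> distr_Lp p V + distr_Lp p U + ennreal e" .
  qed
qed

text \<open>Used with \<open>L\<close> a cut-off that equals \<open>1\<close> where \<open>D\<close> does not vanish.\<close>

lemma absorbed_factor:
  fixes D :: "'a::comm_semiring_1"
  assumes "L * D = D" shows "D * (L * (E * I)) = E * (D * I)" "D * (E * (L * I)) = E * (D * I)"
proof -
  have "D * (L * (E * I)) = (L * D) * (E * I)" "D * (E * (L * I)) = (L * D) * (E * I)" by (simp_all add: mult_ac)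
  then show "D * (L * (E * I)) = E * (D * I)" "D * (E * (L * I)) = E * (D * I)"
    unfolding assms by (simp_all add: mult_ac)
qed

context
  fixes \<mu> lam \<kappa> :: real and phi chi :: "real^'n::finite \<Rightarrow> complex"
    and q0 :: "'n distr" and u0 :: "'n \<Rightarrow> 'n distr" and q :: "real \<Rightarrow> 'n distr" and u :: "real \<Rightarrow> 'n \<Rightarrow> 'n distr"
  assumes \<mu>: "\<mu> > 0" and \<nu>: "lam + 2 * \<mu> > 0" and \<kappa>: "\<kappa> > 0" and lp: "littlewood_paley phi chi"
    and sol: "linear_solution \<mu> lam \<kappa> q0 u0 q u"
    and h: "\<And>i. grad_pair q0 u0 i \<in> tempered_h chi"
begin

abbreviation flow_freq :: "real \<Rightarrow> 'n + 'n \<Rightarrow> 'n distr" where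
  "flow_freq t i \<equiv> distr_fourier (grad_pair (q t) (u t) i)"

abbreviation flow_exp :: "real \<Rightarrow> 'n + 'n \<Rightarrow> 'n + 'n \<Rightarrow> real^'n \<Rightarrow> complex" where
  "flow_exp \<equiv> matexp (sys_symbol \<mu> (lam + 2 * \<mu>) \<kappa>)"

abbreviation flow_block :: "int \<Rightarrow> real \<Rightarrow> 'n + 'n \<Rightarrow> 'n + 'n \<Rightarrow> real^'n \<Rightarrow> complex" where
  "flow_block l \<equiv> block_symbol \<mu> (lam + 2 * \<mu>) \<kappa> (fat_cutoff chi) (2 powi (- l))"

abbreviation datum_block :: "int \<Rightarrow> 'n + 'n \<Rightarrow> 'n distr" where
  "datum_block l i \<equiv> dyadic_block phi l (grad_pair q0 u0 i)"

lemma flow_tempered: "0 \<le> t \<Longrightarrow> tempered (grad_pair (q t) (u t) i)"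
  using sol by (intro tempered_grad_pair) (auto simp: linear_solution_def)

lemma flow_freq_tempered: "0 \<le> t \<Longrightarrow> tempered (flow_freq t i)"
  by (intro tempered_distr_fourier flow_tempered)

lemma datum_tempered: "tempered (grad_pair q0 u0 i)"
  using h[of i] by (simp add: tempered_h_def)

lemma flow_initial: "\<psi> \<in> schwartz \<Longrightarrow> grad_pair (q 0) (u 0) i \<psi> = grad_pair q0 u0 i \<psi>"
  using sol by (cases i) (auto simp: grad_pair_def linear_solution_def distr_partial_def schwartz_partial)

lemma flow_freq_initial: "\<psi> \<in> schwartz \<Longrightarrow> flow_freq 0 i \<psi> = grad_pair q0 u0 i (fourier \<psi>)"
  by (simp add: distr_fourier_def flow_initial fourier_schwartz)

text \<open>\<open>polynomial_flow\<close> for the solution: on frequencies of compact support the solution is the exponential of the symbol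
applied to the initial value.\<close>

lemma flow_represented:
  assumes g: "smooth g" "\<And>x. norm x > \<rho> \<Longrightarrow> g x = 0" and t: "0 \<le> t"
  shows "(\<lambda>\<xi>. flow_exp t i j \<xi> * g \<xi>) \<in> schwartz"
    and "flow_freq t i g = (\<Sum>j\<in>UNIV. grad_pair q0 u0 j (fourier (\<lambda>\<xi>. flow_exp t i j \<xi> * g \<xi>)))"
proof -
  have D: "((\<lambda>\<tau>. \<Sum>i\<in>UNIV. flow_freq \<tau> i (G i)) has_vector_derivative
      (\<Sum>j\<in>UNIV. flow_freq t j (\<lambda>\<xi>. \<Sum>i\<in>UNIV. sys_symbol \<mu> (lam + 2 * \<mu>) \<kappa> i j \<xi> * G i \<xi>))) (at t within {0..})"
    if G: "\<And>i. G i \<in> schwartz" and t: "0 \<le> t" for G :: "'n + 'n \<Rightarrow> real^'n \<Rightarrow> complex" and t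
  proof -
    have "((\<lambda>\<tau>. \<Sum>i\<in>UNIV. flow_freq \<tau> i (G i)) has_vector_derivative
      (\<Sum>i\<in>UNIV. \<Sum>j\<in>UNIV. flow_freq t j (\<lambda>\<xi>. sys_symbol \<mu> (lam + 2 * \<mu>) \<kappa> i j \<xi> * G i \<xi>))) (at t within {0..})"
      by (intro has_vector_derivative_sum linear_solution_flow[OF sol G t])
    also have "(\<Sum>i\<in>UNIV. \<Sum>j\<in>UNIV. flow_freq t j (\<lambda>\<xi>. sys_symbol \<mu> (lam + 2 * \<mu>) \<kappa> i j \<xi> * G i \<xi>))
      = (\<Sum>j\<in>UNIV. flow_freq t j (\<lambda>\<xi>. \<Sum>i\<in>UNIV. sys_symbol \<mu> (lam + 2 * \<mu>) \<kappa> i j \<xi> * G i \<xi>))"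
      by (subst sum.swap, intro sum.cong refl, rule tempered_sum[symmetric, OF flow_freq_tempered[OF t]])
         (intro poly_fun_schwartz sys_symbol_poly G)
    finally show ?thesis .
  qed
  have S: "(\<lambda>\<xi>. flow_exp t i j \<xi> * g \<xi>) \<in> schwartz" for i j
    by (rule polynomial_flow(1)[of _ flow_freq, OF _ _ _ g t]) (fact sys_symbol_poly flow_freq_tempered D)+
  then show "(\<lambda>\<xi>. flow_exp t i j \<xi> * g \<xi>) \<in> schwartz" .
  have "flow_freq t i g = (\<Sum>j\<in>UNIV. flow_freq 0 j (\<lambda>\<xi>. flow_exp t i j \<xi> * g \<xi>))"
    by (rule polynomial_flow(2)[of _ flow_freq, OF _ _ _ g t]) (fact sys_symbol_poly flow_freq_tempered D)+
  then show "flow_freq t i g = (\<Sum>j\<in>UNIV. grad_pair q0 u0 j (fourier (\<lambda>\<xi>. flow_exp t i j \<xi> * g \<xi>)))"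
    by (simp only: flow_freq_initial[OF S])
qed

lemma datum_block_eq:
  assumes "f \<in> schwartz"
  shows "datum_block l i (fourier f) = grad_pair q0 u0 i (fourier (\<lambda>\<xi>. dilated phi l \<xi> * f \<xi>))"
  using assms by (simp add: dyadic_block_def fourier_multiplier_def distr_inv_fourier_def distr_mult_def distr_fourier_def inv_fourier_fourier)

lemma smooth_cutoff: "g \<in> schwartz \<Longrightarrow> smooth m \<Longrightarrow> smooth (\<lambda>\<xi>. dilated m l \<xi> * g \<xi>)"
  by (rule smooth_mult[OF dilated_smooth]) (auto simp: schwartz_def)

lemma dilated_outside:
  assumes "\<And>\<xi>. \<rho> < norm \<xi> \<Longrightarrow> m \<xi> = 0" "2 powi l * \<rho> < norm \<xi>"
  shows "dilated m l \<xi> * g \<xi> = 0"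
proof -
  have "\<rho> < norm ((2 powi (- l)) *\<^sub>R \<xi>)" using assms(2) by (simp add: power_int_minus field_simps)
  then show ?thesis using assms(1) unfolding dilated_def by (simp del: norm_scaleR)
qed

lemma flow_block_schwartz: "0 < t \<Longrightarrow> flow_block l t i j \<in> schwartz"
  by (rule block_symbol_schwartz[OF \<mu> \<nu> \<kappa> _ fat_cutoff_schwartz[OF lp] fat_cutoff_inside[OF lp], of "3/8"]) auto

text \<open>A block of the solution is a matrix multiplier with localised symbol applied to the same block of the initial
value.\<close>

lemma matrix_multiplier_block:
  assumes t: "0 < t" and \<psi>: "\<psi> \<in> schwartz"
  shows "(\<Sum>j\<in>UNIV. datum_block l j (fourier (\<lambda>\<xi>. flow_block l t i j \<xi> * inv_fourier \<psi> \<xi>)))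
    = flow_freq t i (\<lambda>\<xi>. dilated phi l \<xi> * inv_fourier \<psi> \<xi>)"
proof -
  have i\<psi>: "inv_fourier \<psi> \<in> schwartz" by (rule inv_fourier_schwartz[OF \<psi>])
  let ?g = "\<lambda>\<xi>. dilated phi l \<xi> * inv_fourier \<psi> \<xi>"
  have "flow_freq t i ?g = (\<Sum>j\<in>UNIV. grad_pair q0 u0 j (fourier (\<lambda>\<xi>. flow_exp t i j \<xi> * ?g \<xi>)))"
  proof (rule flow_represented(2))
    show "smooth ?g" by (rule smooth_cutoff[OF i\<psi> lp_smooth(1)[OF lp]])
    show "?g \<xi> = 0" if "2 powi l * (8/3) < norm \<xi>" for \<xi>
      by (rule dilated_outside[OF _ that]) (simp add: lp_phi_outside[OF lp])
  qed (use t in simp)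
  also have "\<dots> = (\<Sum>j\<in>UNIV. datum_block l j (fourier (\<lambda>\<xi>. flow_block l t i j \<xi> * inv_fourier \<psi> \<xi>)))"
  proof (intro sum.cong refl)
    fix j
    have "(\<lambda>\<xi>. dilated phi l \<xi> * (flow_block l t i j \<xi> * inv_fourier \<psi> \<xi>)) = (\<lambda>\<xi>. flow_exp t i j \<xi> * ?g \<xi>)"
    proof
      fix \<xi>
      have "fat_cutoff chi ((2 powi (- l)) *\<^sub>R \<xi>) * dilated phi l \<xi> = dilated phi l \<xi>"
        unfolding dilated_def by (rule fat_cutoff_phi[OF lp])
      then show "dilated phi l \<xi> * (flow_block l t i j \<xi> * inv_fourier \<psi> \<xi>) = flow_exp t i j \<xi> * ?g \<xi>"
        unfolding block_symbol_def by (simp only: absorbed_factor mult.assoc)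
    qed
    then show "grad_pair q0 u0 j (fourier (\<lambda>\<xi>. flow_exp t i j \<xi> * ?g \<xi>)) = datum_block l j (fourier (\<lambda>\<xi>. flow_block l t i j \<xi> * inv_fourier \<psi> \<xi>))"
      by (subst datum_block_eq) (auto intro!: schwartz_mult flow_block_schwartz t i\<psi>)
  qed
  finally show ?thesis by simp
qed

text \<open>For the initial value this is the definition of \<open>S'\<^sub>h\<close>. The exponential times a fixed low-frequency cut-off maps
Schwartz functions to Schwartz functions, which carries the convergence over to the solution.\<close>

lemma flow_low_frequency:
  assumes t: "0 \<le> t" and g: "g \<in> schwartz"
  shows "(\<lambda>n. flow_freq t i (\<lambda>\<xi>. dilated chi (- int n) \<xi> * g \<xi>)) \<longlonglongrightarrow> 0"
proof -
  \<comment> \<open>all low-frequency cut-offs factor through the one of index \<open>1\<close>\<close>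
  define \<theta> where "\<theta> j \<xi> = flow_exp t i j \<xi> * (dilated chi 1 \<xi> * g \<xi>)" for j \<xi>
  have c: "smooth chi" "\<And>\<xi>. 4/3 < norm \<xi> \<Longrightarrow> chi \<xi> = 0" using lp_smooth[OF lp] lp_chi_outside[OF lp] by auto
  have cut: "2 powi l * (4/3) < norm \<xi> \<Longrightarrow> dilated chi l \<xi> * g \<xi> = 0" for l \<xi>
    by (rule dilated_outside[of "4/3" chi]) (auto simp: c(2))
  have \<theta>: "\<theta> j \<in> schwartz" for j
    unfolding \<theta>_def[abs_def]
    by (rule flow_represented(1)[OF smooth_cutoff[OF g c(1)] cut t])
  have absorb: "dilated chi (- int n) \<xi> * dilated chi 1 \<xi> = dilated chi (- int n) \<xi>" for n \<xi>
  proof (cases "4/3 < norm ((2 powi int n) *\<^sub>R \<xi>)")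
    case True then show ?thesis by (simp add: dilated_def c(2) del: norm_scaleR)
  next
    case False
    have "1 * norm \<xi> \<le> 2 powi int n * norm \<xi>" by (intro mult_right_mono) auto
    also have "\<dots> \<le> 4/3" using False by simp
    finally have "norm ((2 powi (- 1)) *\<^sub>R \<xi>) < 3/4" by (simp add: power_int_def)
    then show ?thesis by (simp add: dilated_def lp_chi_inside[OF lp] del: norm_scaleR)
  qed
  have "flow_freq t i (\<lambda>\<xi>. dilated chi (- int n) \<xi> * g \<xi>) = (\<Sum>j\<in>UNIV. low_freq chi (- int n) (grad_pair q0 u0 j) (fourier (\<theta> j)))" for n
  proof -
    have "flow_freq t i (\<lambda>\<xi>. dilated chi (- int n) \<xi> * g \<xi>)
       = (\<Sum>j\<in>UNIV. grad_pair q0 u0 j (fourier (\<lambda>\<xi>. flow_exp t i j \<xi> * (dilated chi (- int n) \<xi> * g \<xi>))))"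
      by (rule flow_represented(2)[OF smooth_cutoff[OF g c(1)] cut t])
    also have "\<dots> = (\<Sum>j\<in>UNIV. grad_pair q0 u0 j (fourier (\<lambda>\<xi>. dilated chi (- int n) \<xi> * \<theta> j \<xi>)))"
    proof -
      have "flow_exp t i j \<xi> * (dilated chi (- int n) \<xi> * g \<xi>) = dilated chi (- int n) \<xi> * \<theta> j \<xi>" for j \<xi>
        unfolding \<theta>_def using absorb[of n \<xi>] by (simp only: absorbed_factor mult.commute[of "dilated chi (- int n) \<xi>" "dilated chi 1 \<xi>"])
      then show ?thesis by (simp only:)
    qed
    also have "\<dots> = (\<Sum>j\<in>UNIV. low_freq chi (- int n) (grad_pair q0 u0 j) (fourier (\<theta> j)))"
      by (simp add: low_freq_def fourier_multiplier_def distr_inv_fourier_def distr_mult_def distr_fourier_def inv_fourier_fourier[OF \<theta>])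
    finally show ?thesis .
  qed
  moreover have "(\<lambda>n. \<Sum>j\<in>UNIV. low_freq chi (- int n) (grad_pair q0 u0 j) (fourier (\<theta> j))) \<longlonglongrightarrow> (\<Sum>j\<in>(UNIV::('n + 'n) set). 0)"
  proof (intro tendsto_sum)
    fix j :: "'n + 'n"
    have "((\<lambda>l. low_freq chi l (grad_pair q0 u0 j) (fourier (\<theta> j))) \<longlongrightarrow> 0) at_bot"
      using h[of j] fourier_schwartz[OF \<theta>[of j]] by (auto simp: tempered_h_def)
    moreover have "filterlim (\<lambda>n. - int n) at_bot sequentially"
      unfolding filterlim_at_bot
    proof
      fix Z :: int
      show "\<forall>\<^sub>F n in sequentially. - int n \<le> Z" by (rule eventually_sequentiallyI[of "nat (- Z)"]) auto
    qed
    ultimately show "(\<lambda>n. low_freq chi (- int n) (grad_pair q0 u0 j) (fourier (\<theta> j))) \<longlonglongrightarrow> 0"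
      by (rule filterlim_compose)
  qed
  ultimately show ?thesis by simp
qed

text \<open>The blocks telescope to the difference of a high and a low cut-off.\<close>

lemma flow_decomposition:
  assumes t: "0 < t" and \<psi>: "\<psi> \<in> schwartz"
  shows "(\<lambda>n. \<Sum>l\<in>{- int n..int n}. matrix_multiplier (\<lambda>i j. flow_block l t i j) (datum_block l) i \<psi>) \<longlonglongrightarrow> grad_pair (q t) (u t) i \<psi>"
proof -
  let ?g = "inv_fourier \<psi>"
  have g: "?g \<in> schwartz" by (rule inv_fourier_schwartz[OF \<psi>])
  have T: "tempered (flow_freq t i)" using t by (intro flow_freq_tempered) simp
  have cS: "(\<lambda>\<xi>. dilated chi l \<xi> * ?g \<xi>) \<in> schwartz" for l
    by (intro schwartz_mult dilated_schwartz lp_schwartz[OF lp] g)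
  have "(\<Sum>l\<in>{- int n..int n}. matrix_multiplier (\<lambda>i j. flow_block l t i j) (datum_block l) i \<psi>)
     = flow_freq t i (\<lambda>\<xi>. dilated chi (int n + 1) \<xi> * ?g \<xi>) - flow_freq t i (\<lambda>\<xi>. dilated chi (- int n) \<xi> * ?g \<xi>)" for n
  proof -
    have "(\<Sum>l\<in>{- int n..int n}. matrix_multiplier (\<lambda>i j. flow_block l t i j) (datum_block l) i \<psi>)
      = (\<Sum>l\<in>{- int n..int n}. flow_freq t i (\<lambda>\<xi>. dilated phi l \<xi> * ?g \<xi>))"
      unfolding matrix_multiplier_def by (simp only: matrix_multiplier_block[OF t \<psi>])
    also have "\<dots> = flow_freq t i (\<lambda>\<xi>. \<Sum>l\<in>{- int n..int n}. dilated phi l \<xi> * ?g \<xi>)"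
      by (rule tempered_sum[OF T, symmetric]) (intro schwartz_mult dilated_schwartz lp_schwartz[OF lp] g)
    also have "(\<lambda>\<xi>. \<Sum>l\<in>{- int n..int n}. dilated phi l \<xi> * ?g \<xi>) = (\<lambda>\<xi>. dilated chi (int n + 1) \<xi> * ?g \<xi> - dilated chi (- int n) \<xi> * ?g \<xi>)"
      by (simp add: sum_distrib_right[symmetric] lp_partial_sum[OF lp] left_diff_distrib)
    also have "flow_freq t i \<dots> = flow_freq t i (\<lambda>\<xi>. dilated chi (int n + 1) \<xi> * ?g \<xi>) - flow_freq t i (\<lambda>\<xi>. dilated chi (- int n) \<xi> * ?g \<xi>)"
      by (rule tempered_diff[OF T cS cS])
    finally show ?thesis .
  qed
  moreover have "(\<lambda>n. flow_freq t i (\<lambda>\<xi>. dilated chi (int n + 1) \<xi> * ?g \<xi>) - flow_freq t i (\<lambda>\<xi>. dilated chi (- int n) \<xi> * ?g \<xi>)) \<longlonglongrightarrow> flow_freq t i ?g - 0"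
    using t by (intro tendsto_diff lp_high_frequency[OF lp T g] flow_low_frequency g) simp
  moreover have "flow_freq t i ?g - 0 = grad_pair (q t) (u t) i \<psi>"
    by (simp add: distr_fourier_def fourier_inv_fourier[OF \<psi>])
  ultimately show ?thesis by simp
qed

text \<open>With \<open>\<beta> = 0\<close> this is the estimate at a fixed time; the general case serves to prove continuity in time.\<close>

lemma flow_difference_Lp:
  assumes p: "1 \<le> p" and t: "0 < t" "0 < t'" and c: "\<And>l. 0 < c l"
    and ck: "\<And>l. (\<Sum>i\<in>UNIV. \<Sum>j\<in>UNIV. kernel_norm (\<lambda>\<xi>. complex_of_real \<alpha> * flow_block l t i j \<xi> - complex_of_real \<beta> * flow_block l t' i j \<xi>)) \<le> c l"
    and fin: "\<And>l. distr_Lp p (datum_block l) < \<infinity>"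
  shows "distr_Lp p (\<lambda>i \<psi>. \<alpha> *\<^sub>R grad_pair (q t) (u t) i \<psi> - \<beta> *\<^sub>R grad_pair (q t') (u t') i \<psi>)
     \<le> (\<integral>\<^sup>+l. ennreal (c l) * distr_Lp p (datum_block l) \<partial>count_space UNIV)"
proof (rule distr_Lp_multiplier_series[where m="\<lambda>l i j \<xi>. complex_of_real \<alpha> * flow_block l t i j \<xi> - complex_of_real \<beta> * flow_block l t' i j \<xi>", OF p _ c ck fin])
  show "(\<lambda>\<xi>. complex_of_real \<alpha> * flow_block l t i j \<xi> - complex_of_real \<beta> * flow_block l t' i j \<xi>) \<in> schwartz" for l i j
    using t by (intro schwartz_diff schwartz_cmult flow_block_schwartz)
next
  fix i \<psi> assume \<psi>: "\<psi> \<in> (schwartz :: (real^'n \<Rightarrow> complex) set)"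
  let ?m = "\<lambda>l i j \<xi>. complex_of_real \<alpha> * flow_block l t i j \<xi> - complex_of_real \<beta> * flow_block l t' i j \<xi>"
  have lin: "datum_block l j (fourier (\<lambda>\<xi>. ?m l i j \<xi> * inv_fourier \<psi> \<xi>))
     = complex_of_real \<alpha> * datum_block l j (fourier (\<lambda>\<xi>. flow_block l t i j \<xi> * inv_fourier \<psi> \<xi>))
     - complex_of_real \<beta> * datum_block l j (fourier (\<lambda>\<xi>. flow_block l t' i j \<xi> * inv_fourier \<psi> \<xi>))" for l j
  proof -
    let ?f = "\<lambda>t \<xi>. flow_block l t i j \<xi> * inv_fourier \<psi> \<xi>" and ?T = "distr_fourier (grad_pair q0 u0 j)"
    have T: "tempered ?T" by (intro tempered_distr_fourier datum_tempered)
    have f: "?f t \<in> schwartz" "?f t' \<in> schwartz" using t by (intro schwartz_mult flow_block_schwartz inv_fourier_schwartz \<psi>; simp)+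
    have e: "(\<lambda>\<xi>. ?m l i j \<xi> * inv_fourier \<psi> \<xi>) = (\<lambda>\<xi>. complex_of_real \<alpha> * ?f t \<xi> - complex_of_real \<beta> * ?f t' \<xi>)"
      by (simp add: algebra_simps)
    have s: "(\<lambda>\<xi>. ?m l i j \<xi> * inv_fourier \<psi> \<xi>) \<in> schwartz" unfolding e by (intro schwartz_diff schwartz_cmult f)
    have d: "(\<lambda>\<xi>. dilated phi l \<xi> * ?f t \<xi>) \<in> schwartz" "(\<lambda>\<xi>. dilated phi l \<xi> * ?f t' \<xi>) \<in> schwartz"
      by (intro schwartz_mult dilated_schwartz lp_schwartz[OF lp] f)+
    have "datum_block l j (fourier (\<lambda>\<xi>. ?m l i j \<xi> * inv_fourier \<psi> \<xi>)) = ?T (\<lambda>\<xi>. dilated phi l \<xi> * (?m l i j \<xi> * inv_fourier \<psi> \<xi>))"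
      unfolding distr_fourier_def by (rule datum_block_eq[OF s])
    also have "(\<lambda>\<xi>. dilated phi l \<xi> * (?m l i j \<xi> * inv_fourier \<psi> \<xi>))
      = (\<lambda>\<xi>. complex_of_real \<alpha> * (dilated phi l \<xi> * ?f t \<xi>) - complex_of_real \<beta> * (dilated phi l \<xi> * ?f t' \<xi>))"
      by (simp add: algebra_simps)
    also have "?T \<dots> = complex_of_real \<alpha> * ?T (\<lambda>\<xi>. dilated phi l \<xi> * ?f t \<xi>) - complex_of_real \<beta> * ?T (\<lambda>\<xi>. dilated phi l \<xi> * ?f t' \<xi>)"
      by (simp only: tempered_diff[OF T schwartz_cmult(1)[OF d(1)] schwartz_cmult(1)[OF d(2)]] temperedD(2)[OF T d(1)] temperedD(2)[OF T d(2)])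
    finally show ?thesis unfolding distr_fourier_def datum_block_eq[OF f(1), symmetric] datum_block_eq[OF f(2), symmetric] .
  qed
  have "(\<Sum>l\<in>{- int n..int n}. matrix_multiplier (?m l) (datum_block l) i \<psi>)
     = complex_of_real \<alpha> * (\<Sum>l\<in>{- int n..int n}. matrix_multiplier (\<lambda>i j. flow_block l t i j) (datum_block l) i \<psi>)
     - complex_of_real \<beta> * (\<Sum>l\<in>{- int n..int n}. matrix_multiplier (\<lambda>i j. flow_block l t' i j) (datum_block l) i \<psi>)" for n
    unfolding matrix_multiplier_def by (simp only: lin sum_subtractf sum_distrib_left)
  moreover have "(\<lambda>n. complex_of_real \<alpha> * (\<Sum>l\<in>{- int n..int n}. matrix_multiplier (\<lambda>i j. flow_block l t i j) (datum_block l) i \<psi>)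
     - complex_of_real \<beta> * (\<Sum>l\<in>{- int n..int n}. matrix_multiplier (\<lambda>i j. flow_block l t' i j) (datum_block l) i \<psi>))
     \<longlonglongrightarrow> complex_of_real \<alpha> * grad_pair (q t) (u t) i \<psi> - complex_of_real \<beta> * grad_pair (q t') (u t') i \<psi>"
    by (intro tendsto_diff tendsto_mult tendsto_const flow_decomposition t \<psi>)
  ultimately show "(\<lambda>n. \<Sum>l\<in>{- int n..int n}. matrix_multiplier (?m l) (datum_block l) i \<psi>)
     \<longlonglongrightarrow> \<alpha> *\<^sub>R grad_pair (q t) (u t) i \<psi> - \<beta> *\<^sub>R grad_pair (q t') (u t') i \<psi>"
    by (simp add: scaleR_conv_of_real)
qed

end

section \<open>Time-frequency profile and the measure \<open>dt/t\<close>\<close>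

text \<open>The common bound of \<open>\<tau>\<^sup>s min(1, \<tau>\<^bsup>-K\<^esup>)\<close> for all \<open>K \<ge> s + 1\<close>. The exponents \<open>s\<close> and \<open>-1\<close> make it integrable with respect to
\<open>d\<tau> / \<tau>\<close> both at \<open>0\<close> and at \<open>\<infinity>\<close>.\<close>

definition profile :: "real \<Rightarrow> real \<Rightarrow> real" where
  "profile s \<tau> = (if \<tau> \<le> 1 then \<tau> powr s else 1 / \<tau>)"

lemma profile_pos: "0 < \<tau> \<Longrightarrow> 0 < profile s \<tau>"
  by (simp add: profile_def)

lemma profile_measurable [measurable]: "profile s \<in> borel_measurable borel"
  unfolding profile_def[abs_def] by measurable

text \<open>This allows to round \<open>t\<close> to a power of \<open>4\<close>, and to dominate all times between \<open>t\<^sub>0 / 2\<close> and \<open>2 t\<^sub>0\<close> by the first of them.\<close>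

lemma profile_doubling:
  assumes s: "0 < s" and \<tau>: "0 < \<tau>" and c: "1 \<le> c" "c \<le> 4"
  shows "profile s (c * \<tau>) \<le> 4 powr s * profile s \<tau>"
proof -
  have one: "1 \<le> 4 powr s" using s by (simp add: ge_one_powr_ge_zero)
  have mono: "(c * \<tau>) powr s \<le> 4 powr s * \<tau> powr s"
    using s \<tau> c by (simp add: powr_mult mult_right_mono powr_mono2)
  consider "c * \<tau> \<le> 1" | "1 < c * \<tau>" "\<tau> \<le> 1" | "1 < \<tau>" by linarith
  then show ?thesis
  proof cases
    case 1
    moreover have "1 * \<tau> \<le> c * \<tau>" using \<tau> c by (intro mult_right_mono) auto
    ultimately show ?thesis using mono by (simp add: profile_def)
  next
    case 2
    have "1 / (c * \<tau>) \<le> 1" using 2 by simp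
    also have "1 \<le> (c * \<tau>) powr s" using 2 s by (intro ge_one_powr_ge_zero) auto
    also note mono
    finally show ?thesis using 2 by (simp add: profile_def)
  next
    case 3
    have "1 * \<tau> \<le> c * \<tau>" using \<tau> c by (intro mult_right_mono) auto
    then have "1 / (c * \<tau>) \<le> 1 / \<tau>" and big: "1 < c * \<tau>" proof -
      have "0 < c * \<tau>" using \<tau> c by (intro mult_pos_pos) auto
      then show "1 / (c * \<tau>) \<le> 1 / \<tau>" using \<tau> \<open>1 * \<tau> \<le> c * \<tau>\<close> by (intro divide_left_mono mult_pos_pos) auto
      show "1 < c * \<tau>" using 3 \<open>1 * \<tau> \<le> c * \<tau>\<close> by linarith
    qed
    moreover have "1 * (1 / \<tau>) \<le> 4 powr s * (1 / \<tau>)" using one \<tau> by (intro mult_right_mono) auto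
    ultimately show ?thesis using 3 by (simp add: profile_def)
  qed
qed

lemma nn_integral_int_le:
  fixes f :: "int \<Rightarrow> ennreal"
  shows "(\<integral>\<^sup>+l. f l \<partial>count_space UNIV) \<le> (\<Sum>n. f (int n)) + (\<Sum>n. f (- int n))"
proof -
  have "(\<integral>\<^sup>+l. f l \<partial>count_space UNIV) \<le> (\<integral>\<^sup>+l. f l * indicator (range int) l + f l * indicator (range (\<lambda>n. - int n)) l \<partial>count_space UNIV)"
  proof (rule nn_integral_mono)
    fix l :: int
    have "l \<in> range int \<or> l \<in> range (\<lambda>n. - int n)" by (cases l rule: int_cases2) auto
    then show "f l \<le> f l * indicator (range int) l + f l * indicator (range (\<lambda>n. - int n)) l" by (auto simp: indicator_def)
  qed
  also have "\<dots> = (\<integral>\<^sup>+l. f l * indicator (range int) l \<partial>count_space UNIV) + (\<integral>\<^sup>+l. f l * indicator (range (\<lambda>n. - int n)) l \<partial>count_space UNIV)"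
    by (rule nn_integral_add) auto
  also have "(\<integral>\<^sup>+l. f l * indicator (range int) l \<partial>count_space UNIV) = (\<Sum>n. f (int n))"
    using nn_integral_bij_count_space[of int UNIV "range int" f]
    by (simp add: nn_integral_count_space_indicator nn_integral_count_space_nat bij_betw_def inj_on_def)
  also have "(\<integral>\<^sup>+l. f l * indicator (range (\<lambda>n. - int n)) l \<partial>count_space UNIV) = (\<Sum>n. f (- int n))"
    using nn_integral_bij_count_space[of "\<lambda>n. - int n" UNIV "range (\<lambda>n. - int n)" f]
    by (simp add: nn_integral_count_space_indicator nn_integral_count_space_nat bij_betw_def inj_on_def)
  finally show ?thesis .
qed

text \<open>Rounding \<open>t\<close> to a power of \<open>4\<close> and shifting the index leaves two geometric series.\<close>

lemma profile_sum:
  assumes s: "0 < s"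
  shows "\<exists>S>0. \<forall>t>0. (\<integral>\<^sup>+l. ennreal (profile s (t * 4 powi l)) \<partial>count_space UNIV) \<le> ennreal S"
proof -
  define x where "x = 4 powr (- s)"
  have x: "0 < x" "x < 1" using s by (simp_all add: x_def powr_less_one)
  define S where "S = 4 powr s * (1 / (1 - 1/4) + 1 / (1 - x))"
  have S: "0 < S" unfolding S_def using x by (intro mult_pos_pos add_pos_pos) auto
  have geo: "(\<Sum>n. ennreal (4 powr s * y ^ n)) = ennreal (4 powr s * (1 / (1 - y)))" if "0 \<le> y" "y < 1" for y :: real
    using that by (subst suminf_ennreal2) (auto simp: suminf_mult suminf_geometric summable_geometric intro!: summable_mult)
  have base: "profile s (4 powi int n) = (1/4) ^ n" "profile s (4 powi (- int n)) = x ^ n" for n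
  proof -
    have "(4::real) ^ n \<le> 1 \<longleftrightarrow> n = 0"
      by (cases "n = 0") (auto simp: not_le)
    then show "profile s (4 powi int n) = (1/4) ^ n" by (auto simp: profile_def power_one_over)
    have "(4::real) powi (- int n) = 4 powr (- real n)" by (simp add: powr_minus powr_realpow power_int_minus)
    moreover have "(4::real) powr (- real n) \<le> 1" using powr_mono[of "- real n" 0 "4::real"] by simp
    ultimately show "profile s (4 powi (- int n)) = x ^ n"
      by (simp add: profile_def x_def powr_powr powr_power mult.commute)
  qed
  have "(\<integral>\<^sup>+l. ennreal (profile s (t * 4 powi l)) \<partial>count_space UNIV) \<le> ennreal S" if t: "0 < t" for t
  proof -
    \<comment> \<open>\<open>t = y 4\<^sup>j\<close> with \<open>y\<close> between \<open>1\<close> and \<open>4\<close>\<close>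
    define j where "j = \<lfloor>log 4 t\<rfloor>"
    define y where "y = t * 4 powi (- j)"
    have pj: "(4::real) powi j = 4 powr real_of_int j" by (simp add: powr_real_of_int')
    have "4 powr real_of_int j \<le> t"
      using t unfolding j_def by (subst le_log_iff[symmetric]) auto
    moreover have "t < 4 powr (real_of_int j + 1)"
      using t unfolding j_def by (subst log_less_iff[symmetric]) auto
    ultimately have y: "1 \<le> y" "y \<le> 4"
      unfolding y_def power_int_minus pj by (simp_all add: field_simps powr_add)
    have ty: "t * 4 powi l = y * 4 powi (l + j)" for l
      by (simp add: y_def power_int_add[symmetric])
    have "(\<integral>\<^sup>+l. ennreal (profile s (t * 4 powi l)) \<partial>count_space UNIV) = (\<integral>\<^sup>+l. ennreal (profile s (y * 4 powi (l + j))) \<partial>count_space UNIV)"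
      by (simp only: ty)
    also have "\<dots> = (\<integral>\<^sup>+l. ennreal (profile s (y * 4 powi l)) \<partial>count_space UNIV)"
      by (rule nn_integral_bij_count_space[of "\<lambda>l. l + j" UNIV UNIV "\<lambda>l. ennreal (profile s (y * 4 powi l))"])
         (rule bij_betwI[where g="\<lambda>l. l - j"], auto)
    also have "\<dots> \<le> (\<integral>\<^sup>+l. ennreal (4 powr s * profile s (4 powi l)) \<partial>count_space UNIV)"
      by (intro nn_integral_mono ennreal_leI profile_doubling[OF s _ y]) simp
    also have "\<dots> \<le> (\<Sum>n. ennreal (4 powr s * profile s (4 powi int n))) + (\<Sum>n. ennreal (4 powr s * profile s (4 powi (- int n))))"
      by (rule nn_integral_int_le)
    also have "\<dots> = ennreal (4 powr s * (1 / (1 - 1/4))) + ennreal (4 powr s * (1 / (1 - x)))"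
      unfolding base by (intro arg_cong2[where f="(+)"] geo) (use x in auto)
    also have "\<dots> = ennreal S"
      unfolding S_def distrib_left using x by (intro ennreal_plus[symmetric]) auto
    finally show ?thesis .
  qed
  then show ?thesis using S by blast
qed

lemma dt_over_t_measurable_iff: "f \<in> borel_measurable dt_over_t \<longleftrightarrow> f \<in> borel_measurable (restrict_space borel {0<..})"
  by (rule arg_cong[where f="\<lambda>A. f \<in> A"], rule measurable_cong_sets) (simp_all add: dt_over_t_def sets_restrict_space)

lemma space_dt_over_t: "space dt_over_t = {0<..}"
  by (simp add: dt_over_t_def space_restrict_space)

lemma dt_over_t_borel: "f \<in> borel_measurable borel \<Longrightarrow> f \<in> borel_measurable dt_over_t"
  unfolding dt_over_t_measurable_iff by (rule measurable_restrict_space1)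

lemma sigma_finite_dt_over_t: "sigma_finite_measure dt_over_t"
proof -
  interpret sigma_finite_measure "restrict_space lborel {0<..} :: real measure"
    by (rule sigma_finite_measure_restrict_space[OF lborel.sigma_finite_measure_axioms]) simp
  show ?thesis unfolding dt_over_t_def
    by (subst sigma_finite_iff_density_finite) (auto intro!: measurable_restrict_space1)
qed

lemma nn_integral_dt_over_t:
  assumes [measurable]: "f \<in> borel_measurable borel"
  shows "(\<integral>\<^sup>+t. f t \<partial>dt_over_t) = (\<integral>\<^sup>+t. ennreal (1 / t) * f t * indicator {0<..} t \<partial>lborel)"
proof -
  have "(\<integral>\<^sup>+t. f t \<partial>dt_over_t) = (\<integral>\<^sup>+t. ennreal (1 / t) * f t \<partial>restrict_space lborel {0<..})"
    unfolding dt_over_t_def by (rule nn_integral_density) (auto intro!: measurable_restrict_space1)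
  also have "\<dots> = (\<integral>\<^sup>+t. ennreal (1 / t) * f t * indicator {0<..} t \<partial>lborel)"
    by (rule nn_integral_restrict_space) simp
  finally show ?thesis .
qed

text \<open>The two pieces are integrated over \<open>t \<le> 1 / c\<close> and \<open>t \<ge> 1 / c\<close> and contribute \<open>1 / s\<close> and \<open>1\<close>.\<close>

lemma profile_integral:
  assumes s: "0 < s" and c: "0 < c"
  shows "(\<integral>\<^sup>+t. ennreal (profile s (t * c)) \<partial>dt_over_t) \<le> ennreal (1 / s + 1)"
proof -
  let ?f = "\<lambda>t::real. c powr s * t powr (s - 1)" and ?g = "\<lambda>t::real. (1 / c) * t powr (- 2)"
  have "(?f has_integral (c powr s * ((1 / c) powr s / s))) {0..1/c}"
    using has_integral_powr_from_0[of "s - 1" "1 / c"] s c by (intro has_integral_mult_right) auto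
  from nn_integral_has_integral_lebesgue'[OF _ this] have f: "(\<integral>\<^sup>+t. ennreal (?f t) * indicator {0..1/c} t \<partial>lborel) = ennreal (1 / s)"
    using c by (simp add: powr_mult[symmetric])
  have "(?g has_integral ((1 / c) * (- ((1 / c) powr (- 1)) / (- 1)))) {1/c..}"
    using has_integral_powr_to_inf[of "- 2" "1 / c"] c by (intro has_integral_mult_right) auto
  from nn_integral_has_integral_lebesgue'[OF _ this] have g: "(\<integral>\<^sup>+t. ennreal (?g t) * indicator {1/c..} t \<partial>lborel) = ennreal 1"
    using c by (simp add: powr_minus)
  have "(\<integral>\<^sup>+t. ennreal (profile s (t * c)) \<partial>dt_over_t) = (\<integral>\<^sup>+t. ennreal (1 / t) * ennreal (profile s (t * c)) * indicator {0<..} t \<partial>lborel)"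
    by (rule nn_integral_dt_over_t) measurable
  also have "\<dots> \<le> (\<integral>\<^sup>+t. ennreal (?f t) * indicator {0..1/c} t + ennreal (?g t) * indicator {1/c..} t \<partial>lborel)"
  proof (rule nn_integral_mono)
    fix t :: real
    show "ennreal (1 / t) * ennreal (profile s (t * c)) * indicator {0<..} t \<le> ennreal (?f t) * indicator {0..1/c} t + ennreal (?g t) * indicator {1/c..} t"
    proof (cases "t > 0")
      case t: True
      show ?thesis
      proof (cases "t * c \<le> 1")
        case True
        then have "t \<le> 1 / c" using c by (simp add: field_simps)
        moreover have "1 / t * profile s (t * c) = ?f t"
          using True t c by (simp add: profile_def powr_mult powr_diff)
        ultimately show ?thesis using t by (simp add: ennreal_mult'[symmetric])
      next
        case False
        then have "1 / c \<le> t" using c by (simp add: field_simps)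
        moreover have "1 / t * profile s (t * c) = ?g t"
          using False t c by (simp add: profile_def powr_minus powr_realpow[of t 2, simplified] power2_eq_square field_simps)
        ultimately show ?thesis using t by (simp add: ennreal_mult'[symmetric])
      qed
    qed simp
  qed
  also have "\<dots> = ennreal (1 / s) + ennreal 1"
    unfolding f[symmetric] g[symmetric] by (rule nn_integral_add) measurable
  also have "\<dots> = ennreal (1 / s + 1)" using s by (intro ennreal_plus[symmetric]) auto
  finally show ?thesis .
qed
section \<open>The estimate for a single solution\<close>

lemma sum_pairs_le:
  assumes "\<And>i j. f i j \<le> (b::real)"
  shows "(\<Sum>i\<in>(UNIV::'m::finite set). \<Sum>j\<in>(UNIV::'m set). f i j) \<le> (real CARD('m))\<^sup>2 * b"
proof -
  have "(\<Sum>i\<in>(UNIV::'m set). \<Sum>j\<in>(UNIV::'m set). f i j) \<le> (\<Sum>i\<in>(UNIV::'m set). \<Sum>j\<in>(UNIV::'m set). b)"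
    by (intro sum_mono assms)
  then show ?thesis by (simp add: power2_eq_square)
qed

text \<open>In terms of \<open>\<tau> = t 4\<^sup>l\<close>, use the kernel bound without decay for \<open>\<tau> \<le> 1\<close> and with a power \<open>K \<ge> s + 1\<close> for \<open>\<tau> > 1\<close>.\<close>

lemma block_symbol_weighted_bound:
  fixes \<Phi> :: "real^'n::finite \<Rightarrow> complex"
  assumes \<mu>: "\<mu> > 0" and \<nu>: "\<nu> > 0" and \<kappa>: "\<kappa> > 0" and c: "c > 0"
    and \<Phi>: "\<Phi> \<in> schwartz" "\<And>\<xi>. norm \<xi> < c \<Longrightarrow> \<Phi> \<xi> = 0" and s: "0 < s"
  shows "\<exists>M>0. \<forall>t>0. \<forall>l::int. (\<Sum>i\<in>UNIV. \<Sum>j\<in>UNIV. kernel_norm (\<lambda>\<xi>. complex_of_real (t powr s) * block_symbol \<mu> \<nu> \<kappa> \<Phi> (2 powi (- l)) t i j \<xi>))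
     \<le> M * (2 powr (real_of_int l * (- 2 * s)) * profile s (t * 4 powi l))"
proof -
  define K where "K = nat \<lceil>s + 1\<rceil>"
  have K: "s + 1 \<le> real K" unfolding K_def by linarith
  obtain C0 where C0: "C0 \<ge> 0" "\<And>a t i j. a > 0 \<Longrightarrow> t > 0 \<Longrightarrow> kernel_norm (block_symbol \<mu> \<nu> \<kappa> \<Phi> a t i j) \<le> C0 * (a\<^sup>2 / t) ^ 0"
    using block_symbol_kernel_norm[OF \<mu> \<nu> \<kappa> c \<Phi>, of 0] by blast
  obtain C1 where C1: "C1 \<ge> 0" "\<And>a t i j. a > 0 \<Longrightarrow> t > 0 \<Longrightarrow> kernel_norm (block_symbol \<mu> \<nu> \<kappa> \<Phi> a t i j) \<le> C1 * (a\<^sup>2 / t) ^ K"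
    using block_symbol_kernel_norm[OF \<mu> \<nu> \<kappa> c \<Phi>, of K] by blast
  define C where "C = C0 + C1 + 1"
  have C: "C > 0" "C0 \<le> C" "C1 \<le> C" using C0(1) C1(1) by (auto simp: C_def)
  have one: "kernel_norm (\<lambda>\<xi>. complex_of_real (t powr s) * block_symbol \<mu> \<nu> \<kappa> \<Phi> (2 powi (- l)) t i j \<xi>)
     \<le> C * (2 powr (real_of_int l * (- 2 * s)) * profile s (t * 4 powi l))" if t: "t > 0" for t i j and l :: int
  proof -
    define \<tau> where "\<tau> = t * 4 powi l"
    have \<tau>: "\<tau> > 0" using t by (simp add: \<tau>_def)
    have p4: "(4::real) powi l = 2 powr (2 * real_of_int l)"
      by (simp add: powr_powr[symmetric] powr_real_of_int')
    have a: "((2::real) powi (- l))\<^sup>2 / t = 1 / \<tau>"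
    proof -
      have "((2::real) powi (- l))\<^sup>2 = 4 powi (- l)"
        by (simp add: power2_eq_square power_int_mult_distrib[symmetric])
      then show ?thesis using t by (simp add: \<tau>_def power_int_minus field_simps)
    qed
    have ts: "t powr s = 2 powr (real_of_int l * (- 2 * s)) * \<tau> powr s"
      using t unfolding \<tau>_def p4 by (simp add: powr_mult powr_powr powr_add[symmetric] algebra_simps)
    let ?k = "kernel_norm (block_symbol \<mu> \<nu> \<kappa> \<Phi> (2 powi (- l)) t i j)"
    have "\<tau> powr s * ?k \<le> C * profile s \<tau>"
    proof (cases "\<tau> \<le> 1")
      case True
      have "?k \<le> C" using C0(2)[of "2 powi (- l)" t i j] t C(2) by simp
      then have "\<tau> powr s * ?k \<le> \<tau> powr s * C" by (intro mult_left_mono) auto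
      then show ?thesis using True by (simp add: profile_def mult.commute)
    next
      case False
      have "?k \<le> C1 * (1 / \<tau>) ^ K" using C1(2)[of "2 powi (- l)" t i j] t by (simp only: a) simp
      also have "\<dots> \<le> C * (1 / \<tau>) ^ K" using \<tau> C(3) by (intro mult_right_mono) auto
      finally have "\<tau> powr s * ?k \<le> \<tau> powr s * (C * (1 / \<tau>) ^ K)" by (intro mult_left_mono) auto
      also have "\<dots> = C * \<tau> powr (s - real K)"
        using \<tau> by (simp add: powr_diff powr_realpow power_one_over field_simps)
      also have "\<dots> \<le> C * \<tau> powr (- 1)" using False K C(1) by (intro mult_left_mono powr_mono) auto
      also have "\<tau> powr (- 1) = 1 / \<tau>" using \<tau> by (simp add: powr_minus field_simps)
      finally show ?thesis using False by (simp add: profile_def)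
    qed
    then have "2 powr (real_of_int l * (- 2 * s)) * (\<tau> powr s * ?k) \<le> 2 powr (real_of_int l * (- 2 * s)) * (C * profile s \<tau>)"
      by (intro mult_left_mono) auto
    then show ?thesis unfolding kernel_norm_cmult norm_of_real \<tau>_def[symmetric] ts by (simp add: mult_ac abs_mult)
  qed
  show ?thesis
  proof (intro exI[of _ "(real CARD('n + 'n))\<^sup>2 * C"] conjI allI impI)
    show "0 < (real CARD('n + 'n))\<^sup>2 * C" using C(1) by (intro mult_pos_pos) auto
    show "(\<Sum>i\<in>UNIV. \<Sum>j\<in>UNIV. kernel_norm (\<lambda>\<xi>. complex_of_real (t powr s) * block_symbol \<mu> \<nu> \<kappa> \<Phi> (2 powi (- l)) t i j \<xi>))
      \<le> (real CARD('n + 'n))\<^sup>2 * C * (2 powr (real_of_int l * (- 2 * s)) * profile s (t * 4 powi l))" if "0 < t" for t l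
      unfolding mult.assoc[of _ C] by (rule sum_pairs_le, rule one[OF that])
  qed
qed

lemma count_space_nn_integral_ge: "f l \<le> (\<integral>\<^sup>+l. f l \<partial>count_space UNIV)"
proof -
  have "f l = (\<integral>\<^sup>+k. f k * indicator {l} k \<partial>count_space UNIV)" by (simp add: nn_integral_count_space_indicator[symmetric] nn_integral_count_space_finite)
  also have "\<dots> \<le> (\<integral>\<^sup>+l. f l \<partial>count_space UNIV)" by (intro nn_integral_mono) (auto simp: indicator_def)
  finally show ?thesis .
qed

lemma Lnorm_count_space_finite:
  assumes r: "1 \<le> r" and fin: "Lnorm (count_space UNIV) r f < \<infinity>"
  shows "f l < \<infinity>"
proof (cases "r = \<infinity>")
  case True
  then have "f l \<le> Lnorm (count_space UNIV) r f"
    using esssup_AE[of f "count_space UNIV"] by (simp add: Lnorm_def AE_count_space)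
  then show ?thesis using fin by (rule order_le_less_trans)
next
  case False
  have "enn_powr (f l) (enn2real r) \<le> enn_powr (Lnorm (count_space UNIV) r f) (enn2real r)"
    unfolding Lnorm_finite_eq[OF False r] by (rule count_space_nn_integral_ge)
  also have "\<dots> < \<top>" using fin by (simp add: less_top[symmetric])
  finally show ?thesis by (simp add: less_top[symmetric])
qed

text \<open>Dominating functions are available only for times that stay away from \<open>0\<close> and \<open>\<infinity>\<close>, so continuity is tested on
sequences in a compact interval.\<close>

lemma tendsto_at_interval:
  fixes f :: "real \<Rightarrow> real"
  assumes "0 < t0" and "\<And>X. (\<And>n. X n \<in> {t0 / 2..2 * t0}) \<Longrightarrow> (\<And>n. X n \<noteq> t0) \<Longrightarrow> X \<longlonglongrightarrow> t0 \<Longrightarrow> (\<lambda>n. f (X n)) \<longlonglongrightarrow> f t0"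
  shows "isCont f t0"
proof -
  have "(f \<longlongrightarrow> f t0) (at t0 within {t0 / 2..2 * t0})"
    unfolding tendsto_at_iff_sequentially comp_def using assms(2) by auto
  moreover have "at t0 within {t0 / 2..2 * t0} = at t0"
    using assms(1) by (intro at_within_interior) (auto simp: interior_atLeastAtMost_real)
  ultimately show ?thesis by (simp add: isCont_def)
qed

context
  fixes \<mu> lam \<kappa> s :: real and p :: ennreal and phi chi :: "real^'n::finite \<Rightarrow> complex"
    and q0 :: "'n distr" and u0 :: "'n \<Rightarrow> 'n distr" and q :: "real \<Rightarrow> 'n distr" and u :: "real \<Rightarrow> 'n \<Rightarrow> 'n distr"
    and M S :: real
  assumes \<mu>: "\<mu> > 0" and \<nu>: "lam + 2 * \<mu> > 0" and \<kappa>: "\<kappa> > 0" and s: "s > 0" and p: "1 \<le> p" and lp: "littlewood_paley phi chi"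
    and sol: "linear_solution \<mu> lam \<kappa> q0 u0 q u"
    and h: "\<And>i. grad_pair q0 u0 i \<in> tempered_h chi"
    and fin: "\<And>l. distr_Lp p (\<lambda>i. dyadic_block phi l (grad_pair q0 u0 i)) < \<infinity>"
    and M: "M > 0" "\<And>t l. t > 0 \<Longrightarrow> (\<Sum>i\<in>UNIV. \<Sum>j\<in>UNIV. kernel_norm (\<lambda>\<xi>. complex_of_real (t powr s) * block_symbol \<mu> (lam + 2 * \<mu>) \<kappa> (fat_cutoff chi) (2 powi (- l)) t i j \<xi>))
     \<le> M * (2 powr (real_of_int l * (- 2 * s)) * profile s (t * 4 powi l))"
    and S: "S > 0" "\<And>t. t > 0 \<Longrightarrow> (\<integral>\<^sup>+l. ennreal (profile s (t * 4 powi l)) \<partial>count_space UNIV) \<le> ennreal S"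
begin

abbreviation (input) solution_norm :: "real \<Rightarrow> ennreal" where
  "solution_norm t \<equiv> distr_Lp p (distr_scale (t powr s) (grad_pair (q t) (u t)))"

abbreviation (input) block_norm :: "int \<Rightarrow> ennreal" where
  "block_norm l \<equiv> distr_Lp p (\<lambda>i. dyadic_block phi l (grad_pair q0 u0 i))"

abbreviation (input) besov_term :: "int \<Rightarrow> ennreal" where
  "besov_term l \<equiv> ennreal (2 powr (real_of_int l * (- 2 * s))) * block_norm l"

lemmas difference_Lp = flow_difference_Lp[OF \<mu> \<nu> \<kappa> lp sol h p _ _ _ _ fin]

text \<open>The weight \<open>2\<^bsup>-2sl\<^esup>\<close> of the Besov norm is the one that makes \<open>t\<^sup>s\<close> a function of \<open>t 4\<^sup>l\<close>.\<close>

lemma solution_norm_le: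
  assumes t: "t > 0"
  shows "solution_norm t \<le> (\<integral>\<^sup>+l. ennreal (M * profile s (t * 4 powi l)) * besov_term l \<partial>count_space UNIV)"
proof -
  have "distr_Lp p (\<lambda>i \<psi>. (t powr s) *\<^sub>R grad_pair (q t) (u t) i \<psi> - 0 *\<^sub>R grad_pair (q t) (u t) i \<psi>)
     \<le> (\<integral>\<^sup>+l. ennreal (M * (2 powr (real_of_int l * (- 2 * s)) * profile s (t * 4 powi l))) * block_norm l \<partial>count_space UNIV)"
    using M(2)[OF t] by (intro difference_Lp t) (auto intro!: mult_pos_pos M(1) profile_pos t)
  also have "\<dots> = (\<integral>\<^sup>+l. ennreal (M * profile s (t * 4 powi l)) * besov_term l \<partial>count_space UNIV)"
    using M(1) profile_pos[of "t * 4 powi l" s for l] t by (intro nn_integral_cong) (simp add: ennreal_mult' mult_ac less_imp_le)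
  finally show ?thesis by (simp add: distr_scale_def[abs_def])
qed

text \<open>The norm is continuous in time. The difference of the solutions at two times is the sum of its blocks, and the
bounds of the blocks tend to zero uniformly by \<open>block_symbol_time_continuous\<close> while a summable bound is given by the
block estimates at the two times. Dominated convergence over the frequencies concludes.\<close>

lemma solution_norm_measurable:
  assumes B: "\<And>l. besov_term l \<le> ennreal B" and B0: "0 \<le> B"
  shows "solution_norm \<in> borel_measurable dt_over_t"
proof -
  have maj: "(\<integral>\<^sup>+l. ennreal (M * profile s (t * 4 powi l)) * besov_term l \<partial>count_space UNIV) \<le> ennreal (M * S * B)" if t: "t > 0" for t
  proof -
    have "(\<integral>\<^sup>+l. ennreal (M * profile s (t * 4 powi l)) * besov_term l \<partial>count_space UNIV)
       \<le> (\<integral>\<^sup>+l. ennreal (M * B) * ennreal (profile s (t * 4 powi l)) \<partial>count_space UNIV)"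
    proof (rule nn_integral_mono)
      fix l
      have "ennreal (M * profile s (t * 4 powi l)) * besov_term l \<le> ennreal (M * profile s (t * 4 powi l)) * ennreal B"
        by (intro mult_left_mono B) simp
      also have "\<dots> = ennreal (M * B) * ennreal (profile s (t * 4 powi l))"
        using M(1) B0 profile_pos[of "t * 4 powi l" s] t by (simp add: ennreal_mult'[symmetric] mult_ac)
      finally show "ennreal (M * profile s (t * 4 powi l)) * besov_term l \<le> ennreal (M * B) * ennreal (profile s (t * 4 powi l))" .
    qed
    also have "\<dots> = ennreal (M * B) * (\<integral>\<^sup>+l. ennreal (profile s (t * 4 powi l)) \<partial>count_space UNIV)"
      by (rule nn_integral_cmult) simp
    also have "\<dots> \<le> ennreal (M * B) * ennreal S" by (intro mult_left_mono S(2) t) simp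
    also have "\<dots> = ennreal (M * S * B)" using M(1) S(1) B0 by (simp add: ennreal_mult'[symmetric] mult_ac)
    finally show ?thesis .
  qed
  have finN: "solution_norm t < \<top>" if "t > 0" for t
    using order_trans[OF solution_norm_le[OF that] maj[OF that]] by (simp add: le_less_trans)
  define d where "d t = enn2real (solution_norm t)" for t
  have "isCont d t0" if t0: "t0 > 0" for t0
  proof (rule tendsto_at_interval[OF t0])
    fix X :: "nat \<Rightarrow> real" assume X: "\<And>n. X n \<in> {t0 / 2..2 * t0}" "\<And>n. X n \<noteq> t0" "X \<longlonglongrightarrow> t0"
    have Xp: "X n > 0" for n using X(1)[of n] t0 by auto
    let ?K = "(real CARD('n + 'n))\<^sup>2"
    let ?b = "\<lambda>t l i j \<xi>. complex_of_real (t powr s) * block_symbol \<mu> (lam + 2 * \<mu>) \<kappa> (fat_cutoff chi) (2 powi (- l)) t i j \<xi>"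
    have "\<exists>e. (e \<longlongrightarrow> 0) (at t0 within {t0 / 2..2 * t0}) \<and> (\<forall>t\<in>{t0 / 2..2 * t0}. \<forall>a>0. \<forall>i j.
       kernel_norm (\<lambda>\<xi>. complex_of_real (t powr s) * block_symbol \<mu> (lam + 2 * \<mu>) \<kappa> (fat_cutoff chi) a t i j \<xi>
         - complex_of_real (t0 powr s) * block_symbol \<mu> (lam + 2 * \<mu>) \<kappa> (fat_cutoff chi) a t0 i j \<xi>) \<le> e t)"
      by (rule block_symbol_time_continuous[OF \<mu> \<nu> \<kappa> _ fat_cutoff_schwartz[OF lp] fat_cutoff_inside[OF lp] t0, of "3/8"]) auto
    then obtain e where e: "(e \<longlongrightarrow> 0) (at t0 within {t0 / 2..2 * t0})"
      "\<And>t l i j. t \<in> {t0 / 2..2 * t0} \<Longrightarrow> kernel_norm (\<lambda>\<xi>. ?b t l i j \<xi> - ?b t0 l i j \<xi>) \<le> e t" by force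
    have eX: "(\<lambda>n. e (X n)) \<longlonglongrightarrow> 0"
      using e(1) X unfolding tendsto_at_iff_sequentially comp_def by auto
    have e0: "0 \<le> e (X n)" for n
      using order_trans[OF kernel_norm_nonneg e(2)[OF X(1)]] .
    \<comment> \<open>the second term makes \<open>c n\<close> positive, as \<open>difference_Lp\<close> demands\<close>
    define c where "c n = ?K * e (X n) + \<bar>X n - t0\<bar>" for n
    have c: "0 < c n" for n unfolding c_def using X(2)[of n] e0[of n] by (intro add_nonneg_pos mult_nonneg_nonneg) auto
    have cX: "c \<longlonglongrightarrow> 0"
    proof -
      have "c \<longlonglongrightarrow> ?K * 0 + \<bar>t0 - t0\<bar>" unfolding c_def[abs_def] by (intro tendsto_intros eX X(3))
      then show ?thesis by simp
    qed
    \<comment> \<open>the dominating sequence, twice the estimate at time \<open>t0 / 2\<close> with the factor from \<open>profile_doubling\<close>\<close>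
    define G where "G l = 2 * 4 powr s * M * (2 powr (real_of_int l * (- 2 * s)) * profile s (t0 / 2 * 4 powi l))" for l :: int
    have G: "0 < G l" for l unfolding G_def using M(1) t0 by (intro mult_pos_pos profile_pos) auto
    have bG: "(\<Sum>i\<in>UNIV. \<Sum>j\<in>UNIV. kernel_norm (?b t l i j)) \<le> G l / 2" if t: "t \<in> {t0 / 2..2 * t0}" for t l
    proof -
      have tp: "t > 0" using t t0 by auto
      have "profile s ((t / (t0 / 2)) * (t0 / 2 * 4 powi l)) \<le> 4 powr s * profile s (t0 / 2 * 4 powi l)"
        using t t0 by (intro profile_doubling s) (auto simp: field_simps)
      also have "(t / (t0 / 2)) * (t0 / 2 * 4 powi l) = t * 4 powi l" using t0 by simp
      finally have "M * (2 powr (real_of_int l * (- 2 * s)) * profile s (t * 4 powi l))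
         \<le> M * (2 powr (real_of_int l * (- 2 * s)) * (4 powr s * profile s (t0 / 2 * 4 powi l)))"
        using M(1) by (intro mult_left_mono) auto
      also have "\<dots> = G l / 2" unfolding G_def by simp
      finally show ?thesis using M(2)[OF tp, of l] by linarith
    qed
    have bS: "?b t l i j \<in> schwartz" if "t > 0" for t l i j
      by (intro schwartz_cmult flow_block_schwartz[OF \<mu> \<nu> \<kappa> lp sol h] that)
    have diff_le: "(\<Sum>i\<in>UNIV. \<Sum>j\<in>UNIV. kernel_norm (\<lambda>\<xi>. ?b (X n) l i j \<xi> - ?b t0 l i j \<xi>)) \<le> min (c n) (G l)" for n l
    proof (rule min.boundedI)
      have "(\<Sum>i\<in>UNIV. \<Sum>j\<in>UNIV. kernel_norm (\<lambda>\<xi>. ?b (X n) l i j \<xi> - ?b t0 l i j \<xi>)) \<le> ?K * e (X n)"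
        by (rule sum_pairs_le) (rule e(2)[OF X(1)])
      then show "(\<Sum>i\<in>UNIV. \<Sum>j\<in>UNIV. kernel_norm (\<lambda>\<xi>. ?b (X n) l i j \<xi> - ?b t0 l i j \<xi>)) \<le> c n"
        unfolding c_def by linarith
      have "kernel_norm (\<lambda>\<xi>. ?b (X n) l i j \<xi> - ?b t0 l i j \<xi>) \<le> kernel_norm (?b (X n) l i j) + kernel_norm (?b t0 l i j)" for i j
      proof -
        have "kernel_norm (\<lambda>\<xi>. ?b (X n) l i j \<xi> + (- 1) * ?b t0 l i j \<xi>) \<le> kernel_norm (?b (X n) l i j) + kernel_norm (\<lambda>\<xi>. (- 1) * ?b t0 l i j \<xi>)"
          by (intro kernel_norm_add schwartz_cmult(1)[of _ "- 1"] bS Xp t0)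
        then show ?thesis unfolding kernel_norm_cmult[of "- 1"] by simp
      qed
      then have "(\<Sum>i\<in>UNIV. \<Sum>j\<in>UNIV. kernel_norm (\<lambda>\<xi>. ?b (X n) l i j \<xi> - ?b t0 l i j \<xi>))
        \<le> (\<Sum>i\<in>UNIV. \<Sum>j\<in>UNIV. kernel_norm (?b (X n) l i j) + kernel_norm (?b t0 l i j))" by (intro sum_mono)
      also have "\<dots> \<le> G l / 2 + G l / 2"
        unfolding sum.distrib using t0 by (intro add_mono bG X(1)) auto
      finally show "(\<Sum>i\<in>UNIV. \<Sum>j\<in>UNIV. kernel_norm (\<lambda>\<xi>. ?b (X n) l i j \<xi> - ?b t0 l i j \<xi>)) \<le> G l" by simp
    qed
    define E where "E n = (\<integral>\<^sup>+l. ennreal (min (c n) (G l)) * block_norm l \<partial>count_space UNIV)" for n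
    have GB: "(\<integral>\<^sup>+l. ennreal (G l) * block_norm l \<partial>count_space UNIV) < \<infinity>"
    proof -
      have "(\<integral>\<^sup>+l. ennreal (G l) * block_norm l \<partial>count_space UNIV)
        = (\<integral>\<^sup>+l. ennreal (2 * 4 powr s) * (ennreal (M * profile s (t0 / 2 * 4 powi l)) * besov_term l) \<partial>count_space UNIV)"
        unfolding G_def using M(1) profile_pos[of "t0 / 2 * 4 powi l" s for l] t0
        by (intro nn_integral_cong) (simp add: ennreal_mult' mult_ac less_imp_le)
      also have "\<dots> = ennreal (2 * 4 powr s) * (\<integral>\<^sup>+l. ennreal (M * profile s (t0 / 2 * 4 powi l)) * besov_term l \<partial>count_space UNIV)"
        by (rule nn_integral_cmult) simp
      also have "\<dots> \<le> ennreal (2 * 4 powr s) * ennreal (M * S * B)" using t0 by (intro mult_left_mono maj) auto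
      also have "\<dots> < \<infinity>" by (simp add: ennreal_mult_less_top)
      finally show ?thesis .
    qed
    have E: "E \<longlonglongrightarrow> (\<integral>\<^sup>+l. 0 \<partial>count_space (UNIV :: int set))"
      unfolding E_def
    proof (rule nn_integral_dominated_convergence[where w="\<lambda>l. ennreal (G l) * block_norm l"])
      show "AE l in count_space UNIV. ennreal (min (c n) (G l)) * block_norm l \<le> ennreal (G l) * block_norm l" for n
        by (intro AE_I2 mult_right_mono ennreal_leI) auto
      have "(\<lambda>n. ennreal (min (c n) (G l)) * block_norm l) \<longlonglongrightarrow> 0" for l
      proof -
        obtain a where a: "block_norm l = ennreal a" "0 \<le> a" using fin[of l] by (cases "block_norm l") auto
        have "(\<lambda>n. min (c n) (G l) * a) \<longlonglongrightarrow> min 0 (G l) * a" by (intro tendsto_intros cX)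
        then have "(\<lambda>n. min (c n) (G l) * a) \<longlonglongrightarrow> 0" using G[of l] by simp
        from tendsto_ennrealI[OF this] show ?thesis
          unfolding a(1) using a(2) c G by (simp add: ennreal_mult'' )
      qed
      then show "AE l in count_space UNIV. (\<lambda>n. ennreal (min (c n) (G l)) * block_norm l) \<longlonglongrightarrow> 0" by (intro AE_I2)
    qed (use GB in auto)
    then have E: "E \<longlonglongrightarrow> 0" by simp
    have En: "E n < \<top>" for n
    proof -
      have "E n \<le> (\<integral>\<^sup>+l. ennreal (G l) * block_norm l \<partial>count_space UNIV)"
        unfolding E_def by (intro nn_integral_mono mult_right_mono ennreal_leI) auto
      then show ?thesis using GB by (simp add: le_less_trans)
    qed
    let ?W = "\<lambda>t i \<psi>. (t powr s) *\<^sub>R grad_pair (q t) (u t) i \<psi>"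
    have D: "solution_norm t = distr_Lp p (?W t)" for t by (simp add: distr_scale_def[abs_def])
    have d1: "distr_Lp p (\<lambda>i \<psi>. ?W (X n) i \<psi> - ?W t0 i \<psi>) \<le> E n" for n
      unfolding E_def using diff_le by (intro difference_Lp Xp t0) (auto simp: c G)
    have d2: "distr_Lp p (\<lambda>i \<psi>. ?W t0 i \<psi> - ?W (X n) i \<psi>) \<le> E n" for n
    proof -
      have "kernel_norm (\<lambda>\<xi>. ?b t0 l i j \<xi> - ?b (X n) l i j \<xi>) = kernel_norm (\<lambda>\<xi>. ?b (X n) l i j \<xi> - ?b t0 l i j \<xi>)" for l i j
        using kernel_norm_cmult[of "- 1" "\<lambda>\<xi>. ?b (X n) l i j \<xi> - ?b t0 l i j \<xi>"] by simp
      then show ?thesis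
        unfolding E_def using diff_le by (intro difference_Lp Xp t0) (auto simp: c G)
    qed
    have 1: "solution_norm (X n) \<le> E n + solution_norm t0" for n
      using order_trans[OF distr_Lp_triangle[OF p, of "\<lambda>i \<psi>. ?W (X n) i \<psi> - ?W t0 i \<psi>" "?W t0"] add_right_mono[OF d1]]
      unfolding D by simp
    have 2: "solution_norm t0 \<le> E n + solution_norm (X n)" for n
      using order_trans[OF distr_Lp_triangle[OF p, of "\<lambda>i \<psi>. ?W t0 i \<psi> - ?W (X n) i \<psi>" "?W (X n)"] add_right_mono[OF d2]]
      unfolding D by simp
    have dE: "norm (d (X n) - d t0) \<le> enn2real (E n)" for n
    proof -
      have "d (X n) \<le> enn2real (E n) + d t0"
        unfolding d_def using enn2real_mono[OF 1[of n]] En[of n] finN[OF t0] by (simp add: enn2real_plus)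
      moreover have "d t0 \<le> enn2real (E n) + d (X n)"
        unfolding d_def using enn2real_mono[OF 2[of n]] En[of n] finN[OF Xp[of n]] by (simp add: enn2real_plus)
      ultimately show ?thesis unfolding real_norm_def by linarith
    qed
    have "(\<lambda>n. enn2real (E n)) \<longlonglongrightarrow> 0"
      using tendsto_enn2real[OF E[folded ennreal_0]] by simp
    from Lim_null_comparison[OF always_eventually[OF allI[OF dE]] this] have "(\<lambda>n. d (X n) - d t0) \<longlonglongrightarrow> 0" .
    then show "(\<lambda>n. d (X n)) \<longlonglongrightarrow> d t0" by (simp add: LIM_zero_iff)
  qed
  then have "continuous_on {0<..} d" by (intro continuous_at_imp_continuous_on) auto
  then have "d \<in> borel_measurable (restrict_space borel {0<..})" by (rule borel_measurable_continuous_on_restrict)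
  then have "(\<lambda>t. ennreal (d t)) \<in> borel_measurable dt_over_t" unfolding dt_over_t_measurable_iff by measurable
  moreover have "ennreal (d t) = solution_norm t" if "t \<in> space dt_over_t" for t
    using finN[of t] that by (simp add: d_def space_dt_over_t)
  ultimately show ?thesis by (simp cong: measurable_cong)
qed

text \<open>\<open>Schur_test\<close> for the kernel \<open>profile s (t 4\<^sup>l)\<close> between the counting measure on frequencies and \<open>dt / t\<close>. At \<open>r = \<infinity>\<close>
monotonicity of the essential supremum rests on \<open>solution_norm_measurable\<close>, which applies since the Besov terms are then bounded.\<close>

lemma solution_norm_Lnorm_le:
  assumes S': "\<And>l::int. (\<integral>\<^sup>+t. ennreal (profile s (t * 4 powi l)) \<partial>dt_over_t) \<le> ennreal S"
    and r: "1 \<le> r" and fb: "besov_norm phi (- 2 * s) p r (grad_pair q0 u0) < \<infinity>"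
  shows "Lnorm dt_over_t r solution_norm \<le> ennreal (M * S) * besov_norm phi (- 2 * s) p r (grad_pair q0 u0)"
proof -
  let ?k = "\<lambda>t l. ennreal (M * profile s (t * 4 powi l))"
  have bn: "besov_norm phi (- 2 * s) p r (grad_pair q0 u0) = Lnorm (count_space UNIV) r besov_term"
    by (simp add: besov_norm_def)
  have MS: "0 < M * S" using M(1) S(1) by simp
  have "Lnorm dt_over_t r (\<lambda>t. \<integral>\<^sup>+l. ?k t l * besov_term l \<partial>count_space UNIV) \<le> ennreal (M * S) * Lnorm (count_space UNIV) r besov_term"
  proof (rule Schur_test[OF sigma_finite_dt_over_t _ r MS])
    show "sigma_finite_measure (count_space (UNIV :: int set))" by (rule sigma_finite_measure_count_space)
    have "(\<lambda>x. ?k (fst x) (snd x)) \<in> borel_measurable (dt_over_t \<Otimes>\<^sub>M count_space UNIV)"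
    proof (rule measurable_compose_countable[of "\<lambda>l x. ?k (fst x) l" _ _ snd])
      have "(\<lambda>t. ?k t l) \<in> borel_measurable dt_over_t" for l by (intro dt_over_t_borel) measurable
      then show "(\<lambda>x. ?k (fst x) l) \<in> borel_measurable (dt_over_t \<Otimes>\<^sub>M count_space UNIV)" for l
        by (rule measurable_compose[OF measurable_fst])
    qed simp
    then show "case_prod ?k \<in> borel_measurable (dt_over_t \<Otimes>\<^sub>M count_space UNIV)" by (simp add: split_beta')
    have pull: "integral\<^sup>N N (\<lambda>x. ennreal (M * f x)) \<le> ennreal (M * S)"
      if "integral\<^sup>N N (\<lambda>x. ennreal (f x)) \<le> ennreal S" and [measurable]: "f \<in> borel_measurable N" for N and f :: "'z \<Rightarrow> real"
    proof -
      have "integral\<^sup>N N (\<lambda>x. ennreal (M * f x)) = ennreal M * integral\<^sup>N N (\<lambda>x. ennreal (f x))"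
        using M(1) by (subst nn_integral_cmult[symmetric]) (auto simp: ennreal_mult')
      also have "\<dots> \<le> ennreal M * ennreal S" by (intro mult_left_mono that) simp
      finally show ?thesis using M(1) by (simp add: ennreal_mult')
    qed
    show "(\<integral>\<^sup>+l. ?k t l \<partial>count_space UNIV) \<le> ennreal (M * S)" if "t \<in> space dt_over_t" for t
      using that by (intro pull S(2)) (auto simp: space_dt_over_t)
    show "(\<integral>\<^sup>+t. ?k t l \<partial>dt_over_t) \<le> ennreal (M * S)" for l
      by (intro pull S' dt_over_t_borel) measurable
  qed simp
  moreover have "Lnorm dt_over_t r solution_norm \<le> Lnorm dt_over_t r (\<lambda>t. \<integral>\<^sup>+l. ?k t l * besov_term l \<partial>count_space UNIV)"
  proof (cases "r = \<infinity>")
    case False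
    then show ?thesis by (intro Lnorm_mono_finite r solution_norm_le) (auto simp: space_dt_over_t)
  next
    case True
    obtain B where B: "Lnorm (count_space UNIV) r besov_term = ennreal B" "0 \<le> B"
      using fb unfolding bn by (cases "Lnorm (count_space UNIV) r besov_term") auto
    have "besov_term l \<le> ennreal B" for l
      using esssup_AE[of besov_term "count_space UNIV"] B(1) True by (simp add: Lnorm_def AE_count_space)
    then show ?thesis
      by (intro Lnorm_mono r solution_norm_measurable[OF _ B(2)] solution_norm_le) (auto simp: space_dt_over_t)
  qed
  ultimately show ?thesis unfolding bn by (rule order_trans[rotated])
qed

end

text \<open>The constant is the product of the constant of \<open>block_symbol_weighted_bound\<close> with a common bound in \<open>profile_sum\<close> and
\<open>profile_integral\<close>; all three are fixed before the solution is chosen.\<close>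

theorem proposition10:
  fixes \<mu> lam \<kappa> s :: real and p r :: ennreal
    and phi chi :: "real^'n::finite \<Rightarrow> complex"
  assumes "\<mu> > 0" and "lam + 2 * \<mu> > 0" and "\<kappa> > 0"
    and "s > 0" and "1 \<le> p" and "1 \<le> r"
    and "littlewood_paley phi chi"
  shows "\<exists>C::real. C > 0 \<and>
    (\<forall>(q\<^sub>0 :: 'n distr) (u\<^sub>0 :: 'n \<Rightarrow> 'n distr) (q :: real \<Rightarrow> 'n distr) (u :: real \<Rightarrow> 'n \<Rightarrow> 'n distr).
       linear_solution \<mu> lam \<kappa> q\<^sub>0 u\<^sub>0 q u \<longrightarrow>
       grad_pair q\<^sub>0 u\<^sub>0 \<in> besov phi chi (- 2 * s) p r \<longrightarrow>
       Lnorm dt_over_t r (\<lambda>t. distr_Lp p (distr_scale (t powr s) (grad_pair (q t) (u t))))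
         \<le> ennreal C * besov_norm phi (- 2 * s) p r (grad_pair q\<^sub>0 u\<^sub>0))"
proof -
  note lp = assms(7)
  obtain M where M: "M > 0" "\<And>t l. t > 0 \<Longrightarrow> (\<Sum>i\<in>UNIV. \<Sum>j\<in>UNIV. kernel_norm (\<lambda>\<xi>. complex_of_real (t powr s) * block_symbol \<mu> (lam + 2 * \<mu>) \<kappa> (fat_cutoff chi) (2 powi (- l)) t i j \<xi>))
     \<le> M * (2 powr (real_of_int l * (- 2 * s)) * profile s (t * 4 powi l))"
    using block_symbol_weighted_bound[OF assms(1-3) _ fat_cutoff_schwartz[OF lp] fat_cutoff_inside[OF lp] assms(4), of "3/8"] by auto
  obtain S0 where S0: "S0 > 0" "\<And>t. t > 0 \<Longrightarrow> (\<integral>\<^sup>+l. ennreal (profile s (t * 4 powi l)) \<partial>count_space UNIV) \<le> ennreal S0"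
    using profile_sum[OF assms(4)] by blast
  define S where "S = S0 + (1 / s + 1)"
  have S: "S > 0" "S0 \<le> S" "1 / s + 1 \<le> S" using S0(1) assms(4) by (auto simp: S_def add_pos_pos)
  have S1: "(\<integral>\<^sup>+l. ennreal (profile s (t * 4 powi l)) \<partial>count_space UNIV) \<le> ennreal S" if "t > 0" for t
    by (rule order_trans[OF S0(2)[OF that] ennreal_leI[OF S(2)]])
  have S2: "(\<integral>\<^sup>+t. ennreal (profile s (t * 4 powi l)) \<partial>dt_over_t) \<le> ennreal S" for l :: int
    by (rule order_trans[OF profile_integral[OF assms(4)] ennreal_leI[OF S(3)]]) simp
  have "Lnorm dt_over_t r (\<lambda>t. distr_Lp p (distr_scale (t powr s) (grad_pair (q t) (u t))))
         \<le> ennreal (M * S) * besov_norm phi (- 2 * s) p r (grad_pair q0 u0)"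
    if sol: "linear_solution \<mu> lam \<kappa> q0 u0 q u" and b: "grad_pair q0 u0 \<in> besov phi chi (- 2 * s) p r"
    for q0 u0 q u
  proof -
    have h: "grad_pair q0 u0 i \<in> tempered_h chi" for i using b by (simp add: besov_def)
    have fb: "besov_norm phi (- 2 * s) p r (grad_pair q0 u0) < \<infinity>" using b by (simp add: besov_def)
    have "distr_Lp p (\<lambda>i. dyadic_block phi l (grad_pair q0 u0 i)) < \<infinity>" for l
      using Lnorm_count_space_finite[OF assms(6) fb[unfolded besov_norm_def], of l]
      by (auto simp: ennreal_mult_less_top)
    then show ?thesis
      by (rule solution_norm_Lnorm_le[OF assms(1-5) lp sol h _ M S(1) S1 S2 assms(6) fb])
  qed
  then show ?thesis using M(1) S(1) by (intro exI[of _ "M * S"]) auto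
qed

end
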